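(* Let $C$ be an $n$-dimensional proper polyhedral cone, and suppose that every facet of $C$ omits at most two extreme rays (i.e. for every facet, at most two extreme rays of $C$ are not contained in it). Then the following are equivalent: (1) the minimal operator system $C^{\min}$ is subhomogeneous; (2) there are integers $a,m\geqslant0$ such that $C\cong\mathbb R_+^a\oplus C_\square^{\oplus m}$. In this case $C^{\min}$ is $2$-subhomogeneous and the number of extreme rays of $C$ satisfies $$\#\operatorname{ExtRays}(C)=n+m\leqslant n+\lfloor n/3\rfloor .$$
   Context: A proper polyhedral cone $C\subseteq V$ in a finite-dimensional real vector space is a finitely generated convex cone that is pointed ($C\cap(-C)=\{0\}$) and has nonempty interior; its dimension is $\dim V$. Isomorphism $\cong$ of cones means a linear isomorphism of the ambient spaces mapping one cone onto the other. $C\oplus D\subseteq V\oplus W$ is the direct sum of cones and $C^{\oplus m}$ the $m$-fold direct sum. $\mathbb R_+^a$ is the nonnegative orthant in $\mathbb R^a$. $C_\square$ denotes a three-dimensional proper polyhedral cone with four extreme rays (all such cones are isomorphic). Minimal operator system: an interior point $u$ of $C$ is (arbitrarily) fixed. With $\operatorname{Her}_s$ the complex Hermitian $s\times s$ matrices and $\operatorname{Her}_s(V)=\operatorname{Her}_s\otimes_{\mathbb R}V$, set $C_s^{\min}=\operatorname{cone}\{A\otimes c\mid A\in\operatorname{Her}_s,\ A\geqslant0,\ c\in C\}\subseteq\operatorname{Her}_s(V)$ and $C^{\min}=(V,(C_s^{\min})_{s\geqslant1},u)$, with matrix order unit $I_s\otimes u$ at level $s$. It is called $d$-subhomogeneous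 if it admits a unital complete order embedding into $\operatorname{Mat}_d(\mathcal A)$ for some commutative $C^*$-algebra $\mathcal A$, i.e. a real-linear map $\Phi$ from $V$ to the Hermitian elements of $\operatorname{Mat}_d(\mathcal A)$ with $\Phi(u)=1$ such that for all $s\geqslant1$ and $X\in\operatorname{Her}_s(V)$: $X\in C_s^{\min}$ if and only if $(\mathrm{id}\otimes\Phi)(X)\geqslant0$ in $\operatorname{Mat}_s(\operatorname{Mat}_d(\mathcal A))$. It is subhomogeneous if it is $d$-subhomogeneous for some $d\geqslant1$. *)

theory Defs
  imports
    "HOL-Analysis.Analysis"
    "HOL-Analysis.Finite_Function_Topology"
    "HOL-Algebra.Module"
    "HOL-Algebra.Algebraic_Closure_Type"
begin

section \<open>Polyhedral cones\<close>

text \<open>The ambient finite-dimensional real vector space is a linear subspace \<open>V\<close> of some Euclidean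
  space, so that its dimension \<open>dim V\<close> is an arbitrary natural number, zero included; topological
  notions are relative to \<open>V\<close>. The convex cone generated by the empty set is \<open>{0}\<close>.\<close>

definition proper_polyhedral_cone :: "'e::euclidean_space set \<Rightarrow> 'e set \<Rightarrow> bool" where
  "proper_polyhedral_cone V C \<longleftrightarrow>
     C \<subseteq> V \<and>
     (\<exists>S. finite S \<and> C = convex_cone hull S) \<and>
     C \<inter> uminus ` C = {0} \<and>
     (top_of_set V) interior_of C \<noteq> {}"

definition ext_rays :: "'e::euclidean_space set \<Rightarrow> 'e set set" where
  "ext_rays C = {R. R face_of C \<and> (\<exists>x. x \<noteq> 0 \<and> R = {t *\<^sub>R x |t. 0 \<le> t})}"

text \<open>A linear isomorphism between the subspaces \<open>V\<close> and \<open>W\<close> is the restriction of a linear map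
  between the surrounding types.\<close>

definition cone_iso ::
  "'v::real_vector set \<Rightarrow> 'v set \<Rightarrow> 'w::real_vector set \<Rightarrow> 'w set \<Rightarrow> bool" where
  "cone_iso V C W D \<longleftrightarrow> (\<exists>f. linear f \<and> bij_betw f V W \<and> f ` C = D)"

text \<open>The \<open>m\<close>-fold direct sum of a set \<open>S\<close>, as families supported on \<open>{..<m}\<close>. Thus
  \<open>fin_power a UNIV\<close> is \<open>\<real>\<^sup>a\<close> and \<open>fin_power a {0..}\<close> is its nonnegative orthant. The direct sum of
  two cones is their Cartesian product.\<close>

definition fin_power :: "nat \<Rightarrow> 'b::zero set \<Rightarrow> (nat \<Rightarrow>\<^sub>0 'b) set" where
  "fin_power m S =
     {f. (\<forall>i<m. Poly_Mapping.lookup f i \<in> S) \<and> (\<forall>i\<ge>m. Poly_Mapping.lookup f i = 0)}"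

section \<open>Operator systems\<close>

text \<open>The complexification of \<open>V\<close> is \<open>V \<times> V\<close>, with \<open>(x, y)\<close> standing for \<open>x + iy\<close>. The real vector space
  of Hermitian \<open>s \<times> s\<close> matrices tensored with \<open>V\<close> is the space of \<open>s \<times> s\<close> matrices \<open>Z\<close> over the
  complexification that satisfy \<open>Z j i = conj (Z i j)\<close>; the pure tensor of \<open>A\<close> and \<open>c\<close> has entries
  \<open>A i j \<cdot> c\<close>. Matrices of size \<open>s\<close> are functions vanishing off \<open>{..<s} \<times> {..<s}\<close>.\<close>

type_synonym 'e cmat = "nat \<Rightarrow> nat \<Rightarrow> 'e \<times> 'e"

definition her :: "'e::real_vector set \<Rightarrow> nat \<Rightarrow> 'e cmat set" where
  "her V s =
     {Z. (\<forall>i j. Z i j \<in> V \<times> V) \<and>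
         (\<forall>i j. Z j i = (fst (Z i j), - snd (Z i j))) \<and>
         (\<forall>i j. s \<le> i \<or> s \<le> j \<longrightarrow> Z i j = 0)}"

definition psd :: "nat \<Rightarrow> (nat \<Rightarrow> nat \<Rightarrow> complex) \<Rightarrow> bool" where
  "psd s A \<longleftrightarrow>
     (\<forall>i j. A j i = cnj (A i j)) \<and>
     (\<forall>i j. s \<le> i \<or> s \<le> j \<longrightarrow> A i j = 0) \<and>
     (\<forall>x. 0 \<le> Re (\<Sum>i<s. \<Sum>j<s. cnj (x i) * A i j * x j))"

definition pure_tensor :: "(nat \<Rightarrow> nat \<Rightarrow> complex) \<Rightarrow> 'e::real_vector \<Rightarrow> 'e cmat" where
  "pure_tensor A c = (\<lambda>i j. (Re (A i j) *\<^sub>R c, Im (A i j) *\<^sub>R c))"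

definition min_cone :: "'e::real_vector set \<Rightarrow> nat \<Rightarrow> 'e cmat set" where
  "min_cone C s =
     {Z. \<exists>(N::nat) r A c.
           (\<forall>k<N. 0 \<le> r k \<and> psd s (A k) \<and> c k \<in> C) \<and>
           Z = (\<lambda>i j. \<Sum>k<N. r k *\<^sub>R pure_tensor (A k) (c k) i j)}"

record 'e op_system =
  os_space :: "'e set"
  os_cone :: "nat \<Rightarrow> 'e cmat set"
  os_unit :: 'e

definition min_op_system :: "'e::real_vector set \<Rightarrow> 'e set \<Rightarrow> 'e \<Rightarrow> 'e op_system" where
  "min_op_system V C u = \<lparr>os_space = V, os_cone = min_cone C, os_unit = u\<rparr>"

section \<open>Commutative C*-algebras and subhomogeneity\<close>

record 'u cstar = "(complex, 'u) module" +
  star :: "'u \<Rightarrow> 'u"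
  nrm :: "'u \<Rightarrow> real"

text \<open>Unital commutative complex C*-algebras (commutativity is part of \<open>Module.algebra\<close>). The zero
  algebra is admitted; it is only relevant for \<open>dim V = 0\<close>.\<close>

locale commutative_cstar_algebra = Module.algebra "ring_of_type_algebra :: complex ring" A
  for A :: "'u cstar" (structure) +
  assumes star_closed: "x \<in> carrier A \<Longrightarrow> star A x \<in> carrier A"
    and star_star: "x \<in> carrier A \<Longrightarrow> star A (star A x) = x"
    and star_add: "\<lbrakk>x \<in> carrier A; y \<in> carrier A\<rbrakk> \<Longrightarrow>
          star A (x \<oplus>\<^bsub>A\<^esub> y) = star A x \<oplus>\<^bsub>A\<^esub> star A y"
    and star_smult: "x \<in> carrier A \<Longrightarrow> star A (z \<odot>\<^bsub>A\<^esub> x) = cnj z \<odot>\<^bsub>A\<^esub> star A x"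
    and star_mult: "\<lbrakk>x \<in> carrier A; y \<in> carrier A\<rbrakk> \<Longrightarrow>
          star A (x \<otimes>\<^bsub>A\<^esub> y) = star A y \<otimes>\<^bsub>A\<^esub> star A x"
    and nrm_eq_0: "x \<in> carrier A \<Longrightarrow> nrm A x = 0 \<longleftrightarrow> x = \<zero>\<^bsub>A\<^esub>"
    and nrm_triangle: "\<lbrakk>x \<in> carrier A; y \<in> carrier A\<rbrakk> \<Longrightarrow>
          nrm A (x \<oplus>\<^bsub>A\<^esub> y) \<le> nrm A x + nrm A y"
    and nrm_smult: "x \<in> carrier A \<Longrightarrow> nrm A (z \<odot>\<^bsub>A\<^esub> x) = cmod z * nrm A x"
    and nrm_mult: "\<lbrakk>x \<in> carrier A; y \<in> carrier A\<rbrakk> \<Longrightarrow>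
          nrm A (x \<otimes>\<^bsub>A\<^esub> y) \<le> nrm A x * nrm A y"
    and cstar_identity: "x \<in> carrier A \<Longrightarrow> nrm A (star A x \<otimes>\<^bsub>A\<^esub> x) = (nrm A x)\<^sup>2"
    and complete: "Metric_space.mcomplete (carrier A) (\<lambda>x y. nrm A (x \<ominus>\<^bsub>A\<^esub> y))"

text \<open>Positive elements, i.e. those of the form \<open>Y* Y\<close>, of the C*-algebra of matrices over \<open>A\<close> with
  rows and columns indexed by the finite set \<open>I\<close>; only entries with indices in \<open>I\<close> matter.\<close>

definition mat_nonneg :: "'u cstar \<Rightarrow> 'i set \<Rightarrow> ('i \<Rightarrow> 'i \<Rightarrow> 'u) \<Rightarrow> bool" where
  "mat_nonneg A I M \<longleftrightarrow>
     (\<exists>Y. (\<forall>i\<in>I. \<forall>j\<in>I. Y i j \<in> carrier A) \<and>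
          (\<forall>i\<in>I. \<forall>j\<in>I. M i j = (\<Oplus>\<^bsub>A\<^esub>k\<in>I. star A (Y k i) \<otimes>\<^bsub>A\<^esub> Y k j)))"

text \<open>Unital real-linear maps from \<open>V\<close> to the Hermitian \<open>d \<times> d\<close> matrices over \<open>A\<close>; \<open>\<Phi> v p q\<close> is the
  entry of \<open>\<Phi> v\<close> at \<open>(p, q)\<close>.\<close>

definition unital_herm_map ::
  "'u cstar \<Rightarrow> nat \<Rightarrow> 'e::real_vector set \<Rightarrow> 'e \<Rightarrow> ('e \<Rightarrow> nat \<Rightarrow> nat \<Rightarrow> 'u) \<Rightarrow> bool" where
  "unital_herm_map A d V u \<Phi> \<longleftrightarrow>
     (\<forall>p<d. \<forall>q<d.
        (\<forall>v\<in>V. \<Phi> v p q \<in> carrier A \<and> \<Phi> v q p = star A (\<Phi> v p q)) \<and>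
        (\<forall>v\<in>V. \<forall>w\<in>V. \<Phi> (v + w) p q = \<Phi> v p q \<oplus>\<^bsub>A\<^esub> \<Phi> w p q) \<and>
        (\<forall>r. \<forall>v\<in>V. \<Phi> (r *\<^sub>R v) p q = complex_of_real r \<odot>\<^bsub>A\<^esub> \<Phi> v p q) \<and>
        \<Phi> u p q = (if p = q then \<one>\<^bsub>A\<^esub> else \<zero>\<^bsub>A\<^esub>))"

text \<open>\<open>id \<otimes> \<Phi>\<close>, where \<open>\<Phi>\<close> is extended complex-linearly to the complexification of \<open>V\<close>. An \<open>s \<times> s\<close>
  matrix of \<open>d \<times> d\<close> matrices is viewed as a matrix indexed by \<open>{..<s} \<times> {..<d}\<close>.\<close>

definition ampliation ::
  "'u cstar \<Rightarrow> ('e \<Rightarrow> nat \<Rightarrow> nat \<Rightarrow> 'u) \<Rightarrow> 'e cmat \<Rightarrow> nat \<times> nat \<Rightarrow> nat \<times> nat \<Rightarrow> 'u" where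
  "ampliation A \<Phi> Z = (\<lambda>(i, p) (j, q).
     \<Phi> (fst (Z i j)) p q \<oplus>\<^bsub>A\<^esub> (\<i> \<odot>\<^bsub>A\<^esub> \<Phi> (snd (Z i j)) p q))"

text \<open>Existence of a commutative C*-algebra is expressed for algebras whose elements belong to the
  type \<open>'u\<close>, since one cannot quantify over types. For \<open>'u\<close> of at least the cardinality of the continuum
  this is no restriction: the entries of the values of \<open>\<Phi>\<close> generate a separable unital C*-subalgebra,
  which also serves as the target (an element \<open>Y* Y\<close> of a C*-algebra has a square root in
  every C*-subalgebra that contains it).\<close>

definition d_subhomogeneous :: "'u itself \<Rightarrow> nat \<Rightarrow> 'e::real_vector op_system \<Rightarrow> bool" where
  "d_subhomogeneous TYPE('u) d S \<longleftrightarrow>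
     (\<exists>(A :: 'u cstar) \<Phi>.
        commutative_cstar_algebra A \<and>
        unital_herm_map A d (os_space S) (os_unit S) \<Phi> \<and>
        (\<forall>s\<ge>1. \<forall>Z \<in> her (os_space S) s.
           Z \<in> os_cone S s \<longleftrightarrow> mat_nonneg A ({..<s} \<times> {..<d}) (ampliation A \<Phi> Z)))"

definition subhomogeneous :: "'u itself \<Rightarrow> 'e::real_vector op_system \<Rightarrow> bool" where
  "subhomogeneous TYPE('u) S \<longleftrightarrow> (\<exists>d\<ge>1. d_subhomogeneous TYPE('u) d S)"

end

theory Submission
  imports Defs "HOL-Library.Function_Algebras"
begin

text \<open>Let \<open>x i\<close> generate the extreme rays of \<open>C\<close>. Up to isomorphism
  the cone is determined by the linear relations between these generators. A facet functional h that
  is nonzero on only two of them, i and j, forces c_i h(x i) + c_j h(x j) = 0 for every relation c,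
  so c_i and c_j are proportional with a fixed nonzero factor. This proportionality is an
  equivalence relation, every relation restricts to a relation on each class, and all restrictions
  to one class are multiples of a single one. Extremality and pointedness give a nonzero relation at
  least two coefficients of each sign. A class that carries a nonzero relation and has exactly four
  members spans a square cone, so \<open>exists_sq_presentation\<close> reduces necessity to
  excluding a class relation with two coefficients of one sign and three of the other.

  The exclusion is \<open>not_d_subhomogeneous\<close>. Write the relation as x1 + x2 + ... = y0 +
  y1 + y2 + ... and take positive matrices K_0 + K_1 + K_2 = 1 on C^m. Send y_j to the form <K_j
  q_j, q_j> on triples q of vectors in C^m, x1 to |w|^2 with w = sum_j K_j q_j, x2 to the
  difference, and all other generators to 0. The difference equals sum_j <K_j (q_j - w), q_j - w>,
  so this is a linear map that is positive on \<open>C\<close>, that is, a positive functional on a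
  matrix level of the minimal system. Given an embedding into d by d matrices over a commutative
  algebra, consider the GNS space of an extension of the functional. The kernels of the forms
  determine the action there: up to the common factor e = x1 + x2 + ..., the element x1 acts as the
  projection onto diagonal triples and y_j as the projection onto the j-th component. The factor e
  can be inverted by a polynomial in e, and compressing the j-th projection to the diagonal yields
  K_j. For suitable K_j these generate all m by m matrices, which for large m violate the standard
  polynomial identity of d by d matrices over a commutative ring. Neither the extension nor the GNS
  space is constructed; \<open>null_row\<close> replaces the null vectors of the latter.

  For sufficiency, \<open>C_sq\<close> is |\<beta>| + |\<gamma>| \<le> \<alpha> in suitable
  coordinates, and its point is sent to the function z -> ((\<alpha>, \<beta> + z\<gamma>), (\<beta>
  + conj(z)\<gamma>, \<alpha>)) on roots of unity. The content is \<open>square_split\<close>: if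
  Hermitian matrices a, b, c in place of the coordinates give positive blocks for all z, then a = a0
  + a1 with -a0 \<le> b \<le> a0 and -a1 \<le> c \<le> a1, which exhibits an element of the minimal
  cone. By Fourier analysis (\<open>path_mat_hpsd\<close>) the block tridiagonal matrix with
  diagonal a and off-diagonal blocks b, c, b, c, ... is positive. A path is chordal, so elimination
  splits that matrix into positive blocks for the edges (\<open>path_chain\<close>); averaging them
  gives the decomposition up to a factor tending to 1, and compactness removes the factor.

  The numerical claims come from counting: \<open>a\<close> orthant rays and \<open>m\<close>
  squares give a + 4m extreme rays in dimension a + 3m.\<close>

declare plus_fun_apply [simp del] zero_fun_apply [simp del]

lemmas fun_pointwise = plus_fun_apply zero_fun_apply fun_diff_def fun_Compl_def

section \<open>Commutative rings with involution: matrix products and sums of squares\<close>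

text \<open>The entry ring of the matrices, with neither norm nor order. Positivity of a matrix
  becomes the algebraic condition \<open>sos\<close>, so that the whole exclusion argument is a
  computation with identities between sums of squares.\<close>

locale star_algebra =
  fixes sta :: "'a::comm_ring_1 \<Rightarrow> 'a" and cpx :: "complex \<Rightarrow> 'a"
  assumes sta_sta [simp]: "sta (sta x) = x"
    and sta_add: "sta (x + y) = sta x + sta y"
    and sta_mult: "sta (x * y) = sta x * sta y"
    and cpx_add: "cpx (z + w) = cpx z + cpx w"
    and cpx_mult: "cpx (z * w) = cpx z * cpx w"
    and cpx_1 [simp]: "cpx 1 = 1"
    and sta_cpx [simp]: "sta (cpx z) = cpx (cnj z)"
begin

lemma sta_0 [simp]: "sta 0 = 0"
  using sta_add[of 0 0] by simp

lemma sta_minus: "sta (- x) = - sta x"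
  using sta_add[of x "- x"] by (simp add: eq_neg_iff_add_eq_0 add.commute)

lemma sta_diff: "sta (x - y) = sta x - sta y"
  using sta_add[of x "- y"] by (simp add: sta_minus)

lemma sta_sum: "sta (\<Sum>i\<in>I. f i) = (\<Sum>i\<in>I. sta (f i))"
  by (induction I rule: infinite_finite_induct) (auto simp: sta_add)

lemma cpx_0 [simp]: "cpx 0 = 0"
  using cpx_add[of 0 0] by simp

lemma cpx_minus: "cpx (- x) = - cpx x"
  using cpx_add[of x "- x"] by (simp add: eq_neg_iff_add_eq_0 add.commute)

lemma cpx_diff: "cpx (x - y) = cpx x - cpx y"
  using cpx_add[of x "- y"] by (simp add: cpx_minus)

definition outer :: "('c \<Rightarrow> 'a) \<Rightarrow> 'c \<Rightarrow> 'c \<Rightarrow> 'a" where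
  "outer g = (\<lambda>c c'. sta (g c) * g c')"

text \<open>Algebraic positivity: a finite sum of rank-one squares of any length. The length is only
  brought back to the size of the matrix when an order embedding is applied, by passing to a higher
  matrix level.\<close>

inductive sos :: "('c \<Rightarrow> 'c \<Rightarrow> 'a) \<Rightarrow> bool" where
  sos_0: "sos 0"
| sos_step: "sos M \<Longrightarrow> sos (outer g + M)"

lemma sos_add: "sos M \<Longrightarrow> sos N \<Longrightarrow> sos (M + N)"
proof (induction M rule: sos.induct)
  case sos_0 then show ?case by simp
next
  case (sos_step M g) then show ?case
    unfolding add.assoc by (intro sos.sos_step)
qed

lemma sos_outer: "sos (outer g)"
  using sos_step[OF sos_0, of g] by simp

lemma sos_sum: "(\<And>i. i \<in> I \<Longrightarrow> sos (M i)) \<Longrightarrow> sos (\<Sum>i\<in>I. M i)"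
  by (induction I rule: infinite_finite_induct) (auto intro: sos_0 sos_add)

lemma sos_imp_sum:
  assumes "sos M"
  obtains n G where "\<And>c c'. M c c' = (\<Sum>k<(n::nat). sta (G k c) * G k c')"
proof -
  from assms have "\<exists>n G. \<forall>c c'. M c c' = (\<Sum>k<(n::nat). sta (G k c) * G k c')"
  proof (induction M rule: sos.induct)
    case sos_0 show ?case by (rule exI[of _ 0]) (simp add: fun_pointwise)
  next
    case (sos_step M g)
    then obtain n G where G: "\<And>c c'. M c c' = (\<Sum>k<(n::nat). sta (G k c) * G k c')" by blast
    show ?case
    proof (intro exI allI)
      fix c c'
      show "(outer g + M) c c' = (\<Sum>k<Suc n. sta ((G(n := g)) k c) * (G(n := g)) k c')"
        by (simp add: G outer_def add.commute fun_pointwise)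
    qed
  qed
  then show ?thesis using that by blast
qed

definition sc :: "complex \<Rightarrow> ('b \<Rightarrow> 'c \<Rightarrow> 'a) \<Rightarrow> 'b \<Rightarrow> 'c \<Rightarrow> 'a" where
  "sc z g = (\<lambda>r c. cpx z * g r c)"

definition adj :: "('b \<Rightarrow> 'c \<Rightarrow> 'a) \<Rightarrow> 'c \<Rightarrow> 'b \<Rightarrow> 'a" where
  "adj g = (\<lambda>c r. sta (g r c))"

definition mm :: "nat \<Rightarrow> ('b \<Rightarrow> nat \<Rightarrow> 'a) \<Rightarrow> (nat \<Rightarrow> 'c \<Rightarrow> 'a) \<Rightarrow> 'b \<Rightarrow> 'c \<Rightarrow> 'a" where
  "mm d a g = (\<lambda>p c. \<Sum>l<d. a p l * g l c)"

lemma mm_assoc: "mm d (mm d a b) c = mm d a (mm d b c)"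
proof (intro ext)
  fix p q
  have "mm d (mm d a b) c p q = (\<Sum>l<d. \<Sum>k<d. a p k * b k l * c l q)"
    by (simp add: mm_def sum_distrib_right)
  also have "\<dots> = (\<Sum>k<d. \<Sum>l<d. a p k * b k l * c l q)" by (rule sum.swap)
  also have "\<dots> = mm d a (mm d b c) p q"
    by (simp add: mm_def sum_distrib_left mult.assoc)
  finally show "mm d (mm d a b) c p q = mm d a (mm d b c) p q" .
qed

lemma mm_add_left: "mm d (a + b) g = mm d a g + mm d b g"
  and mm_add_right: "mm d a (g + h) = mm d a g + mm d a h"
  and mm_diff_left: "mm d (a - b) g = mm d a g - mm d b g"
  and mm_diff_right: "mm d a (g - h) = mm d a g - mm d a h"
  unfolding mm_def by (auto simp: fun_pointwise fun_eq_iff algebra_simps sum.distrib sum_subtractf)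

lemma mm_sc_left: "mm d (sc z a) g = sc z (mm d a g)"
  and mm_sc_right: "mm d a (sc z g) = sc z (mm d a g)"
  unfolding mm_def sc_def by (auto simp: fun_pointwise fun_eq_iff sum_distrib_left mult_ac)

lemma mm_0_left [simp]: "mm d 0 g = 0" and mm_0_right [simp]: "mm d a 0 = 0"
  unfolding mm_def by (auto simp: fun_pointwise fun_eq_iff)

lemma mm_sum_left: "mm d (\<Sum>i\<in>I. a i) g = (\<Sum>i\<in>I. mm d (a i) g)"
  by (induction I rule: infinite_finite_induct) (auto simp: mm_add_left)

lemma mm_sum_right: "mm d g (\<Sum>i\<in>I. a i) = (\<Sum>i\<in>I. mm d g (a i))"
  by (induction I rule: infinite_finite_induct) (auto simp: mm_add_right)

lemma sc_add: "sc z (g + h) = sc z g + sc z h" and sc_diff: "sc z (g - h) = sc z g - sc z h"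
  and sc_add_left: "sc (z + w) g = sc z g + sc w g" and sc_diff_left: "sc (z - w) g = sc z g - sc w g"
  and sc_sc: "sc z (sc w g) = sc (z * w) g" and sc_1 [simp]: "sc 1 g = g"
  and sc_0 [simp]: "sc 0 g = 0" and sc_0_right [simp]: "sc z 0 = 0"
  unfolding sc_def by (auto simp: fun_pointwise fun_eq_iff algebra_simps cpx_add cpx_diff cpx_mult)

lemma sc_sum: "sc z (\<Sum>i\<in>I. g i) = (\<Sum>i\<in>I. sc z (g i))"
  by (induction I rule: infinite_finite_induct) (auto simp: sc_add)

lemma adj_add: "adj (g + h) = adj g + adj h" and adj_diff: "adj (g - h) = adj g - adj h"
  and adj_sc: "adj (sc z g) = sc (cnj z) (adj g)" and adj_adj [simp]: "adj (adj g) = g"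
  and adj_mm: "adj (mm d a g) = mm d (adj g) (adj a)" and adj_0 [simp]: "adj 0 = 0"
  unfolding adj_def sc_def mm_def
  by (auto simp: fun_pointwise fun_eq_iff sta_add sta_diff sta_mult sta_sum mult.commute)

lemma sos_congr:
  assumes "sos M"
  shows "sos (mm d (adj g) (mm d M g))"
  using assms
proof (induction M rule: sos.induct)
  case sos_0 then show ?case by (simp add: sos.sos_0)
next
  case (sos_step M w)
  have "mm d (adj g) (mm d (outer w) g) = outer (\<lambda>c. \<Sum>l<d. w l * g l c)"
    unfolding mm_def adj_def outer_def
    by (intro ext) (simp add: sta_sum sta_mult sum_distrib_left sum_distrib_right mult_ac)
  with sos_step show ?case
    by (simp add: mm_add_left mm_add_right sos.sos_step)
qed

lemma sos_gram: "sos (mm d (adj g) g)"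
proof -
  have "mm d (adj g) g = (\<Sum>l<d. outer (g l))"
  proof (intro ext)
    fix c c'
    have "(\<Sum>l\<in>I. outer (g l)) c c' = (\<Sum>l\<in>I. outer (g l) c c')" for I
      by (induction I rule: infinite_finite_induct) (auto simp: fun_pointwise)
    then show "mm d (adj g) g c c' = (\<Sum>l<d. outer (g l)) c c'"
      by (simp add: mm_def adj_def outer_def)
  qed
  then show ?thesis by (simp add: sos_sum sos_outer)
qed

lemma sos_sc:
  assumes "sos M" "0 \<le> r"
  shows "sos (sc (complex_of_real r) M)"
  using assms
proof (induction M rule: sos.induct)
  case sos_0 then show ?case by (simp add: sos.sos_0)
next
  case (sos_step M w)
  have "sc (complex_of_real r) (outer w) = outer (\<lambda>c. cpx (complex_of_real (sqrt r)) * w c)"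
  proof (intro ext)
    fix c c'
    have "cpx (complex_of_real r) = cpx (complex_of_real (sqrt r)) * cpx (complex_of_real (sqrt r))"
      by (metis cpx_mult of_real_mult real_sqrt_mult_self abs_of_nonneg sos_step.prems)
    then show "sc (complex_of_real r) (outer w) c c' = outer (\<lambda>c. cpx (complex_of_real (sqrt r)) * w c) c c'"
      by (simp add: sc_def outer_def sta_mult mult_ac)
  qed
  with sos_step show ?case by (simp add: sc_add sos.sos_step)
qed

end

section \<open>Null rows as a substitute for a GNS space\<close>

text \<open>\<open>Phi\<close> is a unital positive map into d by d matrices over the corner
  \<open>eps\<close>, and \<open>Q y q\<close> is the value at the vector \<open>q\<close> of the
  form attached to \<open>y\<close>. Read \<open>bd M r\<close> as: \<open>M\<close> is the image of
  a Hermitian matrix over \<open>V\<close> on which the functional built from \<open>Q\<close> takes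
  the value \<open>r\<close>. With this reading \<open>bd_sos\<close> says that the functional is
  positive on the image; this is where an order embedding, and not merely a positive map,
  enters.\<close>

locale positive_embedding = star_algebra sta cpx
  for sta :: "'a::comm_ring_1 \<Rightarrow> 'a" and cpx :: "complex \<Rightarrow> 'a" +
  fixes d :: nat and eps :: 'a and V C :: "'e::real_vector set" and u :: 'e
    and Phi :: "'e \<Rightarrow> nat \<Rightarrow> nat \<Rightarrow> 'a"
    and Q :: "'e \<Rightarrow> ('i \<Rightarrow> complex) \<Rightarrow> real"
    and bd :: "('i \<times> nat \<Rightarrow> 'i \<times> nat \<Rightarrow> 'a) \<Rightarrow> real \<Rightarrow> bool"
  assumes V: "subspace V" and CV: "C \<subseteq> V" and uV: "u \<in> V"
    and eps_eps: "eps * eps = eps" and sta_eps: "sta eps = eps"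
    and Phi_add: "v \<in> V \<Longrightarrow> w \<in> V \<Longrightarrow> Phi (v + w) = Phi v + Phi w"
    and Phi_scale: "v \<in> V \<Longrightarrow> Phi (r *\<^sub>R v) = sc (complex_of_real r) (Phi v)"
    and Phi_eps: "v \<in> V \<Longrightarrow> eps * Phi v p p' = Phi v p p'"
    and Phi_out: "v \<in> V \<Longrightarrow> d \<le> p \<or> d \<le> p' \<Longrightarrow> Phi v p p' = 0"
    and Phi_adj: "v \<in> V \<Longrightarrow> adj (Phi v) = Phi v"
    and Phi_unit: "Phi u p p' = (if p = p' \<and> p < d then eps else 0)"
    and Phi_pos: "x \<in> C \<Longrightarrow> sos (Phi x)"
    and order_unit: "x \<in> C \<Longrightarrow> \<exists>k>0. k *\<^sub>R u - x \<in> C"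
    and Q_scale: "y \<in> V \<Longrightarrow> Q (r *\<^sub>R y) q = r * Q y q"
    and bd_tens: "y \<in> V \<Longrightarrow>
          bd (\<lambda>(i, p) (j, p'). cpx (cnj (q i) * q j) * Phi y p p') (Q y q)"
    and bd_add: "bd M r \<Longrightarrow> bd M' r' \<Longrightarrow> bd (M + M') (r + r')"
    and bd_scale: "bd M r \<Longrightarrow> 0 \<le> t \<Longrightarrow> bd (sc (complex_of_real t) M) (t * r)"
    and bd_sos: "bd M r \<Longrightarrow> sos M \<Longrightarrow> 0 \<le> r"
begin

definition tens :: "('i \<Rightarrow> complex) \<Rightarrow> (nat \<Rightarrow> nat \<Rightarrow> 'a) \<Rightarrow> 'i \<times> nat \<Rightarrow> 'i \<times> nat \<Rightarrow> 'a" where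
  "tens q B = (\<lambda>(i, p) (j, p'). cpx (cnj (q i) * q j) * B p p')"

text \<open>The vector \<open>q\<close> of the GNS space, realised as a block row of scalar
  multiples of the unit matrix; a square B of size \<open>d\<close> then has matrix coefficient g^*
  B g, which is \<open>tens q B\<close>.\<close>

definition emb_row :: "('i \<Rightarrow> complex) \<Rightarrow> nat \<Rightarrow> 'i \<times> nat \<Rightarrow> 'a" where
  "emb_row q = (\<lambda>r (i, p). if r = p \<and> p < d then cpx (q i) * eps else 0)"

lemma emb_row_add: "emb_row (q + q') = emb_row q + emb_row q'"
  and emb_row_diff: "emb_row (q - q') = emb_row q - emb_row q'"
  and emb_row_scale: "emb_row (\<lambda>i. z * q i) = sc z (emb_row q)"
  and emb_row_0 [simp]: "emb_row 0 = 0"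
  by (auto simp: fun_pointwise emb_row_def sc_def fun_eq_iff cpx_add cpx_diff cpx_mult algebra_simps)

definition corner :: "(nat \<Rightarrow> 'c \<Rightarrow> 'a) \<Rightarrow> bool" where
  "corner g \<longleftrightarrow> (\<forall>r c. eps * g r c = g r c)"

lemma corner_intros:
  "corner g \<Longrightarrow> corner h \<Longrightarrow> corner (g + h)" "corner g \<Longrightarrow> corner h \<Longrightarrow> corner (g - h)"
  "corner g \<Longrightarrow> corner (sc z g)" "corner g \<Longrightarrow> corner (mm d a g)" "corner (emb_row q)"
  "v \<in> V \<Longrightarrow> corner (Phi v)" "corner 0"
proof -
  show "corner g \<Longrightarrow> corner h \<Longrightarrow> corner (g + h)" "corner g \<Longrightarrow> corner h \<Longrightarrow> corner (g - h)"
    "v \<in> V \<Longrightarrow> corner (Phi v)" "corner 0"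
    by (auto simp: corner_def fun_pointwise algebra_simps Phi_eps)
  show "corner (sc z g)" if "corner g"
    unfolding corner_def
  proof (intro allI)
    fix r c
    have "eps * sc z g r c = cpx z * (eps * g r c)" unfolding sc_def by (rule mult.left_commute)
    moreover have "eps * g r c = g r c" using that by (simp add: corner_def)
    ultimately show "eps * sc z g r c = sc z g r c" by (simp add: sc_def)
  qed
  show "corner (mm d a g)" if "corner g"
    unfolding corner_def
  proof (intro allI)
    fix r c
    have "eps * (a r l * g l c) = a r l * g l c" for l
    proof -
      have "eps * (a r l * g l c) = a r l * (eps * g l c)" by (rule mult.left_commute)
      moreover have "eps * g l c = g l c" using that by (simp add: corner_def)
      ultimately show ?thesis by simp
    qed
    then show "eps * mm d a g r c = mm d a g r c" by (simp add: mm_def sum_distrib_left)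
  qed
  show "corner (emb_row q)"
    using mult.left_commute[of eps _ eps] by (auto simp: corner_def emb_row_def eps_eps)
qed

lemma tens_emb_row:
  assumes "\<And>p q. d \<le> p \<or> d \<le> q \<Longrightarrow> B p q = 0" "corner B"
  shows "mm d (adj (emb_row q)) (mm d B (emb_row q)) = tens q B"
proof (intro ext, safe)
  fix i p j p'
  have 1: "mm d B (emb_row q) r (j, p') = (if p' < d then B r p' * (cpx (q j) * eps) else 0)" for r
    unfolding mm_def emb_row_def by (simp add: if_distrib[of "\<lambda>x. _ * x"] cong: if_cong)
  have 2: "mm d (adj (emb_row q)) (mm d B (emb_row q)) (i, p) (j, p')
     = (if p < d \<and> p' < d then cpx (cnj (q i)) * eps * (B p p' * (cpx (q j) * eps)) else 0)"
  proof -
    have "adj (emb_row q) (i, p) l = (if l = p then (if p < d then cpx (cnj (q i)) * eps else 0) else 0)" for l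
      by (simp add: adj_def emb_row_def sta_mult sta_eps)
    then show ?thesis
      unfolding mm_def[of d "adj (emb_row q)"] 1
      by (simp add: if_distrib[of "\<lambda>x. x * _"] cong: if_cong)
  qed
  have "eps * (eps * B p p') = B p p'" using assms(2) by (simp add: corner_def)
  then have "cpx (cnj (q i)) * eps * (B p p' * (cpx (q j) * eps)) = cpx (cnj (q i)) * cpx (q j) * B p p'"
    by (metis (no_types, lifting) mult.assoc mult.commute)
  then show "mm d (adj (emb_row q)) (mm d B (emb_row q)) (i, p) (j, p') = tens q B (i, p) (j, p')"
    unfolding 2 using assms(1)[of p p'] by (auto simp: tens_def cpx_mult)
qed

text \<open>The left kernel of a positive extension of the functional, without choosing an
  extension: g^* g is dominated by an element of the image on which the functional is 0, so every
  positive extension vanishes at g^* g.\<close>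

definition null_row :: "(nat \<Rightarrow> 'i \<times> nat \<Rightarrow> 'a) \<Rightarrow> bool" where
  "null_row g \<longleftrightarrow> corner g \<and> (\<exists>M. bd M 0 \<and> sos (M - mm d (adj g) g))"

text \<open>Parallelogram law: 2 (g^* g + h^* h) exceeds (g + h)^* (g + h) by the square (g - h)^*
  (g - h).\<close>

lemma null_add:
  assumes "null_row g" "null_row h" shows "null_row (g + h)"
proof -
  from assms obtain M N where MN: "bd M 0" "sos (M - mm d (adj g) g)" "bd N 0" "sos (N - mm d (adj h) h)"
    by (auto simp: null_row_def)
  have "bd (sc (complex_of_real 2) (M + N)) (2 * (0 + 0))"
    by (intro bd_scale bd_add) (use MN in auto)
  moreover have "sc (complex_of_real 2) (M + N) - mm d (adj (g + h)) (g + h)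
     = sc (complex_of_real 2) ((M - mm d (adj g) g) + (N - mm d (adj h) h)) + mm d (adj (g - h)) (g - h)"
    by (simp add: sc_add sc_diff adj_add adj_diff mm_add_left mm_add_right mm_diff_left mm_diff_right
       sc_add_left[of 1 1, simplified])
  moreover have "sos \<dots>"
    by (intro sos_add sos_sc sos_gram) (use MN in auto)
  ultimately have "bd (sc (complex_of_real 2) (M + N)) 0 \<and>
      sos (sc (complex_of_real 2) (M + N) - mm d (adj (g + h)) (g + h))" by simp
  then show ?thesis using assms corner_intros(1) unfolding null_row_def by blast
qed

lemma null_sc:
  assumes "null_row g" shows "null_row (sc z g)"
proof -
  from assms obtain M where M: "bd M 0" "sos (M - mm d (adj g) g)"
    by (auto simp: null_row_def)
  let ?t = "complex_of_real ((cmod z)\<^sup>2)"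
  have "bd (sc ?t M) ((cmod z)\<^sup>2 * 0)"
    by (intro bd_scale) (use M in auto)
  moreover have "z * cnj z = ?t" using complex_norm_square[of z] by simp
  then have "sc ?t M - mm d (adj (sc z g)) (sc z g) = sc ?t (M - mm d (adj g) g)"
    by (simp add: sc_diff adj_sc mm_sc_left mm_sc_right sc_sc)
  moreover have "sos (sc ?t (M - mm d (adj g) g))"
    by (intro sos_sc) (use M in auto)
  ultimately have "bd (sc ?t M) 0 \<and> sos (sc ?t M - mm d (adj (sc z g)) (sc z g))" by simp
  then show ?thesis using assms corner_intros(3) unfolding null_row_def by blast
qed

lemma null_0: "null_row 0"
proof -
  have "bd (sc (complex_of_real 0) (\<lambda>(i, p) (j, p'). cpx (cnj (undefined i) * undefined j) * Phi u p p')) (0 * Q u undefined)"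
    by (rule bd_scale[OF bd_tens[OF uV] order_refl])
  then have "bd 0 0" by simp
  then have "bd 0 0 \<and> sos (0 - mm d (adj 0) (0 :: nat \<Rightarrow> 'i \<times> nat \<Rightarrow> 'a))" by (simp add: sos_0)
  then show ?thesis using corner_intros(7) unfolding null_row_def by blast
qed

lemma sc_minus_1: "sc (-1) h = - h"
  by (auto simp: sc_def cpx_minus fun_pointwise)

lemma null_diff: "null_row g \<Longrightarrow> null_row h \<Longrightarrow> null_row (g - h)"
  using null_add[of g "- h"] null_sc[of h "-1"] by (simp add: sc_minus_1)

lemma null_sum: "(\<And>i. i \<in> I \<Longrightarrow> null_row (g i)) \<Longrightarrow> null_row (\<Sum>i\<in>I. g i)"
  by (induction I rule: infinite_finite_induct) (auto intro: null_0 null_add)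

lemma unit_mm: "corner g \<Longrightarrow> (\<And>r c. d \<le> r \<Longrightarrow> g r c = 0) \<Longrightarrow> mm d (Phi u) g = g"
proof (intro ext)
  fix r c assume g: "corner g" "\<And>r c. d \<le> r \<Longrightarrow> g r c = 0"
  have "mm d (Phi u) g r c = (\<Sum>l<d. if r = l then eps * g l c else 0)"
    unfolding mm_def Phi_unit by (rule sum.cong) auto
  also have "\<dots> = g r c" using g by (auto simp: corner_def)
  finally show "mm d (Phi u) g r c = g r c" .
qed

lemma gram_unit: "corner g \<Longrightarrow> mm d (adj g) (mm d (Phi u) g) = mm d (adj g) g"
proof (intro ext)
  fix c c' assume g: "corner g"
  have "mm d (Phi u) g r c' = (if r < d then g r c' else 0)" for r
  proof -
    have "mm d (Phi u) g r c' = (\<Sum>l<d. if r = l then eps * g l c' else 0)"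
      unfolding mm_def Phi_unit by (rule sum.cong) auto
    also have "\<dots> = (if r < d then g r c' else 0)" using g by (auto simp: corner_def)
    finally show ?thesis .
  qed
  then show "mm d (adj g) (mm d (Phi u) g) c c' = mm d (adj g) g c c'"
    unfolding mm_def[of d "adj g"] by simp
qed

text \<open>The algebraic form of two consequences of 0 \<le> X \<le> k, namely X^2 \<le> k X and
  X^2 \<le> k^2. The first handles kernels of forms, the second boundedness.\<close>

lemma Phi_bound:
  assumes "x \<in> C"
  obtains k where "k > 0" "sos (sc (complex_of_real k) (Phi x) - mm d (Phi x) (Phi x))"
    "sos (sc (complex_of_real (k\<^sup>2)) (Phi u) - mm d (Phi x) (Phi x))"
proof -
  obtain k where k: "k > 0" "k *\<^sub>R u - x \<in> C" using order_unit assms by blast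
  let ?X = "Phi x" and ?W = "Phi (k *\<^sub>R u - x)" and ?k = "complex_of_real k"
  have xV: "x \<in> V" and wV: "k *\<^sub>R u - x \<in> V" using assms k CV by auto
  have "Phi (k *\<^sub>R u) = ?W + ?X" using Phi_add[OF wV xV] by simp
  then have W: "?W = sc ?k (Phi u) - ?X" using Phi_scale[OF uV] by (simp add: algebra_simps)
  have X1: "mm d (Phi u) ?X = ?X" by (rule unit_mm) (auto intro!: corner_intros xV simp: Phi_out xV)
  have X2: "mm d ?X (Phi u) = ?X"
    using arg_cong[OF X1, of adj] by (simp add: adj_mm Phi_adj xV uV)
  have X3: "mm d (Phi u) (mm d a (Phi u)) = mm d (mm d (Phi u) a) (Phi u)" for a
    by (simp add: mm_assoc)
  have U: "mm d (Phi u) (Phi u) = Phi u" by (rule unit_mm) (auto intro!: corner_intros uV simp: Phi_out uV)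
  have s1: "sos (mm d ?X (mm d ?W ?X))"
    using sos_congr[OF Phi_pos[OF k(2)], of d ?X] by (simp add: Phi_adj xV)
  have s2: "sos (mm d ?W (mm d ?X ?W))"
    using sos_congr[OF Phi_pos[OF assms], of d ?W] by (simp add: Phi_adj wV)
  \<comment> \<open>With W = k - X one has XWX + WXW = k (kX - X^2). Both summands are congruences
    of sums of squares, so no square root has to be taken.\<close>
  have e: "sc ?k ?X - mm d ?X ?X = sc (complex_of_real (1/k)) (mm d ?X (mm d ?W ?X) + mm d ?W (mm d ?X ?W))"
  proof -
    have m1: "mm d ?X (mm d ?W ?X) = sc ?k (mm d ?X ?X) - mm d ?X (mm d ?X ?X)"
      by (simp add: W mm_diff_left mm_diff_right mm_sc_left mm_sc_right X1)
    have m2: "mm d ?W (mm d ?X ?W) = sc (?k * ?k) ?X - sc ?k (mm d ?X ?X) - (sc ?k (mm d ?X ?X) - mm d ?X (mm d ?X ?X))"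
      by (simp add: W mm_diff_left mm_diff_right mm_sc_left mm_sc_right X1 X2 sc_diff sc_sc) (simp add: mm_assoc[symmetric] X1)
    have "mm d ?X (mm d ?W ?X) + mm d ?W (mm d ?X ?W) = sc (?k * ?k) ?X - sc ?k (mm d ?X ?X)"
      unfolding m1 m2 by simp
    then show ?thesis using k(1) by (simp add: sc_diff sc_sc)
  qed
  have a: "sos (sc ?k ?X - mm d ?X ?X)" unfolding e
    by (intro sos_sc sos_add s1 s2) (use k in auto)
  have "sc (complex_of_real (k\<^sup>2)) (Phi u) - mm d ?X ?X = sc ?k ?W + (sc ?k ?X - mm d ?X ?X)"
    by (simp add: W sc_diff sc_sc power2_eq_square)
  moreover have "sos \<dots>" by (intro sos_add a sos_sc Phi_pos k) (use k in auto)
  ultimately show ?thesis using that k a by metis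
qed

text \<open>From X^2 \<le> k^2 one gets (Xg)^* (Xg) \<le> k^2 g^* g, so left multiplication by
  \<open>Phi x\<close> descends to the quotient by null rows.\<close>

lemma null_Phi:
  assumes "x \<in> C" "null_row g" shows "null_row (mm d (Phi x) g)"
proof -
  have xV: "x \<in> V" using assms CV by auto
  from assms obtain M where M: "bd M 0" "sos (M - mm d (adj g) g)" "corner g"
    by (auto simp: null_row_def)
  from Phi_bound[OF assms(1)] obtain k where k: "k > 0"
    "sos (sc (complex_of_real (k\<^sup>2)) (Phi u) - mm d (Phi x) (Phi x))" by metis
  let ?t = "complex_of_real (k\<^sup>2)"
  have "bd (sc ?t M) (k\<^sup>2 * 0)"
    by (intro bd_scale) (use M in auto)
  moreover have "sc ?t M - mm d (adj (mm d (Phi x) g)) (mm d (Phi x) g)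
      = sc ?t (M - mm d (adj g) g) + mm d (adj g) (mm d (sc ?t (Phi u) - mm d (Phi x) (Phi x)) g)"
    by (simp add: adj_mm Phi_adj xV sc_diff mm_diff_left mm_diff_right mm_sc_left mm_sc_right gram_unit M mm_assoc)
  moreover have "sos \<dots>"
    by (intro sos_add sos_sc sos_congr) (use M k in auto)
  ultimately have "bd (sc ?t M) 0" "sos (sc ?t M - mm d (adj (mm d (Phi x) g)) (mm d (Phi x) g))"
    by simp_all
  then show ?thesis using corner_intros(4)[OF M(3)] unfolding null_row_def by blast
qed

text \<open>From X^2 \<le> k X, the square of X q is dominated by k times the matrix coefficient of
  X at q, on which the functional is k \<open>Q y q\<close> = 0. Thus a vector in the kernel of the
  form of \<open>y\<close> is annihilated by \<open>Phi y\<close>.\<close>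

lemma null_kernel:
  assumes "y \<in> C" "Q y q = 0" shows "null_row (mm d (Phi y) (emb_row q))"
proof -
  have yV: "y \<in> V" using assms CV by auto
  from Phi_bound[OF assms(1)] obtain k where k: "k > 0"
    "sos (sc (complex_of_real k) (Phi y) - mm d (Phi y) (Phi y))" by metis
  let ?X = "sc (complex_of_real k) (Phi y) - mm d (Phi y) (Phi y)"
  have "bd (tens q (Phi y)) (Q y q)" unfolding tens_def by (rule bd_tens[OF yV])
  then have "bd (sc (complex_of_real k) (tens q (Phi y))) (k * Q y q)"
    by (intro bd_scale) (use k in auto)
  moreover have "sc (complex_of_real k) (tens q (Phi y)) - mm d (adj (mm d (Phi y) (emb_row q))) (mm d (Phi y) (emb_row q))
     = mm d (adj (emb_row q)) (mm d ?X (emb_row q))"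
    by (subst tens_emb_row[symmetric])
      (auto simp: Phi_out yV adj_mm Phi_adj mm_diff_left mm_diff_right mm_sc_left mm_sc_right mm_assoc intro!: corner_intros)
  moreover have "sos \<dots>" by (intro sos_congr k)
  ultimately have "bd (sc (complex_of_real k) (tens q (Phi y))) 0"
    "sos (sc (complex_of_real k) (tens q (Phi y)) - mm d (adj (mm d (Phi y) (emb_row q))) (mm d (Phi y) (emb_row q)))"
    using assms(2) by simp_all
  then show ?thesis unfolding null_row_def
    using corner_intros(4)[OF corner_intros(5)] by blast
qed

text \<open>The way to a contradiction: a vector on which the form of the unit is strictly positive
  must not become null. The dominating element minus the square of the row is positive and has value
  - \<open>Q u q\<close>.\<close>

lemma null_emb_row:
  assumes "null_row (emb_row q)" shows "Q u q \<le> 0"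
proof -
  from assms obtain M where M: "bd M 0" "sos (M - mm d (adj (emb_row q)) (emb_row q))"
    by (auto simp: null_row_def)
  have t: "tens q (Phi u) = mm d (adj (emb_row q)) (emb_row q)"
    by (subst tens_emb_row[symmetric]) (auto simp: Phi_out uV corner_intros gram_unit)
  have mV: "(-1) *\<^sub>R u \<in> V" using V uV by (rule subspace_scale)
  have "bd (tens q (Phi ((-1) *\<^sub>R u))) (Q ((-1) *\<^sub>R u) q)" unfolding tens_def by (rule bd_tens[OF mV])
  moreover have "tens q (Phi ((-1) *\<^sub>R u)) = - tens q (Phi u)"
    using Phi_scale[OF uV, of "-1"] by (auto simp: fun_pointwise tens_def sc_def fun_eq_iff cpx_minus)
  ultimately have "bd (M + - tens q (Phi u)) (0 + Q ((-1) *\<^sub>R u) q)"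
    using M(1) bd_add by metis
  moreover have "sos (M + - tens q (Phi u))" using M(2) t by simp
  ultimately have "0 \<le> Q ((-1) *\<^sub>R u) q" using bd_sos by force
  then show ?thesis using Q_scale[OF uV, of "-1"] by simp
qed

text \<open>The matrices that act on the quotient by null rows. An arbitrary matrix over the ring
  need not, so the property has to be carried along with every element constructed below.\<close>

definition bounded_mult :: "(nat \<Rightarrow> nat \<Rightarrow> 'a) \<Rightarrow> bool" where
  "bounded_mult a \<longleftrightarrow> (\<forall>g. null_row g \<longrightarrow> null_row (mm d a g))"

end

section \<open>Linear relations and the standard polynomial identity\<close>

lemma exists_linear_relation:
  fixes v :: "'k \<Rightarrow> 'j \<Rightarrow> 'f::field"
  assumes "finite I" "finite K" "card I < card K"
  shows "\<exists>a. (\<exists>k\<in>K. a k \<noteq> 0) \<and> (\<forall>i\<in>I. (\<Sum>k\<in>K. a k * v k i) = 0)"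
  using assms
proof (induction I arbitrary: K v rule: finite_induct)
  case empty
  then obtain k where "k \<in> K" by fastforce
  then show ?case by (intro exI[of _ "\<lambda>_. 1"]) auto
next
  case (insert i I)
  show ?case
  proof (cases "\<forall>k\<in>K. v k i = 0")
    case True
    have "card I < card K" using insert by simp
    from insert.IH[OF insert.prems(1) this, of v] obtain a where
      a: "\<exists>k\<in>K. a k \<noteq> 0" "\<forall>i\<in>I. (\<Sum>k\<in>K. a k * v k i) = 0" by blast
    have "(\<Sum>k\<in>K. a k * v k i) = 0" by (rule sum.neutral) (use True in auto)
    then show ?thesis using a by blast
  next
    case False
    then obtain k0 where k0: "k0 \<in> K" "v k0 i \<noteq> 0" by blast
    let ?K = "K - {k0}" and ?v = "\<lambda>k j. v k j - v k i / v k0 i * v k0 j"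
    have "card I < card ?K" using insert k0 by simp
    from insert.IH[OF _ this, of ?v] insert.prems(1) obtain a where
      a: "\<exists>k\<in>?K. a k \<noteq> 0" "\<forall>j\<in>I. (\<Sum>k\<in>?K. a k * ?v k j) = 0" by blast
    let ?c = "- (\<Sum>k\<in>?K. a k * (v k i / v k0 i))"
    let ?b = "a(k0 := ?c)"
    have split: "(\<Sum>k\<in>K. ?b k * v k j) = (\<Sum>k\<in>?K. a k * ?v k j)" for j
    proof -
      have "(\<Sum>k\<in>K. ?b k * v k j) = ?c * v k0 j + (\<Sum>k\<in>?K. ?b k * v k j)"
        using k0(1) insert.prems(1) by (simp add: sum.remove)
      also have "(\<Sum>k\<in>?K. ?b k * v k j) = (\<Sum>k\<in>?K. a k * v k j)"
        by (rule sum.cong) auto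
      also have "?c * v k0 j + (\<Sum>k\<in>?K. a k * v k j) = (\<Sum>k\<in>?K. a k * ?v k j)"
        by (simp add: right_diff_distrib sum_subtractf sum_distrib_right mult.assoc)
      finally show ?thesis .
    qed
    have "(\<Sum>k\<in>?K. a k * ?v k i) = 0" using k0 by (intro sum.neutral) auto
    then have "\<forall>j\<in>insert i I. (\<Sum>k\<in>K. ?b k * v k j) = 0"
      unfolding split using a(2) by auto
    moreover have "\<exists>k\<in>K. ?b k \<noteq> 0" using a(1) by auto
    ultimately show ?thesis by (intro exI[of _ ?b]) simp
  qed
qed

context star_algebra
begin

fun act :: "nat \<Rightarrow> (nat \<Rightarrow> nat \<Rightarrow> 'a) list \<Rightarrow> (nat \<Rightarrow> 'c \<Rightarrow> 'a) \<Rightarrow> nat \<Rightarrow> 'c \<Rightarrow> 'a" where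
  "act d [] g = g"
| "act d (a # as) g = mm d a (act d as g)"

definition index_lists :: "nat \<Rightarrow> nat \<Rightarrow> nat list set" where
  "index_lists d k = {rs. set rs \<subseteq> {..<d} \<and> length rs = k}"

text \<open>Expands a product into a sum over index paths. Each summand is a product of ring
  elements, which commute, so permuting the factors only permutes which matrix stands at which
  position of the path.\<close>

lemma act_paths:
  "act d as g p c = (\<Sum>rs\<in>index_lists d (length as).
     (\<Prod>t<length as. (as ! t) ((p # rs) ! t) (rs ! t)) * g (last (p # rs)) c)"
proof (induction as arbitrary: p)
  case Nil
  have "index_lists d 0 = {[]}" by (auto simp: index_lists_def)
  then show ?case by simp
next
  case (Cons a as)
  have eq: "index_lists d (Suc (length as)) = (\<lambda>(l, rs). l # rs) ` ({..<d} \<times> index_lists d (length as))"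
  proof (rule Set.set_eqI)
    fix xs show "xs \<in> index_lists d (Suc (length as)) \<longleftrightarrow>
        xs \<in> (\<lambda>(l, rs). l # rs) ` ({..<d} \<times> index_lists d (length as))"
      by (cases xs) (auto simp: index_lists_def image_iff)
  qed
  have "act d (a # as) g p c = (\<Sum>l<d. a p l * act d as g l c)" by (simp add: mm_def)
  also have "\<dots> = (\<Sum>l<d. \<Sum>rs\<in>index_lists d (length as).
      a p l * ((\<Prod>t<length as. (as ! t) ((l # rs) ! t) (rs ! t)) * g (last (l # rs)) c))"
    unfolding Cons.IH by (simp add: sum_distrib_left)
  also have "\<dots> = (\<Sum>(l, rs)\<in>{..<d} \<times> index_lists d (length as).
      a p l * ((\<Prod>t<length as. (as ! t) ((l # rs) ! t) (rs ! t)) * g (last (l # rs)) c))"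
    by (simp add: sum.cartesian_product)
  also have "\<dots> = (\<Sum>rs\<in>index_lists d (length (a # as)).
     (\<Prod>t<length (a # as). ((a # as) ! t) ((p # rs) ! t) (rs ! t)) * g (last (p # rs)) c)"
    unfolding length_Cons eq
    by (subst sum.reindex)
      (auto simp: inj_on_def prod.lessThan_Suc_shift mult.assoc simp del: prod.lessThan_Suc intro!: sum.cong)
  finally show ?case .
qed

text \<open>Composing with the transposition of \<open>s\<close> and \<open>t\<close> reverses the
  sign but, as both positions use the same index pair, leaves the product unchanged. The sum
  therefore equals its negative, and 2 is invertible because the ring contains the complex
  scalars.\<close>

lemma alternating_sum_eq_0:
  fixes k s t :: nat
  assumes "s < k" "t < k" "s \<noteq> t" "e s = e t"
  shows "(\<Sum>\<sigma> | \<sigma> permutes {..<k}. cpx (of_int (sign \<sigma>)) * (\<Prod>i<k. f (\<sigma> i) (e i))) = 0"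
    (is "?S = 0")
proof -
  let ?\<tau> = "Transposition.transpose s t"
  have tp: "?\<tau> permutes {..<k}" using assms by (intro permutes_swap_id) auto
  have "?S = (\<Sum>\<sigma> | \<sigma> permutes {..<k}. cpx (of_int (sign (\<sigma> \<circ> ?\<tau>))) * (\<Prod>i<k. f ((\<sigma> \<circ> ?\<tau>) i) (e i)))"
    by (rule sum_permutations_compose_right[OF tp])
  also have "\<dots> = (\<Sum>\<sigma> | \<sigma> permutes {..<k}. - (cpx (of_int (sign \<sigma>)) * (\<Prod>i<k. f (\<sigma> i) (e i))))"
  proof (rule sum.cong[OF refl], clarify)
    fix \<sigma> :: "nat \<Rightarrow> nat" assume "\<sigma> permutes {..<k}"
    then have ps: "permutation \<sigma>" by (meson finite_lessThan permutation_permutes)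
    have "sign (\<sigma> \<circ> ?\<tau>) = - sign \<sigma>"
      using ps assms(3) by (simp add: sign_compose permutation_swap_id sign_swap_id)
    moreover have "(\<Prod>i<k. f ((\<sigma> \<circ> ?\<tau>) i) (e i)) = (\<Prod>i<k. f (\<sigma> i) (e i))"
    proof -
      have "(\<Prod>i<k. f (\<sigma> i) (e i)) = (\<Prod>i<k. f (\<sigma> (?\<tau> i)) (e (?\<tau> i)))"
        using prod.permute[OF tp, of "\<lambda>i. f (\<sigma> i) (e i)"] by (simp add: o_def)
      also have "\<dots> = (\<Prod>i<k. f ((\<sigma> \<circ> ?\<tau>) i) (e i))"
        using assms(4) by (intro prod.cong) (auto simp: Transposition.transpose_def)
      finally show ?thesis by simp
    qed
    ultimately show "cpx (of_int (sign (\<sigma> \<circ> ?\<tau>))) * (\<Prod>i<k. f ((\<sigma> \<circ> ?\<tau>) i) (e i)) =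
       - (cpx (of_int (sign \<sigma>)) * (\<Prod>i<k. f (\<sigma> i) (e i)))"
      by (simp add: cpx_minus)
  qed
  also have "\<dots> = - ?S" by (simp add: sum_negf)
  finally have "?S + ?S = 0" by (simp only: eq_neg_iff_add_eq_0)
  then have "cpx (1/2) * (?S + ?S) = 0" by simp
  moreover have "cpx (1/2) * (?S + ?S) = ?S"
  proof -
    have "cpx (1/2) * (x + x) = x" for x
    proof -
      have "cpx (1/2) * (x + x) = (cpx (1/2) + cpx (1/2)) * x" by (simp only: distrib_left distrib_right)
      also have "cpx (1/2) + cpx (1/2) = cpx (1/2 + 1/2)" by (rule cpx_add[symmetric])
      finally show ?thesis by simp
    qed
    then show ?thesis .
  qed
  ultimately show ?thesis by simp
qed

text \<open>The standard polynomial identity: \<open>d \<times> d\<close> matrices are spanned by \<open>d\<^sup>2\<close> elements over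
  their commutative entry ring, so an alternating multilinear map of more arguments vanishes.\<close>

lemma standard_identity:
  fixes k d :: nat and g :: "nat \<Rightarrow> 'c \<Rightarrow> 'a"
  assumes "d * d + 2 \<le> k"
  shows "(\<Sum>\<sigma> | \<sigma> permutes {..<k}. sc (of_int (sign \<sigma>)) (act d (map (\<lambda>t. a (\<sigma> t)) [0..<k]) g)) = 0"
proof (intro ext)
  fix p c
  have sum_app: "(\<Sum>i\<in>I. h i) p c = (\<Sum>i\<in>I. h i p c)" for I :: "'z set" and h :: "'z \<Rightarrow> nat \<Rightarrow> 'c \<Rightarrow> 'a"
    by (induction I rule: infinite_finite_induct) (auto simp: fun_pointwise)
  have "(\<Sum>\<sigma> | \<sigma> permutes {..<k}. sc (of_int (sign \<sigma>)) (act d (map (\<lambda>t. a (\<sigma> t)) [0..<k]) g)) p c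
    = (\<Sum>\<sigma> | \<sigma> permutes {..<k}. \<Sum>rs\<in>index_lists d k. cpx (of_int (sign \<sigma>)) *
        ((\<Prod>t<k. a (\<sigma> t) ((p # rs) ! t) (rs ! t)) * g (last (p # rs)) c))"
    by (auto simp: sum_app sc_def act_paths sum_distrib_left intro!: sum.cong)
  also have "\<dots> = (\<Sum>rs\<in>index_lists d k. \<Sum>\<sigma> | \<sigma> permutes {..<k}. cpx (of_int (sign \<sigma>)) *
        ((\<Prod>t<k. a (\<sigma> t) ((p # rs) ! t) (rs ! t)) * g (last (p # rs)) c))"
    by (rule sum.swap)
  also have "\<dots> = (\<Sum>rs\<in>index_lists d k. (\<Sum>\<sigma> | \<sigma> permutes {..<k}. cpx (of_int (sign \<sigma>)) *
        (\<Prod>t<k. (\<lambda>i (x, y). a i x y) (\<sigma> t) ((p # rs) ! t, rs ! t))) * g (last (p # rs)) c)"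
    by (simp add: sum_distrib_right mult.assoc)
  also have "\<dots> = 0"
  proof (rule sum.neutral, rule ballI)
    fix rs assume rs: "rs \<in> index_lists d k"
    let ?e = "\<lambda>t. ((p # rs) ! t, rs ! t)"
    \<comment> \<open>The initial index \<open>p\<close> is an arbitrary natural number, possibly at
      least \<open>d\<close>, so only the positions from 1 on carry an index pair below
      \<open>d\<close>. Losing one position is the reason for \<open>d * d + 2\<close> instead of
      \<open>d * d + 1\<close>.\<close>
    have "?e ` {1..<k} \<subseteq> {..<d} \<times> {..<d}"
    proof (rule image_subsetI)
      fix t assume t: "t \<in> {1..<k}"
      have nth: "rs ! i < d" if "i < k" for i
      proof -
        have len: "length rs = k" and sub: "set rs \<subseteq> {..<d}" using rs by (auto simp: index_lists_def)
        have "rs ! i \<in> set rs" using that len by simp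
        with sub show ?thesis by auto
      qed
      show "?e t \<in> {..<d} \<times> {..<d}" using nth[of t] nth[of "t - 1"] t by (auto simp: nth_Cons')
    qed
    then have "card (?e ` {1..<k}) \<le> card ({..<d} \<times> {..<d})" by (intro card_mono) auto
    then have "card (?e ` {1..<k}) < card {1..<k}" using assms by (simp add: card_cartesian_product)
    from pigeonhole[OF this] obtain s t where "s < k" "t < k" "s \<noteq> t" "?e s = ?e t"
      unfolding inj_on_def by force
    from alternating_sum_eq_0[where f = "\<lambda>i (x, y). a i x y" and e = ?e, OF this]
    show "(\<Sum>\<sigma> | \<sigma> permutes {..<k}. cpx (of_int (sign \<sigma>)) *
        (\<Prod>t<k. (\<lambda>i (x, y). a i x y) (\<sigma> t) ((p # rs) ! t, rs ! t))) * g (last (p # rs)) c = 0"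
      by simp
  qed
  finally show "(\<Sum>\<sigma> | \<sigma> permutes {..<k}. sc (of_int (sign \<sigma>)) (act d (map (\<lambda>t. a (\<sigma> t)) [0..<k]) g)) p c = 0 p c"
    by (simp add: fun_pointwise)
qed

end

section \<open>Linear maps on finitely supported complex vectors\<close>

definition fin_supp :: "'i set \<Rightarrow> ('i \<Rightarrow> complex) set" where
  "fin_supp B = {q. \<forall>i. i \<notin> B \<longrightarrow> q i = 0}"

definition lin_on :: "'i set \<Rightarrow> (('i \<Rightarrow> complex) \<Rightarrow> 'j \<Rightarrow> complex) \<Rightarrow> bool" where
  "lin_on B T \<longleftrightarrow> (\<forall>p\<in>fin_supp B. \<forall>q\<in>fin_supp B. T (p + q) = T p + T q) \<and>
     (\<forall>z. \<forall>q\<in>fin_supp B. T (\<lambda>i. z * q i) = (\<lambda>i. z * T q i))"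

lemma fin_supp_intros:
  "p \<in> fin_supp B \<Longrightarrow> q \<in> fin_supp B \<Longrightarrow> p + q \<in> fin_supp B"
  "p \<in> fin_supp B \<Longrightarrow> q \<in> fin_supp B \<Longrightarrow> p - q \<in> fin_supp B"
  "q \<in> fin_supp B \<Longrightarrow> (\<lambda>i. z * q i) \<in> fin_supp B" "0 \<in> fin_supp B"
  by (auto simp: fin_supp_def fun_pointwise)

lemma fin_supp_sum: "(\<And>x. x \<in> A \<Longrightarrow> f x \<in> fin_supp B) \<Longrightarrow> sum f A \<in> fin_supp B"
  by (induction A rule: infinite_finite_induct) (auto intro: fin_supp_intros)

lemma lin_on_sum:
  assumes "lin_on B T" "finite A" "\<And>x. x \<in> A \<Longrightarrow> f x \<in> fin_supp B"
  shows "T (sum f A) = (\<Sum>x\<in>A. T (f x))"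
  using assms(2,3)
proof (induction A rule: finite_induct)
  case empty
  have "T (\<lambda>i. 0 * (0 :: 'a \<Rightarrow> complex) i) = (\<lambda>i. 0 * T 0 i)"
    using assms(1) fin_supp_intros(4)[of B] unfolding lin_on_def by blast
  then have "T (\<lambda>i. 0) = (\<lambda>i. 0)" by simp
  then show ?case by (simp add: zero_fun_def)
next
  case (insert x A)
  then have "T (f x + sum f A) = T (f x) + T (sum f A)"
    using assms(1) fin_supp_sum[of A f B] unfolding lin_on_def by blast
  then show ?case using insert by simp
qed

text \<open>The first |B|^2 + 1 powers of \<open>T\<close> have only |B|^2 matrix entries each, so
  they are linearly dependent; dividing by the top nonzero coefficient expresses one power by lower
  ones.\<close>

lemma power_relation:
  fixes B :: "'i set" and T :: "('i \<Rightarrow> complex) \<Rightarrow> 'i \<Rightarrow> complex"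
  assumes "finite B" "lin_on B T" "\<And>q. q \<in> fin_supp B \<Longrightarrow> T q \<in> fin_supp B"
  obtains r b where "\<And>q. q \<in> fin_supp B \<Longrightarrow> (T ^^ Suc r) q = (\<Sum>k\<le>r. (\<lambda>i. b k * (T ^^ k) q i))"
proof (cases "B = {}")
  case True
  then have "fin_supp B = {0}" by (auto simp: fin_supp_def zero_fun_def)
  moreover have "T 0 = 0" using lin_on_sum[OF assms(2), of "{}"] by simp
  moreover have "(\<Sum>k\<le>0::nat. (\<lambda>i. 0 * (T ^^ k) q i)) = 0" for q by (simp add: zero_fun_def fun_eq_iff)
  ultimately have "(T ^^ Suc 0) q = (\<Sum>k\<le>0. (\<lambda>i. 0 * (T ^^ k) q i))" if "q \<in> fin_supp B" for q
    using that by (metis funpow_0 funpow_Suc_right o_apply singletonD)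
  then show ?thesis using that[of 0 "\<lambda>_. 0"] by blast
next
  case False
  define e :: "'i \<Rightarrow> 'i \<Rightarrow> complex" where "e = (\<lambda>b i. if i = b then 1 else (0::complex))"
  let ?v = "\<lambda>k (b, c). (T ^^ k) (e b) c"
  have eB: "b \<in> B \<Longrightarrow> e b \<in> fin_supp B" for b by (auto simp: e_def fin_supp_def)
  have pw: "q \<in> fin_supp B \<Longrightarrow> (T ^^ k) q \<in> fin_supp B" for k q
    by (induction k) (auto intro: assms(3))
  have plin: "lin_on B (T ^^ k)" for k
  proof (induction k)
    case (Suc k)
    show ?case unfolding lin_on_def
    proof (intro conjI ballI allI)
      fix p q assume pq: "p \<in> fin_supp B" "q \<in> fin_supp B"
      have "(T ^^ k) (p + q) = (T ^^ k) p + (T ^^ k) q" using Suc pq unfolding lin_on_def by blast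
      then show "(T ^^ Suc k) (p + q) = (T ^^ Suc k) p + (T ^^ Suc k) q"
        using assms(2) pw pq unfolding lin_on_def by auto
    next
      fix z q assume q: "q \<in> fin_supp B"
      have "(T ^^ k) (\<lambda>i. z * q i) = (\<lambda>i. z * (T ^^ k) q i)" using Suc q unfolding lin_on_def by blast
      then show "(T ^^ Suc k) (\<lambda>i. z * q i) = (\<lambda>i. z * (T ^^ Suc k) q i)"
        using assms(2) pw q unfolding lin_on_def by auto
    qed
  qed (simp add: lin_on_def)
  have "card (B \<times> B) < card {..card (B \<times> B)}" by simp
  from exists_linear_relation[OF _ _ this, of ?v] assms(1) obtain a where
    a: "\<exists>k\<le>card (B \<times> B). a k \<noteq> 0" "\<forall>i\<in>B \<times> B. (\<Sum>k\<le>card (B \<times> B). a k * ?v k i) = 0" by auto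
  define N where "N = card (B \<times> B)"
  define R where "R = (GREATEST k. k \<le> N \<and> a k \<noteq> 0)"
  have "R \<le> N \<and> a R \<noteq> 0" unfolding R_def
    by (rule GreatestI_ex_nat[where b = N]) (use a N_def in auto)
  moreover have "k \<le> R" if "k \<le> N" "a k \<noteq> 0" for k
    unfolding R_def by (rule Greatest_le_nat[where b = N]) (use that in auto)
  ultimately have R: "R \<le> N" "a R \<noteq> 0" "\<And>k. R < k \<Longrightarrow> k \<le> N \<Longrightarrow> a k = 0" by fastforce+
  have rel: "(\<Sum>k\<le>R. a k * (T ^^ k) q c) = 0" if q: "q \<in> fin_supp B" for q c
  proof (cases "c \<in> B")
    case False then show ?thesis using pw[OF q] by (simp add: fin_supp_def)
  next
    case True
    have qe: "q = (\<Sum>b\<in>B. (\<lambda>i. q b * e b i))"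
    proof
      fix i
      have "(\<Sum>b\<in>A. (\<lambda>i. q b * e b i)) i = (\<Sum>b\<in>A. q b * e b i)" for A
        by (induction A rule: infinite_finite_induct) (auto simp: fun_pointwise)
      then show "q i = (\<Sum>b\<in>B. (\<lambda>i. q b * e b i)) i"
        using q assms(1) by (simp add: e_def fin_supp_def if_distrib cong: if_cong)
    qed
    have "(T ^^ k) q c = (\<Sum>b\<in>B. q b * (T ^^ k) (e b) c)" for k
    proof -
      have "(T ^^ k) q = (\<Sum>b\<in>B. (T ^^ k) (\<lambda>i. q b * e b i))"
        by (subst qe, rule lin_on_sum[OF plin assms(1)]) (auto intro: fin_supp_intros eB)
      also have "\<dots> = (\<Sum>b\<in>B. (\<lambda>i. q b * (T ^^ k) (e b) i))"
        by (rule sum.cong) (use plin eB in \<open>auto simp: lin_on_def\<close>)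
      finally have "(T ^^ k) q c = (\<Sum>b\<in>B. (\<lambda>i. q b * (T ^^ k) (e b) i)) c" by simp
      also have "\<dots> = (\<Sum>b\<in>B. q b * (T ^^ k) (e b) c)"
      proof -
        have "(\<Sum>b\<in>A. (\<lambda>i. q b * (T ^^ k) (e b) i)) c = (\<Sum>b\<in>A. q b * (T ^^ k) (e b) c)" for A
          by (induction A rule: infinite_finite_induct) (auto simp: fun_pointwise)
        then show ?thesis .
      qed
      finally show ?thesis .
    qed
    then have "(\<Sum>k\<le>R. a k * (T ^^ k) q c) = (\<Sum>k\<le>R. \<Sum>b\<in>B. q b * (a k * (T ^^ k) (e b) c))"
      by (simp add: sum_distrib_left mult.left_commute)
    also have "\<dots> = (\<Sum>b\<in>B. q b * (\<Sum>k\<le>R. a k * (T ^^ k) (e b) c))"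
      by (subst sum.swap) (simp add: sum_distrib_left)
    also have "\<dots> = 0"
    proof (rule sum.neutral, rule ballI)
      fix b assume b: "b \<in> B"
      have "(\<Sum>k\<le>N. a k * ?v k (b, c)) = 0" using a(2) b True N_def by blast
      moreover have "(\<Sum>k\<le>N. a k * ?v k (b, c)) = (\<Sum>k\<le>R. a k * (T ^^ k) (e b) c)"
        by (rule sum.mono_neutral_cong_right) (use R in auto)
      ultimately show "q b * (\<Sum>k\<le>R. a k * (T ^^ k) (e b) c) = 0" by simp
    qed
    finally show ?thesis .
  qed
  \<comment> \<open>A relation of degree 0 would make a nonzero multiple of the identity vanish on a
    basis vector.\<close>
  have "R \<noteq> 0"
  proof
    assume "R = 0"
    moreover obtain b where "b \<in> B" using False by blast
    ultimately show False using rel[OF eB, of b b] R(2) by (simp add: e_def)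
  qed
  then obtain r where r: "R = Suc r" by (cases R) auto
  show ?thesis
  proof (rule that[of r "\<lambda>k. - a k / a R"], rule ext)
    fix q c assume q: "q \<in> fin_supp B"
    have "(\<Sum>k\<in>A. (\<lambda>i. - a k / a R * (T ^^ k) q i)) c = (\<Sum>k\<in>A. - a k / a R * (T ^^ k) q c)" for A
      by (induction A rule: infinite_finite_induct) (auto simp: fun_pointwise)
    moreover have "(\<Sum>k\<le>r. a k * (T ^^ k) q c) + a R * (T ^^ R) q c = 0"
      using rel[OF q, of c] r by simp
    then have "(T ^^ R) q c = - (\<Sum>k\<le>r. a k * (T ^^ k) q c) / a R"
      using R(2) by (simp add: field_simps add_eq_0_iff)
    then have "(T ^^ R) q c = (\<Sum>k\<le>r. - a k / a R * (T ^^ k) q c)"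
      by (simp add: sum_divide_distrib sum_negf)
    ultimately show "(T ^^ Suc r) q c = (\<Sum>k\<le>r. (\<lambda>i. - a k / a R * (T ^^ k) q i)) c" using r by simp
  qed
qed

section \<open>The rigid configuration: two generators against three\<close>

text \<open>The row operator (K_0, K_1, K_2) from triples of vectors in C^m to C^m, sending q to w =
  sum_j K_j q_j.\<close>

definition shift_block :: "nat \<Rightarrow> (nat \<Rightarrow> nat \<Rightarrow> nat \<Rightarrow> real) \<Rightarrow> (nat \<times> nat \<Rightarrow> complex) \<Rightarrow> nat \<Rightarrow> complex" where
  "shift_block m K q = (\<lambda>k. if k < m then \<Sum>j<3. \<Sum>l<m. complex_of_real (K j k l) * q (j, l) else 0)"

definition diag_embed :: "nat \<Rightarrow> (nat \<Rightarrow> complex) \<Rightarrow> nat \<times> nat \<Rightarrow> complex" where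
  "diag_embed m v = (\<lambda>(j, k). if j < 3 \<and> k < m then v k else 0)"

definition slot :: "nat \<Rightarrow> (nat \<times> nat \<Rightarrow> complex) \<Rightarrow> nat \<times> nat \<Rightarrow> complex" where
  "slot i q = (\<lambda>(j, k). if j = i then q (j, k) else 0)"

abbreviation slots :: "nat \<Rightarrow> (nat \<times> nat) set" where
  "slots m \<equiv> {..<3} \<times> {..<m}"

text \<open>\<open>x1\<close>, \<open>x2\<close> and \<open>y 0\<close>, \<open>y 1\<close>,
  \<open>y 2\<close> are scaled generators on the two sides of one relation, \<open>r1\<close> and
  \<open>r2\<close> the remainders of the two sides, and \<open>ru\<close> the remainder of an
  expansion of the unit. The assumptions on \<open>Q\<close> say only where the forms vanish: for
  \<open>x1\<close> on the kernel of the row operator, for \<open>x2\<close> on diagonal triples,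
  for \<open>y j\<close> on triples with zero j-th component, for the remainders everywhere.
  \<open>K 0\<close> is diagonal with distinct entries and \<open>K 1\<close> couples neighbours, so
  together they generate all matrices on C^m. The size \<open>m\<close> is one more than the degree
  \<open>d * d + 2\<close> of the identity to be violated.\<close>

locale rigid_embedding = positive_embedding sta cpx d eps V C u Phi Q bd
  for sta :: "'a::comm_ring_1 \<Rightarrow> 'a" and cpx d eps and V C :: "'e::real_vector set" and u Phi
    and Q :: "'e \<Rightarrow> (nat \<times> nat \<Rightarrow> complex) \<Rightarrow> real" and bd +
  fixes x1 x2 r1 r2 ru :: 'e and y :: "nat \<Rightarrow> 'e" and c1 c2 :: real and cy :: "nat \<Rightarrow> real"
    and K :: "nat \<Rightarrow> nat \<Rightarrow> nat \<Rightarrow> real" and m :: nat and dl :: real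
  assumes C_add: "a \<in> C \<Longrightarrow> b \<in> C \<Longrightarrow> a + b \<in> C"
    and mem: "x1 \<in> C" "x2 \<in> C" "r1 \<in> C" "r2 \<in> C" "ru \<in> C" "y 0 \<in> C" "y 1 \<in> C" "y 2 \<in> C" "u \<in> C"
    and xy: "x1 + x2 + r1 = y 0 + y 1 + y 2 + r2"
    and u_eq: "u = c1 *\<^sub>R x1 + c2 *\<^sub>R x2 + (cy 0 *\<^sub>R y 0 + cy 1 *\<^sub>R y 1 + cy 2 *\<^sub>R y 2) + ru"
    and Q_x1: "q \<in> fin_supp (slots m) \<Longrightarrow> shift_block m K q = 0 \<Longrightarrow> Q x1 q = 0"
    and Q_x2: "Q x2 (diag_embed m v) = 0"
    and Q_y: "j < 3 \<Longrightarrow> q \<in> fin_supp (slots m) \<Longrightarrow> slot j q = 0 \<Longrightarrow> Q (y j) q = 0"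
    and Q_rest: "q \<in> fin_supp (slots m) \<Longrightarrow> Q r1 q = 0 \<and> Q r2 q = 0 \<and> Q ru q = 0"
    and K_sum: "k < m \<Longrightarrow> l < m \<Longrightarrow> (\<Sum>j<3. K j k l) = of_bool (k = l)"
    and K_0: "k < m \<Longrightarrow> l < m \<Longrightarrow> K 0 k l = (if k = l then (1 + dl * real k) / 3 else 0)"
    and K_1: "k < m \<Longrightarrow> l < m \<Longrightarrow>
        K 1 k l = (of_bool (k = l) + dl * of_bool (k = Suc l \<or> l = Suc k)) / 3"
    and dl: "dl \<noteq> 0" and m: "m = d * d + 3"
    and Q_u: "0 < Q u (diag_embed m (\<lambda>k. of_bool (k = 0)))"
begin

abbreviation "D \<equiv> fin_supp (slots m)"
abbreviation "W \<equiv> fin_supp {..<m}"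

text \<open>An idempotent with the diagonal triples as range, because the K_j sum to 1, and with the
  kernel of the row operator as kernel.\<close>

definition proj :: "(nat \<times> nat \<Rightarrow> complex) \<Rightarrow> nat \<times> nat \<Rightarrow> complex" where
  "proj q = diag_embed m (shift_block m K q)"

lemma diag_embed_D: "diag_embed m v \<in> D"
  and slot_D: "q \<in> D \<Longrightarrow> slot j q \<in> D"
  and shift_block_W: "shift_block m K q \<in> W"
  by (auto simp: fin_supp_def diag_embed_def slot_def shift_block_def)

lemma diag_embed_add: "diag_embed m (v + w) = diag_embed m v + diag_embed m w"
  and diag_embed_scale: "diag_embed m (\<lambda>k. z * v k) = (\<lambda>i. z * diag_embed m v i)"
  and diag_embed_0: "diag_embed m 0 = 0"
  by (auto simp: diag_embed_def fun_pointwise fun_eq_iff)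

lemma shift_block_add: "shift_block m K (p + q) = shift_block m K p + shift_block m K q"
  and shift_block_diff: "shift_block m K (p - q) = shift_block m K p - shift_block m K q"
  and shift_block_scale: "shift_block m K (\<lambda>i. z * q i) = (\<lambda>k. z * shift_block m K q k)"
  by (auto simp: shift_block_def fun_pointwise fun_eq_iff algebra_simps sum.distrib sum_subtractf sum_distrib_left)

lemma shift_block_slot:
  assumes "j < 3" "v \<in> W" "k < m"
  shows "shift_block m K (slot j (diag_embed m v)) k = (\<Sum>l<m. complex_of_real (K j k l) * v l)"
proof -
  have "shift_block m K (slot j (diag_embed m v)) k
     = (\<Sum>i<3. if i = j then \<Sum>l<m. complex_of_real (K j k l) * v l else 0)"
  proof -
    have "(\<Sum>l<m. complex_of_real (K i k l) * slot j (diag_embed m v) (i, l))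
       = (if i = j then \<Sum>l<m. complex_of_real (K j k l) * v l else 0)" if "i < 3" for i
      using that by (auto simp: slot_def diag_embed_def)
    then show ?thesis using assms by (simp add: shift_block_def)
  qed
  then show ?thesis using assms by simp
qed

lemma shift_block_diag:
  assumes "v \<in> W" shows "shift_block m K (diag_embed m v) = v"
proof
  fix k
  show "shift_block m K (diag_embed m v) k = v k"
  proof (cases "k < m")
    case True
    have "shift_block m K (diag_embed m v) k = (\<Sum>l<m. \<Sum>j<3. complex_of_real (K j k l) * v l)"
      using True by (subst sum.swap) (auto simp: shift_block_def diag_embed_def intro!: sum.cong)
    also have "\<dots> = (\<Sum>l<m. complex_of_real (\<Sum>j<3. K j k l) * v l)"
      by (simp add: sum_distrib_right)
    also have "\<dots> = (\<Sum>l<m. if l = k then v l else 0)"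
      by (rule sum.cong) (auto simp: K_sum True)
    also have "\<dots> = v k" using True by simp
    finally show ?thesis .
  qed (use assms in \<open>auto simp: shift_block_def fin_supp_def\<close>)
qed

lemma proj_D: "proj q \<in> D" by (simp add: proj_def diag_embed_D)

lemma shift_block_proj: "shift_block m K (q - proj q) = 0"
  by (simp add: shift_block_diff proj_def shift_block_diag shift_block_W)

lemma emb_row_null:
  assumes "x \<in> C" "Q x q = 0" "q = p - p'"
  shows "null_row (mm d (Phi x) (emb_row p) - mm d (Phi x) (emb_row p'))"
  using null_kernel[OF assms(1,2)] by (simp add: assms(3) emb_row_diff mm_diff_right)

definition e :: 'e where "e = x1 + x2 + r1"

lemma eC: "e \<in> C" unfolding e_def by (intro C_add mem)

lemma memV: "x1 \<in> V" "x2 \<in> V" "r1 \<in> V" "r2 \<in> V" "ru \<in> V" "y 0 \<in> V" "y 1 \<in> V" "y 2 \<in> V" "e \<in> V"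
  using mem eC CV by auto

lemma Phi_e: "Phi e = Phi x1 + Phi x2 + Phi r1" "Phi e = Phi (y 0) + Phi (y 1) + Phi (y 2) + Phi r2"
  using memV unfolding e_def
  by (simp_all add: Phi_add subspace_add[OF V] del: One_nat_def)
    (simp add: xy Phi_add subspace_add[OF V] del: One_nat_def flip: Phi_add)

lemma null_zero_form: "x \<in> C \<Longrightarrow> Q x q = 0 \<Longrightarrow> null_row (mm d (Phi x) (emb_row q))"
  by (rule null_kernel)

text \<open>\<open>Phi x1\<close> annihilates q - \<open>proj q\<close>, while \<open>Phi x2\<close>
  and \<open>Phi r1\<close> annihilate \<open>proj q\<close>; adding the two missing terms of
  \<open>e\<close> turns \<open>Phi x1\<close> q into \<open>Phi e\<close>
  \<open>proj q\<close>.\<close>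

lemma x1_row:
  assumes q: "q \<in> D"
  shows "null_row (mm d (Phi x1) (emb_row q) - mm d (Phi e) (emb_row (proj q)))"
proof -
  have 1: "null_row (mm d (Phi x1) (emb_row (q - proj q)))"
    by (rule null_kernel[OF mem(1) Q_x1]) (auto intro!: fin_supp_intros q proj_D shift_block_proj)
  have 2: "null_row (mm d (Phi x2) (emb_row (proj q)))"
    by (rule null_kernel[OF mem(2)]) (simp add: proj_def Q_x2)
  have 3: "null_row (mm d (Phi r1) (emb_row (proj q)))"
    by (rule null_kernel[OF mem(3)]) (simp add: Q_rest proj_D)
  have "mm d (Phi x1) (emb_row q) - mm d (Phi e) (emb_row (proj q))
     = mm d (Phi x1) (emb_row (q - proj q)) - mm d (Phi x2) (emb_row (proj q)) - mm d (Phi r1) (emb_row (proj q))"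
    by (simp add: Phi_e(1) mm_add_left emb_row_diff mm_diff_right algebra_simps)
  then show ?thesis using 1 2 3 by (simp add: null_diff)
qed

lemma x2_row:
  assumes q: "q \<in> D"
  shows "null_row (mm d (Phi x2) (emb_row q) - mm d (Phi e) (emb_row (q - proj q)))"
proof -
  have 1: "null_row (mm d (Phi x1) (emb_row (q - proj q)))"
    by (rule null_kernel[OF mem(1) Q_x1]) (auto intro!: fin_supp_intros q proj_D shift_block_proj)
  have 2: "null_row (mm d (Phi x2) (emb_row (proj q)))"
    by (rule null_kernel[OF mem(2)]) (simp add: proj_def Q_x2)
  have 3: "null_row (mm d (Phi r1) (emb_row (q - proj q)))"
    by (rule null_kernel[OF mem(3)]) (simp add: Q_rest proj_D q fin_supp_intros)
  have "mm d (Phi x2) (emb_row q) - mm d (Phi e) (emb_row (q - proj q))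
     = mm d (Phi x2) (emb_row (proj q)) - mm d (Phi x1) (emb_row (q - proj q)) - mm d (Phi r1) (emb_row (q - proj q))"
    by (simp add: Phi_e(1) mm_add_left emb_row_diff mm_diff_right algebra_simps)
  then show ?thesis using 1 2 3 by (simp add: null_diff)
qed

lemma less3: "(j::nat) < 3 \<longleftrightarrow> j = 0 \<or> j = 1 \<or> j = 2" by auto

text \<open>The same mechanism for the other side of the relation: \<open>Phi (y j)\<close> ignores
  the other two components, and the remaining summands of \<open>e\<close> annihilate the j-th
  one.\<close>

lemma y_row:
  assumes q: "q \<in> D" and j: "j < 3"
  shows "null_row (mm d (Phi (y j)) (emb_row q) - mm d (Phi e) (emb_row (slot j q)))"
proof -
  have yC: "y i \<in> C" if "i < 3" for i using that mem unfolding less3 by auto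
  have s: "null_row (mm d (Phi (y i)) (emb_row (slot j q)))" if "i < 3" "i \<noteq> j" for i
    by (rule null_kernel[OF yC[OF that(1)] Q_y])
      (use that slot_D[OF q] in \<open>auto simp: slot_def fun_pointwise fun_eq_iff\<close>)
  have t: "null_row (mm d (Phi (y j)) (emb_row (q - slot j q)))"
    by (rule null_kernel[OF yC[OF j] Q_y])
      (use j slot_D[OF q] q in \<open>auto simp: slot_def fun_pointwise fun_eq_iff fin_supp_def\<close>)
  have r: "null_row (mm d (Phi r2) (emb_row (slot j q)))"
    by (rule null_kernel[OF mem(4)]) (simp add: Q_rest slot_D q)
  from j have "j = 0 \<or> j = 1 \<or> j = 2" by auto
  then show ?thesis
  proof (elim disjE)
    assume j: "j = 0"
    have "mm d (Phi (y j)) (emb_row q) - mm d (Phi e) (emb_row (slot j q))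
     = mm d (Phi (y j)) (emb_row (q - slot j q)) - mm d (Phi (y 1)) (emb_row (slot j q))
       - mm d (Phi (y 2)) (emb_row (slot j q)) - mm d (Phi r2) (emb_row (slot j q))"
      by (simp add: Phi_e(2) j mm_add_left emb_row_diff mm_diff_right algebra_simps)
    then show ?thesis using t r s[of 1] s[of 2] j by (simp add: null_diff)
  next
    assume j: "j = 1"
    have "mm d (Phi (y j)) (emb_row q) - mm d (Phi e) (emb_row (slot j q))
     = mm d (Phi (y j)) (emb_row (q - slot j q)) - mm d (Phi (y 0)) (emb_row (slot j q))
       - mm d (Phi (y 2)) (emb_row (slot j q)) - mm d (Phi r2) (emb_row (slot j q))"
      by (simp add: Phi_e(2) j mm_add_left emb_row_diff mm_diff_right algebra_simps)
    then show ?thesis using t r s[of 0] s[of 2] j by (simp add: null_diff)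
  next
    assume j: "j = 2"
    have "mm d (Phi (y j)) (emb_row q) - mm d (Phi e) (emb_row (slot j q))
     = mm d (Phi (y j)) (emb_row (q - slot j q)) - mm d (Phi (y 0)) (emb_row (slot j q))
       - mm d (Phi (y 1)) (emb_row (slot j q)) - mm d (Phi r2) (emb_row (slot j q))"
      by (simp add: Phi_e(2) j mm_add_left emb_row_diff mm_diff_right algebra_simps)
    then show ?thesis using t r s[of 0] s[of 1] j by (simp add: null_diff)
  qed
qed

text \<open>The candidate for the inverse of \<open>Phi e\<close> modulo null rows: substitute the
  actions of the generators into the expansion \<open>u_eq\<close> of the unit.\<close>

definition tau :: "(nat \<times> nat \<Rightarrow> complex) \<Rightarrow> nat \<times> nat \<Rightarrow> complex" where
  "tau q = (\<lambda>i. complex_of_real c1 * proj q i) + (\<lambda>i. complex_of_real c2 * (q - proj q) i)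
     + ((\<lambda>i. complex_of_real (cy 0) * slot 0 q i) + (\<lambda>i. complex_of_real (cy 1) * slot 1 q i)
     + (\<lambda>i. complex_of_real (cy 2) * slot 2 q i))"

lemma tau_D: "q \<in> D \<Longrightarrow> tau q \<in> D"
  unfolding tau_def by (intro fin_supp_intros proj_D slot_D)

lemma lin_on_tau: "lin_on (slots m) tau"
  unfolding lin_on_def
proof (intro conjI ballI allI)
  fix p q
  have "proj (p + q) = proj p + proj q" by (simp add: proj_def shift_block_add diag_embed_add)
  moreover have "slot j (p + q) = slot j p + slot j q" for j by (auto simp: slot_def fun_pointwise fun_eq_iff)
  ultimately show "tau (p + q) = tau p + tau q"
    by (auto simp: tau_def fun_pointwise fun_eq_iff algebra_simps)
next
  fix z q
  have "proj (\<lambda>i. z * q i) = (\<lambda>i. z * proj q i)" by (simp add: proj_def shift_block_scale diag_embed_scale)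
  moreover have "slot j (\<lambda>i. z * q i) = (\<lambda>i. z * slot j q i)" for j by (auto simp: slot_def fun_pointwise fun_eq_iff)
  ultimately show "tau (\<lambda>i. z * q i) = (\<lambda>i. z * tau q i)"
    by (auto simp: tau_def fun_pointwise fun_eq_iff algebra_simps)
qed

lemma unit_emb_row: "mm d (Phi u) (emb_row q) = emb_row q"
  by (rule unit_mm[OF corner_intros(5)]) (auto simp: emb_row_def)

lemma tau_row:
  assumes q: "q \<in> D"
  shows "null_row (mm d (Phi e) (emb_row (tau q)) - emb_row q)"
proof -
  let ?r = complex_of_real
  have sV: "r *\<^sub>R x \<in> V" if "x \<in> V" for r x using that V by (simp add: subspace_scale)
  have "Phi u = sc (?r c1) (Phi x1) + sc (?r c2) (Phi x2)
     + (sc (?r (cy 0)) (Phi (y 0)) + sc (?r (cy 1)) (Phi (y 1)) + sc (?r (cy 2)) (Phi (y 2))) + Phi ru"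
    by (subst u_eq) (simp add: Phi_add Phi_scale memV sV subspace_add[OF V] del: One_nat_def)
  then have 1: "emb_row q = sc (?r c1) (mm d (Phi x1) (emb_row q)) + sc (?r c2) (mm d (Phi x2) (emb_row q))
     + (sc (?r (cy 0)) (mm d (Phi (y 0)) (emb_row q)) + sc (?r (cy 1)) (mm d (Phi (y 1)) (emb_row q))
     + sc (?r (cy 2)) (mm d (Phi (y 2)) (emb_row q))) + mm d (Phi ru) (emb_row q)"
    using unit_emb_row[of q] by (simp add: mm_add_left mm_sc_left)
  have 2: "mm d (Phi e) (emb_row (tau q)) = sc (?r c1) (mm d (Phi e) (emb_row (proj q)))
     + sc (?r c2) (mm d (Phi e) (emb_row (q - proj q)))
     + (sc (?r (cy 0)) (mm d (Phi e) (emb_row (slot 0 q))) + sc (?r (cy 1)) (mm d (Phi e) (emb_row (slot 1 q)))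
     + sc (?r (cy 2)) (mm d (Phi e) (emb_row (slot 2 q))))"
    unfolding tau_def by (simp only: emb_row_add emb_row_scale mm_add_right mm_sc_right)
  have "emb_row q - mm d (Phi e) (emb_row (tau q)) =
      sc (?r c1) (mm d (Phi x1) (emb_row q) - mm d (Phi e) (emb_row (proj q)))
    + sc (?r c2) (mm d (Phi x2) (emb_row q) - mm d (Phi e) (emb_row (q - proj q)))
    + (sc (?r (cy 0)) (mm d (Phi (y 0)) (emb_row q) - mm d (Phi e) (emb_row (slot 0 q)))
    + sc (?r (cy 1)) (mm d (Phi (y 1)) (emb_row q) - mm d (Phi e) (emb_row (slot 1 q)))
    + sc (?r (cy 2)) (mm d (Phi (y 2)) (emb_row q) - mm d (Phi e) (emb_row (slot 2 q)))) + mm d (Phi ru) (emb_row q)"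
    unfolding 2 sc_diff by (subst 1) (simp only: algebra_simps)
  moreover have "null_row (mm d (Phi ru) (emb_row q))"
    by (rule null_kernel[OF mem(5)]) (simp add: Q_rest q)
  ultimately have "null_row (emb_row q - mm d (Phi e) (emb_row (tau q)))"
    using q by (auto intro!: null_add null_sc x1_row x2_row y_row)
  from null_sc[OF this, of "-1"] show ?thesis by (simp add: sc_minus_1)
qed

end

declare minus_apply [simp del] uminus_apply [simp del]

section \<open>Realising matrix units by elements of size d\<close>

context rigid_embedding
begin

fun mpow :: "nat \<Rightarrow> nat \<Rightarrow> nat \<Rightarrow> 'a" where
  "mpow 0 = Phi u"
| "mpow (Suc k) = mm d (mpow k) (Phi e)"

lemma bounded_Phi: "x \<in> C \<Longrightarrow> bounded_mult (Phi x)"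
  by (simp add: bounded_mult_def null_Phi)

lemma bounded_mm: "bounded_mult a \<Longrightarrow> bounded_mult b \<Longrightarrow> bounded_mult (mm d a b)"
  by (simp add: bounded_mult_def mm_assoc)

lemma bounded_add: "bounded_mult a \<Longrightarrow> bounded_mult b \<Longrightarrow> bounded_mult (a + b)"
  by (simp add: bounded_mult_def mm_add_left null_add)

lemma bounded_sc: "bounded_mult a \<Longrightarrow> bounded_mult (sc z a)"
  by (simp add: bounded_mult_def mm_sc_left null_sc)

lemma bounded_sum: "(\<And>i. i \<in> I \<Longrightarrow> bounded_mult (a i)) \<Longrightarrow> bounded_mult (\<Sum>i\<in>I. a i)"
  by (simp add: bounded_mult_def mm_sum_left null_sum)

lemma boundedD: "bounded_mult a \<Longrightarrow> null_row g \<Longrightarrow> null_row (mm d a g)"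
  by (simp add: bounded_mult_def)

lemma bounded_mpow: "bounded_mult (mpow k)"
  by (induction k) (auto intro: bounded_mm bounded_Phi mem eC)

lemma null_trans: "null_row (g - h) \<Longrightarrow> null_row (h - k) \<Longrightarrow> null_row (g - k)"
  using null_add[of "g - h" "h - k"] by simp

lemma null_sym: "null_row (g - h) \<Longrightarrow> null_row (h - g)"
  using null_sc[of "g - h" "-1"] by (simp add: sc_minus_1)

lemma bounded_cong: "bounded_mult a \<Longrightarrow> null_row (g - h) \<Longrightarrow> null_row (mm d a g - mm d a h)"
  using boundedD[of a "g - h"] by (simp add: mm_diff_right)

lemma unit_Phi: "x \<in> V \<Longrightarrow> mm d (Phi u) (Phi x) = Phi x"
  by (rule unit_mm) (auto intro!: corner_intros simp: Phi_out)

lemma Phi_unit_right: "x \<in> V \<Longrightarrow> mm d (Phi x) (Phi u) = Phi x"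
  using arg_cong[OF unit_Phi, of x adj] by (simp add: adj_mm Phi_adj uV)

lemma mpow_comm: "mm d (Phi e) (mpow k) = mpow (Suc k)"
  by (induction k) (auto simp: Phi_unit_right unit_Phi memV mm_assoc[symmetric])

lemma mpow_unit: "mm d (mpow k) (Phi u) = mpow k"
  by (induction k) (auto simp: Phi_unit_right unit_Phi memV uV mm_assoc)

lemma mpow_add: "mpow (i + j) = mm d (mpow i) (mpow j)"
  by (induction j) (auto simp: mpow_unit mm_assoc)

lemma tau_pow_D: "q \<in> D \<Longrightarrow> (tau ^^ k) q \<in> D"
  by (induction k) (auto intro: tau_D)

lemma mpow_row:
  assumes "q \<in> D"
  shows "null_row (mm d (mpow k) (emb_row ((tau ^^ k) q)) - emb_row q)"
proof (induction k)
  case 0 then show ?case by (simp add: unit_emb_row null_0)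
next
  case (Suc k)
  have "null_row (mm d (mpow k) (mm d (Phi e) (emb_row (tau ((tau ^^ k) q)))) - mm d (mpow k) (emb_row ((tau ^^ k) q)))"
    by (intro bounded_cong bounded_mpow tau_row tau_pow_D assms)
  from null_trans[OF this Suc] show ?case by (simp add: mm_assoc)
qed

text \<open>Since \<open>Phi e\<close> inverts \<open>tau\<close> and the powers of \<open>tau\<close> satisfy a linear relation, a polynomial in
  \<open>Phi e\<close> realises \<open>tau\<close> itself.\<close>

lemma exists_tau:
  obtains T where "bounded_mult T" "mm d T (Phi e) = mm d (Phi e) T"
    "\<And>q. q \<in> D \<Longrightarrow> null_row (mm d T (emb_row q) - emb_row (tau q))"
proof -
  obtain r b where rel: "\<And>q. q \<in> D \<Longrightarrow> (tau ^^ Suc r) q = (\<Sum>k\<le>r. (\<lambda>i. b k * (tau ^^ k) q i))"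
    using power_relation[OF _ lin_on_tau] tau_D by blast
  \<comment> \<open>Apply the r-th power of \<open>Phi e\<close> to the relation for tau^(r+1): the
    left side becomes tau, and tau^k on the right becomes the power r - k of
    \<open>Phi e\<close>.\<close>
  define T where "T = (\<Sum>k\<le>r. sc (b k) (mpow (r - k)))"
  have "bounded_mult T" unfolding T_def by (intro bounded_sum bounded_sc bounded_mpow)
  moreover have "mm d T (Phi e) = mm d (Phi e) T"
    by (simp add: T_def mm_sum_left mm_sum_right mm_sc_left mm_sc_right mpow_comm)
  moreover have "null_row (mm d T (emb_row q) - emb_row (tau q))" if q: "q \<in> D" for q
  proof -
    have er: "emb_row (\<Sum>k\<in>A. (\<lambda>i. b k * (tau ^^ k) q i)) = (\<Sum>k\<in>A. sc (b k) (emb_row ((tau ^^ k) q)))" for A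
      by (induction A rule: infinite_finite_induct) (auto simp: emb_row_add emb_row_scale)
    have 1: "null_row (mm d (mpow r) (emb_row ((tau ^^ Suc r) q)) - emb_row (tau q))"
      using mpow_row[OF tau_D[OF q], of r] by (simp add: funpow_swap1)
    have "mm d (mpow r) (emb_row ((tau ^^ Suc r) q)) - mm d T (emb_row q)
        = (\<Sum>k\<le>r. sc (b k) (mm d (mpow r) (emb_row ((tau ^^ k) q)) - mm d (mpow (r - k)) (emb_row q)))"
      unfolding rel[OF q] er
      by (simp add: T_def mm_sum_left mm_sum_right mm_sc_left mm_sc_right sc_diff sum_subtractf)
    moreover have "null_row (\<Sum>k\<le>r. sc (b k) (mm d (mpow r) (emb_row ((tau ^^ k) q)) - mm d (mpow (r - k)) (emb_row q)))"
    proof (intro null_sum null_sc)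
      fix k assume "k \<in> {..r}"
      then have "mpow r = mm d (mpow (r - k)) (mpow k)" by (simp flip: mpow_add)
      then show "null_row (mm d (mpow r) (emb_row ((tau ^^ k) q)) - mm d (mpow (r - k)) (emb_row q))"
        by (simp add: mm_assoc bounded_cong bounded_mpow mpow_row q)
    qed
    ultimately have "null_row (mm d (mpow r) (emb_row ((tau ^^ Suc r) q)) - mm d T (emb_row q))" by simp
    from null_trans[OF null_sym[OF this] 1] show ?thesis .
  qed
  ultimately show ?thesis by (rule that)
qed

text \<open>Boundedness is part of the notion because realisers get multiplied, and an error term
  that is a null row must remain one under the next factor.\<close>

definition realizes :: "(nat \<Rightarrow> nat \<Rightarrow> 'a) \<Rightarrow> ((nat \<Rightarrow> complex) \<Rightarrow> nat \<Rightarrow> complex) \<Rightarrow> bool" where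
  "realizes a Z \<longleftrightarrow> bounded_mult a \<and>
     (\<forall>v\<in>W. Z v \<in> W \<and> null_row (mm d a (emb_row (diag_embed m v)) - emb_row (diag_embed m (Z v))))"

definition realizable :: "((nat \<Rightarrow> complex) \<Rightarrow> nat \<Rightarrow> complex) \<Rightarrow> bool" where
  "realizable Z \<longleftrightarrow> (\<exists>a. realizes a Z)"

lemma realizable_cong:
  "realizable Z \<Longrightarrow> (\<And>v. v \<in> W \<Longrightarrow> Z' v = Z v) \<Longrightarrow> realizable Z'"
  by (simp add: realizable_def realizes_def)

lemma realizable_add:
  assumes "realizable Y" "realizable Z" shows "realizable (\<lambda>v. Y v + Z v)"
proof -
  from assms obtain a b where ab: "realizes a Y" "realizes b Z" by (auto simp: realizable_def)
  have "realizes (a + b) (\<lambda>v. Y v + Z v)" unfolding realizes_def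
  proof (intro conjI ballI)
    show "bounded_mult (a + b)" using ab by (simp add: bounded_add realizes_def)
    fix v assume v: "v \<in> W"
    show "Y v + Z v \<in> W" using ab v by (simp add: realizes_def fin_supp_intros)
    have "mm d (a + b) (emb_row (diag_embed m v)) - emb_row (diag_embed m (Y v + Z v))
      = (mm d a (emb_row (diag_embed m v)) - emb_row (diag_embed m (Y v)))
      + (mm d b (emb_row (diag_embed m v)) - emb_row (diag_embed m (Z v)))"
      by (simp add: mm_add_left diag_embed_add emb_row_add)
    then show "null_row (mm d (a + b) (emb_row (diag_embed m v)) - emb_row (diag_embed m (Y v + Z v)))"
      using ab v by (simp add: realizes_def null_add)
  qed
  then show ?thesis by (auto simp: realizable_def)
qed

lemma realizable_scale:
  assumes "realizable Z" shows "realizable (\<lambda>v i. z * Z v i)"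
proof -
  from assms obtain a where a: "realizes a Z" by (auto simp: realizable_def)
  have "realizes (sc z a) (\<lambda>v i. z * Z v i)" unfolding realizes_def
  proof (intro conjI ballI)
    show "bounded_mult (sc z a)" using a by (simp add: bounded_sc realizes_def)
    fix v assume v: "v \<in> W"
    show "(\<lambda>i. z * Z v i) \<in> W" using a v by (simp add: realizes_def fin_supp_intros)
    have "mm d (sc z a) (emb_row (diag_embed m v)) - emb_row (diag_embed m (\<lambda>i. z * Z v i))
      = sc z (mm d a (emb_row (diag_embed m v)) - emb_row (diag_embed m (Z v)))"
      by (simp add: mm_sc_left diag_embed_scale emb_row_scale sc_diff)
    then show "null_row (mm d (sc z a) (emb_row (diag_embed m v)) - emb_row (diag_embed m (\<lambda>i. z * Z v i)))"
      using a v by (simp add: realizes_def null_sc)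
  qed
  then show ?thesis by (auto simp: realizable_def)
qed

lemma realizable_comp:
  assumes "realizable Y" "realizable Z" shows "realizable (\<lambda>v. Y (Z v))"
proof -
  from assms obtain a b where ab: "realizes a Y" "realizes b Z" by (auto simp: realizable_def)
  have "realizes (mm d a b) (\<lambda>v. Y (Z v))" unfolding realizes_def
  proof (intro conjI ballI)
    show "bounded_mult (mm d a b)" using ab by (simp add: bounded_mm realizes_def)
    fix v assume v: "v \<in> W"
    then have Z: "Z v \<in> W" using ab by (simp add: realizes_def)
    then show "Y (Z v) \<in> W" using ab by (simp add: realizes_def)
    have "null_row (mm d a (mm d b (emb_row (diag_embed m v))) - mm d a (emb_row (diag_embed m (Z v))))"
      using ab v by (intro bounded_cong) (auto simp: realizes_def)
    from null_trans[OF this, of "emb_row (diag_embed m (Y (Z v)))"]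
    show "null_row (mm d (mm d a b) (emb_row (diag_embed m v)) - emb_row (diag_embed m (Y (Z v))))"
      using ab Z by (simp add: realizes_def mm_assoc)
  qed
  then show ?thesis by (auto simp: realizable_def)
qed

lemma realizable_id: "realizable (\<lambda>v. v)"
proof -
  have "realizes (Phi u) (\<lambda>v. v)"
    by (simp add: realizes_def bounded_Phi mem unit_emb_row null_0)
  then show ?thesis by (auto simp: realizable_def)
qed

text \<open>Since \<open>T\<close> inverts \<open>Phi e\<close>, the products of \<open>T\<close>
  with \<open>Phi x1\<close> and with \<open>Phi (y j)\<close> act as \<open>proj\<close> and as
  \<open>slot j\<close>. On a diagonal triple of v the composition gives the diagonal triple of K_j
  v.\<close>

lemma realizable_K:
  assumes j: "j < 3"
  shows "realizable (\<lambda>v k. if k < m then \<Sum>l<m. complex_of_real (K j k l) * v l else 0)"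
proof -
  obtain T where T: "bounded_mult T" "mm d T (Phi e) = mm d (Phi e) T"
    "\<And>q. q \<in> D \<Longrightarrow> null_row (mm d T (emb_row q) - emb_row (tau q))" using exists_tau by blast
  have be: "bounded_mult (Phi e)" and bx: "bounded_mult (Phi x1)" by (simp_all add: bounded_Phi eC mem)
  have yC: "y i \<in> C" if "i < 3" for i using that mem unfolding less3 by auto
  have inv: "null_row (mm d T (mm d (Phi e) (emb_row q)) - emb_row q)" if "q \<in> D" for q
  proof -
    have "null_row (mm d (Phi e) (mm d T (emb_row q)) - mm d (Phi e) (emb_row (tau q)))"
      by (intro bounded_cong be T that)
    from null_trans[OF this tau_row[OF that]] show ?thesis
      by (simp add: T(2)[symmetric] flip: mm_assoc)
  qed
  have px: "null_row (mm d (mm d T (Phi x1)) (emb_row q) - emb_row (proj q))" if "q \<in> D" for q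
    using null_trans[OF bounded_cong[OF T(1) x1_row[OF that]] inv[OF proj_D]] by (simp add: mm_assoc)
  have py: "null_row (mm d (mm d T (Phi (y j))) (emb_row q) - emb_row (slot j q))" if "q \<in> D" for q
    using null_trans[OF bounded_cong[OF T(1) y_row[OF that j]] inv[OF slot_D[OF that]]] by (simp add: mm_assoc)
  let ?a = "mm d (mm d T (Phi x1)) (mm d T (Phi (y j)))"
  let ?Z = "\<lambda>v k. if k < m then \<Sum>l<m. complex_of_real (K j k l) * v l else 0"
  have "realizes ?a ?Z" unfolding realizes_def
  proof (intro conjI ballI)
    show "bounded_mult ?a" by (intro bounded_mm T bx bounded_Phi yC j)
    fix v assume v: "v \<in> W"
    show "?Z v \<in> W" by (simp add: fin_supp_def)
    have "shift_block m K (slot j (diag_embed m v)) = ?Z v"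
      using shift_block_slot[OF j v] by (auto simp: shift_block_def fun_eq_iff)
    then have p: "proj (slot j (diag_embed m v)) = diag_embed m (?Z v)" by (simp add: proj_def)
    have "null_row (mm d (mm d T (Phi x1)) (mm d (mm d T (Phi (y j))) (emb_row (diag_embed m v)))
       - mm d (mm d T (Phi x1)) (emb_row (slot j (diag_embed m v))))"
      by (intro bounded_cong py diag_embed_D bounded_mm T bx)
    from null_trans[OF this px[OF slot_D[OF diag_embed_D]]]
    show "null_row (mm d ?a (emb_row (diag_embed m v)) - emb_row (diag_embed m (?Z v)))"
      by (simp add: p mm_assoc)
  qed
  then show ?thesis by (auto simp: realizable_def)
qed

lemma realizable_number: "realizable (\<lambda>v k. of_nat k * v k)"
proof -
  have "realizable (\<lambda>v. (\<lambda>k. 3 / complex_of_real dl * (if k < m then \<Sum>l<m. complex_of_real (K 0 k l) * v l else 0))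
      + (\<lambda>k. - 1 / complex_of_real dl * v k))"
    by (intro realizable_add realizable_scale realizable_K realizable_id) simp
  then show ?thesis
  proof (rule realizable_cong)
    fix v assume v: "v \<in> W"
    have "(\<Sum>l<m. complex_of_real (K 0 k l) * v l) = (1 + complex_of_real dl * of_nat k) / 3 * v k" if "k < m" for k
    proof -
      have "(\<Sum>l<m. complex_of_real (K 0 k l) * v l) = (\<Sum>l<m. if l = k then (1 + complex_of_real dl * of_nat k) / 3 * v k else 0)"
        by (rule sum.cong) (auto simp: K_0 that)
      then show ?thesis using that by simp
    qed
    then show "(\<lambda>k. of_nat k * v k) = (\<lambda>k. 3 / complex_of_real dl * (if k < m then \<Sum>l<m. complex_of_real (K 0 k l) * v l else 0))
      + (\<lambda>k. - 1 / complex_of_real dl * v k)"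
      using dl v by (auto simp: fun_eq_iff fun_pointwise fin_supp_def field_simps)
  qed
qed

lemma realizable_neighbours:
  "realizable (\<lambda>v k. if k < m then (if k = 0 then 0 else v (k - 1)) + v (Suc k) else 0)"
proof -
  have "realizable (\<lambda>v. (\<lambda>k. 3 / complex_of_real dl * (if k < m then \<Sum>l<m. complex_of_real (K 1 k l) * v l else 0))
      + (\<lambda>k. - 1 / complex_of_real dl * v k))"
    by (intro realizable_add realizable_scale realizable_K realizable_id) simp
  then show ?thesis
  proof (rule realizable_cong)
    fix v assume v: "v \<in> W"
    have row: "(\<Sum>l<m. complex_of_real (K 1 k l) * v l) =
       (v k + complex_of_real dl * ((if k = 0 then 0 else v (k - 1)) + v (Suc k))) / 3" if "k < m" for k
    proof -
      have "(\<Sum>l<m. complex_of_real (K 1 k l) * v l) = (\<Sum>l<m. (if l = k then v k / 3 else 0)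
          + ((if l = k - 1 then if k = 0 then 0 else complex_of_real dl * v (k - 1) / 3 else 0)
          + (if l = Suc k then complex_of_real dl * v (Suc k) / 3 else 0)))"
        by (rule sum.cong) (use that in \<open>auto simp: K_1[unfolded One_nat_def]\<close>)
      also have "\<dots> = v k / 3 + ((if k = 0 then 0 else complex_of_real dl * v (k - 1) / 3)
          + (if Suc k < m then complex_of_real dl * v (Suc k) / 3 else 0))"
        using that by (simp add: sum.distrib)
      also have "(if Suc k < m then complex_of_real dl * v (Suc k) / 3 else 0) = complex_of_real dl * v (Suc k) / 3"
        using v by (auto simp: fin_supp_def)
      finally show ?thesis by (cases "k = 0") (simp_all add: add_divide_distrib distrib_left)
    qed
    show "(\<lambda>k. if k < m then (if k = 0 then 0 else v (k - 1)) + v (Suc k) else 0)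
      = (\<lambda>k. 3 / complex_of_real dl * (if k < m then \<Sum>l<m. complex_of_real (K 1 k l) * v l else 0))
      + (\<lambda>k. - 1 / complex_of_real dl * v k)"
    proof (intro ext)
      fix k
      have "3 / c * ((x + c * y) / 3) + - 1 / c * x = y" if "c \<noteq> 0" for c x y :: complex
      proof -
        have "3 / c * (z / 3) = z / c" for z by simp
        from this[of "x + c * y"] have "3 / c * ((x + c * y) / 3) + - 1 / c * x = (x + c * y) / c - x / c"
          by (simp only: mult_minus_left minus_divide_left[symmetric]) simp
        then show ?thesis using that by (simp add: add_divide_distrib)
      qed
      note eq = this[of "complex_of_real dl" "v k" "(if k = 0 then 0 else v (k - 1)) + v (Suc k)"]
      show "(if k < m then (if k = 0 then 0 else v (k - 1)) + v (Suc k) else 0)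
        = ((\<lambda>k. 3 / complex_of_real dl * (if k < m then \<Sum>l<m. complex_of_real (K 1 k l) * v l else 0))
        + (\<lambda>k. - 1 / complex_of_real dl * v k)) k"
      proof (cases "k < m")
        case True
        have "complex_of_real dl \<noteq> 0" using dl by simp
        then show ?thesis unfolding fun_pointwise if_P[OF True] row[OF True] by (rule eq[symmetric])
      qed (use v in \<open>auto simp: fun_pointwise fin_supp_def\<close>)
    qed
  qed
qed

text \<open>With N the multiplication by the index and J the sum over neighbours, the commutator
  [N, J] changes the sign of one of the two one-sided shifts in J, so (J - [N, J]) / 2 isolates v ->
  v (k + 1).\<close>

lemma realizable_shift: "realizable (\<lambda>v k. v (Suc k))"
proof -
  let ?N = "\<lambda>v k. of_nat k * v k" and ?J = "\<lambda>v k. if k < m then (if k = 0 then 0 else v (k - 1)) + v (Suc k) else (0::complex)"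
  have "realizable (\<lambda>v. (\<lambda>k. 1/2 * ?J v k) + ((\<lambda>k. - 1/2 * ?N (?J v) k) + (\<lambda>k. 1/2 * ?J (?N v) k)))"
    by (intro realizable_add realizable_scale realizable_neighbours realizable_comp[OF realizable_number]
      realizable_comp[OF _ realizable_number])
  then show ?thesis
    by (rule realizable_cong) (auto simp: fun_eq_iff fun_pointwise fin_supp_def field_simps of_nat_diff)
qed

lemma realizable_diag:
  assumes "finite S" shows "realizable (\<lambda>v k. (\<Prod>j\<in>S. of_nat k - complex_of_nat j) * v k)"
  using assms
proof (induction S rule: finite_induct)
  case empty then show ?case using realizable_id by simp
next
  case (insert i S)
  have "realizable (\<lambda>v. (\<lambda>k. of_nat k * v k) + (\<lambda>k. - complex_of_nat i * v k))"
    by (intro realizable_add realizable_number realizable_scale realizable_id)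
  from realizable_comp[OF insert.IH this] show ?case
    by (rule realizable_cong) (use insert in \<open>auto simp: fun_eq_iff fun_pointwise algebra_simps\<close>)
qed

text \<open>A Lagrange interpolation polynomial in the index operator is the indicator of row
  \<open>t\<close>; multiplied by the shift it leaves a single matrix unit next to the
  diagonal.\<close>

lemma realizable_unit:
  assumes "t < m"
  shows "realizable (\<lambda>v k. if k = t then v (Suc t) else 0)"
proof -
  let ?S = "{..<m} - {t}"
  let ?c = "\<Prod>j\<in>?S. of_nat t - complex_of_nat j"
  have "?c \<noteq> 0" by simp
  have "realizable (\<lambda>v k. 1 / ?c * ((\<Prod>j\<in>?S. of_nat k - complex_of_nat j) * v (Suc k)))"
    by (intro realizable_scale realizable_comp[OF realizable_diag realizable_shift]) simp
  then show ?thesis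
  proof (rule realizable_cong)
    fix v assume v: "v \<in> W"
    show "(\<lambda>k. if k = t then v (Suc t) else 0) = (\<lambda>k. 1 / ?c * ((\<Prod>j\<in>?S. of_nat k - complex_of_nat j) * v (Suc k)))"
    proof
      fix k
      show "(if k = t then v (Suc t) else 0) = 1 / ?c * ((\<Prod>j\<in>?S. of_nat k - complex_of_nat j) * v (Suc k))"
      proof (cases "k = t \<or> m \<le> k")
        case True then show ?thesis using \<open>?c \<noteq> 0\<close> v assms by (auto simp: fin_supp_def)
      next
        case False
        then have "(\<Prod>j\<in>?S. of_nat k - complex_of_nat j) = 0"
          by (intro prod_zero) (auto intro!: bexI[of _ k])
        then show ?thesis using False by simp
      qed
    qed
  qed
qed

text \<open>The matrix units E_(t,t+1), t < n, can be multiplied to reach e_0 from e_n in one order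
  only. Their alternating sum therefore sends e_n to e_0, whereas the standard identity for the
  realisers makes the same sum 0. So e_0 becomes a null row, against \<open>Q_u\<close>.\<close>

lemma contradiction: False
proof -
  define n where "n = d * d + 2"
  have mn: "m = Suc n" by (simp add: m n_def)
  let ?E = "\<lambda>t v k. if k = t then v (Suc t) else (0::complex)"
  let ?e = "\<lambda>i k. of_bool (k = i) :: complex"
  let ?h = "\<lambda>v. emb_row (diag_embed m v)"
  have "\<forall>t\<in>{..<n}. \<exists>a. realizes a (?E t)"
    using realizable_unit mn unfolding realizable_def by (metis lessThan_iff less_SucI)
  then obtain a where a: "\<And>t. t < n \<Longrightarrow> realizes (a t) (?E t)" by (metis lessThan_iff)
  have eW: "i < m \<Longrightarrow> ?e i \<in> W" for i by (auto simp: fin_supp_def)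
  \<comment> \<open>Induction from the right end of the product: a permuted product keeps the vector
    alive only while sigma fixes every position applied so far.\<close>
  have act: "null_row (act d (map (\<lambda>t. a (\<sigma> t)) [i..<n]) (?h (?e n)) -
      (if \<forall>t\<in>{i..<n}. \<sigma> t = t then ?h (?e i) else 0))"
    if \<sigma>: "\<sigma> permutes {..<n}" and "i \<le> n" for \<sigma> i
    using \<open>i \<le> n\<close>
  proof (induction rule: inc_induct)
    case base then show ?case by (simp add: null_0)
  next
    case (step i)
    have si: "\<sigma> i < n" using permutes_in_image[OF \<sigma>, of i] step by simp
    have ai: "realizes (a (\<sigma> i)) (?E (\<sigma> i))" using a si by simp
    have eq: "(if \<forall>t\<in>{Suc i..<n}. \<sigma> t = t then ?h (?e (Suc i)) else 0)
        = ?h (if \<forall>t\<in>{Suc i..<n}. \<sigma> t = t then ?e (Suc i) else 0)"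
      by (simp add: diag_embed_0)
    let ?v = "if \<forall>t\<in>{Suc i..<n}. \<sigma> t = t then ?e (Suc i) else 0"
    have vW: "?v \<in> W" using eW[of "Suc i"] step by (auto simp: mn fin_supp_def fun_pointwise)
    have Ev: "?E (\<sigma> i) ?v = (if \<forall>t\<in>{i..<n}. \<sigma> t = t then ?e i else 0)"
    proof -
      have "{i..<n} = insert i {Suc i..<n}" using step by auto
      then show ?thesis by (auto simp: fun_eq_iff fun_pointwise)
    qed
    have 1: "null_row (mm d (a (\<sigma> i)) (act d (map (\<lambda>t. a (\<sigma> t)) [Suc i..<n]) (?h (?e n))) - mm d (a (\<sigma> i)) (?h ?v))"
      using step.IH ai unfolding eq by (intro bounded_cong) (auto simp: realizes_def)
    have 2: "null_row (mm d (a (\<sigma> i)) (?h ?v) - ?h (?E (\<sigma> i) ?v))"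
      using ai vW unfolding realizes_def by blast
    have "[i..<n] = i # [Suc i..<n]" using step by (simp add: upt_conv_Cons)
    moreover have "?h (?E (\<sigma> i) ?v) = (if \<forall>t\<in>{i..<n}. \<sigma> t = t then ?h (?e i) else 0)"
      unfolding Ev by (simp add: diag_embed_0)
    ultimately show ?case using null_trans[OF 1 2] by simp
  qed
  let ?P = "{\<sigma>. \<sigma> permutes {..<n}}"
  have fin: "finite ?P" by (rule finite_permutations) simp
  have "null_row (\<Sum>\<sigma>\<in>?P. sc (of_int (sign \<sigma>)) (act d (map (\<lambda>t. a (\<sigma> t)) [0..<n]) (?h (?e n)) -
      (if \<forall>t\<in>{0..<n}. \<sigma> t = t then ?h (?e 0) else 0)))"
    by (intro null_sum null_sc act) auto
  then have "null_row (0 - (\<Sum>\<sigma>\<in>?P. sc (of_int (sign \<sigma>)) (if \<forall>t\<in>{0..<n}. \<sigma> t = t then ?h (?e 0) else 0)))"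
    using standard_identity[of d n a "?h (?e n)"] by (simp add: sc_diff sum_subtractf n_def)
  moreover have "(\<Sum>\<sigma>\<in>?P. sc (of_int (sign \<sigma>)) (if \<forall>t\<in>{0..<n}. \<sigma> t = t then ?h (?e 0) else 0))
     = (\<Sum>\<sigma>\<in>?P. if \<sigma> = id then ?h (?e 0) else 0)"
  proof (rule sum.cong[OF refl])
    fix \<sigma> assume "\<sigma> \<in> ?P"
    then have "\<sigma> t = t" if "\<not> t < n" for t using that by (simp add: permutes_def)
    then have "(\<forall>t\<in>{0..<n}. \<sigma> t = t) \<longleftrightarrow> \<sigma> = id" by (auto simp: fun_eq_iff)
    then show "sc (of_int (sign \<sigma>)) (if \<forall>t\<in>{0..<n}. \<sigma> t = t then ?h (?e 0) else 0)
       = (if \<sigma> = id then ?h (?e 0) else 0)" by (simp add: sign_id)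
  qed
  moreover have "\<dots> = ?h (?e 0)" using fin by (simp add: permutes_id)
  ultimately have "null_row (0 - ?h (?e 0))" by simp
  from null_sym[OF this] have "null_row (?h (?e 0))" by simp
  from null_emb_row[OF this] Q_u show False by simp
qed

end

section \<open>Positive semidefinite matrices and elimination\<close>

definition herm_form :: "'i set \<Rightarrow> ('i \<Rightarrow> 'i \<Rightarrow> complex) \<Rightarrow> ('i \<Rightarrow> complex) \<Rightarrow> complex" where
  "herm_form I H x = (\<Sum>i\<in>I. \<Sum>j\<in>I. cnj (x i) * H i j * x j)"

definition hpsd :: "'i set \<Rightarrow> ('i \<Rightarrow> 'i \<Rightarrow> complex) \<Rightarrow> bool" where
  "hpsd I H \<longleftrightarrow> (\<forall>i\<in>I. \<forall>j\<in>I. H j i = cnj (H i j)) \<and> (\<forall>x. 0 \<le> Re (herm_form I H x))"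

lemma psd_iff_hpsd:
  "psd s A \<longleftrightarrow> hpsd {..<s} A \<and> (\<forall>i j. s \<le> i \<or> s \<le> j \<longrightarrow> A i j = 0)"
proof
  assume "psd s A"
  then show "hpsd {..<s} A \<and> (\<forall>i j. s \<le> i \<or> s \<le> j \<longrightarrow> A i j = 0)"
    unfolding psd_def hpsd_def herm_form_def by blast
next
  assume h: "hpsd {..<s} A \<and> (\<forall>i j. s \<le> i \<or> s \<le> j \<longrightarrow> A i j = 0)"
  have "A j i = cnj (A i j)" for i j
  proof (cases "i < s \<and> j < s")
    case True then show ?thesis using h unfolding hpsd_def by blast
  next
    case False
    then have "A j i = 0" "A i j = 0" using h by (meson not_less)+
    then show ?thesis by simp
  qed
  then show "psd s A" using h unfolding psd_def hpsd_def herm_form_def by blast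
qed

lemma herm_form_cong:
  "(\<And>i. i \<in> I \<Longrightarrow> x i = y i) \<Longrightarrow> (\<And>i j. i \<in> I \<Longrightarrow> j \<in> I \<Longrightarrow> H i j = G i j) \<Longrightarrow>
     herm_form I H x = herm_form I G y"
  unfolding herm_form_def by (auto intro!: sum.cong)

lemma hpsd_cong:
  assumes "\<And>i j. i \<in> I \<Longrightarrow> j \<in> I \<Longrightarrow> H i j = G i j"
  shows "hpsd I H \<longleftrightarrow> hpsd I G"
  using assms herm_form_cong[of I _ _ H G] by (simp add: hpsd_def)

lemma herm_form_add: "herm_form I (\<lambda>i j. H i j + G i j) x = herm_form I H x + herm_form I G x"
  and herm_form_diff: "herm_form I (\<lambda>i j. H i j - G i j) x = herm_form I H x - herm_form I G x"
  and herm_form_scale: "herm_form I (\<lambda>i j. c * H i j) x = c * herm_form I H x"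
  unfolding herm_form_def by (simp_all add: algebra_simps sum.distrib sum_subtractf sum_distrib_left)

lemma herm_form_rank1:
  "herm_form I (\<lambda>i j. cnj (y i) * y j) x = complex_of_real ((cmod (\<Sum>j\<in>I. y j * x j))\<^sup>2)"
proof -
  have "herm_form I (\<lambda>i j. cnj (y i) * y j) x = (\<Sum>i\<in>I. \<Sum>j\<in>I. cnj (y i * x i) * (y j * x j))"
    unfolding herm_form_def by (simp add: mult_ac)
  also have "\<dots> = cnj (\<Sum>j\<in>I. y j * x j) * (\<Sum>j\<in>I. y j * x j)"
    by (simp add: sum_product)
  also have "\<dots> = complex_of_real ((cmod (\<Sum>j\<in>I. y j * x j))\<^sup>2)"
    using complex_norm_square[of "\<Sum>j\<in>I. y j * x j"] by (simp add: mult.commute)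
  finally show ?thesis .
qed

lemma hpsdI:
  "(\<And>i j. i \<in> I \<Longrightarrow> j \<in> I \<Longrightarrow> H j i = cnj (H i j)) \<Longrightarrow> (\<And>x. 0 \<le> Re (herm_form I H x)) \<Longrightarrow> hpsd I H"
  and hpsd_herm: "hpsd I H \<Longrightarrow> i \<in> I \<Longrightarrow> j \<in> I \<Longrightarrow> H j i = cnj (H i j)"
  and hpsd_pos: "hpsd I H \<Longrightarrow> 0 \<le> Re (herm_form I H x)"
  unfolding hpsd_def by blast+

lemma hpsd_rank1: "hpsd I (\<lambda>i j. cnj (y i) * y j)"
  unfolding hpsd_def herm_form_rank1 by simp

lemma hpsd_add: "hpsd I H \<Longrightarrow> hpsd I G \<Longrightarrow> hpsd I (\<lambda>i j. H i j + G i j)"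
proof (rule hpsdI)
  assume h: "hpsd I H" "hpsd I G"
  show "0 \<le> Re (herm_form I (\<lambda>i j. H i j + G i j) x)" for x
    using h by (simp add: herm_form_add hpsd_pos)
  fix i j assume "i \<in> I" "j \<in> I"
  then show "H j i + G j i = cnj (H i j + G i j)"
    using hpsd_herm[OF h(1)] hpsd_herm[OF h(2)] by (metis complex_cnj_add)
qed

lemma hpsd_scale: "hpsd I H \<Longrightarrow> 0 \<le> r \<Longrightarrow> hpsd I (\<lambda>i j. complex_of_real r * H i j)"
proof (rule hpsdI)
  assume h: "hpsd I H" and r: "0 \<le> r"
  show "0 \<le> Re (herm_form I (\<lambda>i j. complex_of_real r * H i j) x)" for x
    using h r by (simp add: herm_form_scale hpsd_pos)
  fix i j assume "i \<in> I" "j \<in> I"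
  then show "complex_of_real r * H j i = cnj (complex_of_real r * H i j)"
    using hpsd_herm[OF h] by (metis complex_cnj_complex_of_real complex_cnj_mult)
qed

lemma hpsd_0: "hpsd I (\<lambda>i j. 0)"
  unfolding hpsd_def herm_form_def by simp

lemma hpsd_sum: "(\<And>t. t \<in> T \<Longrightarrow> hpsd I (H t)) \<Longrightarrow> hpsd I (\<lambda>i j. \<Sum>t\<in>T. H t i j)"
  by (induction T rule: infinite_finite_induct) (auto intro: hpsd_0 hpsd_add)

lemma hpsd_subset:
  assumes "hpsd I H" "J \<subseteq> I" "finite I" shows "hpsd J H"
proof -
  have "herm_form J H x = herm_form I H (\<lambda>i. if i \<in> J then x i else 0)" for x
  proof -
    have "herm_form I H (\<lambda>i. if i \<in> J then x i else 0) = (\<Sum>i\<in>I. if i \<in> J then \<Sum>j\<in>J. cnj (x i) * H i j * x j else 0)"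
      unfolding herm_form_def
    proof (rule sum.cong[OF refl])
      fix i assume "i \<in> I"
      have "(\<Sum>j\<in>I. cnj (x i) * H i j * (if j \<in> J then x j else 0)) = (\<Sum>j\<in>J. cnj (x i) * H i j * x j)"
        by (rule sum.mono_neutral_cong_right) (use assms in auto)
      then show "(\<Sum>j\<in>I. cnj (if i \<in> J then x i else 0) * H i j * (if j \<in> J then x j else 0)) =
         (if i \<in> J then \<Sum>j\<in>J. cnj (x i) * H i j * x j else 0)" by auto
    qed
    also have "\<dots> = herm_form J H x"
      unfolding herm_form_def by (rule sum.mono_neutral_cong_right) (use assms in auto)
    finally show ?thesis by simp
  qed
  then have "0 \<le> Re (herm_form J H x)" for x using hpsd_pos[OF assms(1)] by simp
  then show ?thesis using assms(1,2) unfolding hpsd_def by (meson subsetD)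
qed

text \<open>Used for completing the square: the form as a quadratic polynomial in the perturbation
  \<open>t\<close> of one coordinate.\<close>

lemma herm_form_shift:
  assumes "finite I" "a \<in> I" "\<forall>i\<in>I. \<forall>j\<in>I. H j i = cnj (H i j)"
  shows "Re (herm_form I H (\<lambda>i. x i + (if i = a then t else 0)))
    = Re (herm_form I H x) + 2 * Re (cnj t * (\<Sum>j\<in>I. H a j * x j)) + (cmod t)\<^sup>2 * Re (H a a)"
proof -
  let ?d = "\<lambda>i. if i = a then t else 0"
  have 1: "herm_form I H (\<lambda>i. x i + ?d i) = herm_form I H x
     + (\<Sum>i\<in>I. \<Sum>j\<in>I. cnj (?d i) * H i j * x j) + (\<Sum>i\<in>I. \<Sum>j\<in>I. cnj (x i) * H i j * ?d j)
     + (\<Sum>i\<in>I. \<Sum>j\<in>I. cnj (?d i) * H i j * ?d j)"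
    unfolding herm_form_def by (simp only: complex_cnj_add distrib_left distrib_right sum.distrib) (simp add: add_ac)
  have 2: "(\<Sum>i\<in>I. \<Sum>j\<in>I. cnj (?d i) * H i j * x j) = cnj t * (\<Sum>j\<in>I. H a j * x j)"
  proof -
    have "(\<Sum>i\<in>I. \<Sum>j\<in>I. cnj (?d i) * H i j * x j) = (\<Sum>i\<in>I. if i = a then \<Sum>j\<in>I. cnj t * H a j * x j else 0)"
      by (rule sum.cong) auto
    then show ?thesis using assms(1,2) by (simp add: sum_distrib_left mult.assoc)
  qed
  have 3: "(\<Sum>i\<in>I. \<Sum>j\<in>I. cnj (x i) * H i j * ?d j) = cnj (cnj t * (\<Sum>j\<in>I. H a j * x j))"
  proof -
    have "(\<Sum>j\<in>I. cnj (x i) * H i j * ?d j) = cnj (x i) * H i a * t" for i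
      using assms(1,2) by (simp add: if_distrib cong: if_cong)
    moreover have "cnj (x i) * H i a * t = cnj (cnj t * (H a i * x i))" if "i \<in> I" for i
    proof -
      have "H i a = cnj (H a i)" using assms that by blast
      then show ?thesis by simp
    qed
    ultimately have "(\<Sum>i\<in>I. \<Sum>j\<in>I. cnj (x i) * H i j * ?d j) = (\<Sum>i\<in>I. cnj (cnj t * (H a i * x i)))"
      by (intro sum.cong) simp_all
    then show ?thesis by (simp add: sum_distrib_left)
  qed
  have 4: "(\<Sum>i\<in>I. \<Sum>j\<in>I. cnj (?d i) * H i j * ?d j) = cnj t * H a a * t"
  proof -
    have "(\<Sum>j\<in>I. cnj (?d i) * H i j * ?d j) = (if i = a then cnj t * H a a * t else 0)" for i
      using assms(1,2) by (simp add: if_distrib cong: if_cong)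
    then show ?thesis using assms(1,2) by simp
  qed
  have "cnj t * H a a * t = (t * cnj t) * H a a" by (simp only: mult_ac)
  also have "t * cnj t = complex_of_real ((cmod t)\<^sup>2)" by (rule complex_norm_square[symmetric])
  finally have 5: "Re (cnj t * H a a * t) = (cmod t)\<^sup>2 * Re (H a a)" by (simp only: Re_complex_of_real times_complex.sel Im_complex_of_real)
  have "Re (c + z + cnj z + w) = Re c + 2 * Re z + Re w" for c z w :: complex by simp
  then show ?thesis unfolding 1 2 3 4 5[symmetric] by blast
qed

lemma hpsd_diag: assumes "hpsd I H" "finite I" "a \<in> I"
  shows "0 \<le> Re (H a a)" "H a a = complex_of_real (Re (H a a))"
proof -
  have "hpsd {a} H" using assms hpsd_subset by blast
  then have "0 \<le> Re (herm_form {a} H (\<lambda>_. 1))" unfolding hpsd_def by blast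
  then show "0 \<le> Re (H a a)" by (simp add: herm_form_def)
  have "H a a = cnj (H a a)" using assms unfolding hpsd_def by blast
  then show "H a a = complex_of_real (Re (H a a))" by (simp add: complex_eq_iff)
qed

lemma hpsd_zero_row:
  assumes "hpsd I H" "finite I" "a \<in> I" "H a a = 0" "j \<in> I" shows "H a j = 0"
proof (rule ccontr)
  assume n: "H a j \<noteq> 0"
  have herm: "\<forall>i\<in>I. \<forall>j\<in>I. H j i = cnj (H i j)" using assms(1) unfolding hpsd_def by blast
  let ?x = "\<lambda>i. if i = j then 1 else (0::complex)"
  have L: "(\<Sum>k\<in>I. H a k * ?x k) = H a j" using assms(2,5) by (simp add: if_distrib cong: if_cong)
  define f where "f = Re (herm_form I H ?x)"
  \<comment> \<open>Chosen so that moving coordinate \<open>a\<close> lowers the form to f - 2 (f +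
    1), which is negative.\<close>
  define r where "r = (f + 1) / (cmod (H a j))\<^sup>2"
  have "0 \<le> Re (herm_form I H (\<lambda>i. ?x i + (if i = a then - complex_of_real r * H a j else 0)))"
    using assms(1) unfolding hpsd_def by blast
  also have "\<dots> = f + 2 * Re (cnj (- complex_of_real r * H a j) * H a j)"
    unfolding herm_form_shift[OF assms(2,3) herm] L f_def by (simp add: assms(4))
  also have "cnj (- complex_of_real r * H a j) * H a j = - complex_of_real (r * (cmod (H a j))\<^sup>2)"
    using complex_norm_square[of "H a j"] by (simp add: mult_ac)
  also have "r * (cmod (H a j))\<^sup>2 = f + 1" using n by (simp add: r_def)
  finally have "f \<le> -2" by simp
  moreover have "0 \<le> f" using assms(1) unfolding hpsd_def f_def by blast
  ultimately show False by simp
qed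

text \<open>One step of the Cholesky decomposition.\<close>

lemma hpsd_eliminate:
  assumes "hpsd I H" "finite I" "a \<in> I"
  obtains y where "hpsd I (\<lambda>i j. H i j - cnj (y i) * y j)"
    "\<And>j. j \<in> I \<Longrightarrow> cnj (y a) * y j = H a j" "\<And>j. j \<in> I \<Longrightarrow> H a j = 0 \<Longrightarrow> y j = 0"
proof (cases "H a a = 0")
  case True
  then show ?thesis using that[of "\<lambda>_. 0"] hpsd_zero_row[OF assms True] assms(1) by simp
next
  case False
  have herm: "\<forall>i\<in>I. \<forall>j\<in>I. H j i = cnj (H i j)" using assms(1) unfolding hpsd_def by blast
  define h where "h = Re (H a a)"
  have Haa: "H a a = complex_of_real h" and h: "h > 0"
    using hpsd_diag[OF assms] False h_def by (auto simp: less_le)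
  define y where "y j = H a j / complex_of_real (sqrt h)" for j
  have ss: "complex_of_real (sqrt h) * complex_of_real (sqrt h) = complex_of_real h"
    using h by (simp flip: of_real_mult)
  have ya: "y a = complex_of_real (sqrt h)" using h ss unfolding y_def Haa
    by (metis nonzero_mult_div_cancel_left of_real_eq_0_iff real_sqrt_eq_zero_cancel_iff less_irrefl)
  show ?thesis
  proof (rule that[of y])
    show "cnj (y a) * y j = H a j" for j using h by (simp add: ya) (simp add: y_def)
    show "H a j = 0 \<Longrightarrow> y j = 0" for j by (simp add: y_def)
    show "hpsd I (\<lambda>i j. H i j - cnj (y i) * y j)"
      unfolding hpsd_def
    proof (intro conjI allI ballI)
      fix i j assume "i \<in> I" "j \<in> I"
      then have "H j i = cnj (H i j)" using herm by blast
      then show "H j i - cnj (y j) * y i = cnj (H i j - cnj (y i) * y j)" by (simp add: mult.commute)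
    next
      fix x
      define L where "L = (\<Sum>j\<in>I. H a j * x j)"
      have yL: "(\<Sum>j\<in>I. y j * x j) = L / complex_of_real (sqrt h)"
        by (simp add: y_def L_def sum_divide_distrib)
      have n: "(cmod (L / complex_of_real (sqrt h)))\<^sup>2 = (cmod L)\<^sup>2 / h"
        using h by (simp add: norm_divide power_divide)
      \<comment> \<open>The minimiser of the form in coordinate \<open>a\<close>; the minimum is the
        form of the Schur complement.\<close>
      define t where "t = - L / complex_of_real h"
      have t1: "cnj t * L = - complex_of_real ((cmod L)\<^sup>2 / h)"
        using complex_norm_square[of L] by (simp add: t_def mult.commute)
      have t2: "(cmod t)\<^sup>2 * h = (cmod L)\<^sup>2 / h"
        using h by (simp add: t_def norm_divide power_divide power2_eq_square)
      have "0 \<le> Re (herm_form I H (\<lambda>i. x i + (if i = a then t else 0)))"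
        using assms(1) unfolding hpsd_def by blast
      also have "\<dots> = Re (herm_form I H x) - (cmod L)\<^sup>2 / h"
        unfolding herm_form_shift[OF assms(2,3) herm] L_def[symmetric] t1 h_def[symmetric] t2 by simp
      also have "\<dots> = Re (herm_form I (\<lambda>i j. H i j - cnj (y i) * y j) x)"
        unfolding herm_form_diff herm_form_rank1 yL n by simp
      finally show "0 \<le> Re (herm_form I (\<lambda>i j. H i j - cnj (y i) * y j) x)" .
    qed
  qed
qed

text \<open>No fill-in: the vectors produced while eliminating \<open>J\<close> stay supported on the neighbourhood
  \<open>N\<close> of \<open>J\<close>.\<close>

lemma hpsd_eliminate_set:
  assumes "hpsd I H" "finite I" "J \<subseteq> I"
    and "\<And>a j. a \<in> J \<Longrightarrow> j \<in> I \<Longrightarrow> j \<notin> N \<Longrightarrow> H a j = 0"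
  shows "\<exists>(n::nat) y. hpsd I (\<lambda>i j. H i j - (\<Sum>t<n. cnj (y t i) * y t j)) \<and>
     (\<forall>a\<in>J. \<forall>j\<in>I. (\<Sum>t<n. cnj (y t a) * y t j) = H a j) \<and>
     (\<forall>t<n. \<forall>j\<in>I. j \<notin> N \<longrightarrow> y t j = 0)"
proof -
  have "finite J" using assms(2,3) finite_subset by blast
  then show ?thesis using assms(3,4)
  proof (induction J rule: finite_induct)
    case empty
    show ?case by (rule exI[of _ 0]) (simp add: assms(1))
  next
    case (insert a J)
    have "J \<subseteq> I" "\<And>b j. b \<in> J \<Longrightarrow> j \<in> I \<Longrightarrow> j \<notin> N \<Longrightarrow> H b j = 0"
      using insert.prems by auto
    then have "\<exists>(n::nat) y. hpsd I (\<lambda>i j. H i j - (\<Sum>t<n. cnj (y t i) * y t j)) \<and>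
         (\<forall>a\<in>J. \<forall>j\<in>I. (\<Sum>t<n. cnj (y t a) * y t j) = H a j) \<and>
         (\<forall>t<n. \<forall>j\<in>I. j \<notin> N \<longrightarrow> y t j = 0)"
      by (rule insert.IH)
    then obtain n :: nat and y where
        ny: "hpsd I (\<lambda>i j. H i j - (\<Sum>t<n. cnj (y t i) * y t j)) \<and>
         (\<forall>a\<in>J. \<forall>j\<in>I. (\<Sum>t<n. cnj (y t a) * y t j) = H a j) \<and>
         (\<forall>t<n. \<forall>j\<in>I. j \<notin> N \<longrightarrow> y t j = 0)" by blast
    then have n: "hpsd I (\<lambda>i j. H i j - (\<Sum>t<n. cnj (y t i) * y t j))"
      "\<And>b j. b \<in> J \<Longrightarrow> j \<in> I \<Longrightarrow> (\<Sum>t<n. cnj (y t b) * y t j) = H b j"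
      "\<And>t j. t < n \<Longrightarrow> j \<in> I \<Longrightarrow> j \<notin> N \<Longrightarrow> y t j = 0" by blast+
    have aI: "a \<in> I" using insert by simp
    obtain z where z: "hpsd I (\<lambda>i j. H i j - (\<Sum>t<n. cnj (y t i) * y t j) - cnj (z i) * z j)"
      "\<And>j. j \<in> I \<Longrightarrow> cnj (z a) * z j = H a j - (\<Sum>t<n. cnj (y t a) * y t j)"
      "\<And>j. j \<in> I \<Longrightarrow> H a j - (\<Sum>t<n. cnj (y t a) * y t j) = 0 \<Longrightarrow> z j = 0"
      by (rule hpsd_eliminate[OF n(1) assms(2) aI]) (rule that; assumption)
    have zJ: "z b = 0" if "b \<in> J" for b
    proof (rule z(3))
      show b: "b \<in> I" using that insert by auto
      have "H b a - (\<Sum>t<n. cnj (y t b) * y t a) = 0" using n(2)[OF that aI] by simp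
      moreover have "H a b - (\<Sum>t<n. cnj (y t a) * y t b) = cnj (H b a - (\<Sum>t<n. cnj (y t b) * y t a))"
        using n(1) aI b unfolding hpsd_def by blast
      ultimately show "H a b - (\<Sum>t<n. cnj (y t a) * y t b) = 0" by simp
    qed
    have zN: "z j = 0" if "j \<in> I" "j \<notin> N" for j
      using insert.prems(2)[of a j] n(3) that by (intro z(3)) auto
    let ?y = "y(n := z)"
    have s: "(\<Sum>t<Suc n. cnj (?y t i) * ?y t j) = (\<Sum>t<n. cnj (y t i) * y t j) + cnj (z i) * z j" for i j
      by simp
    show ?case
    proof (intro exI[of _ "Suc n"] exI[of _ ?y] conjI ballI allI impI)
      show "hpsd I (\<lambda>i j. H i j - (\<Sum>t<Suc n. cnj (?y t i) * ?y t j))"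
        unfolding s using z(1) by (simp add: diff_diff_eq)
      fix b j assume "b \<in> insert a J" "j \<in> I"
      then show "(\<Sum>t<Suc n. cnj (?y t b) * ?y t j) = H b j"
        unfolding s using z(2)[of j] n(2)[of b j] zJ[of b] by auto
    next
      fix t j assume "t < Suc n" "j \<in> I" "j \<notin> N"
      then show "?y t j = 0" using n(3)[of t j] zN by (auto simp: less_Suc_eq)
    qed
  qed
qed

lemma hpsd_gram_ex:
  assumes "hpsd I H" "finite I"
  shows "\<exists>(n::nat) y. \<forall>i\<in>I. \<forall>j\<in>I. H i j = (\<Sum>t<n. cnj (y t i) * y t j)"
proof -
  have "\<exists>(n::nat) y. hpsd I (\<lambda>i j. H i j - (\<Sum>t<n. cnj (y t i) * y t j)) \<and>
     (\<forall>a\<in>I. \<forall>j\<in>I. (\<Sum>t<n. cnj (y t a) * y t j) = H a j) \<and>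
     (\<forall>t<n. \<forall>j\<in>I. j \<notin> UNIV \<longrightarrow> y t j = 0)"
    by (rule hpsd_eliminate_set[OF assms]) auto
  then obtain n :: nat and y where "\<forall>a\<in>I. \<forall>j\<in>I. (\<Sum>t<n. cnj (y t a) * y t j) = H a j" by blast
  then have "\<forall>i\<in>I. \<forall>j\<in>I. H i j = (\<Sum>t<n. cnj (y t i) * y t j)" by simp
  then show ?thesis by blast
qed

section \<open>One commutative ring type containing all the algebras\<close>

text \<open>The product of \<open>\<complex>\<close> and of all commutative C*-algebras with elements in \<open>'u\<close>: a single commutative
  ring type into which each of these algebras embeds as a (non-unital) corner, so that computations
  in an algebra can be done with type classes. The factor \<open>\<complex>\<close> only ensures \<open>0 \<noteq> 1\<close>.\<close>

typedef 'u cfam = "{f :: complex \<times> ('u cstar \<Rightarrow> 'u). \<forall>A. (commutative_cstar_algebra A \<longrightarrow> snd f A \<in> carrier A)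
    \<and> (\<not> commutative_cstar_algebra A \<longrightarrow> snd f A = undefined)}"
proof -
  have "\<exists>x. x \<in> carrier A" if "commutative_cstar_algebra A" for A :: "'u cstar"
  proof -
    interpret commutative_cstar_algebra A by fact
    show ?thesis using zero_closed by blast
  qed
  then show ?thesis
    by (intro exI[of _ "(0, \<lambda>A. if commutative_cstar_algebra A then SOME x. x \<in> carrier A else undefined)"])
      (auto intro: someI_ex)
qed

setup_lifting type_definition_cfam

lemma cstar_cring: "commutative_cstar_algebra A \<Longrightarrow> cring A"
  by (auto simp: commutative_cstar_algebra_def algebra_def)

lemma cstar_smult_closed:
  assumes "commutative_cstar_algebra A" "x \<in> carrier A"
  shows "z \<odot>\<^bsub>A\<^esub> x \<in> carrier A"
proof -
  interpret commutative_cstar_algebra A by fact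
  show ?thesis using smult_closed assms(2) by (simp add: ring_of_type_algebra_def)
qed

lift_definition cfam_fst :: "'u cfam \<Rightarrow> complex" is fst .

lift_definition cfam_proj :: "'u cstar \<Rightarrow> 'u cfam \<Rightarrow> 'u" is "\<lambda>A f. snd f A" .

lemma cfam_eqI:
  assumes "cfam_fst x = cfam_fst y" "\<And>A. commutative_cstar_algebra A \<Longrightarrow> cfam_proj A x = cfam_proj A y"
  shows "x = y"
  using assms by transfer (metis ext prod_eqI)

lemma cfam_proj_closed: "commutative_cstar_algebra A \<Longrightarrow> cfam_proj A x \<in> carrier A"
  by transfer simp

instantiation cfam :: (type) comm_ring_1
begin

lift_definition zero_cfam :: "'a cfam" is
  "(0, \<lambda>A. if commutative_cstar_algebra A then \<zero>\<^bsub>A\<^esub> else undefined)"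
  by (auto dest!: cstar_cring intro: cring.cring_simprules)

lift_definition one_cfam :: "'a cfam" is
  "(1, \<lambda>A. if commutative_cstar_algebra A then \<one>\<^bsub>A\<^esub> else undefined)"
  by (auto dest!: cstar_cring intro: cring.cring_simprules)

lift_definition plus_cfam :: "'a cfam \<Rightarrow> 'a cfam \<Rightarrow> 'a cfam" is
  "\<lambda>f g. (fst f + fst g, \<lambda>A. if commutative_cstar_algebra A then snd f A \<oplus>\<^bsub>A\<^esub> snd g A else undefined)"
  by (simp add: cring.cring_simprules(1) cstar_cring)

lift_definition times_cfam :: "'a cfam \<Rightarrow> 'a cfam \<Rightarrow> 'a cfam" is
  "\<lambda>f g. (fst f * fst g, \<lambda>A. if commutative_cstar_algebra A then snd f A \<otimes>\<^bsub>A\<^esub> snd g A else undefined)"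
  by (simp add: cring.cring_simprules(5) cstar_cring)

lift_definition uminus_cfam :: "'a cfam \<Rightarrow> 'a cfam" is
  "\<lambda>f. (- fst f, \<lambda>A. if commutative_cstar_algebra A then \<ominus>\<^bsub>A\<^esub> snd f A else undefined)"
  by (simp add: cring.cring_simprules(3) cstar_cring)

definition minus_cfam :: "'a cfam \<Rightarrow> 'a cfam \<Rightarrow> 'a cfam" where
  "minus_cfam f g = f + - g"

lemma cfam_fst_simps:
  "cfam_fst (0 :: 'a cfam) = 0" "cfam_fst (1 :: 'a cfam) = 1" "cfam_fst (x + y) = cfam_fst x + cfam_fst y"
  "cfam_fst (x * y) = cfam_fst x * cfam_fst y" "cfam_fst (- x) = - cfam_fst x" for x y :: "'a cfam"
  by (transfer, simp)+

lemma cfam_proj_simps: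
  assumes "commutative_cstar_algebra A"
  shows "cfam_proj A 0 = \<zero>\<^bsub>A\<^esub>" "cfam_proj A 1 = \<one>\<^bsub>A\<^esub>"
    "cfam_proj A (x + y) = cfam_proj A x \<oplus>\<^bsub>A\<^esub> cfam_proj A y"
    "cfam_proj A (x * y) = cfam_proj A x \<otimes>\<^bsub>A\<^esub> cfam_proj A y"
    "cfam_proj A (- x) = \<ominus>\<^bsub>A\<^esub> cfam_proj A x"
  using assms by (transfer, simp)+

instance
proof
  fix a b c :: "'a cfam"
  show "(0 :: 'a cfam) \<noteq> 1" using cfam_fst_simps(1,2) by (metis zero_neq_one)
  show "a - b = a + - b" by (simp add: minus_cfam_def)
  show "a * b * c = a * (b * c)" "a * b = b * a" "1 * a = a" "a + b + c = a + (b + c)" "a + b = b + a"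
    "0 + a = a" "- a + a = 0" "(a + b) * c = a * c + b * c"
    by (rule cfam_eqI; simp add: cfam_fst_simps cfam_proj_simps algebra_simps cstar_cring cfam_proj_closed
        cring.cring_simprules)+
qed

end

lift_definition cfam_star :: "'u cfam \<Rightarrow> 'u cfam" is
  "\<lambda>f. (cnj (fst f), \<lambda>A. if commutative_cstar_algebra A then star A (snd f A) else undefined)"
  by (simp add: commutative_cstar_algebra.star_closed)

lift_definition cfam_cpx :: "complex \<Rightarrow> 'u cfam" is
  "\<lambda>z. (z, \<lambda>A. if commutative_cstar_algebra A then z \<odot>\<^bsub>A\<^esub> \<one>\<^bsub>A\<^esub> else undefined)"
  by (simp add: cstar_smult_closed cstar_cring cring.cring_simprules(6))

text \<open>Total by sending elements outside the carrier to 0. The unit of \<open>A\<close> becomes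
  an idempotent different from 1, which is why \<open>positive_embedding\<close> carries the corner
  \<open>eps\<close>.\<close>

lift_definition cfam_lift :: "'u cstar \<Rightarrow> 'u \<Rightarrow> 'u cfam" is
  "\<lambda>A x. (0, \<lambda>B. if commutative_cstar_algebra B then (if B = A \<and> x \<in> carrier A then x else \<zero>\<^bsub>B\<^esub>) else undefined)"
  by (auto dest!: cstar_cring intro: cring.cring_simprules)

context commutative_cstar_algebra
begin

lemma this_cstar: "commutative_cstar_algebra A" by unfold_locales

lemma smult_rules:
  "x \<in> carrier A \<Longrightarrow> z \<odot>\<^bsub>A\<^esub> x \<in> carrier A"
  "x \<in> carrier A \<Longrightarrow> (z + w) \<odot>\<^bsub>A\<^esub> x = z \<odot>\<^bsub>A\<^esub> x \<oplus>\<^bsub>A\<^esub> w \<odot>\<^bsub>A\<^esub> x"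
  "x \<in> carrier A \<Longrightarrow> y \<in> carrier A \<Longrightarrow> z \<odot>\<^bsub>A\<^esub> (x \<oplus>\<^bsub>A\<^esub> y) = z \<odot>\<^bsub>A\<^esub> x \<oplus>\<^bsub>A\<^esub> z \<odot>\<^bsub>A\<^esub> y"
  "x \<in> carrier A \<Longrightarrow> (z * w) \<odot>\<^bsub>A\<^esub> x = z \<odot>\<^bsub>A\<^esub> (w \<odot>\<^bsub>A\<^esub> x)"
  "x \<in> carrier A \<Longrightarrow> 1 \<odot>\<^bsub>A\<^esub> x = x"
  "x \<in> carrier A \<Longrightarrow> y \<in> carrier A \<Longrightarrow> (z \<odot>\<^bsub>A\<^esub> x) \<otimes>\<^bsub>A\<^esub> y = z \<odot>\<^bsub>A\<^esub> (x \<otimes>\<^bsub>A\<^esub> y)"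
  using smult_closed smult_l_distr smult_r_distr smult_assoc1 smult_one smult_assoc2
  by (simp_all add: ring_of_type_algebra_def)

lemma star_one: "star A \<one>\<^bsub>A\<^esub> = \<one>\<^bsub>A\<^esub>"
proof -
  have "star A \<one>\<^bsub>A\<^esub> = star A \<one>\<^bsub>A\<^esub> \<otimes>\<^bsub>A\<^esub> star A (star A \<one>\<^bsub>A\<^esub>)"
    by (simp add: star_star star_closed)
  also have "\<dots> = star A (star A \<one>\<^bsub>A\<^esub> \<otimes>\<^bsub>A\<^esub> \<one>\<^bsub>A\<^esub>)"
    by (subst star_mult) (simp_all add: star_closed)
  also have "\<dots> = \<one>\<^bsub>A\<^esub>" by (simp add: star_star star_closed)
  finally show ?thesis .
qed

end

lemma cfam_star_simps: "cfam_fst (cfam_star x) = cnj (cfam_fst x)" "cfam_fst (cfam_cpx z) = z"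
  "cfam_fst (cfam_lift A w) = 0"
  by (transfer, simp)+

lemma cfam_proj_star_simps:
  assumes "commutative_cstar_algebra A"
  shows "cfam_proj A (cfam_star x) = star A (cfam_proj A x)" "cfam_proj A (cfam_cpx z) = z \<odot>\<^bsub>A\<^esub> \<one>\<^bsub>A\<^esub>"
    "w \<in> carrier A \<Longrightarrow> cfam_proj A (cfam_lift A w) = w" "B \<noteq> A \<Longrightarrow> cfam_proj A (cfam_lift B w) = \<zero>\<^bsub>A\<^esub>"
  using assms by (transfer, simp)+

interpretation cfam: star_algebra "cfam_star :: 'u cfam \<Rightarrow> 'u cfam" cfam_cpx
proof
  fix x y :: "'u cfam" and z w :: complex
  note simps = cfam_fst_simps cfam_star_simps cfam_proj_simps cfam_proj_star_simps cfam_proj_closed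
    commutative_cstar_algebra.star_star commutative_cstar_algebra.star_add commutative_cstar_algebra.star_mult
    commutative_cstar_algebra.star_closed cstar_cring cring.cring_simprules(6) commutative_cstar_algebra.smult_rules
    commutative_cstar_algebra.star_smult commutative_cstar_algebra.star_one
  show "cfam_star (cfam_star x) = x" "cfam_star (x + y) = cfam_star x + cfam_star y"
    "(cfam_cpx (z + w) :: 'u cfam) = cfam_cpx z + cfam_cpx w" "(cfam_cpx 1 :: 'u cfam) = 1"
    "cfam_star (cfam_cpx z :: 'u cfam) = cfam_cpx (cnj z)"
    by (rule cfam_eqI; simp add: simps)+
  show "(cfam_cpx (z * w) :: 'u cfam) = cfam_cpx z * cfam_cpx w"
    by (rule cfam_eqI; simp add: simps cring.cring_simprules(12))
  show "cfam_star (x * y) = cfam_star x * cfam_star y"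
    by (rule cfam_eqI; simp add: simps cring.cring_simprules(14))
qed

context commutative_cstar_algebra
begin

lemmas proj_simps = cfam_proj_simps[OF this_cstar] cfam_proj_star_simps[OF this_cstar]

lemma proj_closed [simp]: "cfam_proj A x \<in> carrier A"
  by (rule cfam_proj_closed[OF this_cstar])

lemma proj_sum: "cfam_proj A (\<Sum>i\<in>I. f i) = (\<Oplus>\<^bsub>A\<^esub>i\<in>I. cfam_proj A (f i))"
  by (induction I rule: infinite_finite_induct) (auto simp: proj_simps)

lemma proj_smult: "cfam_proj A (cfam_cpx z * x) = z \<odot>\<^bsub>A\<^esub> cfam_proj A x"
  by (simp add: proj_simps smult_rules)

lemma star_zero: "star A \<zero>\<^bsub>A\<^esub> = \<zero>\<^bsub>A\<^esub>"
  using proj_simps(6)[of 0] by (simp add: proj_simps)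

lemma lift_eqI:
  assumes "x \<in> carrier A" "cfam_fst y = 0" "cfam_proj A y = x"
    "\<And>B :: 'u cstar. commutative_cstar_algebra B \<Longrightarrow> B \<noteq> A \<Longrightarrow> cfam_proj B y = \<zero>\<^bsub>B\<^esub>"
  shows "cfam_lift A x = y"
proof (rule cfam_eqI)
  fix B :: "'u cstar" assume "commutative_cstar_algebra B"
  then show "cfam_proj B (cfam_lift A x) = cfam_proj B y"
    using assms by (cases "B = A") (simp_all add: cfam_proj_star_simps)
qed (simp add: assms cfam_star_simps)

lemma lift_hom:
  assumes "x \<in> carrier A" "y \<in> carrier A"
  shows lift_add: "cfam_lift A (x \<oplus>\<^bsub>A\<^esub> y) = cfam_lift A x + cfam_lift A y"
    and lift_mult: "cfam_lift A (x \<otimes>\<^bsub>A\<^esub> y) = cfam_lift A x * cfam_lift A y"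
  by (rule lift_eqI; simp add: assms cfam_fst_simps cfam_star_simps cfam_proj_simps cfam_proj_star_simps
      cstar_cring cring.cring_simprules this_cstar)+

lemma lift_star: "x \<in> carrier A \<Longrightarrow> cfam_lift A (star A x) = cfam_star (cfam_lift A x)"
  by (rule lift_eqI; simp add: cfam_fst_simps cfam_star_simps cfam_proj_simps cfam_proj_star_simps
      star_closed commutative_cstar_algebra.star_zero this_cstar)

lemma lift_smult: "x \<in> carrier A \<Longrightarrow> cfam_lift A (z \<odot>\<^bsub>A\<^esub> x) = cfam_cpx z * cfam_lift A x"
proof (rule lift_eqI)
  fix B :: "'u cstar" assume B: "commutative_cstar_algebra B" "B \<noteq> A"
  interpret B: commutative_cstar_algebra B by fact
  show "cfam_proj B (cfam_cpx z * cfam_lift A x) = \<zero>\<^bsub>B\<^esub>"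
    using B by (simp add: B.proj_simps B.smult_rules)
qed (simp_all add: cfam_fst_simps cfam_star_simps proj_smult proj_simps smult_rules)

lemma lift_zero: "cfam_lift A \<zero>\<^bsub>A\<^esub> = 0"
  by (rule lift_eqI; simp add: cfam_fst_simps proj_simps cfam_proj_simps)

lemma lift_sum:
  "(\<And>i. i \<in> I \<Longrightarrow> f i \<in> carrier A) \<Longrightarrow> cfam_lift A (\<Oplus>\<^bsub>A\<^esub>i\<in>I. f i) = (\<Sum>i\<in>I. cfam_lift A (f i))"
proof (induction I rule: infinite_finite_induct)
  case (insert i I)
  then have "f \<in> I \<rightarrow> carrier A" by auto
  with insert show ?case by (simp add: lift_add)
qed (auto simp: lift_zero)

lemma lift_one_idem: "cfam_lift A \<one>\<^bsub>A\<^esub> * cfam_lift A \<one>\<^bsub>A\<^esub> = cfam_lift A \<one>\<^bsub>A\<^esub>"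
  by (simp flip: lift_mult)

lemma lift_one_star: "cfam_star (cfam_lift A \<one>\<^bsub>A\<^esub>) = cfam_lift A \<one>\<^bsub>A\<^esub>"
  using lift_star[OF one_closed] by (simp add: star_one)

lemma lift_one_mult: "x \<in> carrier A \<Longrightarrow> cfam_lift A \<one>\<^bsub>A\<^esub> * cfam_lift A x = cfam_lift A x"
  by (simp flip: lift_mult)

end

section \<open>Generated cones and the quadratic forms on triples\<close>

definition gen_cone :: "'i set \<Rightarrow> ('i \<Rightarrow> 'e::real_vector) \<Rightarrow> 'e set" where
  "gen_cone I x = {\<Sum>i\<in>I. a i *\<^sub>R x i |a. \<forall>i\<in>I. 0 \<le> a i}"

lemma gen_coneI: "(\<And>i. i \<in> I \<Longrightarrow> 0 \<le> a i) \<Longrightarrow> (\<Sum>i\<in>I. a i *\<^sub>R x i) \<in> gen_cone I x"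
  by (auto simp: gen_cone_def)

lemma gen_cone_add:
  assumes "v \<in> gen_cone I x" "w \<in> gen_cone I x" shows "v + w \<in> gen_cone I x"
proof -
  from assms obtain a b where ab: "v = (\<Sum>i\<in>I. a i *\<^sub>R x i)" "w = (\<Sum>i\<in>I. b i *\<^sub>R x i)"
    "\<forall>i\<in>I. 0 \<le> a i" "\<forall>i\<in>I. 0 \<le> b i" by (auto simp: gen_cone_def)
  have "v + w = (\<Sum>i\<in>I. (a i + b i) *\<^sub>R x i)" by (simp add: ab scaleR_add_left sum.distrib)
  then show ?thesis using ab gen_coneI[of I "\<lambda>i. a i + b i" x] by simp
qed

lemma gen_cone_scale:
  assumes "v \<in> gen_cone I x" "0 \<le> r" shows "r *\<^sub>R v \<in> gen_cone I x"
proof -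
  from assms obtain a where a: "v = (\<Sum>i\<in>I. a i *\<^sub>R x i)" "\<forall>i\<in>I. 0 \<le> a i" by (auto simp: gen_cone_def)
  have "r *\<^sub>R v = (\<Sum>i\<in>I. (r * a i) *\<^sub>R x i)" by (simp add: a scaleR_sum_right)
  then show ?thesis using a assms(2) gen_coneI[of I "\<lambda>i. r * a i" x] by simp
qed

lemma gen_cone_partial:
  assumes "finite I" "J \<subseteq> I" "\<And>i. i \<in> J \<Longrightarrow> 0 \<le> a i"
  shows "(\<Sum>i\<in>J. a i *\<^sub>R x i) \<in> gen_cone I x"
proof -
  have "(\<Sum>i\<in>J. a i *\<^sub>R x i) = (\<Sum>i\<in>I. (if i \<in> J then a i else 0) *\<^sub>R x i)"
    by (rule sum.mono_neutral_cong_left) (use assms in auto)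
  then show ?thesis using gen_coneI[of I "\<lambda>i. if i \<in> J then a i else 0" x] assms by simp
qed

lemma gen_cone_gen: "finite I \<Longrightarrow> i \<in> I \<Longrightarrow> 0 \<le> r \<Longrightarrow> r *\<^sub>R x i \<in> gen_cone I x"
  using gen_cone_partial[of I "{i}" "\<lambda>_. r" x] by simp

text \<open>A family of prescribed values extends linearly as soon as it satisfies all relations of
  the given vectors: define the map on a basis selected from the family and test the other members
  on the relation expressing them in that basis.\<close>

lemma linear_extension_family:
  fixes x :: "'i \<Rightarrow> 'a::real_vector" and f :: "'i \<Rightarrow> 'b::real_vector"
  assumes "finite I"
    and rel: "\<And>c. (\<Sum>i\<in>I. c i *\<^sub>R x i) = 0 \<Longrightarrow> (\<Sum>i\<in>I. c i *\<^sub>R f i) = 0"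
  obtains g where "linear g" "\<And>i. i \<in> I \<Longrightarrow> g (x i) = f i"
proof -
  obtain B where B: "B \<subseteq> x ` I" "independent B" "x ` I \<subseteq> span B"
    using maximal_independent_subset[of "x ` I"] by metis
  have finB: "finite B" using B(1) assms(1) finite_subset by blast
  define h where "h = inv_into I x"
  have h: "h b \<in> I" "x (h b) = b" if "b \<in> B" for b
    using B(1) that unfolding h_def by (auto intro: inv_into_into f_inv_into_f)
  have hinj: "inj_on h B" by (metis h(2) inj_onI)
  obtain g where g: "linear g" "\<And>b. b \<in> B \<Longrightarrow> g b = f (h b)"
    using linear_independent_extend[OF B(2), of "\<lambda>b. f (h b)"] by blast
  have "g (x i) = f i" if i: "i \<in> I" for i
  proof -
    have "x i \<in> span B" using B(3) i by blast
    then obtain c where c: "x i = (\<Sum>b\<in>B. c b *\<^sub>R b)"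
      using span_finite[OF finB] by auto
    \<comment> \<open>The relation x_i = sum of c_b b, written with coefficients on the index set.
      As \<open>x\<close> need not be injective, each basis vector is represented by the single
      index \<open>h b\<close>.\<close>
    define e where "e k = (if k = i then 1 else 0) - (if k \<in> h ` B then c (x k) else 0)" for k
    have eq: "(\<Sum>k\<in>I. e k *\<^sub>R F k) = F i - (\<Sum>b\<in>B. c b *\<^sub>R F (h b))" for F :: "'i \<Rightarrow> 'z::real_vector"
    proof -
      have "(\<Sum>k\<in>I. e k *\<^sub>R F k) = (\<Sum>k\<in>I. if k = i then F k else 0) - (\<Sum>k\<in>I. if k \<in> h ` B then c (x k) *\<^sub>R F k else 0)"
        unfolding e_def scaleR_diff_left sum_subtractf
        by (intro arg_cong2[where f = "(-)"] sum.cong) auto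
      also have "(\<Sum>k\<in>I. if k = i then F k else 0) = F i" using i assms(1) by simp
      also have "(\<Sum>k\<in>I. if k \<in> h ` B then c (x k) *\<^sub>R F k else 0) = (\<Sum>k\<in>h ` B. c (x k) *\<^sub>R F k)"
        by (rule sum.mono_neutral_cong_right) (use assms(1) h in auto)
      also have "\<dots> = (\<Sum>b\<in>B. c b *\<^sub>R F (h b))"
        by (subst sum.reindex[OF hinj]) (simp add: h)
      finally show ?thesis .
    qed
    have "(\<Sum>k\<in>I. e k *\<^sub>R x k) = 0" unfolding eq c by (simp add: h)
    then have "(\<Sum>k\<in>I. e k *\<^sub>R f k) = 0" by (rule rel)
    then have "f i = (\<Sum>b\<in>B. c b *\<^sub>R f (h b))" unfolding eq by simp
    also have "\<dots> = g (x i)" unfolding c linear_sum[OF g(1)] by (simp add: linear_cmul[OF g(1)] g(2))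
    finally show ?thesis by simp
  qed
  then show ?thesis using that g(1) by blast
qed

definition quad :: "'j set \<Rightarrow> ('j \<Rightarrow> 'j \<Rightarrow> real) \<Rightarrow> ('j \<Rightarrow> complex) \<Rightarrow> real" where
  "quad S M q = (\<Sum>a\<in>S. \<Sum>b\<in>S. Re (cnj (q a) * q b) * M a b)"

lemma quad_add: "quad S (\<lambda>a b. M a b + N a b) q = quad S M q + quad S N q"
  and quad_diff: "quad S (\<lambda>a b. M a b - N a b) q = quad S M q - quad S N q"
  and quad_scale: "quad S (\<lambda>a b. r * M a b) q = r * quad S M q"
  and quad_0: "quad S (\<lambda>a b. 0) q = 0"
  by (simp_all add: quad_def algebra_simps sum.distrib sum_subtractf sum_distrib_left)

lemma quad_id: "finite S \<Longrightarrow> quad S (\<lambda>a b. of_bool (a = b)) q = (\<Sum>a\<in>S. (cmod (q a))\<^sup>2)"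
  unfolding quad_def cmod_power2
  by (simp add: of_bool_def if_distrib power2_eq_square cong: if_cong)

lemma quad_sub:
  assumes "\<And>a b. M a b = M b a"
  shows "quad S M (\<lambda>a. q a - w a) = quad S M q + quad S M w - 2 * Re (\<Sum>a\<in>S. \<Sum>b\<in>S. cnj (w a) * complex_of_real (M a b) * q b)"
proof -
  have sw: "(\<Sum>a\<in>S. \<Sum>b\<in>S. Re (cnj (q a) * w b) * M a b) = (\<Sum>a\<in>S. \<Sum>b\<in>S. Re (cnj (w a) * q b) * M a b)"
    by (subst sum.swap) (auto intro!: sum.cong simp: assms mult.commute)
  have "quad S M (\<lambda>a. q a - w a) = quad S M q + quad S M w - (\<Sum>a\<in>S. \<Sum>b\<in>S. Re (cnj (q a) * w b) * M a b)
     - (\<Sum>a\<in>S. \<Sum>b\<in>S. Re (cnj (w a) * q b) * M a b)"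
    unfolding quad_def by (simp add: algebra_simps sum.distrib sum_subtractf)
  moreover have "Re (\<Sum>a\<in>S. \<Sum>b\<in>S. cnj (w a) * complex_of_real (M a b) * q b) = (\<Sum>a\<in>S. \<Sum>b\<in>S. Re (cnj (w a) * q b) * M a b)"
    by (simp add: algebra_simps)
  ultimately show ?thesis unfolding sw by simp
qed

text \<open>K_0 = (1 + dl N) / 3 and K_1 = (1 + dl J) / 3 with N the index operator and J the
  adjacency matrix of a path, and K_2 = 1 - K_0 - K_1. Small perturbations of 1/3 keep all three
  positive, while N and J still generate every matrix.\<close>

definition kmat :: "nat \<Rightarrow> real \<Rightarrow> nat \<Rightarrow> nat \<Rightarrow> nat \<Rightarrow> real" where
  "kmat m dl j k l =
    (let k0 = (if k = l then (1 + dl * real k) / 3 else 0);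
         k1 = (of_bool (k = l) + dl * of_bool (k = Suc l \<or> l = Suc k)) / 3
     in if j = 0 then k0 else if j = 1 then k1 else of_bool (k = l) - k0 - k1)"

lemma kmat_sym: "kmat m dl j k l = kmat m dl j l k"
  by (auto simp: kmat_def Let_def)

lemma kmat_sum: "(\<Sum>j<3. kmat m dl j k l) = of_bool (k = l)"
  by (simp add: kmat_def Let_def numeral_3_eq_3)

text \<open>Each term is bounded by the mean of two squares, and every vertex of a path has at most
  two neighbours.\<close>

lemma neighbour_bound:
  "\<bar>quad {..<m} (\<lambda>k l. of_bool (k = Suc l \<or> l = Suc k)) v\<bar> \<le> 2 * (\<Sum>k<m. (cmod (v k))\<^sup>2)"
proof -
  let ?J = "\<lambda>k l::nat. of_bool (k = Suc l \<or> l = Suc k) :: real"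
  have ab: "\<bar>Re (cnj a * b)\<bar> \<le> ((cmod a)\<^sup>2 + (cmod b)\<^sup>2) / 2" for a b
  proof -
    have "\<bar>Re (cnj a * b)\<bar> \<le> cmod a * cmod b" using abs_Re_le_cmod[of "cnj a * b"] by (simp add: norm_mult)
    also have "\<dots> \<le> ((cmod a)\<^sup>2 + (cmod b)\<^sup>2) / 2"
      using sum_squares_bound[of "cmod a" "cmod b"] by (simp add: field_simps)
    finally show ?thesis .
  qed
  have row: "(\<Sum>l<m. ?J k l) \<le> 2" for k
  proof -
    have "(\<Sum>l<m. ?J k l) = real (card {l \<in> {..<m}. k = Suc l \<or> l = Suc k})"
      by (simp add: of_bool_def flip: sum.inter_filter)
    also have "\<dots> \<le> real (card {k - 1, Suc k})" by (intro of_nat_mono card_mono) auto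
    also have "\<dots> \<le> 2" by (simp add: card_insert_if)
    finally show ?thesis .
  qed
  have "\<bar>quad {..<m} ?J v\<bar> \<le> (\<Sum>k<m. \<Sum>l<m. \<bar>Re (cnj (v k) * v l) * ?J k l\<bar>)"
    unfolding quad_def by (intro order.trans[OF sum_abs] sum_mono sum_abs)
  also have "\<dots> \<le> (\<Sum>k<m. \<Sum>l<m. ((cmod (v k))\<^sup>2 / 2 * ?J k l + (cmod (v l))\<^sup>2 / 2 * ?J k l))"
  proof (intro sum_mono)
    fix k l
    have "\<bar>Re (cnj (v k) * v l) * ?J k l\<bar> = \<bar>Re (cnj (v k) * v l)\<bar> * ?J k l" by (simp add: abs_mult)
    also have "\<dots> \<le> ((cmod (v k))\<^sup>2 + (cmod (v l))\<^sup>2) / 2 * ?J k l" by (intro mult_right_mono ab) simp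
    finally show "\<bar>Re (cnj (v k) * v l) * ?J k l\<bar> \<le> (cmod (v k))\<^sup>2 / 2 * ?J k l + (cmod (v l))\<^sup>2 / 2 * ?J k l"
      by (simp add: add_divide_distrib distrib_right)
  qed
  also have "\<dots> = (\<Sum>k<m. (cmod (v k))\<^sup>2 / 2 * (\<Sum>l<m. ?J k l)) + (\<Sum>l<m. (cmod (v l))\<^sup>2 / 2 * (\<Sum>k<m. ?J k l))"
    by (simp only: sum.distrib sum_distrib_left) (simp only: sum.swap[of "\<lambda>k l. (cmod (v l))\<^sup>2 / 2 * ?J k l"])
  also have "(\<Sum>l<m. (cmod (v l))\<^sup>2 / 2 * (\<Sum>k<m. ?J k l)) = (\<Sum>k<m. (cmod (v k))\<^sup>2 / 2 * (\<Sum>l<m. ?J k l))"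
    by (simp add: disj_commute)
  also have "(\<Sum>k<m. (cmod (v k))\<^sup>2 / 2 * (\<Sum>l<m. ?J k l)) \<le> (\<Sum>k<m. (cmod (v k))\<^sup>2 / 2 * 2)"
    by (intro sum_mono mult_left_mono row) simp
  finally show ?thesis by simp
qed

text \<open>The critical case is K_2 = (1 - dl (N + J)) / 3, where N \<le> m and J \<le> 2; the
  condition on \<open>dl\<close> is exactly what these bounds require.\<close>

lemma kmat_nonneg:
  assumes "j < 3" "0 < dl" "dl * (real m + 2) \<le> 1"
  shows "0 \<le> quad {..<m} (kmat m dl j) v"
proof -
  let ?J = "\<lambda>k l::nat. of_bool (k = Suc l \<or> l = Suc k) :: real"
  let ?D = "\<lambda>k l::nat. real k * of_bool (k = l)"
  let ?n = "\<Sum>k<m. (cmod (v k))\<^sup>2"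
  have D: "quad {..<m} ?D v = (\<Sum>k<m. real k * (cmod (v k))\<^sup>2)"
    unfolding quad_def cmod_power2 by (simp add: of_bool_def if_distrib power2_eq_square mult_ac cong: if_cong)
  have D0: "0 \<le> quad {..<m} ?D v" unfolding D by (intro sum_nonneg) simp
  have Dm: "quad {..<m} ?D v \<le> real m * ?n" unfolding D sum_distrib_left
    by (intro sum_mono mult_right_mono) auto
  have n0: "0 \<le> ?n" by (intro sum_nonneg) simp
  have J: "\<bar>quad {..<m} ?J v\<bar> \<le> 2 * ?n" by (rule neighbour_bound)
  have q0: "quad {..<m} (kmat m dl 0) v = (?n + dl * quad {..<m} ?D v) / 3"
  proof -
    have "kmat m dl 0 = (\<lambda>k l. (1/3) * (of_bool (k = l) + dl * ?D k l))"
      by (auto simp: kmat_def Let_def fun_eq_iff)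
    then show ?thesis by (simp only: quad_add quad_scale quad_id finite_lessThan)
  qed
  have q1: "quad {..<m} (kmat m dl 1) v = (?n + dl * quad {..<m} ?J v) / 3"
  proof -
    have "kmat m dl 1 = (\<lambda>k l. (1/3) * (of_bool (k = l) + dl * ?J k l))"
      by (auto simp: kmat_def Let_def fun_eq_iff)
    then show ?thesis by (simp only: quad_add quad_scale quad_id finite_lessThan)
  qed
  have q2: "quad {..<m} (kmat m dl 2) v = ?n - quad {..<m} (kmat m dl 0) v - quad {..<m} (kmat m dl 1) v"
  proof -
    have "kmat m dl 2 = (\<lambda>k l. of_bool (k = l) - kmat m dl 0 k l - kmat m dl 1 k l)"
      by (auto simp: kmat_def Let_def fun_eq_iff)
    then show ?thesis by (simp only: quad_diff quad_id finite_lessThan)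
  qed
  have b1: "dl * quad {..<m} ?D v \<le> dl * real m * ?n" using Dm assms(2) by simp
  have b2: "\<bar>dl * quad {..<m} ?J v\<bar> \<le> dl * 2 * ?n"
    using mult_left_mono[OF J, of dl] assms(2) by (simp add: abs_mult)
  have b3: "dl * real m * ?n + dl * 2 * ?n \<le> ?n"
    using mult_right_mono[OF assms(3) n0] by (simp add: algebra_simps)
  have b4: "0 \<le> dl * real m * ?n" using assms(2) n0 by simp
  have "0 \<le> dl * quad {..<m} ?D v" using D0 assms(2) by simp
  note d0 = this
  define N where "N = ?n"
  define X0 where "X0 = dl * quad {..<m} ?D v"
  define X1 where "X1 = dl * quad {..<m} ?J v"
  note fold = N_def[symmetric] X0_def[symmetric] X1_def[symmetric]
  have "\<bar>X1\<bar> \<le> dl * 2 * N" "X0 \<le> dl * real m * N" "dl * real m * N + dl * 2 * N \<le> N" "0 \<le> X0" "0 \<le> N"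
      "0 \<le> dl * real m * N"
    using b1 b2 b3 b4 d0 n0 unfolding fold by blast+
  then have "0 \<le> (N + X0) / 3" "0 \<le> (N + X1) / 3" "0 \<le> N - (N + X0) / 3 - (N + X1) / 3"
    by (simp_all add: field_simps)
  then have "0 \<le> quad {..<m} (kmat m dl 0) v \<and> 0 \<le> quad {..<m} (kmat m dl 1) v \<and> 0 \<le> quad {..<m} (kmat m dl 2) v"
    unfolding q2 q0 q1 fold by blast
  moreover from assms(1) have "j = 0 \<or> j = 1 \<or> j = 2" by auto
  ultimately show ?thesis by blast
qed

text \<open>The Gram matrix of the row operator: its form is |w|^2 with w = sum_j K_j q_j.\<close>

definition amat :: "nat \<Rightarrow> real \<Rightarrow> nat \<times> nat \<Rightarrow> nat \<times> nat \<Rightarrow> real" where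
  "amat m dl a b = (\<Sum>i<m. kmat m dl (fst a) i (snd a) * kmat m dl (fst b) i (snd b))"

definition bmat :: "nat \<Rightarrow> real \<Rightarrow> nat \<Rightarrow> nat \<times> nat \<Rightarrow> nat \<times> nat \<Rightarrow> real" where
  "bmat m dl j a b = of_bool (fst a = j \<and> fst b = j) * kmat m dl j (snd a) (snd b)"

lemma quad_amat: "quad (slots m) (amat m dl) q = (\<Sum>i<m. (cmod (shift_block m (kmat m dl) q i))\<^sup>2)"
proof -
  define w where "w i = (\<Sum>a\<in>slots m. complex_of_real (kmat m dl (fst a) i (snd a)) * q a)" for i
  have w: "shift_block m (kmat m dl) q i = w i" if "i < m" for i
    using that by (simp add: shift_block_def w_def sum.cartesian_product case_prod_unfold)
  have "(cmod (w i))\<^sup>2 = (\<Sum>a\<in>slots m. \<Sum>b\<in>slots m. Re (cnj (q a) * q b) * (kmat m dl (fst a) i (snd a) * kmat m dl (fst b) i (snd b)))" for i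
  proof -
    have "complex_of_real ((cmod (w i))\<^sup>2) = cnj (w i) * w i"
      using complex_norm_square[of "w i"] by (simp add: mult.commute)
    also have "\<dots> = (\<Sum>a\<in>slots m. \<Sum>b\<in>slots m. (cnj (q a) * q b) * complex_of_real (kmat m dl (fst a) i (snd a) * kmat m dl (fst b) i (snd b)))"
      unfolding w_def cnj_sum sum_product by (intro sum.cong) (auto simp: mult_ac)
    finally have "Re (complex_of_real ((cmod (w i))\<^sup>2)) = Re \<dots>" by (rule arg_cong)
    moreover have "Re (z * complex_of_real r) = Re z * r" for z r by simp
    ultimately show ?thesis by (simp only: Re_complex_of_real Re_sum)
  qed
  then have "(\<Sum>i<m. (cmod (shift_block m (kmat m dl) q i))\<^sup>2) =
     (\<Sum>i<m. \<Sum>a\<in>slots m. \<Sum>b\<in>slots m. Re (cnj (q a) * q b) * (kmat m dl (fst a) i (snd a) * kmat m dl (fst b) i (snd b)))"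
    by (intro sum.cong) (simp_all only: w lessThan_iff)
  also have "\<dots> = (\<Sum>a\<in>slots m. \<Sum>b\<in>slots m. \<Sum>i<m. Re (cnj (q a) * q b) * (kmat m dl (fst a) i (snd a) * kmat m dl (fst b) i (snd b)))"
    by (subst sum.swap, rule sum.cong[OF refl], rule sum.swap)
  also have "\<dots> = quad (slots m) (amat m dl) q"
    unfolding quad_def amat_def sum_distrib_left ..
  finally show ?thesis by simp
qed

lemma quad_bmat:
  assumes "j < 3"
  shows "quad (slots m) (bmat m dl j) q = quad {..<m} (kmat m dl j) (\<lambda>k. q (j, k))"
proof -
  have "quad (slots m) (bmat m dl j) q = (\<Sum>a\<in>{j} \<times> {..<m}. \<Sum>b\<in>{j} \<times> {..<m}. Re (cnj (q a) * q b) * kmat m dl j (snd a) (snd b))"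
    unfolding quad_def
    by (rule sum.mono_neutral_cong_right; (intro ballI sum.neutral)?; (rule sum.mono_neutral_cong_right)?)
      (use assms in \<open>auto simp: bmat_def\<close>)
  also have "\<dots> = quad {..<m} (kmat m dl j) (\<lambda>k. q (j, k))"
  proof -
    have s: "(\<Sum>a\<in>{j} \<times> {..<m}. F a) = (\<Sum>k<m. F (j, k))" for F :: "nat \<times> nat \<Rightarrow> real"
      using sum.cartesian_product[of "\<lambda>a b. F (a, b)" "{..<m}" "{j}"] by simp
    show ?thesis unfolding s quad_def by simp
  qed
  finally show ?thesis .
qed

lemma sum_slots_split:
  "(\<Sum>j<3. quad {..<m} (kmat m dl j) v) = (\<Sum>k<m. (cmod (v k))\<^sup>2)"
proof -
  have "(\<Sum>j<3. quad {..<m} (kmat m dl j) v) = quad {..<m} (\<lambda>k l. \<Sum>j<3. kmat m dl j k l) v"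
    by (simp only: numeral_3_eq_3 sum.lessThan_Suc quad_add lessThan_0 sum.empty quad_0)
  then show ?thesis by (simp only: kmat_sum quad_id finite_lessThan)
qed

text \<open>Completing the square: as the K_j sum to 1, the difference is sum_j <K_j (q_j - w), q_j
  - w>. It vanishes on diagonal triples, where every q_j equals w.\<close>

lemma quad_complement:
  assumes "0 < dl" "dl * (real m + 2) \<le> 1"
  shows "0 \<le> (\<Sum>j<3. quad (slots m) (bmat m dl j) q) - quad (slots m) (amat m dl) q"
proof -
  let ?w = "shift_block m (kmat m dl) q"
  let ?N = "\<Sum>k<m. (cmod (?w k))\<^sup>2"
  have "0 \<le> (\<Sum>j<3. quad {..<m} (kmat m dl j) (\<lambda>k. q (j, k) - ?w k))"
    by (intro sum_nonneg kmat_nonneg assms) auto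
  also have "\<dots> = (\<Sum>j<3. quad {..<m} (kmat m dl j) (\<lambda>k. q (j, k))) + (\<Sum>j<3. quad {..<m} (kmat m dl j) ?w)
     - 2 * Re (\<Sum>j<3. \<Sum>a<m. \<Sum>b<m. cnj (?w a) * complex_of_real (kmat m dl j a b) * q (j, b))"
    by (subst quad_sub[OF kmat_sym]) (simp add: sum.distrib sum_subtractf sum_distrib_left)
  also have "(\<Sum>j<3. \<Sum>a<m. \<Sum>b<m. cnj (?w a) * complex_of_real (kmat m dl j a b) * q (j, b)) = (\<Sum>a<m. cnj (?w a) * ?w a)"
    by (subst sum.swap) (auto simp: shift_block_def sum_distrib_left mult.assoc intro!: sum.cong)
  also have "\<dots> = complex_of_real ?N"
    using complex_norm_square by (simp add: mult.commute)
  also have "(\<Sum>j<3. quad {..<m} (kmat m dl j) ?w) = ?N" by (rule sum_slots_split)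
  finally show ?thesis by (simp add: quad_amat quad_bmat)
qed

section \<open>Hermitian matrices over V and their images in the ring\<close>

lemma herI:
  assumes "\<And>i j. fst (Z i j) \<in> V" "\<And>i j. snd (Z i j) \<in> V"
    and "\<And>i j. fst (Z j i) = fst (Z i j)" "\<And>i j. snd (Z j i) = - snd (Z i j)"
    and "\<And>i j. s \<le> i \<or> s \<le> j \<Longrightarrow> Z i j = 0"
  shows "Z \<in> her V s"
  unfolding her_def mem_Collect_eq
proof (intro conjI allI impI)
  fix i j
  show "Z i j \<in> V \<times> V" using assms(1,2) by (simp add: mem_Times_iff)
  show "Z j i = (fst (Z i j), - snd (Z i j))"
    by (rule prod_eqI) (simp_all only: fst_conv snd_conv assms(3)[where i = i and j = j] assms(4)[where i = i and j = j])
  show "s \<le> i \<or> s \<le> j \<Longrightarrow> Z i j = 0" by (rule assms(5))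
qed

lemma herD:
  assumes "Z \<in> her V s"
  shows "fst (Z i j) \<in> V" "snd (Z i j) \<in> V" "fst (Z j i) = fst (Z i j)" "snd (Z j i) = - snd (Z i j)"
    "s \<le> i \<or> s \<le> j \<Longrightarrow> Z i j = 0"
proof -
  have "Z i j \<in> V \<times> V" and e: "Z j i = (fst (Z i j), - snd (Z i j))"
    using assms unfolding her_def by blast+
  then show "fst (Z i j) \<in> V" "snd (Z i j) \<in> V" by (simp_all add: mem_Times_iff)
  show "fst (Z j i) = fst (Z i j)" "snd (Z j i) = - snd (Z i j)"
    unfolding e by simp_all
  show "s \<le> i \<or> s \<le> j \<Longrightarrow> Z i j = 0" using assms unfolding her_def by blast
qed

lemma her_add:
  assumes V: "subspace V" and Z: "Z \<in> her V s" and Y: "Y \<in> her V s"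
  shows "(\<lambda>i j. Z i j + Y i j) \<in> her V s"
proof (rule herI)
  fix i j
  show "fst (Z j i + Y j i) = fst (Z i j + Y i j)"
    using herD(3)[OF Z, where i = i and j = j] herD(3)[OF Y, where i = i and j = j] by simp
  show "snd (Z j i + Y j i) = - snd (Z i j + Y i j)"
    using herD(4)[OF Z, where i = i and j = j] herD(4)[OF Y, where i = i and j = j] by simp
qed (use herD(1,2,5)[OF Z] herD(1,2,5)[OF Y] V in \<open>auto simp: subspace_add\<close>)

lemma her_scale:
  assumes V: "subspace V" and Z: "Z \<in> her V s"
  shows "(\<lambda>i j. r *\<^sub>R Z i j) \<in> her V s"
proof (rule herI)
  fix i j
  show "fst (r *\<^sub>R Z j i) = fst (r *\<^sub>R Z i j)"
    using herD(3)[OF Z, where i = i and j = j] by simp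
  show "snd (r *\<^sub>R Z j i) = - snd (r *\<^sub>R Z i j)"
    using herD(4)[OF Z, where i = i and j = j] by simp
qed (use herD(1,2,5)[OF Z] V in \<open>auto simp: subspace_scale\<close>)

lemma her_mono: "Z \<in> her V s \<Longrightarrow> s \<le> s' \<Longrightarrow> Z \<in> her V s'"
proof (rule herI)
  assume Z: "Z \<in> her V s" and s: "s \<le> s'"
  show "fst (Z i j) \<in> V" "snd (Z i j) \<in> V" "fst (Z j i) = fst (Z i j)" "snd (Z j i) = - snd (Z i j)" for i j
    by (fact herD[OF Z])+
  show "s' \<le> i \<or> s' \<le> j \<Longrightarrow> Z i j = 0" for i j using herD(5)[OF Z] s by (meson order.trans)
qed

lemma pure_tensor_her:
  assumes "subspace V" "psd s A" "c \<in> V"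
  shows "pure_tensor A c \<in> her V s"
proof (rule herI)
  fix i j
  have sym: "A j i = cnj (A i j)" using assms(2) unfolding psd_def by blast
  then have "Re (A j i) = Re (A i j)" "Im (A j i) = - Im (A i j)" by simp_all
  then show "fst (pure_tensor A c j i) = fst (pure_tensor A c i j)"
    "snd (pure_tensor A c j i) = - snd (pure_tensor A c i j)" by (simp_all add: pure_tensor_def)
  have "A i j = 0" if "s \<le> i \<or> s \<le> j"
    using assms(2) that unfolding psd_def by blast
  then show "s \<le> i \<or> s \<le> j \<Longrightarrow> pure_tensor A c i j = 0" by (simp add: pure_tensor_def zero_prod_def)
qed (use assms in \<open>auto simp: pure_tensor_def subspace_scale\<close>)

lemma pure_tensor_min_cone:
  assumes "psd s A" "c \<in> C" shows "pure_tensor A c \<in> min_cone C s"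
  unfolding min_cone_def using assms
  by (intro CollectI exI[of _ 1] exI[of _ "\<lambda>_. 1"] exI[of _ "\<lambda>_. A"] exI[of _ "\<lambda>_. c"]) auto

locale cstar_map = commutative_cstar_algebra A for A :: "'u cstar" (structure) +
  fixes d :: nat and V :: "'e::real_vector set" and u :: 'e and \<Phi> :: "'e \<Rightarrow> nat \<Rightarrow> nat \<Rightarrow> 'u"
  assumes V: "subspace V" and herm_map: "unital_herm_map A d V u \<Phi>"
begin

definition lmap :: "'e \<Rightarrow> nat \<Rightarrow> nat \<Rightarrow> 'u cfam" where
  "lmap v p q = (if p < d \<and> q < d then cfam_lift A (\<Phi> v p q) else 0)"

lemma map_closed: "v \<in> V \<Longrightarrow> p < d \<Longrightarrow> q < d \<Longrightarrow> \<Phi> v p q \<in> carrier A"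
  and map_star: "v \<in> V \<Longrightarrow> p < d \<Longrightarrow> q < d \<Longrightarrow> \<Phi> v q p = star A (\<Phi> v p q)"
  and map_add: "v \<in> V \<Longrightarrow> w \<in> V \<Longrightarrow> p < d \<Longrightarrow> q < d \<Longrightarrow> \<Phi> (v + w) p q = \<Phi> v p q \<oplus> \<Phi> w p q"
  and map_scale: "v \<in> V \<Longrightarrow> p < d \<Longrightarrow> q < d \<Longrightarrow> \<Phi> (r *\<^sub>R v) p q = complex_of_real r \<odot> \<Phi> v p q"
  and map_unit: "p < d \<Longrightarrow> q < d \<Longrightarrow> \<Phi> u p q = (if p = q then \<one> else \<zero>)"
  using herm_map unfolding unital_herm_map_def by blast+

lemma lmap_add: "v \<in> V \<Longrightarrow> w \<in> V \<Longrightarrow> lmap (v + w) = lmap v + lmap w"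
  by (auto simp: lmap_def fun_eq_iff fun_pointwise map_add lift_add map_closed)

lemma lmap_scale: "v \<in> V \<Longrightarrow> lmap (r *\<^sub>R v) = cfam.sc (complex_of_real r) (lmap v)"
  by (auto simp: lmap_def fun_eq_iff cfam.sc_def map_scale lift_smult map_closed)

lemma lmap_0: "lmap 0 p q = 0"
  using lmap_scale[of 0 0] V subspace_0[OF V] by (simp add: fun_pointwise)

lemma lmap_adj: "v \<in> V \<Longrightarrow> cfam.adj (lmap v) = lmap v"
proof (intro ext)
  fix p q assume v: "v \<in> V"
  show "cfam.adj (lmap v) p q = lmap v p q"
  proof (cases "p < d \<and> q < d")
    case True
    then have "\<Phi> v p q = star A (\<Phi> v q p)" using map_star v by blast
    then show ?thesis using True v by (simp add: cfam.adj_def lmap_def lift_star map_closed)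
  qed (auto simp: cfam.adj_def lmap_def)
qed

lemma lmap_unit: "lmap u p q = (if p = q \<and> p < d then cfam_lift A \<one> else 0)"
  by (auto simp: lmap_def map_unit lift_zero)

lemma ampliation_closed:
  "fst (Z i j) \<in> V \<Longrightarrow> snd (Z i j) \<in> V \<Longrightarrow> p < d \<Longrightarrow> q < d \<Longrightarrow> ampliation A \<Phi> Z (i, p) (j, q) \<in> carrier A"
  by (simp add: ampliation_def map_closed smult_rules)

lemma lift_ampliation:
  "fst (Z i j) \<in> V \<Longrightarrow> snd (Z i j) \<in> V \<Longrightarrow> p < d \<Longrightarrow> q < d \<Longrightarrow>
    cfam_lift A (ampliation A \<Phi> Z (i, p) (j, q)) = lmap (fst (Z i j)) p q + cfam_cpx \<i> * lmap (snd (Z i j)) p q"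
  by (simp add: ampliation_def map_closed smult_rules lift_add lift_smult lmap_def)

lemma lmap_sos:
  assumes x: "x \<in> V" and pos: "mat_nonneg A ({..<1} \<times> {..<d}) (ampliation A \<Phi> (pure_tensor (\<lambda>i j. of_bool (i = 0 \<and> j = 0)) x))"
  shows "cfam.sos (lmap x)"
proof -
  let ?I = "{..<1::nat} \<times> {..<d}" and ?Z = "pure_tensor (\<lambda>i j. of_bool (i = 0 \<and> j = 0)) x"
  from pos obtain Y where Y0: "(\<forall>i\<in>?I. \<forall>j\<in>?I. Y i j \<in> carrier A) \<and>
    (\<forall>i\<in>?I. \<forall>j\<in>?I. ampliation A \<Phi> ?Z i j = (\<Oplus>k\<in>?I. star A (Y k i) \<otimes> Y k j))"
    unfolding mat_nonneg_def by (rule exE)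
  then have Y: "\<And>i j. i \<in> ?I \<Longrightarrow> j \<in> ?I \<Longrightarrow> Y i j \<in> carrier A"
    "\<And>i j. i \<in> ?I \<Longrightarrow> j \<in> ?I \<Longrightarrow> ampliation A \<Phi> ?Z i j = (\<Oplus>k\<in>?I. star A (Y k i) \<otimes> Y k j)"
    by blast+
  have Z: "fst (?Z 0 0) = x" "snd (?Z 0 0) = 0" by (simp_all add: pure_tensor_def)
  define g where "g k p = (if p < d then cfam_lift A (Y k (0, p)) else 0)" for k p
  have "lmap x p q = (\<Sum>k\<in>?I. cfam.outer (g k) p q)" for p q
  proof (cases "p < d \<and> q < d")
    case True
    then have pq: "(0, p) \<in> ?I" "(0, q) \<in> ?I" by auto
    have "lmap x p q = cfam_lift A (ampliation A \<Phi> ?Z (0, p) (0, q))"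
      using True x subspace_0[OF V] by (subst lift_ampliation) (simp_all add: Z lmap_0)
    also have "\<dots> = (\<Sum>k\<in>?I. cfam_lift A (star A (Y k (0, p)) \<otimes> Y k (0, q)))"
      unfolding Y(2)[OF pq] by (rule lift_sum) (intro m_closed star_closed Y(1) pq)
    also have "\<dots> = (\<Sum>k\<in>?I. cfam.outer (g k) p q)"
    proof (rule sum.cong[OF refl])
      fix k assume "k \<in> ?I"
      then have "Y k (0, p) \<in> carrier A" "Y k (0, q) \<in> carrier A"
        using Y(1)[OF _ pq(1)] Y(1)[OF _ pq(2)] by blast+
      then show "cfam_lift A (star A (Y k (0, p)) \<otimes> Y k (0, q)) = cfam.outer (g k) p q"
        using True by (simp add: cfam.outer_def g_def lift_mult lift_star star_closed)
    qed
    finally show ?thesis .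
  next
    case False then show ?thesis by (auto simp: lmap_def cfam.outer_def g_def)
  qed
  then have "lmap x = (\<Sum>k\<in>?I. cfam.outer (g k))"
  proof -
    have "(\<Sum>k\<in>K. cfam.outer (g k)) p q = (\<Sum>k\<in>K. cfam.outer (g k) p q)" for K p q
      by (induction K rule: infinite_finite_induct) (auto simp: fun_pointwise)
    with \<open>\<And>p q. lmap x p q = _\<close> show ?thesis by (simp add: fun_eq_iff)
  qed
  then show ?thesis by (simp add: cfam.sos_sum cfam.sos_outer)
qed

text \<open>A sum of arbitrarily many squares becomes a single square after enlarging the matrices.\<close>

lemma sos_imp_mat_nonneg:
  fixes G :: "nat \<Rightarrow> nat \<times> nat \<Rightarrow> 'u cfam"
  assumes Z: "\<And>i j. fst (Z i j) \<in> V \<and> snd (Z i j) \<in> V" and d: "1 \<le> d" and n: "n \<le> s"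
    and G: "\<And>i p j q. i < s \<Longrightarrow> j < s \<Longrightarrow> p < d \<Longrightarrow> q < d \<Longrightarrow>
        lmap (fst (Z i j)) p q + cfam_cpx \<i> * lmap (snd (Z i j)) p q
          = (\<Sum>k<n. cfam_star (G k (i, p)) * G k (j, q))"
  shows "mat_nonneg A ({..<s} \<times> {..<d}) (ampliation A \<Phi> Z)"
proof -
  \<comment> \<open>The k-th square goes into row (k, 0) and all other rows are zero; this needs
    \<open>n \<le> s\<close> and \<open>1 \<le> d\<close>.\<close>
  define Y :: "nat \<times> nat \<Rightarrow> nat \<times> nat \<Rightarrow> 'u cfam" where "Y = (\<lambda>(k, r) c. if r = 0 \<and> k < n then G k c else 0)"
  have sY: "(\<Sum>kr\<in>{..<s} \<times> {..<d}. cfam_star (Y kr c) * Y kr c') = (\<Sum>k<n. cfam_star (G k c) * G k c')" for c c'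
  proof -
    have "(\<Sum>kr\<in>{..<s} \<times> {..<d}. cfam_star (Y kr c) * Y kr c') = (\<Sum>kr\<in>(\<lambda>k. (k, 0)) ` {..<n}. cfam_star (Y kr c) * Y kr c')"
      by (rule sum.mono_neutral_right) (use n d in \<open>auto simp: Y_def\<close>)
    also have "\<dots> = (\<Sum>k<n. cfam_star (G k c) * G k c')"
      by (subst sum.reindex) (auto simp: inj_on_def Y_def)
    finally show ?thesis .
  qed
  show ?thesis unfolding mat_nonneg_def
  proof (intro exI[of _ "\<lambda>k c. cfam_proj A (Y k c)"] conjI ballI)
    fix a b assume ab: "a \<in> {..<s} \<times> {..<d}" "b \<in> {..<s} \<times> {..<d}"
    then obtain i p j q where [simp]: "a = (i, p)" "b = (j, q)" and l: "i < s" "j < s" "p < d" "q < d" by auto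
    have "ampliation A \<Phi> Z a b = cfam_proj A (cfam_lift A (ampliation A \<Phi> Z (i, p) (j, q)))"
      using l Z by (simp add: proj_simps ampliation_closed)
    also have "\<dots> = cfam_proj A (\<Sum>kr\<in>{..<s} \<times> {..<d}. cfam_star (Y kr a) * Y kr b)"
      using l Z G by (simp add: lift_ampliation sY)
    also have "\<dots> = (\<Oplus>k\<in>{..<s} \<times> {..<d}. star A (cfam_proj A (Y k a)) \<otimes> cfam_proj A (Y k b))"
      by (simp add: proj_sum proj_simps)
    finally show "ampliation A \<Phi> Z a b = (\<Oplus>k\<in>{..<s} \<times> {..<d}. star A (cfam_proj A (Y k a)) \<otimes> cfam_proj A (Y k b))" .
  qed simp
qed

end

lemma shift_block_kmat_diag:
  assumes "k < m" shows "shift_block m (kmat m dl) (diag_embed m v) k = v k"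
proof -
  have "shift_block m (kmat m dl) (diag_embed m v) k = (\<Sum>l<m. \<Sum>j<3. complex_of_real (kmat m dl j k l) * v l)"
    using assms by (subst sum.swap) (auto simp: shift_block_def diag_embed_def intro!: sum.cong)
  also have "\<dots> = (\<Sum>l<m. complex_of_real (\<Sum>j<3. kmat m dl j k l) * v l)"
    by (simp only: sum_distrib_right of_real_sum)
  also have "\<dots> = (\<Sum>l<m. if l = k then v l else 0)"
    by (rule sum.cong) (auto simp: kmat_sum)
  also have "\<dots> = v k" using assms by simp
  finally show ?thesis .
qed

section \<open>A relation with two against three generators excludes embeddings\<close>

text \<open>Instantiates the rigid configuration. By \<open>rels\<close> every relation between the
  generators restricts to a multiple of the given one, hence forms balanced for that one relation
  extend to a linear map on the whole space. An order embedding then makes the associated functional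
  positive on the image, and \<open>contradiction\<close> applies.\<close>

lemma not_d_subhomogeneous:
  fixes V C :: "'e::real_vector set" and x :: "'i \<Rightarrow> 'e" and u :: 'e
  assumes V: "subspace V" and I: "finite I" and xV: "\<And>i. i \<in> I \<Longrightarrow> x i \<in> V"
    and C: "C = gen_cone I x" and uV: "u \<in> V" and ou: "\<And>v. v \<in> V \<Longrightarrow> \<exists>k>0. k *\<^sub>R u - v \<in> C"
    and I12: "I1 \<subseteq> I" "I2 \<subseteq> I" "I1 \<inter> I2 = {}" and z: "\<And>i. i \<in> I1 \<union> I2 \<Longrightarrow> 0 < z i"
    and rel: "(\<Sum>i\<in>I1. z i *\<^sub>R x i) = (\<Sum>i\<in>I2. z i *\<^sub>R x i)"
    and rels: "\<And>c. (\<Sum>i\<in>I. c i *\<^sub>R x i) = 0 \<Longrightarrow> \<exists>r. (\<forall>i\<in>I1. c i = r * z i) \<and> (\<forall>i\<in>I2. c i = - r * z i)"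
    and i12: "i1 \<in> I1" "i2 \<in> I1" "i1 \<noteq> i2"
    and jj: "jj 0 \<in> I2" "jj 1 \<in> I2" "jj 2 \<in> I2" "jj 0 \<noteq> jj 1" "jj 0 \<noteq> jj 2" "jj 1 \<noteq> jj (2::nat)"
    and d: "1 \<le> d"
  shows "\<not> d_subhomogeneous TYPE('u) d (min_op_system V C u)"
proof
  assume "d_subhomogeneous TYPE('u) d (min_op_system V C u)"
  then obtain A :: "'u cstar" and \<Phi> where A: "commutative_cstar_algebra A" and \<Phi>: "unital_herm_map A d V u \<Phi>"
    and emb: "\<And>s Z. 1 \<le> s \<Longrightarrow> Z \<in> her V s \<Longrightarrow>
        Z \<in> min_cone C s \<longleftrightarrow> mat_nonneg A ({..<s} \<times> {..<d}) (ampliation A \<Phi> Z)"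
    unfolding d_subhomogeneous_def min_op_system_def by auto
  interpret cstar_map A d V u \<Phi>
    by (intro cstar_map.intro A cstar_map_axioms.intro V \<Phi>)
  define m where "m = d * d + 3"
  define dl where "dl = 1 / (real m + 2)"
  have dl: "0 < dl" "dl * (real m + 2) \<le> 1" by (simp_all add: dl_def)
  let ?S = "slots m"
  define A2 where "A2 a b = bmat m dl 0 a b + bmat m dl 1 a b + bmat m dl 2 a b - amat m dl a b" for a b
  \<comment> \<open>Division by \<open>z i\<close> normalises the forms so that the scaled
    generators \<open>z i *\<^sub>R x i\<close> satisfy x1 + x2 = y0 + y1 + y2 entrywise; generators
    outside the five selected ones get the zero form.\<close>
  define F where "F i a b = (if i = i1 then amat m dl a b else if i = i2 then A2 a b
     else if i = jj 0 then bmat m dl 0 a b else if i = jj 1 then bmat m dl 1 a b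
     else if i = jj 2 then bmat m dl 2 a b else 0) / z i" for i a b
  have dist: "i1 \<noteq> jj 0" "i1 \<noteq> jj 1" "i1 \<noteq> jj 2" "i2 \<noteq> jj 0" "i2 \<noteq> jj 1" "i2 \<noteq> jj 2"
    using i12 jj I12 by auto
  have zpos: "0 < z i1" "0 < z i2" "0 < z (jj 0)" "0 < z (jj 1)" "0 < z (jj 2)"
    using z i12 jj by auto
  have sum5: "(\<Sum>i\<in>I. c i * F i a b) = c i1 * F i1 a b + c i2 * F i2 a b + c (jj 0) * F (jj 0) a b
      + c (jj 1) * F (jj 1) a b + c (jj 2) * F (jj 2) a b" for c a b
  proof -
    have "(\<Sum>i\<in>I. c i * F i a b) = (\<Sum>i\<in>{i1, i2, jj 0, jj 1, jj 2}. c i * F i a b)"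
      by (rule sum.mono_neutral_right) (use I i12 jj I12 in \<open>auto simp: F_def\<close>)
    then show ?thesis using dist jj i12 by (simp add: add_ac)
  qed
  have "\<exists>g. linear g \<and> (\<forall>i\<in>I. g (x i) = F i a b)" for a b
  proof -
    have "(\<Sum>i\<in>I. c i *\<^sub>R F i a b) = 0" if "(\<Sum>i\<in>I. c i *\<^sub>R x i) = 0" for c
    proof -
      from rels[OF that] obtain r where "\<forall>i\<in>I1. c i = r * z i" "\<forall>i\<in>I2. c i = - r * z i" by blast
      then have c: "c i1 = r * z i1" "c i2 = r * z i2" "c (jj 0) = - r * z (jj 0)"
          "c (jj 1) = - r * z (jj 1)" "c (jj 2) = - r * z (jj 2)" using i12 jj by auto
      have "(\<Sum>i\<in>I. c i * F i a b) = r * (amat m dl a b + A2 a b - bmat m dl 0 a b - bmat m dl 1 a b - bmat m dl 2 a b)"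
        unfolding sum5 c using zpos dist jj i12 by (simp add: F_def algebra_simps)
      then show ?thesis by (simp add: A2_def)
    qed
    from linear_extension_family[OF I this] show ?thesis by metis
  qed
  then obtain \<psi> where \<psi>: "\<And>a b. linear (\<psi> a b)" "\<And>a b i. i \<in> I \<Longrightarrow> \<psi> a b (x i) = F i a b" by metis
  define Q where "Q y q = quad ?S (\<lambda>a b. \<psi> a b y) q" for y q
  have Q_add: "Q (v + w) q = Q v q + Q w q" for v w q
    by (simp add: Q_def linear_add[OF \<psi>(1)] quad_add)
  have Q_scale: "Q (r *\<^sub>R v) q = r * Q v q" for r v q
    by (simp add: Q_def linear_cmul[OF \<psi>(1)] quad_scale)
  have Q_sum: "Q (\<Sum>i\<in>J. c i *\<^sub>R x i) q = (\<Sum>i\<in>J. c i * Q (x i) q)" for c J q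
  proof (induction J rule: infinite_finite_induct)
    case (insert i J) then show ?case by (simp add: Q_add Q_scale)
  qed (use Q_scale[of 0 0 q] in auto)
  have Qx: "Q (x i) q = quad ?S (F i) q" if "i \<in> I" for i q
    using that by (simp add: Q_def \<psi>(2))
  have inI: "i1 \<in> I" "i2 \<in> I" "jj 0 \<in> I" "jj 1 \<in> I" "jj 2 \<in> I" using i12 jj I12 by auto
  have Q1: "Q (z i1 *\<^sub>R x i1) q = quad ?S (amat m dl) q" for q
  proof -
    have "F i1 = (\<lambda>a b. 1 / z i1 * amat m dl a b)" by (auto simp: F_def fun_eq_iff)
    then show ?thesis unfolding Q_scale Qx[OF inI(1)] using zpos by (simp add: quad_scale del: times_divide_eq_left)
  qed
  have Q2: "Q (z i2 *\<^sub>R x i2) q = (\<Sum>j<3. quad ?S (bmat m dl j) q) - quad ?S (amat m dl) q" for q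
  proof -
    have "F i2 = (\<lambda>a b. 1 / z i2 * A2 a b)" using i12 by (auto simp: F_def fun_eq_iff)
    then have "Q (z i2 *\<^sub>R x i2) q = quad ?S A2 q"
      unfolding Q_scale Qx[OF inI(2)] using zpos by (simp add: quad_scale del: times_divide_eq_left)
    also have "A2 = (\<lambda>a b. bmat m dl 0 a b + bmat m dl 1 a b + bmat m dl 2 a b - amat m dl a b)"
      by (auto simp: A2_def fun_eq_iff)
    finally show ?thesis by (simp add: quad_add quad_diff numeral_3_eq_3 numeral_2_eq_2)
  qed
  have Qy: "Q (z (jj j) *\<^sub>R x (jj j)) q = quad ?S (bmat m dl j) q" if j: "j < 3" for j q
  proof -
    have j': "j = 0 \<or> j = 1 \<or> j = 2" using j by auto
    have "F (jj j) = (\<lambda>a b. 1 / z (jj j) * bmat m dl j a b)" using j' dist jj i12 by (auto simp: F_def fun_eq_iff)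
    moreover have "jj j \<in> I" "0 < z (jj j)" using j' inI zpos by auto
    ultimately show ?thesis unfolding Q_scale Qx[OF \<open>jj j \<in> I\<close>] by (simp add: quad_scale del: times_divide_eq_left)
  qed
  have Qo: "Q (x i) q = 0" if "i \<in> I" "i \<noteq> i1" "i \<noteq> i2" "i \<noteq> jj 0" "i \<noteq> jj 1" "i \<noteq> jj 2" for i q
  proof -
    have "F i = (\<lambda>a b. 0)" using that by (auto simp: F_def fun_eq_iff)
    then show ?thesis using Qx[OF that(1)] by (simp add: quad_0)
  qed
  have Qpos: "0 \<le> Q (x i) q" if "i \<in> I" for i q
  proof -
    have "0 \<le> Q (z i1 *\<^sub>R x i1) q" unfolding Q1 quad_amat by (intro sum_nonneg) simp
    moreover have "0 \<le> Q (z i2 *\<^sub>R x i2) q" unfolding Q2 by (rule quad_complement[OF dl])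
    moreover have "0 \<le> Q (z (jj j) *\<^sub>R x (jj j)) q" if "j < 3" for j
      unfolding Qy[OF that] quad_bmat[OF that] by (rule kmat_nonneg[OF that dl])
    note this[of 0] this[of 1] this[of 2]
    ultimately show ?thesis using zpos Qo[OF that] unfolding Q_scale
      by (cases "i \<in> {i1, i2, jj 0, jj 1, jj 2}") (auto simp: zero_le_mult_iff)
  qed
  have QC: "0 \<le> Q c q" if "c \<in> C" for c q
    using that unfolding C gen_cone_def by (auto simp: Q_sum intro!: sum_nonneg mult_nonneg_nonneg Qpos)
  obtain s0 where s0: "\<And>a. a \<in> ?S \<Longrightarrow> prod_encode a < s0"
  proof -
    have "finite (prod_encode ` ?S)" by simp
    then obtain k where "\<forall>i\<in>prod_encode ` ?S. i < k" using finite_nat_set_iff_bounded by blast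
    then show ?thesis using that by blast
  qed
  define E where "E = prod_encode ` ?S"
  \<comment> \<open>The functional on Hermitian matrices whose value at the tensor of the Gram
    matrix of q with y is \<open>Q y q\<close>. Matrix positions are the codes of pairs, so that one
    index type serves all levels.\<close>
  define form where "form Z = (\<Sum>a\<in>?S. \<Sum>b\<in>?S. \<psi> a b (fst (Z (prod_encode a) (prod_encode b))))" for Z :: "'e cmat"
  \<comment> \<open>A positive semidefinite matrix is a sum of rank-one matrices, which turns the
    value into a nonnegative combination of values of \<open>Q\<close> at elements of the cone. The
    level must be at least \<open>s0\<close> for all codes to be in range.\<close>
  have form_min: "0 \<le> form Z" if "Z \<in> min_cone C s" "s0 \<le> s" for Z s
  proof -
    from that(1) obtain N r B c where Z: "\<And>k. k < (N::nat) \<Longrightarrow> 0 \<le> r k \<and> psd s (B k) \<and> c k \<in> C"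
      "Z = (\<lambda>i j. \<Sum>k<N. r k *\<^sub>R pure_tensor (B k) (c k) i j)" unfolding min_cone_def by blast
    have "form Z = (\<Sum>a\<in>?S. \<Sum>b\<in>?S. \<Sum>k<N. r k * (Re (B k (prod_encode a) (prod_encode b)) * \<psi> a b (c k)))"
      unfolding form_def Z(2)
      by (simp add: fst_sum pure_tensor_def linear_sum[OF \<psi>(1)] linear_cmul[OF \<psi>(1)] mult.assoc)
    also have "\<dots> = (\<Sum>k<N. r k * (\<Sum>a\<in>?S. \<Sum>b\<in>?S. Re (B k (prod_encode a) (prod_encode b)) * \<psi> a b (c k)))"
    proof -
      have "(\<Sum>a\<in>?S. \<Sum>b\<in>?S. \<Sum>k<N. G a b k) = (\<Sum>k<N. \<Sum>a\<in>?S. \<Sum>b\<in>?S. G a b k)" for G :: "nat \<times> nat \<Rightarrow> nat \<times> nat \<Rightarrow> nat \<Rightarrow> real"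
      proof -
        have "(\<Sum>b\<in>?S. \<Sum>k<N. G a b k) = (\<Sum>k<N. \<Sum>b\<in>?S. G a b k)" for a by (rule sum.swap)
        then show ?thesis by (simp only:) (rule sum.swap)
      qed
      then show ?thesis by (simp only: sum_distrib_left)
    qed
    also have "\<dots> \<ge> 0"
    proof (rule sum_nonneg, rule mult_nonneg_nonneg)
      fix k assume "k \<in> {..<N}"
      then have k: "0 \<le> r k" "psd s (B k)" "c k \<in> C" using Z(1) by auto
      show "0 \<le> r k" by fact
      have "hpsd {..<s} (B k)" using k(2) psd_iff_hpsd by blast
      from hpsd_gram_ex[OF this] obtain n :: nat and y where
        "\<forall>i\<in>{..<s}. \<forall>j\<in>{..<s}. B k i j = (\<Sum>t<n. cnj (y t i) * y t j)" by auto
      then have y: "\<And>i j. i \<in> {..<s} \<Longrightarrow> j \<in> {..<s} \<Longrightarrow> B k i j = (\<Sum>t<n. cnj (y t i) * y t j)" by blast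
      have "(\<Sum>a\<in>?S. \<Sum>b\<in>?S. Re (B k (prod_encode a) (prod_encode b)) * \<psi> a b (c k))
         = (\<Sum>a\<in>?S. \<Sum>b\<in>?S. \<Sum>t<n. Re (cnj (y t (prod_encode a)) * y t (prod_encode b)) * \<psi> a b (c k))"
      proof (intro sum.cong refl)
        fix a b assume "a \<in> ?S" "b \<in> ?S"
        then have "prod_encode a \<in> {..<s}" "prod_encode b \<in> {..<s}" using s0 that(2) by (auto intro: less_le_trans)
        from y[OF this] show "Re (B k (prod_encode a) (prod_encode b)) * \<psi> a b (c k)
           = (\<Sum>t<n. Re (cnj (y t (prod_encode a)) * y t (prod_encode b)) * \<psi> a b (c k))"
          by (simp only: Re_sum sum_distrib_right)
      qed
      also have "\<dots> = (\<Sum>t<n. Q (c k) (\<lambda>a. y t (prod_encode a)))"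
      proof -
        have "(\<Sum>a\<in>?S. \<Sum>b\<in>?S. \<Sum>t<n. G a b t) = (\<Sum>t<n. \<Sum>a\<in>?S. \<Sum>b\<in>?S. G a b t)" for G :: "nat \<times> nat \<Rightarrow> nat \<times> nat \<Rightarrow> nat \<Rightarrow> real"
        proof -
          have "(\<Sum>b\<in>?S. \<Sum>t<n. G a b t) = (\<Sum>t<n. \<Sum>b\<in>?S. G a b t)" for a by (rule sum.swap)
          then show ?thesis by (simp only:) (rule sum.swap)
        qed
        from this[of "\<lambda>a b t. Re (cnj (y t (prod_encode a)) * y t (prod_encode b)) * \<psi> a b (c k)"]
        show ?thesis by (simp only: Q_def quad_def)
      qed
      finally have eq: "(\<Sum>a\<in>?S. \<Sum>b\<in>?S. Re (B k (prod_encode a) (prod_encode b)) * \<psi> a b (c k))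
          = (\<Sum>t<n. Q (c k) (\<lambda>a. y t (prod_encode a)))" .
      show "0 \<le> (\<Sum>a\<in>?S. \<Sum>b\<in>?S. Re (B k (prod_encode a) (prod_encode b)) * \<psi> a b (c k))"
        unfolding eq by (intro sum_nonneg QC k)
    qed
    finally show ?thesis .
  qed
  \<comment> \<open>The support condition on \<open>E\<close> lets entries outside the codes be
    filled with zeros when the level is raised.\<close>
  define bd where "bd M r \<longleftrightarrow> (\<exists>Z\<in>her V s0. (\<forall>i j. i \<notin> E \<or> j \<notin> E \<longrightarrow> Z i j = 0) \<and> form Z = r \<and>
      (\<forall>a\<in>?S. \<forall>b\<in>?S. \<forall>p<d. \<forall>q<d. M (a, p) (b, q) = lmap (fst (Z (prod_encode a) (prod_encode b))) p q
          + cfam_cpx \<i> * lmap (snd (Z (prod_encode a) (prod_encode b))) p q))" for M r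
  have CV: "C \<subseteq> V" unfolding C gen_cone_def using xV V by (auto intro!: subspace_sum subspace_scale)
  have pos: "cfam.sos (lmap c)" if "c \<in> C" for c
  proof (rule lmap_sos)
    show cV: "c \<in> V" using that CV by auto
    let ?A = "\<lambda>i j::nat. of_bool (i = 0 \<and> j = 0) :: complex"
    have "hpsd {..<1} ?A"
      by (rule hpsd_cong[THEN iffD2, OF _ hpsd_rank1[of _ "\<lambda>i. of_bool (i = 0)"]]) auto
    then have psd: "psd 1 ?A" unfolding psd_iff_hpsd by auto
    show "mat_nonneg A ({..<1} \<times> {..<d}) (ampliation A \<Phi> (pure_tensor ?A c))"
      using emb[of 1 "pure_tensor ?A c"] pure_tensor_her[OF V psd cV] pure_tensor_min_cone[OF psd that] by simp
  qed
  interpret positive_embedding cfam_star cfam_cpx d "cfam_lift A \<one>\<^bsub>A\<^esub>" V C u lmap Q bd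
  proof
    fix v w :: 'e and r :: real and p p' :: nat
    show "cfam_lift A \<one>\<^bsub>A\<^esub> * cfam_lift A \<one>\<^bsub>A\<^esub> = cfam_lift A \<one>\<^bsub>A\<^esub>" by (rule lift_one_idem)
    show "cfam_star (cfam_lift A \<one>\<^bsub>A\<^esub>) = cfam_lift A \<one>\<^bsub>A\<^esub>" by (rule lift_one_star)
    show "v \<in> V \<Longrightarrow> w \<in> V \<Longrightarrow> lmap (v + w) = lmap v + lmap w" by (rule lmap_add)
    show "v \<in> V \<Longrightarrow> lmap (r *\<^sub>R v) = cfam.sc (complex_of_real r) (lmap v)" by (rule lmap_scale)
    show "v \<in> V \<Longrightarrow> cfam_lift A \<one>\<^bsub>A\<^esub> * lmap v p p' = lmap v p p'"
      by (simp add: lmap_def lift_one_mult map_closed)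
    show "v \<in> V \<Longrightarrow> d \<le> p \<or> d \<le> p' \<Longrightarrow> lmap v p p' = 0" by (auto simp: lmap_def)
    show "v \<in> V \<Longrightarrow> cfam.adj (lmap v) = lmap v" by (rule lmap_adj)
    show "lmap u p p' = (if p = p' \<and> p < d then cfam_lift A \<one>\<^bsub>A\<^esub> else 0)" by (rule lmap_unit)
    show "v \<in> C \<Longrightarrow> cfam.sos (lmap v)" by (rule pos)
    show "v \<in> C \<Longrightarrow> \<exists>k>0. k *\<^sub>R u - v \<in> C" using ou CV by blast
  next
    fix y :: 'e and q :: "nat \<times> nat \<Rightarrow> complex" and r :: real
    show "Q (r *\<^sub>R y) q = r * Q y q" by (rule Q_scale)
    assume y: "y \<in> V"
    let ?q = "\<lambda>i. q (prod_decode i)"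
    define B where "B i j = (if i \<in> E \<and> j \<in> E then cnj (?q i) * ?q j else 0)" for i j
    have B: "psd s0 B" unfolding psd_iff_hpsd
    proof
      have "B = (\<lambda>i j. cnj (if i \<in> E then ?q i else 0) * (if j \<in> E then ?q j else 0))"
        by (auto simp: B_def fun_eq_iff)
      then show "hpsd {..<s0} B" by (simp only: hpsd_rank1)
      show "\<forall>i j. s0 \<le> i \<or> s0 \<le> j \<longrightarrow> B i j = 0" using s0 by (auto simp: B_def E_def not_less[symmetric])
    qed
    have BE: "B (prod_encode a) (prod_encode b) = cnj (q a) * q b" if "a \<in> ?S" "b \<in> ?S" for a b
      using that by (simp add: B_def E_def)
    show "bd (\<lambda>(i, p) (j, p'). cfam_cpx (cnj (q i) * q j) * lmap y p p') (Q y q)"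
      unfolding bd_def
    proof (intro bexI[of _ "pure_tensor B y"] conjI ballI allI impI)
      show "pure_tensor B y \<in> her V s0" by (rule pure_tensor_her[OF V B y])
      show "i \<notin> E \<or> j \<notin> E \<Longrightarrow> pure_tensor B y i j = 0" for i j by (auto simp: pure_tensor_def B_def zero_prod_def)
      show "form (pure_tensor B y) = Q y q"
        unfolding form_def Q_def quad_def
        by (intro sum.cong refl) (simp add: pure_tensor_def BE linear_cmul[OF \<psi>(1)])
      fix a b p p' assume ab: "a \<in> ?S" "b \<in> ?S" "p < d" "p' < d"
      have split: "cfam_cpx z * t = cfam_cpx (complex_of_real (Re z)) * t + cfam_cpx \<i> * (cfam_cpx (complex_of_real (Im z)) * t)" for z and t :: "'u cfam"
      proof -
        have "cfam_cpx z = cfam_cpx (complex_of_real (Re z)) + cfam_cpx \<i> * cfam_cpx (complex_of_real (Im z))"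
          unfolding cfam.cpx_mult[symmetric] cfam.cpx_add[symmetric] by (rule arg_cong[of _ _ cfam_cpx], rule complex_eq)
        then show ?thesis by (subst \<open>cfam_cpx z = _\<close>) (simp only: distrib_right mult.assoc)
      qed
      define w where "w = cnj (q a) * q b"
      have w: "B (prod_encode a) (prod_encode b) = w" by (simp add: w_def BE ab)
      have l: "lmap (r *\<^sub>R y) p p' = cfam_cpx (complex_of_real r) * lmap y p p'" for r
        by (simp add: lmap_scale y cfam.sc_def)
      show "(case (a, p) of (i, p) \<Rightarrow> \<lambda>(j, p'). cfam_cpx (cnj (q i) * q j) * lmap y p p') (b, p') =
         lmap (fst (pure_tensor B y (prod_encode a) (prod_encode b))) p p' +
         cfam_cpx \<i> * lmap (snd (pure_tensor B y (prod_encode a) (prod_encode b))) p p'"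
        unfolding pure_tensor_def w prod.case fst_conv snd_conv l w_def[symmetric] by (rule split)
    qed
  next
    fix M M' :: "(nat \<times> nat) \<times> nat \<Rightarrow> (nat \<times> nat) \<times> nat \<Rightarrow> 'u cfam" and r r' :: real
    assume "bd M r" "bd M' r'"
    then obtain Z Z' where Z: "Z \<in> her V s0" "\<forall>i j. i \<notin> E \<or> j \<notin> E \<longrightarrow> Z i j = 0" "form Z = r"
      "\<forall>a\<in>?S. \<forall>b\<in>?S. \<forall>p<d. \<forall>q<d. M (a, p) (b, q) = lmap (fst (Z (prod_encode a) (prod_encode b))) p q
          + cfam_cpx \<i> * lmap (snd (Z (prod_encode a) (prod_encode b))) p q"
      and Z': "Z' \<in> her V s0" "\<forall>i j. i \<notin> E \<or> j \<notin> E \<longrightarrow> Z' i j = 0" "form Z' = r'"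
      "\<forall>a\<in>?S. \<forall>b\<in>?S. \<forall>p<d. \<forall>q<d. M' (a, p) (b, q) = lmap (fst (Z' (prod_encode a) (prod_encode b))) p q
          + cfam_cpx \<i> * lmap (snd (Z' (prod_encode a) (prod_encode b))) p q"
      unfolding bd_def by blast
    show "bd (M + M') (r + r')"
      unfolding bd_def
    proof (intro bexI[of _ "\<lambda>i j. Z i j + Z' i j"] conjI ballI allI impI)
      show "(\<lambda>i j. Z i j + Z' i j) \<in> her V s0" by (rule her_add[OF V Z(1) Z'(1)])
      show "i \<notin> E \<or> j \<notin> E \<Longrightarrow> Z i j + Z' i j = 0" for i j using Z(2) Z'(2) by auto
      show "form (\<lambda>i j. Z i j + Z' i j) = r + r'"
        by (simp add: form_def linear_add[OF \<psi>(1)] sum.distrib flip: Z(3) Z'(3))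
      fix a b p q assume ab: "a \<in> ?S" "b \<in> ?S" "p < d" "q < d"
      have "M (a, p) (b, q) = lmap (fst (Z (prod_encode a) (prod_encode b))) p q + cfam_cpx \<i> * lmap (snd (Z (prod_encode a) (prod_encode b))) p q" "M' (a, p) (b, q) = lmap (fst (Z' (prod_encode a) (prod_encode b))) p q + cfam_cpx \<i> * lmap (snd (Z' (prod_encode a) (prod_encode b))) p q"
        using Z(4) Z'(4) ab by blast+
      then show "(M + M') (a, p) (b, q) = lmap (fst (Z (prod_encode a) (prod_encode b) + Z' (prod_encode a) (prod_encode b))) p q +
         cfam_cpx \<i> * lmap (snd (Z (prod_encode a) (prod_encode b) + Z' (prod_encode a) (prod_encode b))) p q"
        using herD(1,2)[OF Z(1)] herD(1,2)[OF Z'(1)]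
        by (simp add: fun_pointwise lmap_add algebra_simps)
    qed
  next
    fix M :: "(nat \<times> nat) \<times> nat \<Rightarrow> (nat \<times> nat) \<times> nat \<Rightarrow> 'u cfam" and r t :: real
    assume bdM: "bd M r"
    then obtain Z where Z: "Z \<in> her V s0" "\<forall>i j. i \<notin> E \<or> j \<notin> E \<longrightarrow> Z i j = 0" "form Z = r"
      "\<forall>a\<in>?S. \<forall>b\<in>?S. \<forall>p<d. \<forall>q<d. M (a, p) (b, q) = lmap (fst (Z (prod_encode a) (prod_encode b))) p q
          + cfam_cpx \<i> * lmap (snd (Z (prod_encode a) (prod_encode b))) p q"
      unfolding bd_def by blast
    show "bd (cfam.sc (complex_of_real t) M) (t * r)"
      unfolding bd_def
    proof (intro bexI[of _ "\<lambda>i j. t *\<^sub>R Z i j"] conjI ballI allI impI)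
      show "(\<lambda>i j. t *\<^sub>R Z i j) \<in> her V s0" by (rule her_scale[OF V Z(1)])
      show "i \<notin> E \<or> j \<notin> E \<Longrightarrow> t *\<^sub>R Z i j = 0" for i j using Z(2) by auto
      show "form (\<lambda>i j. t *\<^sub>R Z i j) = t * r"
        by (simp add: form_def linear_cmul[OF \<psi>(1)] sum_distrib_left flip: Z(3))
      fix a b p q assume ab: "a \<in> ?S" "b \<in> ?S" "p < d" "q < d"
      have "M (a, p) (b, q) = lmap (fst (Z (prod_encode a) (prod_encode b))) p q + cfam_cpx \<i> * lmap (snd (Z (prod_encode a) (prod_encode b))) p q" using Z(4) ab by blast
      then show "cfam.sc (complex_of_real t) M (a, p) (b, q) = lmap (fst (t *\<^sub>R Z (prod_encode a) (prod_encode b))) p q +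
         cfam_cpx \<i> * lmap (snd (t *\<^sub>R Z (prod_encode a) (prod_encode b))) p q"
        using herD(1,2)[OF Z(1)] by (simp add: cfam.sc_def lmap_scale algebra_simps)
    qed
    assume "cfam.sos M"
    then obtain n G where G: "\<And>c c'. M c c' = (\<Sum>k<(n::nat). cfam_star (G k c) * G k c')"
      using cfam.sos_imp_sum by blast
    \<comment> \<open>\<open>M\<close> may be a sum of more squares than the level \<open>s0\<close>
      can hold in one Gram factor. Padding \<open>Z\<close> with zeros raises the level to at least
      \<open>n\<close> without changing \<open>form Z\<close>, and the order embedding is used at
      this higher level.\<close>
    define s where "s = s0 + n + 1"
    define G' where "G' k c = (if fst c \<in> E then G k (prod_decode (fst c), snd c) else 0)" for k c
    have Zs: "Z \<in> her V s" using Z(1) by (rule her_mono) (simp add: s_def)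
    have "mat_nonneg A ({..<s} \<times> {..<d}) (ampliation A \<Phi> Z)"
    proof (rule sos_imp_mat_nonneg[where n = n and G = G'])
      show "fst (Z i j) \<in> V \<and> snd (Z i j) \<in> V" for i j using herD[OF Z(1)] by blast
      fix i p j q assume pq: "p < d" "q < d"
      show "lmap (fst (Z i j)) p q + cfam_cpx \<i> * lmap (snd (Z i j)) p q = (\<Sum>k<n. cfam_star (G' k (i, p)) * G' k (j, q))"
      proof (cases "i \<in> E \<and> j \<in> E")
        case True
        then obtain a b where ab: "a \<in> ?S" "b \<in> ?S" "i = prod_encode a" "j = prod_encode b" by (auto simp: E_def)
        have M: "M (a, p) (b, q) = lmap (fst (Z (prod_encode a) (prod_encode b))) p q + cfam_cpx \<i> * lmap (snd (Z (prod_encode a) (prod_encode b))) p q"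
          using Z(4) pq ab(1,2) by blast
        show ?thesis using True unfolding ab(3,4) M[symmetric] G by (simp add: G'_def)
      next
        case False
        then have "Z i j = 0" using Z(2) by blast
        then show ?thesis using False by (auto simp: G'_def lmap_0)
      qed
    qed (use d in \<open>auto simp: s_def\<close>)
    then have "Z \<in> min_cone C s" using emb[of s Z] Zs by (simp add: s_def)
    then have "0 \<le> form Z" by (rule form_min) (simp add: s_def)
    then show "0 \<le> r" by (simp add: Z(3))
  qed (auto simp: V CV uV)
  have "(\<Sum>i\<in>I. x i) \<in> V" by (intro subspace_sum V xV)
  then obtain k where k: "k > 0" "k *\<^sub>R u - (\<Sum>i\<in>I. x i) \<in> C" using ou by blast
  then obtain a where a: "k *\<^sub>R u - (\<Sum>i\<in>I. x i) = (\<Sum>i\<in>I. a i *\<^sub>R x i)" "\<forall>i\<in>I. 0 \<le> a i"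
    unfolding C gen_cone_def by blast
  \<comment> \<open>Subtracting the sum of all generators from a multiple of \<open>u\<close> before
    expanding makes every coefficient strictly positive; this gives Q u > 0 as soon as one generator
    has a positive form value.\<close>
  define b where "b i = (1 + a i) / k" for i
  have bpos: "0 < b i" if "i \<in> I" for i using a(2) k(1) that by (auto simp: b_def intro!: divide_pos_pos add_pos_nonneg)
  have u_sum: "u = (\<Sum>i\<in>I. b i *\<^sub>R x i)"
  proof -
    have "k *\<^sub>R u = (\<Sum>i\<in>I. (1 + a i) *\<^sub>R x i)"
      using a(1) by (simp add: scaleR_add_left sum.distrib algebra_simps)
    then have "(1 / k) *\<^sub>R (k *\<^sub>R u) = (\<Sum>i\<in>I. (1 / k) *\<^sub>R ((1 + a i) *\<^sub>R x i))"
      by (simp only: scaleR_sum_right)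
    then show ?thesis using k(1) by (simp add: b_def)
  qed
  let ?J = "{i1, i2, jj 0, jj 1, jj 2}"
  let ?r1 = "\<Sum>i\<in>I1 - {i1, i2}. z i *\<^sub>R x i" and ?r2 = "\<Sum>i\<in>I2 - {jj 0, jj 1, jj 2}. z i *\<^sub>R x i"
    and ?ru = "\<Sum>i\<in>I - ?J. b i *\<^sub>R x i"
  have finI: "finite I1" "finite I2" by (rule finite_subset[OF I12(1) I], rule finite_subset[OF I12(2) I])
  have zI: "i \<in> I1 \<Longrightarrow> 0 \<le> z i" "i \<in> I2 \<Longrightarrow> 0 \<le> z i" for i using z[of i] by auto
  have C_gen: "r *\<^sub>R x i \<in> C" if "i \<in> I" "0 \<le> r" for i r unfolding C by (rule gen_cone_gen[OF I that])
  have C_part: "(\<Sum>i\<in>J. c i *\<^sub>R x i) \<in> C" if "J \<subseteq> I" "\<And>i. i \<in> J \<Longrightarrow> 0 \<le> c i" for J c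
    unfolding C by (rule gen_cone_partial[OF I that])
  have e1: "z i1 *\<^sub>R x i1 + z i2 *\<^sub>R x i2 + ?r1 = (\<Sum>i\<in>I1. z i *\<^sub>R x i)"
  proof -
    have "(\<Sum>i\<in>I1. z i *\<^sub>R x i) = (\<Sum>i\<in>{i1, i2}. z i *\<^sub>R x i) + ?r1"
      by (subst add.commute, rule sum.subset_diff) (use finI i12 in auto)
    then show ?thesis using i12 by simp
  qed
  have e2: "z (jj 0) *\<^sub>R x (jj 0) + z (jj 1) *\<^sub>R x (jj 1) + z (jj 2) *\<^sub>R x (jj 2) + ?r2 = (\<Sum>i\<in>I2. z i *\<^sub>R x i)"
  proof -
    have "(\<Sum>i\<in>I2. z i *\<^sub>R x i) = (\<Sum>i\<in>{jj 0, jj 1, jj 2}. z i *\<^sub>R x i) + ?r2"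
      by (subst add.commute, rule sum.subset_diff) (use finI jj in auto)
    then show ?thesis using jj by (simp add: add.assoc)
  qed
  have e3: "u = (\<Sum>i\<in>?J. b i *\<^sub>R x i) + ?ru"
    unfolding u_sum by (subst add.commute, rule sum.subset_diff) (use I inI in auto)
  have uC: "u \<in> C" unfolding u_sum by (rule C_part) (use bpos in \<open>auto intro: less_imp_le\<close>)
  interpret rigid_embedding cfam_star cfam_cpx d "cfam_lift A \<one>\<^bsub>A\<^esub>" V C u lmap Q bd
    "z i1 *\<^sub>R x i1" "z i2 *\<^sub>R x i2" ?r1 ?r2 ?ru "\<lambda>j. z (jj j) *\<^sub>R x (jj j)" "b i1 / z i1" "b i2 / z i2"
    "\<lambda>j. b (jj j) / z (jj j)" "kmat m dl" m dl
  proof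
    show "v \<in> C \<Longrightarrow> w \<in> C \<Longrightarrow> v + w \<in> C" for v w unfolding C by (rule gen_cone_add)
    show "z i1 *\<^sub>R x i1 \<in> C" "z i2 *\<^sub>R x i2 \<in> C" "z (jj 0) *\<^sub>R x (jj 0) \<in> C" "z (jj 1) *\<^sub>R x (jj 1) \<in> C"
      "z (jj 2) *\<^sub>R x (jj 2) \<in> C" using inI zpos by (auto intro!: C_gen less_imp_le)
    show "?r1 \<in> C" by (rule C_part) (use I12 zI in auto)
    show "?r2 \<in> C" by (rule C_part) (use I12 zI in auto)
    show "?ru \<in> C" by (rule C_part) (use bpos in \<open>auto intro: less_imp_le\<close>)
    show "u \<in> C" by (rule uC)
    show "z i1 *\<^sub>R x i1 + z i2 *\<^sub>R x i2 + ?r1 = z (jj 0) *\<^sub>R x (jj 0) + z (jj 1) *\<^sub>R x (jj 1) + z (jj 2) *\<^sub>R x (jj 2) + ?r2"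
      unfolding e1 e2 by (rule rel)
    have "(\<Sum>i\<in>?J. b i *\<^sub>R x i) = b i1 *\<^sub>R x i1 + b i2 *\<^sub>R x i2 + (b (jj 0) *\<^sub>R x (jj 0) + b (jj 1) *\<^sub>R x (jj 1) + b (jj 2) *\<^sub>R x (jj 2))"
      using dist jj i12 by (simp add: add.assoc)
    moreover have "(b i / z i) *\<^sub>R (z i *\<^sub>R x i) = b i *\<^sub>R x i" if "0 < z i" for i using that by simp
    ultimately show "u = (b i1 / z i1) *\<^sub>R (z i1 *\<^sub>R x i1) + (b i2 / z i2) *\<^sub>R (z i2 *\<^sub>R x i2) +
      ((b (jj 0) / z (jj 0)) *\<^sub>R (z (jj 0) *\<^sub>R x (jj 0)) + (b (jj 1) / z (jj 1)) *\<^sub>R (z (jj 1) *\<^sub>R x (jj 1))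
       + (b (jj 2) / z (jj 2)) *\<^sub>R (z (jj 2) *\<^sub>R x (jj 2))) + ?ru"
      using e3 zpos by (simp only:)
    show "q \<in> fin_supp ?S \<Longrightarrow> shift_block m (kmat m dl) q = 0 \<Longrightarrow> Q (z i1 *\<^sub>R x i1) q = 0" for q
      unfolding Q1 quad_amat by (simp add: fun_pointwise)
    show "Q (z i2 *\<^sub>R x i2) (diag_embed m v) = 0" for v
    proof -
      have "quad ?S (bmat m dl j) (diag_embed m v) = quad {..<m} (kmat m dl j) v" if "j < 3" for j
        unfolding quad_bmat[OF that] unfolding quad_def using that by (intro sum.cong) (auto simp: diag_embed_def)
      then have "(\<Sum>j<3. quad ?S (bmat m dl j) (diag_embed m v)) = (\<Sum>j<3. quad {..<m} (kmat m dl j) v)"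
        by (intro sum.cong) auto
      then show ?thesis unfolding Q2 sum_slots_split quad_amat by (simp add: shift_block_kmat_diag)
    qed
    show "Q (z (jj j) *\<^sub>R x (jj j)) q = 0" if "j < 3" "q \<in> fin_supp ?S" "slot j q = 0" for j q
    proof -
      have "q (j, k) = 0" for k using fun_cong[OF that(3), of "(j, k)"] by (simp add: slot_def fun_pointwise)
      then show ?thesis unfolding Qy[OF that(1)] quad_bmat[OF that(1)] by (simp add: quad_def)
    qed
    show "Q ?r1 q = 0 \<and> Q ?r2 q = 0 \<and> Q ?ru q = 0" for q
    proof -
      have "Q (x i) q = 0" if "i \<in> I1 - {i1, i2}" for i by (rule Qo) (use that I12 jj in blast)+
      moreover have "Q (x i) q = 0" if "i \<in> I2 - {jj 0, jj 1, jj 2}" for i by (rule Qo) (use that I12 i12 in blast)+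
      moreover have "Q (x i) q = 0" if "i \<in> I - ?J" for i by (rule Qo) (use that in blast)+
      ultimately show ?thesis unfolding Q_sum by (intro conjI sum.neutral ballI) simp_all
    qed
    show "(\<Sum>j<3. kmat m dl j k l) = of_bool (k = l)" for k l by (rule kmat_sum)
    show "kmat m dl 0 k l = (if k = l then (1 + dl * real k) / 3 else 0)" for k l by (simp add: kmat_def)
    show "kmat m dl 1 k l = (of_bool (k = l) + dl * of_bool (k = Suc l \<or> l = Suc k)) / 3" for k l
      by (simp add: kmat_def)
    show "dl \<noteq> 0" "m = d * d + 3" using dl by (simp_all add: m_def)
    let ?v = "diag_embed m (\<lambda>k. of_bool (k = 0))"
    \<comment> \<open>On the diagonal triple of e_0 the row operator returns e_0, so the form of the
      scaled first generator is 1.\<close>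
    have "Q (z i1 *\<^sub>R x i1) ?v = (\<Sum>k<m. (cmod (of_bool (k = 0)))\<^sup>2)"
      unfolding Q1 quad_amat by (intro sum.cong) (auto simp: shift_block_kmat_diag)
    also have "\<dots> = (\<Sum>k<m. if k = 0 then 1 else 0)" by (intro sum.cong) auto
    also have "\<dots> = 1" by (simp add: m_def)
    finally have "z i1 * Q (x i1) ?v = 1" unfolding Q_scale[OF xV[OF inI(1)]] .
    then have "0 < z i1 * Q (x i1) ?v" by (simp only: zero_less_one)
    from zero_less_mult_pos[OF this zpos(1)] have "0 < Q (x i1) ?v" .
    then have "0 < b i1 * Q (x i1) ?v" using bpos inI by simp
    also have "\<dots> \<le> (\<Sum>i\<in>I. b i * Q (x i) ?v)"
    proof (rule member_le_sum)
      show "i1 \<in> I" "finite I" by (fact inI I)+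
      fix i assume "i \<in> I - {i1}"
      then show "0 \<le> b i * Q (x i) ?v" by (intro mult_nonneg_nonneg Qpos less_imp_le[OF bpos]) auto
    qed
    also have "\<dots> = Q u ?v" by (subst u_sum) (rule Q_sum[symmetric])
    finally show "0 < Q u ?v" .
  qed
  show False by (rule contradiction)
qed

section \<open>Positive block matrices on a path\<close>

definition sesq :: "nat \<Rightarrow> (nat \<Rightarrow> nat \<Rightarrow> complex) \<Rightarrow> (nat \<Rightarrow> complex) \<Rightarrow> (nat \<Rightarrow> complex) \<Rightarrow> complex" where
  "sesq s H x y = (\<Sum>i<s. \<Sum>j<s. cnj (x i) * H i j * y j)"

lemma sesq_diag: "sesq s H x x = herm_form {..<s} H x"
  by (simp add: sesq_def herm_form_def)

lemma sesq_zero [simp]: "sesq s (\<lambda>i j. 0) x y = 0"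
  by (simp add: sesq_def)

lemma sesq_add: "sesq s (\<lambda>i j. H i j + G i j) x y = sesq s H x y + sesq s G x y"
  and sesq_scale: "sesq s (\<lambda>i j. c * H i j) x y = c * sesq s H x y"
  unfolding sesq_def by (simp_all add: algebra_simps sum.distrib sum_distrib_left)

lemma sesq_sum_sum:
  "sesq s H (\<lambda>i. \<Sum>t\<in>A. f t * x t i) (\<lambda>i. \<Sum>t\<in>B. g t * y t i)
     = (\<Sum>t\<in>A. \<Sum>u\<in>B. cnj (f t) * g u * sesq s H (x t) (y u))"
proof -
  have "sesq s H (\<lambda>i. \<Sum>t\<in>A. f t * x t i) (\<lambda>i. \<Sum>t\<in>B. g t * y t i)
     = (\<Sum>i<s. \<Sum>j<s. \<Sum>t\<in>A. \<Sum>u\<in>B. cnj (f t) * g u * (cnj (x t i) * H i j * y u j))"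
  proof -
    have "cnj (\<Sum>t\<in>A. f t * x t i) * H i j * (\<Sum>t\<in>B. g t * y t j)
      = (\<Sum>t\<in>A. \<Sum>u\<in>B. cnj (f t) * g u * (cnj (x t i) * H i j * y u j))" for i j
    proof -
      have "cnj (\<Sum>t\<in>A. f t * x t i) * H i j * (\<Sum>t\<in>B. g t * y t j)
         = (\<Sum>t\<in>A. cnj (f t * x t i)) * (\<Sum>u\<in>B. H i j * (g u * y u j))"
        unfolding cnj_sum mult.assoc sum_distrib_left[of "H i j"] ..
      also have "\<dots> = (\<Sum>t\<in>A. \<Sum>u\<in>B. cnj (f t * x t i) * (H i j * (g u * y u j)))"
        by (rule sum_product)
      finally show ?thesis by (simp add: mult_ac)
    qed
    then show ?thesis unfolding sesq_def by (simp only:)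
  qed
  also have "\<dots> = (\<Sum>t\<in>A. \<Sum>u\<in>B. \<Sum>i<s. \<Sum>j<s. cnj (f t) * g u * (cnj (x t i) * H i j * y u j))"
  proof -
    have "(\<Sum>i<s. \<Sum>j<s. \<Sum>t\<in>A. \<Sum>u\<in>B. F i j t u) = (\<Sum>t\<in>A. \<Sum>u\<in>B. \<Sum>i<s. \<Sum>j<s. F i j t u)" for F :: "nat \<Rightarrow> nat \<Rightarrow> 'a \<Rightarrow> 'b \<Rightarrow> complex"
    proof -
      have "(\<Sum>i<s. \<Sum>j<s. \<Sum>t\<in>A. \<Sum>u\<in>B. F i j t u) = (\<Sum>i<s. \<Sum>t\<in>A. \<Sum>j<s. \<Sum>u\<in>B. F i j t u)"
        by (intro sum.cong refl sum.swap)
      also have "\<dots> = (\<Sum>t\<in>A. \<Sum>i<s. \<Sum>j<s. \<Sum>u\<in>B. F i j t u)" by (rule sum.swap)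
      also have "\<dots> = (\<Sum>t\<in>A. \<Sum>i<s. \<Sum>u\<in>B. \<Sum>j<s. F i j t u)"
        by (intro sum.cong refl sum.swap)
      also have "\<dots> = (\<Sum>t\<in>A. \<Sum>u\<in>B. \<Sum>i<s. \<Sum>j<s. F i j t u)"
        by (intro sum.cong refl sum.swap)
      finally show ?thesis .
    qed
    then show ?thesis .
  qed
  also have "\<dots> = (\<Sum>t\<in>A. \<Sum>u\<in>B. cnj (f t) * g u * sesq s H (x t) (y u))"
    unfolding sesq_def by (simp add: sum_distrib_left)
  finally show ?thesis .
qed

lemma Re_sesq_swap:
  assumes "\<And>i j. i < s \<Longrightarrow> j < s \<Longrightarrow> H j i = cnj (H i j)"
  shows "Re (sesq s H y x) = Re (sesq s H x y)"
proof -
  have "sesq s H y x = (\<Sum>j<s. \<Sum>i<s. cnj (y i) * H i j * x j)"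
    unfolding sesq_def by (rule sum.swap)
  also have "\<dots> = (\<Sum>j<s. \<Sum>i<s. cnj (cnj (x j) * H j i * y i))"
  proof (intro sum.cong refl)
    fix i j assume "j \<in> {..<s}" "i \<in> {..<s}"
    then have "H i j = cnj (H j i)" by (intro assms) auto
    then show "cnj (y i) * H i j * x j = cnj (cnj (x j) * H j i * y i)" by simp
  qed
  also have "\<dots> = cnj (sesq s H x y)" by (simp add: sesq_def)
  finally show ?thesis by simp
qed

lemma roots_orthogonal:
  assumes "t < N" "u < (N::nat)"
  shows "(\<Sum>j<N. cnj (cis (2 * pi * real j / real N) ^ t) * cis (2 * pi * real j / real N) ^ u)
     = (if t = u then of_nat N else 0)"
proof -
  let ?w = "\<lambda>t. cis (2 * pi * real t / real N)"
  have N: "0 < N" using assms by simp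
  define r where "r = cnj (?w t) * ?w u"
  have "cnj (?w j ^ t) * ?w j ^ u = r ^ j" for j
  proof -
    have "?w j ^ v = ?w v ^ j" for v
      by (simp only: Complex.DeMoivre, rule arg_cong[where f = cis]) (simp add: mult_ac)
    then show ?thesis by (simp add: r_def power_mult_distrib)
  qed
  then have sum: "(\<Sum>j<N. cnj (?w j ^ t) * ?w j ^ u) = (\<Sum>j<N. r ^ j)" by simp
  have rN: "r ^ N = 1"
  proof -
    have "?w v ^ N = 1" for v
    proof -
      have "?w v ^ N = cis (2 * pi * real v)"
        using N by (simp only: Complex.DeMoivre) simp
      then show ?thesis by (simp add: cis_multiple_2pi)
    qed
    then show ?thesis by (simp add: r_def power_mult_distrib flip: complex_cnj_power)
  qed
  show ?thesis
  proof (cases "t = u")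
    case True
    have "r = 1" unfolding r_def True using complex_norm_square[of "?w u"] by (simp add: mult.commute)
    then show ?thesis using sum True by simp
  next
    case False
    have "r \<noteq> 1"
    proof
      assume "r = 1"
      then have "?w t * (cnj (?w t) * ?w u) = ?w t" by (simp add: r_def)
      moreover have "?w t * cnj (?w t) = 1" using complex_norm_square[of "?w t"] by simp
      ultimately have "?w u = ?w t" by (simp flip: mult.assoc)
      moreover have "inj_on ?w {..<N}" using Complex.bij_betw_roots_unity[OF N] by (simp add: bij_betw_def)
      ultimately show False using False assms by (auto simp: inj_on_def)
    qed
    then show ?thesis using sum rN False by (simp add: sum_gp_strict)
  qed
qed

definition path_edge :: "('m \<Rightarrow> 'm \<Rightarrow> complex) \<Rightarrow> ('m \<Rightarrow> 'm \<Rightarrow> complex) \<Rightarrow> nat \<Rightarrow> 'm \<Rightarrow> 'm \<Rightarrow> complex" where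
  "path_edge b c k = (if even k then b else c)"

text \<open>Block tridiagonal with \<open>a\<close> on the diagonal and couplings b, c, b, c, ...: a
  finite section of the operator on the line whose 2 by 2 symbol has diagonal \<open>a\<close> and
  corner b + z c.\<close>

definition path_mat :: "(nat \<Rightarrow> nat \<Rightarrow> complex) \<Rightarrow> (nat \<Rightarrow> nat \<Rightarrow> complex) \<Rightarrow> (nat \<Rightarrow> nat \<Rightarrow> complex) \<Rightarrow>
    nat \<times> nat \<Rightarrow> nat \<times> nat \<Rightarrow> complex" where
  "path_mat a b c = (\<lambda>(p, i) (q, j). if p = q then a i j else if q = Suc p then path_edge b c p i j
     else if p = Suc q then path_edge b c q i j else 0)"

lemma path_form:
  "herm_form ({..L} \<times> {..<s}) (path_mat a b c) x =
     (\<Sum>k\<le>L. sesq s a (\<lambda>i. x (k, i)) (\<lambda>i. x (k, i))) +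
     (\<Sum>k<L. sesq s (path_edge b c k) (\<lambda>i. x (k, i)) (\<lambda>i. x (Suc k, i))
          + sesq s (path_edge b c k) (\<lambda>i. x (Suc k, i)) (\<lambda>i. x (k, i)))"
proof -
  let ?x = "\<lambda>k i. x (k, i)"
  let ?e = "path_edge b c"
  have cart: "(\<Sum>i\<in>{..L} \<times> {..<s}. F i) = (\<Sum>p\<le>L. \<Sum>i<s. F (p, i))" for F :: "nat \<times> nat \<Rightarrow> complex"
    by (simp add: sum.cartesian_product)
  have "herm_form ({..L} \<times> {..<s}) (path_mat a b c) x
     = (\<Sum>p\<le>L. \<Sum>i<s. \<Sum>q\<le>L. \<Sum>j<s. cnj (x (p, i)) * path_mat a b c (p, i) (q, j) * x (q, j))"
    unfolding herm_form_def cart ..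
  also have "\<dots> = (\<Sum>p\<le>L. \<Sum>q\<le>L. \<Sum>i<s. \<Sum>j<s. cnj (x (p, i)) * path_mat a b c (p, i) (q, j) * x (q, j))"
    by (intro sum.cong refl sum.swap)
  also have "\<dots> = (\<Sum>p\<le>L. \<Sum>q\<le>L. (if q = p then sesq s a (?x p) (?x p) else 0)
      + (if q = Suc p then sesq s (?e p) (?x p) (?x (Suc p)) else 0)
      + (if p = Suc q then sesq s (?e q) (?x (Suc q)) (?x q) else 0))"
    by (intro sum.cong refl) (auto simp: path_mat_def sesq_def)
  also have "\<dots> = (\<Sum>p\<le>L. sesq s a (?x p) (?x p)) + (\<Sum>p\<le>L. if p < L then sesq s (?e p) (?x p) (?x (Suc p)) else 0)
      + (\<Sum>q\<le>L. if q < L then sesq s (?e q) (?x (Suc q)) (?x q) else 0)"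
  proof -
    have 1: "(\<Sum>q\<le>L. if q = Suc p then F p else 0) = (if p < L then F p else 0)" for p and F :: "nat \<Rightarrow> complex" by auto
    have 2: "(\<Sum>p\<le>L. \<Sum>q\<le>L. if p = Suc q then F q else 0) = (\<Sum>q\<le>L. if q < L then F q else 0)" for F :: "nat \<Rightarrow> complex"
      by (subst sum.swap) (intro sum.cong refl, auto)
    show ?thesis unfolding sum.distrib 1 2 by (simp add: Suc_le_eq)
  qed
  also have "\<dots> = (\<Sum>p\<le>L. sesq s a (?x p) (?x p)) + (\<Sum>p<L. sesq s (?e p) (?x p) (?x (Suc p)))
      + (\<Sum>q<L. sesq s (?e q) (?x (Suc q)) (?x q))"
  proof -
    have "(\<Sum>p\<le>L. if p < L then F p else 0) = (\<Sum>p<L. F p)" for F :: "nat \<Rightarrow> complex"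
      by (rule sum.mono_neutral_cong_right) auto
    then show ?thesis by (simp only:)
  qed
  finally show ?thesis by (simp only: sum.distrib add.assoc)
qed

text \<open>Fourier analysis on a cycle: a finitely supported vector on the path is an average of vectors on
  which the path operator acts by the \<open>2 \<times> 2\<close> symbol at a root of unity.\<close>

lemma path_mat_hpsd:
  assumes herm: "\<And>i j. i < s \<Longrightarrow> j < s \<Longrightarrow> a j i = cnj (a i j)" "\<And>i j. i < s \<Longrightarrow> j < s \<Longrightarrow> b j i = cnj (b i j)"
      "\<And>i j. i < s \<Longrightarrow> j < s \<Longrightarrow> c j i = cnj (c i j)"
    and pos: "\<And>N j v w. 0 \<le> Re (sesq s a v v) + Re (sesq s a w w) + 2 * Re (sesq s b v w)
        + 2 * Re (cis (2 * pi * real j / real N) * sesq s c v w)"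
  shows "hpsd ({..2 * M} \<times> {..<s}) (path_mat a b c)"
proof (rule hpsdI)
  fix x y :: "nat \<times> nat" assume xy: "x \<in> {..2 * M} \<times> {..<s}" "y \<in> {..2 * M} \<times> {..<s}"
  obtain p i q j where e: "x = (p, i)" "y = (q, j)" by (cases x, cases y) auto
  have ij: "i < s" "j < s" using xy e by auto
  show "path_mat a b c y x = cnj (path_mat a b c x y)"
    unfolding e path_mat_def path_edge_def prod.case
    using herm[OF ij] by simp
next
  fix x :: "nat \<times> nat \<Rightarrow> complex"
  \<comment> \<open>More roots of unity than exponents occurring below, so distinct Fourier modes do
    not alias.\<close>
  define N where "N = M + 2"
  define z where "z j = cis (2 * pi * real j / real N)" for j
  \<comment> \<open>Even vertices form \<open>v\<close>, odd ones \<open>w\<close>. Vertex 2t is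
    joined to 2t + 1 by \<open>b\<close>, and 2t + 1 to 2t + 2 by \<open>c\<close>; the second edge
    relates \<open>w t\<close> to \<open>v (Suc t)\<close>, and this index shift is the factor z in
    front of \<open>c\<close>.\<close>
  define v where "v t i = x (2 * t, i)" for t i
  define w where "w t i = (if t < M then x (2 * t + 1, i) else 0)" for t i
  let ?v = "\<lambda>j i. \<Sum>t\<le>M. z j ^ t * v t i" and ?w = "\<lambda>j i. \<Sum>t<M. z j ^ t * w t i"
  have orth: "(\<Sum>j<N. cnj (z j ^ t) * z j ^ u) = (if t = u then of_nat N else 0)" if "t \<le> Suc M" "u \<le> Suc M" for t u
    unfolding z_def by (rule roots_orthogonal) (use that in \<open>auto simp: N_def\<close>)
  have swap3: "(\<Sum>j<N. \<Sum>t\<in>A. \<Sum>u\<in>B. F j t u) = (\<Sum>t\<in>A. \<Sum>u\<in>B. \<Sum>j<N. F j t u)" for F :: "nat \<Rightarrow> nat \<Rightarrow> nat \<Rightarrow> complex" and A B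
  proof -
    have "(\<Sum>j<N. \<Sum>t\<in>A. \<Sum>u\<in>B. F j t u) = (\<Sum>t\<in>A. \<Sum>j<N. \<Sum>u\<in>B. F j t u)" by (rule sum.swap)
    also have "\<dots> = (\<Sum>t\<in>A. \<Sum>u\<in>B. \<Sum>j<N. F j t u)" by (intro sum.cong refl sum.swap)
    finally show ?thesis .
  qed
  have vv: "(\<Sum>j<N. sesq s a (?v j) (?v j)) = of_nat N * (\<Sum>t\<le>M. sesq s a (v t) (v t))"
  proof -
    have "(\<Sum>j<N. sesq s a (?v j) (?v j)) = (\<Sum>t\<le>M. \<Sum>u\<le>M. (\<Sum>j<N. cnj (z j ^ t) * z j ^ u) * sesq s a (v t) (v u))"
      unfolding sesq_sum_sum swap3 sum_distrib_right ..
    also have "\<dots> = (\<Sum>t\<le>M. \<Sum>u\<le>M. if t = u then of_nat N * sesq s a (v t) (v t) else 0)"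
      by (intro sum.cong refl, subst orth) auto
    finally show ?thesis by (simp add: sum_distrib_left)
  qed
  have ww: "(\<Sum>j<N. sesq s a (?w j) (?w j)) = of_nat N * (\<Sum>t<M. sesq s a (w t) (w t))"
  proof -
    have "(\<Sum>j<N. sesq s a (?w j) (?w j)) = (\<Sum>t<M. \<Sum>u<M. (\<Sum>j<N. cnj (z j ^ t) * z j ^ u) * sesq s a (w t) (w u))"
      unfolding sesq_sum_sum swap3 sum_distrib_right ..
    also have "\<dots> = (\<Sum>t<M. \<Sum>u<M. if t = u then of_nat N * sesq s a (w t) (w t) else 0)"
      by (intro sum.cong refl, subst orth) auto
    finally show ?thesis by (simp add: sum_distrib_left)
  qed
  have vw: "(\<Sum>j<N. sesq s b (?v j) (?w j)) = of_nat N * (\<Sum>t<M. sesq s b (v t) (w t))"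
  proof -
    have "(\<Sum>j<N. sesq s b (?v j) (?w j)) = (\<Sum>t\<le>M. \<Sum>u<M. (\<Sum>j<N. cnj (z j ^ t) * z j ^ u) * sesq s b (v t) (w u))"
      unfolding sesq_sum_sum swap3 sum_distrib_right ..
    also have "\<dots> = (\<Sum>t\<le>M. \<Sum>u<M. if t = u then of_nat N * sesq s b (v t) (w t) else 0)"
      by (intro sum.cong refl, subst orth) auto
    also have "\<dots> = (\<Sum>u<M. of_nat N * sesq s b (v u) (w u))"
      by (subst sum.swap) simp
    finally show ?thesis by (simp add: sum_distrib_left)
  qed
  have vzw: "(\<Sum>j<N. z j * sesq s c (?v j) (?w j)) = of_nat N * (\<Sum>t<M. sesq s c (v (Suc t)) (w t))"
  proof -
    have "(\<Sum>j<N. z j * sesq s c (?v j) (?w j)) = (\<Sum>j<N. \<Sum>t\<le>M. \<Sum>u<M. cnj (z j ^ t) * z j ^ Suc u * sesq s c (v t) (w u))"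
      unfolding sesq_sum_sum sum_distrib_left by (intro sum.cong refl) (simp add: mult_ac)
    also have "\<dots> = (\<Sum>t\<le>M. \<Sum>u<M. (\<Sum>j<N. cnj (z j ^ t) * z j ^ Suc u) * sesq s c (v t) (w u))"
      unfolding swap3 sum_distrib_right ..
    also have "\<dots> = (\<Sum>t\<le>M. \<Sum>u<M. if t = Suc u then of_nat N * sesq s c (v (Suc u)) (w u) else 0)"
      by (intro sum.cong refl, subst orth) auto
    also have "\<dots> = (\<Sum>u<M. of_nat N * sesq s c (v (Suc u)) (w u))"
      by (subst sum.swap) (intro sum.cong refl, auto)
    finally show ?thesis by (simp add: sum_distrib_left)
  qed
  have split_atMost: "(\<Sum>k\<le>2 * M. F k) = (\<Sum>t\<le>M. F (2 * t)) + (\<Sum>t<M. F (2 * t + 1))" for F :: "nat \<Rightarrow> complex"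
    by (induction M) (auto simp: algebra_simps)
  have split_less: "(\<Sum>k<2 * M. F k) = (\<Sum>t<M. F (2 * t)) + (\<Sum>t<M. F (2 * t + 1))" for F :: "nat \<Rightarrow> complex"
    by (induction M) (auto simp: algebra_simps)
  have wt: "w t = (\<lambda>i. x (2 * t + 1, i))" if "t < M" for t using that by (auto simp: w_def)
  have vt: "v t = (\<lambda>i. x (2 * t, i))" for t by (auto simp: v_def)
  have pf: "Re (herm_form ({..2 * M} \<times> {..<s}) (path_mat a b c) x) =
     Re (\<Sum>t\<le>M. sesq s a (v t) (v t)) + Re (\<Sum>t<M. sesq s a (w t) (w t)) + 2 * Re (\<Sum>t<M. sesq s b (v t) (w t))
     + 2 * Re (\<Sum>t<M. sesq s c (v (Suc t)) (w t))"
  proof -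
    have "(\<Sum>t<M. Re (sesq s b (w t) (v t))) = (\<Sum>t<M. Re (sesq s b (v t) (w t)))"
      by (intro sum.cong refl Re_sesq_swap herm)
    moreover have "(\<Sum>t<M. Re (sesq s c (w t) (v (Suc t)))) = (\<Sum>t<M. Re (sesq s c (v (Suc t)) (w t)))"
      by (intro sum.cong refl Re_sesq_swap herm)
    moreover have "herm_form ({..2 * M} \<times> {..<s}) (path_mat a b c) x = (\<Sum>t\<le>M. sesq s a (v t) (v t)) + (\<Sum>t<M. sesq s a (w t) (w t))
       + ((\<Sum>t<M. sesq s b (v t) (w t) + sesq s b (w t) (v t)) + (\<Sum>t<M. sesq s c (w t) (v (Suc t)) + sesq s c (v (Suc t)) (w t)))"
      unfolding path_form split_atMost split_less by (simp add: path_edge_def vt wt)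
    ultimately show ?thesis by (simp add: sum.distrib)
  qed
  have "0 \<le> (\<Sum>j<N. Re (sesq s a (?v j) (?v j)) + Re (sesq s a (?w j) (?w j)) + 2 * Re (sesq s b (?v j) (?w j))
      + 2 * Re (z j * sesq s c (?v j) (?w j)))"
    unfolding z_def by (intro sum_nonneg pos)
  also have "\<dots> = Re (\<Sum>j<N. sesq s a (?v j) (?v j)) + Re (\<Sum>j<N. sesq s a (?w j) (?w j))
      + 2 * Re (\<Sum>j<N. sesq s b (?v j) (?w j)) + 2 * Re (\<Sum>j<N. z j * sesq s c (?v j) (?w j))"
    by (simp add: sum.distrib sum_distrib_left)
  also have "\<dots> = real N * Re (herm_form ({..2 * M} \<times> {..<s}) (path_mat a b c) x)"
    unfolding vv ww vw vzw pf by (simp add: algebra_simps)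
  finally show "0 \<le> Re (herm_form ({..2 * M} \<times> {..<s}) (path_mat a b c) x)"
    by (simp add: zero_le_mult_iff N_def)
qed

lemma hpsd_reindex:
  assumes "inj_on f J" "hpsd (f ` J) H"
  shows "hpsd J (\<lambda>i j. H (f i) (f j))"
proof (rule hpsdI)
  fix i j assume "i \<in> J" "j \<in> J"
  then show "H (f j) (f i) = cnj (H (f i) (f j))" by (intro hpsd_herm[OF assms(2)]) auto
next
  fix x
  have "herm_form J (\<lambda>i j. H (f i) (f j)) x = herm_form (f ` J) H (\<lambda>k. x (inv_into J f k))"
    unfolding herm_form_def using assms(1) by (simp add: sum.reindex)
  then show "0 \<le> Re (herm_form J (\<lambda>i j. H (f i) (f j)) x)" using hpsd_pos[OF assms(2)] by simp
qed

text \<open>The matrix left after eliminating the vertices below \<open>k\<close>. Only the block of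
  vertex \<open>k\<close> has changed: elimination of its predecessor has subtracted \<beta> from
  \<open>a\<close>.\<close>

definition residual :: "(nat \<Rightarrow> nat \<Rightarrow> complex) \<Rightarrow> (nat \<Rightarrow> nat \<Rightarrow> complex) \<Rightarrow> (nat \<Rightarrow> nat \<Rightarrow> complex) \<Rightarrow>
    nat \<Rightarrow> (nat \<Rightarrow> nat \<Rightarrow> complex) \<Rightarrow> nat \<times> nat \<Rightarrow> nat \<times> nat \<Rightarrow> complex" where
  "residual a b c k \<beta> = (\<lambda>(p, i) (q, j). if p < k \<or> q < k then 0
     else if p = k \<and> q = k then a i j - \<beta> i j else path_mat a b c (p, i) (q, j))"

text \<open>The path is a chordal graph: eliminating its vertices one by one splits the path matrix into
  positive semidefinite blocks, one for each edge.\<close>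

lemma path_chain:
  fixes s L k :: nat
  assumes herm: "\<And>i j. i < s \<Longrightarrow> j < s \<Longrightarrow> b j i = cnj (b i j)" "\<And>i j. i < s \<Longrightarrow> j < s \<Longrightarrow> c j i = cnj (c i j)"
    and H: "hpsd ({..L} \<times> {..<s}) (path_mat a b c)" and kL: "k \<le> L"
  shows "\<exists>\<beta> P. hpsd ({..L} \<times> {..<s}) (residual a b c k \<beta>) \<and>
    (\<forall>t<k. hpsd {..<s} (\<lambda>i j. P t i j + 2 * path_edge b c t i j) \<and> hpsd {..<s} (\<lambda>i j. P t i j - 2 * path_edge b c t i j)) \<and>
    (\<forall>i<s. \<forall>j<s. (\<Sum>t<k. P t i j) = of_nat k * a i j + \<beta> i j)"
  using kL
proof (induction k)
  case 0
  have "hpsd ({..L} \<times> {..<s}) (residual a b c 0 (\<lambda>i j. 0))"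
    using H by (rule hpsd_cong[THEN iffD1, rotated]) (auto simp: residual_def path_mat_def)
  then show ?case by (intro exI[of _ "\<lambda>i j. 0"] exI[of _ "\<lambda>t i j. 0"]) simp
next
  case (Suc k)
  then obtain \<beta> P where R: "hpsd ({..L} \<times> {..<s}) (residual a b c k \<beta>)"
    and P: "\<And>t. t < k \<Longrightarrow> hpsd {..<s} (\<lambda>i j. P t i j + 2 * path_edge b c t i j) \<and> hpsd {..<s} (\<lambda>i j. P t i j - 2 * path_edge b c t i j)"
    and S: "\<And>i j. i < s \<Longrightarrow> j < s \<Longrightarrow> (\<Sum>t<k. P t i j) = of_nat k * a i j + \<beta> i j"
    by force
  let ?I = "{..L} \<times> {..<s}" and ?J = "{k} \<times> {..<s}" and ?N = "{k, Suc k} \<times> {..<s}" and ?R = "residual a b c k \<beta>"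
  let ?e = "path_edge b c k"
  have "\<exists>(n::nat) y. hpsd ?I (\<lambda>i j. ?R i j - (\<Sum>t<n. cnj (y t i) * y t j)) \<and>
     (\<forall>a\<in>?J. \<forall>j\<in>?I. (\<Sum>t<n. cnj (y t a) * y t j) = ?R a j) \<and>
     (\<forall>t<n. \<forall>j\<in>?I. j \<notin> ?N \<longrightarrow> y t j = 0)"
    by (rule hpsd_eliminate_set[OF R]) (use Suc.prems in \<open>auto simp: residual_def path_mat_def split: if_splits\<close>)
  then obtain n :: nat and y where y: "hpsd ?I (\<lambda>i j. ?R i j - (\<Sum>t<n. cnj (y t i) * y t j)) \<and>
     (\<forall>a\<in>?J. \<forall>j\<in>?I. (\<Sum>t<n. cnj (y t a) * y t j) = ?R a j) \<and>
     (\<forall>t<n. \<forall>j\<in>?I. j \<notin> ?N \<longrightarrow> y t j = 0)" by blast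
  define E where "E i j = (\<Sum>t<n. cnj (y t i) * y t j)" for i j
  have E1: "hpsd ?I (\<lambda>i j. ?R i j - E i j)" using y by (simp add: E_def)
  have E2: "E (k, i) z = ?R (k, i) z" if "i < s" "z \<in> ?I" for i z
    using y that unfolding E_def by blast
  have E3: "E w z = 0" if "w \<in> ?I" "z \<in> ?I" "w \<notin> ?N \<or> z \<notin> ?N" for w z
  proof -
    have "y t w = 0 \<or> y t z = 0" if "t < n" for t
      using y that \<open>w \<in> ?I\<close> \<open>z \<in> ?I\<close> \<open>w \<notin> ?N \<or> z \<notin> ?N\<close> by blast
    then show ?thesis unfolding E_def by (intro sum.neutral) auto
  qed
  have Eh: "E z w = cnj (E w z)" for z w by (simp add: E_def mult.commute)
  have R_herm: "?R z w = cnj (?R w z)" if "w \<in> ?I" "z \<in> ?I" for z w by (rule hpsd_herm[OF R that])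
  have E4: "E z (k, j) = ?R z (k, j)" if "j < s" "z \<in> ?I" for j z
  proof -
    have "(k, j) \<in> ?I" using that Suc.prems by auto
    then show ?thesis using E2[OF that] Eh[of z "(k, j)"] R_herm[of "(k, j)" z] that by simp
  qed
  \<comment> \<open>What the elimination of vertex \<open>k\<close> subtracts from the block of its
    successor. Recording a - \<beta> + \<beta>' for the edge makes the sum over the edges
    telescope.\<close>
  define \<beta>' where "\<beta>' i j = E (Suc k, i) (Suc k, j)" for i j
  define P' where "P' = P(k := (\<lambda>i j. a i j - \<beta> i j + \<beta>' i j))"
  have eh: "?e j i = cnj (?e i j)" if "i < s" "j < s" for i j
    using herm(1)[OF that] herm(2)[OF that] by (simp add: path_edge_def)
  have Ekk: "E (k, i) (k, j) = a i j - \<beta> i j" "E (k, i) (Suc k, j) = ?e i j" "E (Suc k, i) (k, j) = ?e i j"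
    if "i < s" "j < s" for i j
  proof -
    show "E (k, i) (k, j) = a i j - \<beta> i j"
      using E2[of i "(k, j)"] that Suc.prems by (simp add: residual_def)
    have 1: "E (k, i) (Suc k, j) = ?e i j" if "i < s" "j < s" for i j
      using E2[of i "(Suc k, j)"] that Suc.prems by (simp add: residual_def path_mat_def)
    show "E (k, i) (Suc k, j) = ?e i j" by (rule 1[OF that])
    show "E (Suc k, i) (k, j) = ?e i j"
      using Eh[of "(Suc k, i)" "(k, j)"] 1[OF that(2,1)] eh[OF that(2,1)] by simp
  qed
  \<comment> \<open>The two-vertex Gram matrix \<open>E\<close> is tested on vectors that are equal
    or opposite on the vertices \<open>k\<close> and \<open>k + 1\<close>: r = 1 and r = -1 give a -
    \<beta> + \<beta>' plus and minus twice the coupling.\<close>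
  have gram: "hpsd {..<s} (\<lambda>i j. \<Sum>t<n. cnj (y t (k, i) + r * y t (Suc k, i)) * (y t (k, j) + r * y t (Suc k, j)))" for r
    by (intro hpsd_sum hpsd_rank1)
  have "(\<Sum>t<n. cnj (y t (k, i) + complex_of_real r * y t (Suc k, i)) * (y t (k, j) + complex_of_real r * y t (Suc k, j)))
     = E (k, i) (k, j) + r * E (k, i) (Suc k, j) + r * E (Suc k, i) (k, j) + r * r * E (Suc k, i) (Suc k, j)" for r :: real and i j
    unfolding E_def by (simp add: algebra_simps sum.distrib sum_distrib_left)
  note expand = this
  have hp: "hpsd {..<s} (\<lambda>i j. E (k, i) (k, j) + complex_of_real r * E (k, i) (Suc k, j) + complex_of_real r * E (Suc k, i) (k, j)
       + complex_of_real r * complex_of_real r * E (Suc k, i) (Suc k, j))" for r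
    by (rule hpsd_cong[THEN iffD1, OF _ gram[of "complex_of_real r"]]) (simp only: expand of_real_mult)
  have "hpsd {..<s} (\<lambda>i j. P' k i j + 2 * ?e i j)"
    by (rule hpsd_cong[THEN iffD1, OF _ hp[of 1]]) (auto simp: Ekk P'_def \<beta>'_def)
  moreover have "hpsd {..<s} (\<lambda>i j. P' k i j - 2 * ?e i j)"
    by (rule hpsd_cong[THEN iffD1, OF _ hp[of "-1"]]) (auto simp: Ekk P'_def \<beta>'_def)
  ultimately have PP: "\<forall>t<Suc k. hpsd {..<s} (\<lambda>i j. P' t i j + 2 * path_edge b c t i j) \<and> hpsd {..<s} (\<lambda>i j. P' t i j - 2 * path_edge b c t i j)"
    using P by (auto simp: P'_def less_Suc_eq)
  have "(\<Sum>t<Suc k. P' t i j) = of_nat (Suc k) * a i j + \<beta>' i j" if "i < s" "j < s" for i j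
    using S[OF that] by (simp add: P'_def algebra_simps)
  moreover have "hpsd ?I (residual a b c (Suc k) \<beta>')"
  proof (rule hpsd_cong[THEN iffD1, OF _ E1])
    fix w z assume w: "w \<in> ?I" and z: "z \<in> ?I"
    obtain p i q j where e: "w = (p, i)" "z = (q, j)" by (cases w, cases z) auto
    have ij: "i < s" "j < s" using w z e by auto
    consider "p = k" | "q = k" | "p < k \<or> q < k" "p \<noteq> k" "q \<noteq> k" | "p = Suc k" "q = Suc k"
      | "p > k" "q > k" "\<not> (p = Suc k \<and> q = Suc k)" by linarith
    then show "?R w z - E w z = residual a b c (Suc k) \<beta>' w z"
    proof cases
      case 1 then show ?thesis using E2[of i z] ij z e by (simp add: residual_def)
    next
      case 2 then show ?thesis using E4[of j w] ij w e by (simp add: residual_def)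
    next
      case 3
      then have "E w z = 0" using E3[of w z] w z e by auto
      then show ?thesis using 3 e by (auto simp: residual_def)
    next
      case 4 then show ?thesis using e by (simp add: residual_def \<beta>'_def path_mat_def)
    next
      case 5
      then have "E w z = 0" using E3[of w z] w z e by auto
      then show ?thesis using 5 e by (auto simp: residual_def)
    qed
  qed
  ultimately show ?case using PP by blast
qed

text \<open>Average the edge blocks of \<open>path_chain\<close>, even edges separately from odd
  ones: each family controls only its own coupling. The boundary of the path costs the factor 1 +
  1/(2M).\<close>

lemma approximate_split:
  fixes s M :: nat
  assumes herm: "\<And>i j. i < s \<Longrightarrow> j < s \<Longrightarrow> b j i = cnj (b i j)" "\<And>i j. i < s \<Longrightarrow> j < s \<Longrightarrow> c j i = cnj (c i j)"
    and H: "hpsd ({..2 * M} \<times> {..<s}) (path_mat a b c)" and M: "0 < M"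
  shows "\<exists>a0 a1. hpsd {..<s} (\<lambda>i j. a0 i j + b i j) \<and> hpsd {..<s} (\<lambda>i j. a0 i j - b i j) \<and>
    hpsd {..<s} (\<lambda>i j. a1 i j + c i j) \<and> hpsd {..<s} (\<lambda>i j. a1 i j - c i j) \<and>
    (\<forall>i<s. \<forall>j<s. a0 i j + a1 i j = (1 + 1 / of_nat (2 * M)) * a i j)"
proof -
  have "\<exists>\<beta> P. hpsd ({..2 * M} \<times> {..<s}) (residual a b c (2 * M) \<beta>) \<and>
    (\<forall>t<2 * M. hpsd {..<s} (\<lambda>i j. P t i j + 2 * path_edge b c t i j) \<and> hpsd {..<s} (\<lambda>i j. P t i j - 2 * path_edge b c t i j)) \<and>
    (\<forall>i<s. \<forall>j<s. (\<Sum>t<2 * M. P t i j) = of_nat (2 * M) * a i j + \<beta> i j)"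
    by (rule path_chain[OF herm H order_refl])
  then obtain \<beta> P where RP: "hpsd ({..2 * M} \<times> {..<s}) (residual a b c (2 * M) \<beta>) \<and>
    (\<forall>t<2 * M. hpsd {..<s} (\<lambda>i j. P t i j + 2 * path_edge b c t i j) \<and> hpsd {..<s} (\<lambda>i j. P t i j - 2 * path_edge b c t i j)) \<and>
    (\<forall>i<s. \<forall>j<s. (\<Sum>t<2 * M. P t i j) = of_nat (2 * M) * a i j + \<beta> i j)"
    by (elim exE) (rule that)
  have R: "hpsd ({..2 * M} \<times> {..<s}) (residual a b c (2 * M) \<beta>)" using RP by (rule conjunct1)
  have P: "hpsd {..<s} (\<lambda>i j. P t i j + 2 * path_edge b c t i j)" "hpsd {..<s} (\<lambda>i j. P t i j - 2 * path_edge b c t i j)"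
    if "t < 2 * M" for t using RP that by simp_all
  have S: "(\<Sum>t<2 * M. P t i j) = of_nat (2 * M) * a i j + \<beta> i j" if "i < s" "j < s" for i j
    using RP that by simp
  have P0: "hpsd {..<s} (\<lambda>i j. P (2 * t) i j + 2 * b i j)" "hpsd {..<s} (\<lambda>i j. P (2 * t) i j - 2 * b i j)" if "t \<in> {..<M}" for t
    using P[of "2 * t"] that by (simp_all add: path_edge_def)
  have P1: "hpsd {..<s} (\<lambda>i j. P (2 * t + 1) i j + 2 * c i j)" "hpsd {..<s} (\<lambda>i j. P (2 * t + 1) i j - 2 * c i j)" if "t \<in> {..<M}" for t
    using P[of "2 * t + 1"] that by (simp_all add: path_edge_def)
  have slack: "hpsd {..<s} (\<lambda>i j. a i j - \<beta> i j)"
  proof -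
    have "hpsd ((\<lambda>i. (2 * M, i)) ` {..<s}) (residual a b c (2 * M) \<beta>)"
      by (rule hpsd_subset[OF R]) auto
    from hpsd_reindex[OF _ this] show ?thesis by (simp add: residual_def inj_on_def)
  qed
  define r where "r = 1 / real (2 * M)"
  have r0: "0 \<le> r" by (simp add: r_def)
  have rM: "complex_of_real r * (of_nat M * 2) = 1" using M by (simp add: r_def)
  \<comment> \<open>The edge blocks sum to 2M a + \<beta>. Adding the positive slack a - \<beta> of
    the last vertex cancels \<beta>, so the total becomes exactly (2M + 1) a.\<close>
  define a0 where "a0 i j = complex_of_real r * ((\<Sum>t<M. P (2 * t) i j) + (a i j - \<beta> i j))" for i j
  define a1 where "a1 i j = complex_of_real r * (\<Sum>t<M. P (2 * t + 1) i j)" for i j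
  have rMx: "complex_of_real r * (\<Sum>t<M. 2 * x) = x" for x
    using rM by (simp add: mult.assoc[symmetric])
  have q: "hpsd {..<s} (\<lambda>i j. complex_of_real r * ((\<Sum>t<M. P (2 * t) i j + 2 * b i j) + (a i j - \<beta> i j)))"
    "hpsd {..<s} (\<lambda>i j. complex_of_real r * ((\<Sum>t<M. P (2 * t) i j - 2 * b i j) + (a i j - \<beta> i j)))"
    "hpsd {..<s} (\<lambda>i j. complex_of_real r * (\<Sum>t<M. P (2 * t + 1) i j + 2 * c i j))"
    "hpsd {..<s} (\<lambda>i j. complex_of_real r * (\<Sum>t<M. P (2 * t + 1) i j - 2 * c i j))"
    by (rule hpsd_scale[OF hpsd_add[OF hpsd_sum[OF P0(1)] slack] r0], assumption,
      rule hpsd_scale[OF hpsd_add[OF hpsd_sum[OF P0(2)] slack] r0], assumption,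
      rule hpsd_scale[OF hpsd_sum[OF P1(1)] r0], assumption, rule hpsd_scale[OF hpsd_sum[OF P1(2)] r0], assumption)
  have eq: "complex_of_real r * ((\<Sum>t<M. P (2 * t) i j + 2 * b i j) + (a i j - \<beta> i j)) = a0 i j + b i j"
    "complex_of_real r * ((\<Sum>t<M. P (2 * t) i j - 2 * b i j) + (a i j - \<beta> i j)) = a0 i j - b i j"
    "complex_of_real r * (\<Sum>t<M. P (2 * t + 1) i j + 2 * c i j) = a1 i j + c i j"
    "complex_of_real r * (\<Sum>t<M. P (2 * t + 1) i j - 2 * c i j) = a1 i j - c i j" for i j
    unfolding a0_def a1_def sum.distrib sum_subtractf distrib_left right_diff_distrib rMx by simp_all
  have "a0 i j + a1 i j = (1 + 1 / of_nat (2 * M)) * a i j" if "i < s" "j < s" for i j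
  proof -
    have split: "(\<Sum>k<2 * M. F k) = (\<Sum>t<M. F (2 * t)) + (\<Sum>t<M. F (2 * t + 1))" for F :: "nat \<Rightarrow> complex"
      by (induction M) (auto simp: algebra_simps)
    have "a0 i j + a1 i j = complex_of_real r * ((\<Sum>t<2 * M. P t i j) + (a i j - \<beta> i j))"
      unfolding a0_def a1_def split by (simp add: algebra_simps)
    also have "\<dots> = complex_of_real r * ((of_nat (2 * M) + 1) * a i j)"
      unfolding S[OF that] by (simp add: algebra_simps)
    also have "\<dots> = (1 + 1 / of_nat (2 * M)) * a i j" using M by (simp add: r_def field_simps)
    finally show ?thesis .
  qed
  then show ?thesis using q unfolding eq by blast
qed

lemma hpsd_entry_bound:
  assumes "hpsd I H" "finite I" "i \<in> I" "j \<in> I"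
  shows "2 * cmod (H i j) \<le> Re (H i i) + Re (H j j)"
proof -
  obtain n :: nat and y where y: "\<forall>i\<in>I. \<forall>j\<in>I. H i j = (\<Sum>t<n. cnj (y t i) * y t j)"
    using hpsd_gram_ex[OF assms(1,2)] by blast
  have d: "Re (H k k) = (\<Sum>t<n. (cmod (y t k))\<^sup>2)" if "k \<in> I" for k
  proof -
    have "H k k = (\<Sum>t<n. cnj (y t k) * y t k)" using y that by blast
    also have "\<dots> = (\<Sum>t<n. complex_of_real ((cmod (y t k))\<^sup>2))"
      by (intro sum.cong refl) (use complex_norm_square in \<open>simp add: mult.commute\<close>)
    finally show ?thesis by simp
  qed
  have "H i j = (\<Sum>t<n. cnj (y t i) * y t j)" using y assms by blast
  then have "2 * cmod (H i j) \<le> 2 * (\<Sum>t<n. cmod (y t i) * cmod (y t j))"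
    using norm_sum[of "\<lambda>t. cnj (y t i) * y t j" "{..<n}"] by (simp add: norm_mult)
  also have "\<dots> \<le> (\<Sum>t<n. (cmod (y t i))\<^sup>2 + (cmod (y t j))\<^sup>2)"
    unfolding sum_distrib_left
    by (intro sum_mono) (use sum_squares_bound in \<open>simp add: mult.assoc\<close>)
  also have "\<dots> = Re (H i i) + Re (H j j)" using d assms by (simp add: sum.distrib)
  finally show ?thesis .
qed

lemma common_subsequence:
  fixes f :: "nat \<Rightarrow> 'i \<Rightarrow> complex"
  assumes "finite S" "\<And>i. i \<in> S \<Longrightarrow> bounded (range (\<lambda>n. f n i))"
  shows "\<exists>r::nat \<Rightarrow> nat. strict_mono r \<and> (\<forall>i\<in>S. convergent (\<lambda>n. f (r n) i))"
  using assms
proof (induction S rule: finite_induct)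
  case empty then show ?case by (auto intro: exI[of _ id] simp: strict_mono_id)
next
  case (insert i S)
  then obtain r :: "nat \<Rightarrow> nat" where r: "strict_mono r" "\<And>j. j \<in> S \<Longrightarrow> convergent (\<lambda>n. f (r n) j)" by auto
  have "bounded (range (\<lambda>n. f (r n) i))" by (rule bounded_subset[OF insert.prems[of i]]) auto
  then obtain l q where q: "strict_mono q" "((\<lambda>n. f (r n) i) \<circ> q) \<longlonglongrightarrow> l"
    using bounded_imp_convergent_subsequence by blast
  have "convergent (\<lambda>n. f ((r \<circ> q) n) j)" if "j \<in> insert i S" for j
  proof (cases "j = i")
    case True then show ?thesis using q(2) by (auto simp: o_def convergent_def)
  next
    case False
    then have "convergent (\<lambda>n. f (r n) j)" using r that by auto
    from convergent_subseq_convergent[OF this q(1)] show ?thesis by (simp add: o_def)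
  qed
  then show ?case using strict_mono_o[OF r(1) q(1)] by blast
qed

lemma hpsd_limit:
  assumes "\<And>n. hpsd I (H n)" "\<And>i j. i \<in> I \<Longrightarrow> j \<in> I \<Longrightarrow> (\<lambda>n. H n i j) \<longlonglongrightarrow> G i j"
  shows "hpsd I G"
proof (rule hpsdI)
  fix i j assume ij: "i \<in> I" "j \<in> I"
  have "(\<lambda>n. cnj (H n i j)) \<longlonglongrightarrow> cnj (G i j)" by (intro tendsto_intros assms(2) ij)
  moreover have "(\<lambda>n. cnj (H n i j)) = (\<lambda>n. H n j i)" using hpsd_herm[OF assms(1) ij] by simp
  ultimately show "G j i = cnj (G i j)" using assms(2)[OF ij(2,1)] LIMSEQ_unique by metis
next
  fix x
  have "(\<lambda>n. Re (herm_form I (H n) x)) \<longlonglongrightarrow> Re (herm_form I G x)"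
    unfolding herm_form_def by (intro tendsto_intros assms(2))
  then show "0 \<le> Re (herm_form I G x)"
    by (rule LIMSEQ_le_const) (use hpsd_pos[OF assms(1)] in blast)
qed

text \<open>Limit of the approximate splits. The candidates for a0 are positive with diagonal
  bounded in terms of \<open>a\<close>, hence all their entries are bounded and a subsequence
  converges; positivity is closed.\<close>

lemma square_split:
  fixes s :: nat
  assumes herm: "\<And>i j. i < s \<Longrightarrow> j < s \<Longrightarrow> a j i = cnj (a i j)" "\<And>i j. i < s \<Longrightarrow> j < s \<Longrightarrow> b j i = cnj (b i j)"
      "\<And>i j. i < s \<Longrightarrow> j < s \<Longrightarrow> c j i = cnj (c i j)"
    and pos: "\<And>N j v w. 0 \<le> Re (sesq s a v v) + Re (sesq s a w w) + 2 * Re (sesq s b v w)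
        + 2 * Re (cis (2 * pi * real j / real N) * sesq s c v w)"
  shows "\<exists>a0 a1. hpsd {..<s} (\<lambda>i j. a0 i j + b i j) \<and> hpsd {..<s} (\<lambda>i j. a0 i j - b i j) \<and>
    hpsd {..<s} (\<lambda>i j. a1 i j + c i j) \<and> hpsd {..<s} (\<lambda>i j. a1 i j - c i j) \<and>
    (\<forall>i<s. \<forall>j<s. a0 i j + a1 i j = a i j)"
proof -
  let ?I = "{..<s}"
  have "\<forall>n. \<exists>a0 a1. hpsd ?I (\<lambda>i j. a0 i j + b i j) \<and> hpsd ?I (\<lambda>i j. a0 i j - b i j) \<and>
    hpsd ?I (\<lambda>i j. a1 i j + c i j) \<and> hpsd ?I (\<lambda>i j. a1 i j - c i j) \<and>
    (\<forall>i<s. \<forall>j<s. a0 i j + a1 i j = (1 + 1 / of_nat (2 * Suc n)) * a i j)"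
    by (intro allI approximate_split herm path_mat_hpsd pos) auto
  from choice[OF this] obtain A0 where "\<forall>n. \<exists>a1. hpsd ?I (\<lambda>i j. A0 n i j + b i j) \<and> hpsd ?I (\<lambda>i j. A0 n i j - b i j) \<and>
    hpsd ?I (\<lambda>i j. a1 i j + c i j) \<and> hpsd ?I (\<lambda>i j. a1 i j - c i j) \<and>
    (\<forall>i<s. \<forall>j<s. A0 n i j + a1 i j = (1 + 1 / of_nat (2 * Suc n)) * a i j)" by (elim exE) (rule that)
  from choice[OF this] obtain A1 where AA: "\<forall>n. hpsd ?I (\<lambda>i j. A0 n i j + b i j) \<and> hpsd ?I (\<lambda>i j. A0 n i j - b i j) \<and>
    hpsd ?I (\<lambda>i j. A1 n i j + c i j) \<and> hpsd ?I (\<lambda>i j. A1 n i j - c i j) \<and>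
    (\<forall>i<s. \<forall>j<s. A0 n i j + A1 n i j = (1 + 1 / of_nat (2 * Suc n)) * a i j)" by (elim exE) (rule that)
  have A: "hpsd ?I (\<lambda>i j. A0 n i j + b i j)" "hpsd ?I (\<lambda>i j. A0 n i j - b i j)"
    "hpsd ?I (\<lambda>i j. A1 n i j + c i j)" "hpsd ?I (\<lambda>i j. A1 n i j - c i j)"
    "i < s \<Longrightarrow> j < s \<Longrightarrow> A0 n i j + A1 n i j = (1 + 1 / of_nat (2 * Suc n)) * a i j" for n i j
    using spec[OF AA, of n] by simp_all
  have half: "hpsd ?I G" if "hpsd ?I (\<lambda>i j. G i j + g i j)" "hpsd ?I (\<lambda>i j. G i j - g i j)" for G g
  proof -
    have "hpsd ?I (\<lambda>i j. complex_of_real (1/2) * ((G i j + g i j) + (G i j - g i j)))"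
      by (intro hpsd_scale hpsd_add that) simp
    then show ?thesis by simp
  qed
  have p0: "hpsd ?I (A0 n)" and p1: "hpsd ?I (A1 n)" for n using half[OF A(1,2)] half[OF A(3,4)] by auto
  have dbound: "Re (A0 n i i) \<le> 2 * cmod (a i i)" if "i < s" for n i
  proof -
    have "0 \<le> Re (A1 n i i)" using hpsd_diag(1)[OF p1] that by simp
    then have "Re (A0 n i i) \<le> Re ((1 + 1 / of_nat (2 * Suc n)) * a i i)"
      using arg_cong[OF A(5)[OF that that, of n], of Re] by simp
    also have "\<dots> \<le> cmod ((1 + 1 / of_nat (2 * Suc n)) * a i i)" by (rule complex_Re_le_cmod)
    also have "\<dots> \<le> 2 * cmod (a i i)"
    proof -
      have "cmod (1 + 1 / of_nat (2 * Suc n)) \<le> cmod 1 + cmod (1 / of_nat (2 * Suc n))" by (rule norm_triangle_ineq)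
      also have "cmod (1 / of_nat (2 * Suc n)) \<le> 1" unfolding norm_divide norm_of_nat by simp
      finally show ?thesis unfolding norm_mult by (intro mult_right_mono) auto
    qed
    finally show ?thesis .
  qed
  have bnd: "bounded (range (\<lambda>n. (\<lambda>(i, j). A0 n i j) p))" if pI: "p \<in> ?I \<times> ?I" for p
  proof -
    obtain i j where p: "p = (i, j)" "i < s" "j < s" using pI by auto
    have "cmod (A0 n i j) \<le> cmod (a i i) + cmod (a j j)" for n
      using hpsd_entry_bound[OF p0, of i j n] dbound[of i n] dbound[of j n] p by simp
    then show ?thesis unfolding p(1) by (auto simp: bounded_iff)
  qed
  obtain r :: "nat \<Rightarrow> nat" where r: "strict_mono r" "\<forall>p\<in>?I \<times> ?I. convergent (\<lambda>n. (\<lambda>(i, j). A0 (r n) i j) p)"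
    using common_subsequence[of "?I \<times> ?I" "\<lambda>n (i, j). A0 n i j", OF _ bnd] by auto
  define a0 where "a0 i j = lim (\<lambda>n. A0 (r n) i j)" for i j
  have l0: "(\<lambda>n. A0 (r n) i j) \<longlonglongrightarrow> a0 i j" if "i \<in> ?I" "j \<in> ?I" for i j
    using r(2) that unfolding a0_def by (auto dest: convergent_LIMSEQ_iff[THEN iffD1])
  have inv0: "(\<lambda>n. 1 / of_nat (2 * Suc (r n)) :: complex) \<longlonglongrightarrow> 0"
  proof -
    have "(\<lambda>n. 1 / of_nat (2 * Suc n) :: complex) \<longlonglongrightarrow> 0"
    proof -
      have "(\<lambda>n. complex_of_real (1/2 * inverse (real (Suc n)))) \<longlonglongrightarrow> complex_of_real (1/2 * 0)"
        by (intro tendsto_intros LIMSEQ_inverse_real_of_nat)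
      moreover have "complex_of_real (1/2 * inverse (real m)) = 1 / of_nat (2 * m)" for m
        by (cases "m = 0") (simp_all add: field_simps)
      ultimately show ?thesis by (simp only: mult_zero_right of_real_0)
    qed
    from LIMSEQ_subseq_LIMSEQ[OF this r(1)] show ?thesis by (simp add: o_def)
  qed
  have l1: "(\<lambda>n. A1 (r n) i j) \<longlonglongrightarrow> a i j - a0 i j" if "i \<in> ?I" "j \<in> ?I" for i j
  proof -
    have "(\<lambda>n. (1 + 1 / of_nat (2 * Suc (r n))) * a i j - A0 (r n) i j) \<longlonglongrightarrow> (1 + 0) * a i j - a0 i j"
      by (intro tendsto_intros inv0 l0 that)
    moreover have "(1 + 1 / of_nat (2 * Suc (r n))) * a i j - A0 (r n) i j = A1 (r n) i j" for n
      using A(5)[of i j "r n"] that by (simp add: algebra_simps)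
    ultimately show ?thesis by simp
  qed
  show ?thesis
  proof (rule exI[of _ a0], rule exI[of _ "\<lambda>i j. a i j - a0 i j"], intro conjI)
    show "hpsd ?I (\<lambda>i j. a0 i j + b i j)" by (rule hpsd_limit[where H = "\<lambda>n i j. A0 (r n) i j + b i j", OF A(1)]) (intro tendsto_intros l0)
    show "hpsd ?I (\<lambda>i j. a0 i j - b i j)" by (rule hpsd_limit[where H = "\<lambda>n i j. A0 (r n) i j - b i j", OF A(2)]) (intro tendsto_intros l0)
    show "hpsd ?I (\<lambda>i j. a i j - a0 i j + c i j)" by (rule hpsd_limit[where H = "\<lambda>n i j. A1 (r n) i j + c i j", OF A(3)]) (intro tendsto_intros l1)
    show "hpsd ?I (\<lambda>i j. a i j - a0 i j - c i j)" by (rule hpsd_limit[where H = "\<lambda>n i j. A1 (r n) i j - c i j", OF A(4)]) (intro tendsto_intros l1)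
  qed simp
qed

text \<open>Elimination produces one vector for each index, so the Gram factor can be indexed by
  \<open>I\<close> itself, as the definition of \<open>mat_nonneg\<close> demands.\<close>

lemma hpsd_square_gram:
  assumes "hpsd I H" "finite I"
  shows "\<exists>Y. \<forall>i\<in>I. \<forall>j\<in>I. H i j = (\<Sum>k\<in>I. cnj (Y k i) * Y k j)"
proof -
  have "\<exists>Y. hpsd I (\<lambda>i j. H i j - (\<Sum>k\<in>J. cnj (Y k i) * Y k j)) \<and>
     (\<forall>a\<in>J. \<forall>j\<in>I. (\<Sum>k\<in>J. cnj (Y k a) * Y k j) = H a j)" if "finite J" "J \<subseteq> I" for J
    using that
  proof (induction J rule: finite_induct)
    case empty then show ?case using assms by simp
  next
    case (insert a J)
    then obtain Y where Y: "hpsd I (\<lambda>i j. H i j - (\<Sum>k\<in>J. cnj (Y k i) * Y k j))"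
      "\<forall>a\<in>J. \<forall>j\<in>I. (\<Sum>k\<in>J. cnj (Y k a) * Y k j) = H a j" by auto
    have aI: "a \<in> I" using insert by simp
    let ?R = "\<lambda>i j. H i j - (\<Sum>k\<in>J. cnj (Y k i) * Y k j)"
    obtain z where z: "hpsd I (\<lambda>i j. ?R i j - cnj (z i) * z j)"
      "\<And>j. j \<in> I \<Longrightarrow> cnj (z a) * z j = ?R a j" "\<And>j. j \<in> I \<Longrightarrow> ?R a j = 0 \<Longrightarrow> z j = 0"
      by (rule hpsd_eliminate[OF Y(1) assms(2) aI]) (rule that; assumption)
    have zJ: "z b = 0" if "b \<in> J" for b
    proof (rule z(3))
      show b: "b \<in> I" using that insert by auto
      have "?R b a = 0" using Y(2) that aI by simp
      moreover have "?R a b = cnj (?R b a)" by (rule hpsd_herm[OF Y(1) b aI])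
      ultimately show "?R a b = 0" by simp
    qed
    let ?Y = "Y(a := z)"
    have s: "(\<Sum>k\<in>insert a J. cnj (?Y k i) * ?Y k j) = cnj (z i) * z j + (\<Sum>k\<in>J. cnj (Y k i) * Y k j)" for i j
    proof -
      have "(\<Sum>k\<in>J. cnj (?Y k i) * ?Y k j) = (\<Sum>k\<in>J. cnj (Y k i) * Y k j)"
        by (rule sum.cong) (use insert.hyps in auto)
      then show ?thesis using insert.hyps by simp
    qed
    show ?case
    proof (rule exI[of _ ?Y], intro conjI ballI)
      show "hpsd I (\<lambda>i j. H i j - (\<Sum>k\<in>insert a J. cnj (?Y k i) * ?Y k j))"
        unfolding s using z(1) by (simp add: diff_diff_eq add.commute)
      fix b j assume b: "b \<in> insert a J" and j: "j \<in> I"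
      show "(\<Sum>k\<in>insert a J. cnj (?Y k b) * ?Y k j) = H b j"
      proof (cases "b = a")
        case True then show ?thesis unfolding s using z(2)[OF j] by simp
      next
        case False
        then have "b \<in> J" using b by simp
        then show ?thesis unfolding s using zJ Y(2) j by simp
      qed
    qed
  qed
  from this[OF assms(2) order_refl] obtain Y where
    "\<forall>a\<in>I. \<forall>j\<in>I. (\<Sum>k\<in>I. cnj (Y k a) * Y k j) = H a j" by blast
  then have "\<forall>i\<in>I. \<forall>j\<in>I. H i j = (\<Sum>k\<in>I. cnj (Y k i) * Y k j)" by simp
  then show ?thesis by blast
qed

section \<open>Bounded sequences as a commutative C*-algebra\<close>

lemma bcontfun_Cauchy_convergent:
  fixes f :: "nat \<Rightarrow> 'a::topological_space \<Rightarrow>\<^sub>C 'b::complete_space"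
  assumes "Cauchy f" shows "convergent f"
proof -
  have "uniformly_Cauchy_on UNIV (\<lambda>n. apply_bcontfun (f n))"
    unfolding uniformly_Cauchy_on_def
  proof (intro allI impI)
    fix \<epsilon> :: real assume "0 < \<epsilon>"
    then obtain M where "\<forall>m\<ge>M. \<forall>n\<ge>M. dist (f m) (f n) < \<epsilon>" using assms unfolding Cauchy_def by blast
    then show "\<exists>M. \<forall>x\<in>UNIV. \<forall>m\<ge>M. \<forall>n\<ge>M. dist (apply_bcontfun (f m) x) (apply_bcontfun (f n) x) < \<epsilon>"
      using dist_fun_lt_imp_dist_val_lt by (intro exI[of _ M]) blast
  qed
  then have "uniformly_convergent_on UNIV (\<lambda>n. apply_bcontfun (f n))"
    by (rule Cauchy_uniformly_convergent)
  then obtain g where "uniform_limit UNIV (\<lambda>n. apply_bcontfun (f n)) g sequentially"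
    unfolding uniformly_convergent_on_def by (elim exE) (rule that)
  then obtain l where "f \<longlonglongrightarrow> l" by (rule uniform_limit_bcontfunE[OF _ sequentially_bot]) (rule that)
  then show ?thesis by (rule convergentI)
qed

text \<open>The algebra of bounded functions on \<open>K \<subseteq> \<nat>\<close>, transported along an injection into \<open>'u\<close>.\<close>

locale linf =
  fixes e :: "(nat \<Rightarrow>\<^sub>C complex) \<Rightarrow> 'u" and K :: "nat set"
  assumes inj_e: "inj e"
begin

definition carr :: "'u set" where
  "carr = e ` {f. \<forall>n. n \<notin> K \<longrightarrow> apply_bcontfun f n = 0}"

definition dec :: "'u \<Rightarrow> nat \<Rightarrow>\<^sub>C complex" where
  "dec x = (if x \<in> carr then inv_into UNIV e x else 0)"

definition pt :: "'u \<Rightarrow> nat \<Rightarrow> complex" where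
  "pt x n = apply_bcontfun (dec x) n"

definition enc :: "(nat \<Rightarrow> complex) \<Rightarrow> 'u" where
  "enc h = e (Bcontfun h)"

lemma bcontfun_nat: "bounded (range h) \<Longrightarrow> apply_bcontfun (Bcontfun h) = h" for h :: "nat \<Rightarrow> complex"
  by (rule Bcontfun_inverse) (simp add: bcontfun_def)

lemma enc_carr:
  assumes "bounded (range h)" "\<And>n. n \<notin> K \<Longrightarrow> h n = 0"
  shows "enc h \<in> carr"
  unfolding enc_def carr_def using bcontfun_nat[OF assms(1)] assms(2) by auto

lemma pt_enc:
  assumes "bounded (range h)" "\<And>n. n \<notin> K \<Longrightarrow> h n = 0"
  shows "pt (enc h) n = h n"
proof -
  have "dec (enc h) = Bcontfun h"
    using enc_carr[OF assms] by (simp add: dec_def enc_def inv_f_f[OF inj_e])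
  then show ?thesis by (simp add: pt_def bcontfun_nat[OF assms(1)])
qed

lemma pt_bounded: "bounded (range (pt x))"
proof -
  have "pt x = apply_bcontfun (dec x)" by (auto simp: pt_def)
  then show ?thesis by simp
qed

lemma pt_out: "n \<notin> K \<Longrightarrow> pt x n = 0"
  unfolding pt_def dec_def carr_def by (auto simp: inv_f_f[OF inj_e])

lemma carr_eqI:
  assumes "x \<in> carr" "y \<in> carr" "\<And>n. pt x n = pt y n"
  shows "x = y"
proof -
  have "dec x = dec y" by (rule bcontfun_eqI) (use assms(3) in \<open>simp add: pt_def\<close>)
  moreover have "e (dec z) = z" if "z \<in> carr" for z
    using that unfolding dec_def carr_def by (auto simp: inv_f_f[OF inj_e])
  ultimately show ?thesis using assms(1,2) by metis
qed

definition alg :: "'u cstar" where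
  "alg = \<lparr>carrier = carr, monoid.mult = (\<lambda>x y. enc (\<lambda>n. pt x n * pt y n)), one = enc (\<lambda>n. of_bool (n \<in> K)),
     zero = enc (\<lambda>n. 0), add = (\<lambda>x y. enc (\<lambda>n. pt x n + pt y n)),
     smult = (\<lambda>z x. enc (\<lambda>n. z * pt x n)), star = (\<lambda>x. enc (\<lambda>n. cnj (pt x n))), nrm = (\<lambda>x. norm (dec x))\<rparr>"

lemma alg_sel: "carrier alg = carr" "x \<otimes>\<^bsub>alg\<^esub> y = enc (\<lambda>n. pt x n * pt y n)"
  "\<one>\<^bsub>alg\<^esub> = enc (\<lambda>n. of_bool (n \<in> K))" "\<zero>\<^bsub>alg\<^esub> = enc (\<lambda>n. 0)" "x \<oplus>\<^bsub>alg\<^esub> y = enc (\<lambda>n. pt x n + pt y n)"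
  "z \<odot>\<^bsub>alg\<^esub> x = enc (\<lambda>n. z * pt x n)" "star alg x = enc (\<lambda>n. cnj (pt x n))" "nrm alg x = norm (dec x)"
  by (simp_all add: alg_def)

lemma bounded_rangeI: "(\<And>n. cmod (h n) \<le> b) \<Longrightarrow> bounded (range h)" for h :: "nat \<Rightarrow> complex"
  by (auto simp: bounded_iff)

lemma pt_le: "cmod (pt x n) \<le> norm (dec x)"
  unfolding pt_def by (rule norm_bounded)

lemma bounded_ops:
  "bounded (range (\<lambda>n. pt x n * pt y n))" "bounded (range (\<lambda>n. of_bool (n \<in> K) :: complex))"
  "bounded (range (\<lambda>n::nat. 0 :: complex))" "bounded (range (\<lambda>n. pt x n + pt y n))"
  "bounded (range (\<lambda>n. z * pt x n))" "bounded (range (\<lambda>n. cnj (pt x n)))"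
proof -
  show "bounded (range (\<lambda>n. pt x n * pt y n))"
    by (rule bounded_rangeI[where b = "norm (dec x) * norm (dec y)"]) (simp add: norm_mult mult_mono pt_le)
  show "bounded (range (\<lambda>n. of_bool (n \<in> K) :: complex))" by (rule bounded_rangeI[where b = 1]) simp
  show "bounded (range (\<lambda>n::nat. 0 :: complex))" by (rule bounded_rangeI[where b = 1]) simp
  show "bounded (range (\<lambda>n. pt x n + pt y n))"
    by (rule bounded_rangeI[where b = "norm (dec x) + norm (dec y)"])
      (rule order.trans[OF norm_triangle_ineq add_mono[OF pt_le pt_le]])
  show "bounded (range (\<lambda>n. z * pt x n))"
    by (rule bounded_rangeI[where b = "cmod z * norm (dec x)"]) (simp add: norm_mult mult_left_mono pt_le)
  show "bounded (range (\<lambda>n. cnj (pt x n)))"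
    by (rule bounded_rangeI[where b = "norm (dec x)"]) (simp add: pt_le)
qed

lemma closed_ops:
  "x \<otimes>\<^bsub>alg\<^esub> y \<in> carr" "\<one>\<^bsub>alg\<^esub> \<in> carr" "\<zero>\<^bsub>alg\<^esub> \<in> carr" "x \<oplus>\<^bsub>alg\<^esub> y \<in> carr" "z \<odot>\<^bsub>alg\<^esub> x \<in> carr" "star alg x \<in> carr"
  unfolding alg_sel by (rule enc_carr[OF bounded_ops(1)] enc_carr[OF bounded_ops(2)] enc_carr[OF bounded_ops(3)]
    enc_carr[OF bounded_ops(4)] enc_carr[OF bounded_ops(5)] enc_carr[OF bounded_ops(6)]; simp add: pt_out)+

lemma pt_ops:
  "pt (x \<otimes>\<^bsub>alg\<^esub> y) n = pt x n * pt y n" "pt \<one>\<^bsub>alg\<^esub> n = of_bool (n \<in> K)" "pt \<zero>\<^bsub>alg\<^esub> n = 0"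
  "pt (x \<oplus>\<^bsub>alg\<^esub> y) n = pt x n + pt y n" "pt (z \<odot>\<^bsub>alg\<^esub> x) n = z * pt x n" "pt (star alg x) n = cnj (pt x n)"
proof -
  show "pt (x \<otimes>\<^bsub>alg\<^esub> y) n = pt x n * pt y n" unfolding alg_sel by (rule pt_enc[OF bounded_ops(1)]) (simp add: pt_out)
  show "pt \<one>\<^bsub>alg\<^esub> n = of_bool (n \<in> K)" unfolding alg_sel by (rule pt_enc[OF bounded_ops(2)]) simp
  show "pt \<zero>\<^bsub>alg\<^esub> n = 0" unfolding alg_sel by (rule pt_enc[OF bounded_ops(3)]) simp
  show "pt (x \<oplus>\<^bsub>alg\<^esub> y) n = pt x n + pt y n" unfolding alg_sel by (rule pt_enc[OF bounded_ops(4)]) (simp add: pt_out)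
  show "pt (z \<odot>\<^bsub>alg\<^esub> x) n = z * pt x n" unfolding alg_sel by (rule pt_enc[OF bounded_ops(5)]) (simp add: pt_out)
  show "pt (star alg x) n = cnj (pt x n)" unfolding alg_sel by (rule pt_enc[OF bounded_ops(6)]) (simp add: pt_out)
qed

lemma alg_cring: "cring alg"
proof (rule cringI)
  show "abelian_group alg"
  proof (rule abelian_groupI)
    fix x assume x: "x \<in> carrier alg"
    show "\<zero>\<^bsub>alg\<^esub> \<oplus>\<^bsub>alg\<^esub> x = x" using x by (intro carr_eqI closed_ops) (simp_all add: alg_sel(1) pt_ops)
    show "\<exists>y\<in>carrier alg. y \<oplus>\<^bsub>alg\<^esub> x = \<zero>\<^bsub>alg\<^esub>"
      by (rule bexI[of _ "(-1) \<odot>\<^bsub>alg\<^esub> x"], rule carr_eqI) (simp_all only: alg_sel(1) closed_ops pt_ops, simp)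
  next
    fix x y z
    show "x \<oplus>\<^bsub>alg\<^esub> y \<oplus>\<^bsub>alg\<^esub> z = x \<oplus>\<^bsub>alg\<^esub> (y \<oplus>\<^bsub>alg\<^esub> z)" by (intro carr_eqI closed_ops) (simp add: pt_ops)
    show "x \<oplus>\<^bsub>alg\<^esub> y = y \<oplus>\<^bsub>alg\<^esub> x" by (intro carr_eqI closed_ops) (simp add: pt_ops)
  qed (simp_all only: alg_sel(1) closed_ops)
  show "comm_monoid alg"
  proof (rule comm_monoidI)
    fix x assume x: "x \<in> carrier alg"
    show "\<one>\<^bsub>alg\<^esub> \<otimes>\<^bsub>alg\<^esub> x = x" using x by (intro carr_eqI closed_ops) (auto simp: alg_sel(1) pt_ops pt_out)
  next
    fix x y z
    show "x \<otimes>\<^bsub>alg\<^esub> y \<otimes>\<^bsub>alg\<^esub> z = x \<otimes>\<^bsub>alg\<^esub> (y \<otimes>\<^bsub>alg\<^esub> z)" by (intro carr_eqI closed_ops) (simp add: pt_ops)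
    show "x \<otimes>\<^bsub>alg\<^esub> y = y \<otimes>\<^bsub>alg\<^esub> x" by (intro carr_eqI closed_ops) (simp add: pt_ops)
  qed (simp_all only: alg_sel(1) closed_ops)
  fix x y z
  show "(x \<oplus>\<^bsub>alg\<^esub> y) \<otimes>\<^bsub>alg\<^esub> z = x \<otimes>\<^bsub>alg\<^esub> z \<oplus>\<^bsub>alg\<^esub> y \<otimes>\<^bsub>alg\<^esub> z"
    by (intro carr_eqI closed_ops) (simp add: pt_ops distrib_right)
qed

lemma alg_minus: "x \<ominus>\<^bsub>alg\<^esub> y \<in> carr" "pt (x \<ominus>\<^bsub>alg\<^esub> y) n = pt x n - pt y n"
proof -
  interpret cring alg by (rule alg_cring)
  have m: "\<ominus>\<^bsub>alg\<^esub> y = (-1) \<odot>\<^bsub>alg\<^esub> y"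
    unfolding a_inv_def m_inv_def
  proof (rule the_equality)
    let ?z = "(-1) \<odot>\<^bsub>alg\<^esub> y"
    show "?z \<in> carrier (add_monoid alg) \<and> y \<otimes>\<^bsub>add_monoid alg\<^esub> ?z = \<one>\<^bsub>add_monoid alg\<^esub> \<and> ?z \<otimes>\<^bsub>add_monoid alg\<^esub> y = \<one>\<^bsub>add_monoid alg\<^esub>"
      by (auto simp: closed_ops alg_sel(1) pt_ops intro!: carr_eqI)
    fix z assume z: "z \<in> carrier (add_monoid alg) \<and> y \<otimes>\<^bsub>add_monoid alg\<^esub> z = \<one>\<^bsub>add_monoid alg\<^esub> \<and> z \<otimes>\<^bsub>add_monoid alg\<^esub> y = \<one>\<^bsub>add_monoid alg\<^esub>"
    then have "z \<in> carr" and yz: "y \<oplus>\<^bsub>alg\<^esub> z = \<zero>\<^bsub>alg\<^esub>" by (simp_all add: alg_sel(1))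
    show "z = ?z"
    proof (rule carr_eqI)
      show "z \<in> carr" "?z \<in> carr" by (fact, rule closed_ops)
      fix n
      have "pt y n + pt z n = 0" using arg_cong[OF yz, of "\<lambda>x. pt x n"] by (simp add: pt_ops)
      then show "pt z n = pt ?z n" by (simp add: pt_ops add_eq_0_iff)
    qed
  qed
  show "x \<ominus>\<^bsub>alg\<^esub> y \<in> carr" unfolding a_minus_def by (rule closed_ops)
  show "pt (x \<ominus>\<^bsub>alg\<^esub> y) n = pt x n - pt y n" unfolding a_minus_def m by (simp add: pt_ops)
qed

lemma nrm_minus: "nrm alg (x \<ominus>\<^bsub>alg\<^esub> y) = norm (dec x - dec y)"
proof -
  have "dec (x \<ominus>\<^bsub>alg\<^esub> y) = dec x - dec y"
  proof (rule bcontfun_eqI)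
    fix n
    have "apply_bcontfun (dec (x \<ominus>\<^bsub>alg\<^esub> y)) n = pt (x \<ominus>\<^bsub>alg\<^esub> y) n" by (simp add: pt_def)
    then show "apply_bcontfun (dec (x \<ominus>\<^bsub>alg\<^esub> y)) n = apply_bcontfun (dec x - dec y) n"
      by (simp add: alg_minus) (simp add: pt_def)
  qed
  then show ?thesis by (simp add: alg_sel(8))
qed

lemma dec_inj: "x \<in> carr \<Longrightarrow> y \<in> carr \<Longrightarrow> dec x = dec y \<Longrightarrow> x = y"
  by (rule carr_eqI) (simp_all add: pt_def)

lemma norm_dec_le: "(\<And>n. cmod (pt x n) \<le> b) \<Longrightarrow> norm (dec x) \<le> b"
  by (rule norm_bound) (simp add: pt_def)

lemma metric_alg: "Metric_space (carrier alg) (\<lambda>x y. nrm alg (x \<ominus>\<^bsub>alg\<^esub> y))"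
proof
  fix x y z
  show "0 \<le> nrm alg (x \<ominus>\<^bsub>alg\<^esub> y)" by (simp add: nrm_minus)
  show "nrm alg (x \<ominus>\<^bsub>alg\<^esub> y) = nrm alg (y \<ominus>\<^bsub>alg\<^esub> x)" by (simp add: nrm_minus norm_minus_commute)
  show "x \<in> carrier alg \<Longrightarrow> y \<in> carrier alg \<Longrightarrow> (nrm alg (x \<ominus>\<^bsub>alg\<^esub> y) = 0) = (x = y)"
    by (auto simp: nrm_minus alg_sel(1) dec_inj)
  show "nrm alg (x \<ominus>\<^bsub>alg\<^esub> z) \<le> nrm alg (x \<ominus>\<^bsub>alg\<^esub> y) + nrm alg (y \<ominus>\<^bsub>alg\<^esub> z)"
    unfolding nrm_minus using norm_triangle_ineq[of "dec x - dec y" "dec y - dec z"] by simp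
qed

lemma alg_complete: "Metric_space.mcomplete (carrier alg) (\<lambda>x y. nrm alg (x \<ominus>\<^bsub>alg\<^esub> y))"
proof -
  interpret M: Metric_space "carrier alg" "\<lambda>x y. nrm alg (x \<ominus>\<^bsub>alg\<^esub> y)" by (rule metric_alg)
  have "\<exists>x. limitin M.mtopology \<sigma> x sequentially" if \<sigma>: "M.MCauchy \<sigma>" for \<sigma>
  proof -
    have "range \<sigma> \<subseteq> carrier alg" using \<sigma> unfolding M.MCauchy_def by blast
    then have r: "\<sigma> n \<in> carr" for n unfolding alg_sel(1) by blast
    have "Cauchy (\<lambda>n. dec (\<sigma> n))"
    proof (rule CauchyI)
      fix \<epsilon> :: real assume "0 < \<epsilon>"
      then obtain N where "\<forall>n n'. N \<le> n \<longrightarrow> N \<le> n' \<longrightarrow> nrm alg (\<sigma> n \<ominus>\<^bsub>alg\<^esub> \<sigma> n') < \<epsilon>"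
        using \<sigma> unfolding M.MCauchy_def by blast
      then show "\<exists>N. \<forall>m\<ge>N. \<forall>n\<ge>N. norm (dec (\<sigma> m) - dec (\<sigma> n)) < \<epsilon>" by (auto simp: nrm_minus)
    qed
    then have "convergent (\<lambda>n. dec (\<sigma> n))" by (rule bcontfun_Cauchy_convergent)
    then obtain l where l: "(\<lambda>n. dec (\<sigma> n)) \<longlonglongrightarrow> l" unfolding convergent_def by (elim exE) (rule that)
    have lK: "apply_bcontfun l n = 0" if "n \<notin> K" for n
    proof -
      have "cmod (apply_bcontfun l n) \<le> norm (l - dec (\<sigma> k))" for k
        using norm_bounded[of "l - dec (\<sigma> k)" n] pt_out[OF that, of "\<sigma> k"] by (simp add: pt_def)
      moreover have "(\<lambda>k. norm (l - dec (\<sigma> k))) \<longlonglongrightarrow> 0"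
        using tendsto_norm[OF tendsto_diff[OF tendsto_const[of l] l]] by simp
      ultimately have "cmod (apply_bcontfun l n) \<le> 0" by (intro LIMSEQ_le_const) auto
      then show ?thesis by simp
    qed
    have el: "e l \<in> carr" unfolding carr_def using lK by auto
    then have dl: "dec (e l) = l" by (simp add: dec_def inv_f_f[OF inj_e])
    have "limitin M.mtopology \<sigma> (e l) sequentially"
      unfolding M.limit_metric_sequentially
    proof (intro conjI allI impI)
      show "e l \<in> carrier alg" using el by (simp add: alg_sel(1))
      fix \<epsilon> :: real assume "0 < \<epsilon>"
      then obtain N where "\<forall>n\<ge>N. norm (dec (\<sigma> n) - l) < \<epsilon>" using LIMSEQ_D[OF l] by blast
      then show "\<exists>N. \<forall>n\<ge>N. \<sigma> n \<in> carrier alg \<and> nrm alg (\<sigma> n \<ominus>\<^bsub>alg\<^esub> e l) < \<epsilon>"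
        using r by (auto simp: nrm_minus dl alg_sel(1))
    qed
    then show ?thesis by blast
  qed
  then show ?thesis unfolding M.mcomplete_def by blast
qed

lemma alg_cstar: "commutative_cstar_algebra alg"
proof (intro commutative_cstar_algebra.intro commutative_cstar_algebra_axioms.intro)
  show "algebra (ring_of_type_algebra :: complex ring) alg"
  proof (rule algebraI)
    show "cring (ring_of_type_algebra :: complex ring)" by (rule cring_from_type_algebra)
    show "cring alg" by (rule alg_cring)
    fix a b :: complex and x y assume x: "x \<in> carrier alg"
    show "\<one>\<^bsub>ring_of_type_algebra\<^esub> \<odot>\<^bsub>alg\<^esub> x = x"
      using x by (intro carr_eqI closed_ops) (simp_all add: alg_sel(1) ring_of_type_algebra_def pt_ops)
    show "a \<odot>\<^bsub>alg\<^esub> x \<in> carrier alg" by (simp only: alg_sel(1) closed_ops)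
    show "(a \<oplus>\<^bsub>ring_of_type_algebra\<^esub> b) \<odot>\<^bsub>alg\<^esub> x = a \<odot>\<^bsub>alg\<^esub> x \<oplus>\<^bsub>alg\<^esub> b \<odot>\<^bsub>alg\<^esub> x"
      by (intro carr_eqI closed_ops) (simp add: ring_of_type_algebra_def pt_ops distrib_right)
    show "a \<odot>\<^bsub>alg\<^esub> (x \<oplus>\<^bsub>alg\<^esub> y) = a \<odot>\<^bsub>alg\<^esub> x \<oplus>\<^bsub>alg\<^esub> a \<odot>\<^bsub>alg\<^esub> y"
      by (intro carr_eqI closed_ops) (simp add: pt_ops distrib_left)
    show "(a \<otimes>\<^bsub>ring_of_type_algebra\<^esub> b) \<odot>\<^bsub>alg\<^esub> x = a \<odot>\<^bsub>alg\<^esub> (b \<odot>\<^bsub>alg\<^esub> x)"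
      by (intro carr_eqI closed_ops) (simp add: ring_of_type_algebra_def pt_ops)
    show "(a \<odot>\<^bsub>alg\<^esub> x) \<otimes>\<^bsub>alg\<^esub> y = a \<odot>\<^bsub>alg\<^esub> (x \<otimes>\<^bsub>alg\<^esub> y)"
      by (intro carr_eqI closed_ops) (simp add: pt_ops)
  qed
  show "Metric_space.mcomplete (carrier alg) (\<lambda>x y. nrm alg (x \<ominus>\<^bsub>alg\<^esub> y))" by (rule alg_complete)
next
  fix x y z assume x: "x \<in> carrier alg"
  show "star alg x \<in> carrier alg" by (simp only: alg_sel(1) closed_ops)
  show "star alg (star alg x) = x" using x by (intro carr_eqI closed_ops) (simp_all add: alg_sel(1) pt_ops)
  show "star alg (x \<oplus>\<^bsub>alg\<^esub> y) = star alg x \<oplus>\<^bsub>alg\<^esub> star alg y" by (intro carr_eqI closed_ops) (simp add: pt_ops)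
  show "star alg (x \<otimes>\<^bsub>alg\<^esub> y) = star alg y \<otimes>\<^bsub>alg\<^esub> star alg x" by (intro carr_eqI closed_ops) (simp add: pt_ops)
  show "star alg (z \<odot>\<^bsub>alg\<^esub> x) = cnj z \<odot>\<^bsub>alg\<^esub> star alg x" by (intro carr_eqI closed_ops) (simp add: pt_ops)
  have d0: "dec \<zero>\<^bsub>alg\<^esub> = 0"
  proof (rule bcontfun_eqI)
    fix n show "apply_bcontfun (dec \<zero>\<^bsub>alg\<^esub>) n = apply_bcontfun 0 n" using pt_ops(3)[of n] by (simp add: pt_def)
  qed
  show "(nrm alg x = 0) = (x = \<zero>\<^bsub>alg\<^esub>)"
  proof
    assume "nrm alg x = 0"
    then have "dec x = dec \<zero>\<^bsub>alg\<^esub>" by (simp add: alg_sel(8) d0)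
    then show "x = \<zero>\<^bsub>alg\<^esub>" using x closed_ops(3) dec_inj by (simp add: alg_sel(1))
  qed (simp add: alg_sel(8) d0)
  show "nrm alg (x \<oplus>\<^bsub>alg\<^esub> y) \<le> nrm alg x + nrm alg y"
    unfolding alg_sel(8) by (rule norm_dec_le) (simp add: pt_ops order.trans[OF norm_triangle_ineq add_mono[OF pt_le pt_le]])
  show "nrm alg (x \<otimes>\<^bsub>alg\<^esub> y) \<le> nrm alg x * nrm alg y"
    unfolding alg_sel(8) by (rule norm_dec_le) (simp add: pt_ops norm_mult mult_mono pt_le)
  show "nrm alg (z \<odot>\<^bsub>alg\<^esub> x) = cmod z * nrm alg x"
  proof (rule antisym)
    show "nrm alg (z \<odot>\<^bsub>alg\<^esub> x) \<le> cmod z * nrm alg x"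
      unfolding alg_sel(8) by (rule norm_dec_le) (simp add: pt_ops norm_mult mult_left_mono pt_le)
    show "cmod z * nrm alg x \<le> nrm alg (z \<odot>\<^bsub>alg\<^esub> x)"
    proof (cases "z = 0")
      case True then show ?thesis by (simp add: alg_sel(8))
    next
      case False
      have "norm (dec x) \<le> norm (dec (z \<odot>\<^bsub>alg\<^esub> x)) / cmod z"
      proof (rule norm_dec_le)
        fix n
        have "cmod z * cmod (pt x n) \<le> norm (dec (z \<odot>\<^bsub>alg\<^esub> x))"
          using pt_le[of "z \<odot>\<^bsub>alg\<^esub> x" n] by (simp add: pt_ops norm_mult)
        then show "cmod (pt x n) \<le> norm (dec (z \<odot>\<^bsub>alg\<^esub> x)) / cmod z" using False by (simp add: field_simps)
      qed
      then show ?thesis using False by (simp add: alg_sel(8) field_simps)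
    qed
  qed
  show "nrm alg (star alg x \<otimes>\<^bsub>alg\<^esub> x) = (nrm alg x)\<^sup>2"
  proof (rule antisym)
    show "nrm alg (star alg x \<otimes>\<^bsub>alg\<^esub> x) \<le> (nrm alg x)\<^sup>2"
      unfolding alg_sel(8) power2_eq_square
      by (rule norm_dec_le) (simp add: pt_ops norm_mult mult_mono pt_le)
    have "norm (dec x) \<le> sqrt (norm (dec (star alg x \<otimes>\<^bsub>alg\<^esub> x)))"
    proof (rule norm_dec_le)
      fix n
      have "(cmod (pt x n))\<^sup>2 \<le> norm (dec (star alg x \<otimes>\<^bsub>alg\<^esub> x))"
        using pt_le[of "star alg x \<otimes>\<^bsub>alg\<^esub> x" n] by (simp add: pt_ops norm_mult power2_eq_square)
      then show "cmod (pt x n) \<le> sqrt (norm (dec (star alg x \<otimes>\<^bsub>alg\<^esub> x)))" by (rule real_le_rsqrt)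
    qed
    then have "(norm (dec x))\<^sup>2 \<le> (sqrt (norm (dec (star alg x \<otimes>\<^bsub>alg\<^esub> x))))\<^sup>2" by (intro power_mono) auto
    then show "(nrm alg x)\<^sup>2 \<le> nrm alg (star alg x \<otimes>\<^bsub>alg\<^esub> x)" by (simp add: alg_sel(8))
  qed
qed

lemma pt_finsum:
  assumes "finite I" "\<And>i. i \<in> I \<Longrightarrow> f i \<in> carr"
  shows "pt (\<Oplus>\<^bsub>alg\<^esub>i\<in>I. f i) n = (\<Sum>i\<in>I. pt (f i) n)"
  using assms
proof (induction I rule: finite_induct)
  case empty
  interpret cring alg by (rule alg_cring)
  show ?case by (simp add: pt_ops)
next
  case (insert i I)
  interpret cring alg by (rule alg_cring)
  have "f \<in> I \<rightarrow> carrier alg" "f i \<in> carrier alg" using insert.prems by (auto simp: alg_sel(1))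
  then show ?case using insert by (simp add: pt_ops)
qed

text \<open>Positivity can be tested pointwise because pointwise factors fit together to a bounded
  one: the squared absolute values in a column of the factor sum to a diagonal entry of the
  matrix.\<close>

lemma mat_nonneg_iff:
  assumes "finite I" "\<And>i j. i \<in> I \<Longrightarrow> j \<in> I \<Longrightarrow> M i j \<in> carr"
  shows "mat_nonneg alg I M \<longleftrightarrow> (\<forall>n\<in>K. hpsd I (\<lambda>i j. pt (M i j) n))"
proof
  assume "mat_nonneg alg I M"
  then obtain Y where Y: "\<forall>i\<in>I. \<forall>j\<in>I. M i j = (\<Oplus>\<^bsub>alg\<^esub>k\<in>I. star alg (Y k i) \<otimes>\<^bsub>alg\<^esub> Y k j)"
    unfolding mat_nonneg_def by blast
  show "\<forall>n\<in>K. hpsd I (\<lambda>i j. pt (M i j) n)"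
  proof
    fix n
    have "hpsd I (\<lambda>i j. \<Sum>k\<in>I. cnj (pt (Y k i) n) * pt (Y k j) n)" by (intro hpsd_sum hpsd_rank1)
    moreover have "pt (M i j) n = (\<Sum>k\<in>I. cnj (pt (Y k i) n) * pt (Y k j) n)" if "i \<in> I" "j \<in> I" for i j
    proof -
      have "M i j = (\<Oplus>\<^bsub>alg\<^esub>k\<in>I. star alg (Y k i) \<otimes>\<^bsub>alg\<^esub> Y k j)" using Y that by blast
      then show ?thesis by (simp only: pt_finsum[OF assms(1) closed_ops(1)] pt_ops)
    qed
    ultimately show "hpsd I (\<lambda>i j. pt (M i j) n)" using hpsd_cong[of I] by (metis (no_types, lifting))
  qed
next
  assume h: "\<forall>n\<in>K. hpsd I (\<lambda>i j. pt (M i j) n)"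
  have "\<forall>n\<in>K. \<exists>Y. \<forall>i\<in>I. \<forall>j\<in>I. pt (M i j) n = (\<Sum>k\<in>I. cnj (Y k i) * Y k j)"
  proof
    fix n assume "n \<in> K"
    then have "hpsd I (\<lambda>i j. pt (M i j) n)" using h by blast
    from hpsd_square_gram[OF this assms(1)]
    show "\<exists>Y. \<forall>i\<in>I. \<forall>j\<in>I. pt (M i j) n = (\<Sum>k\<in>I. cnj (Y k i) * Y k j)" .
  qed
  from bchoice[OF this] obtain Y where Y: "\<forall>n\<in>K. \<forall>i\<in>I. \<forall>j\<in>I. pt (M i j) n = (\<Sum>k\<in>I. cnj (Y n k i) * Y n k j)"
    by (elim exE) (rule that)
  define y where "y k i n = (if n \<in> K then Y n k i else 0)" for k i n
  have yb: "bounded (range (y k i))" if ki: "k \<in> I" "i \<in> I" for k i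
  proof (rule bounded_rangeI)
    fix n
    show "cmod (y k i n) \<le> sqrt (norm (dec (M i i)))"
    proof (cases "n \<in> K")
      case True
      have "pt (M i i) n = (\<Sum>k\<in>I. cnj (Y n k i) * Y n k i)" using Y True ki by blast
      also have "\<dots> = (\<Sum>k\<in>I. complex_of_real ((cmod (Y n k i))\<^sup>2))"
        by (intro sum.cong refl) (use complex_norm_square in \<open>simp add: mult.commute\<close>)
      finally have "pt (M i i) n = complex_of_real (\<Sum>k\<in>I. (cmod (Y n k i))\<^sup>2)" by simp
      then have "cmod (pt (M i i) n) = (\<Sum>k\<in>I. (cmod (Y n k i))\<^sup>2)"
        by (simp only: norm_of_real) (simp add: sum_nonneg)
      moreover have "(cmod (Y n k i))\<^sup>2 \<le> (\<Sum>k\<in>I. (cmod (Y n k i))\<^sup>2)"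
        by (rule member_le_sum) (use ki assms(1) in auto)
      ultimately have "(cmod (Y n k i))\<^sup>2 \<le> norm (dec (M i i))" using pt_le[of "M i i" n] by simp
      then show ?thesis using True by (simp add: y_def real_le_rsqrt)
    qed (simp add: y_def)
  qed
  have yK: "n \<notin> K \<Longrightarrow> y k i n = 0" for k i n by (simp add: y_def)
  show "mat_nonneg alg I M"
    unfolding mat_nonneg_def
  proof (rule exI[of _ "\<lambda>k i. enc (y k i)"], intro conjI ballI)
    fix i j assume ij: "i \<in> I" "j \<in> I"
    show "enc (y i j) \<in> carrier alg" unfolding alg_sel(1) by (rule enc_carr[OF yb[OF ij] yK])
    show "M i j = (\<Oplus>\<^bsub>alg\<^esub>k\<in>I. star alg (enc (y k i)) \<otimes>\<^bsub>alg\<^esub> enc (y k j))"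
    proof (rule carr_eqI)
      show "M i j \<in> carr" by (rule assms(2)[OF ij])
      interpret cring alg by (rule alg_cring)
      have "(\<Oplus>\<^bsub>alg\<^esub>k\<in>I. star alg (enc (y k i)) \<otimes>\<^bsub>alg\<^esub> enc (y k j)) \<in> carrier alg"
        by (rule finsum_closed) (simp only: alg_sel(1) closed_ops Pi_iff Ball_def simp_thms)
      then show "(\<Oplus>\<^bsub>alg\<^esub>k\<in>I. star alg (enc (y k i)) \<otimes>\<^bsub>alg\<^esub> enc (y k j)) \<in> carr" by (simp only: alg_sel(1))
      fix n
      have "pt (\<Oplus>\<^bsub>alg\<^esub>k\<in>I. star alg (enc (y k i)) \<otimes>\<^bsub>alg\<^esub> enc (y k j)) n = (\<Sum>k\<in>I. cnj (y k i n) * y k j n)"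
        unfolding pt_finsum[OF assms(1) closed_ops(1)]
        by (rule sum.cong[OF refl]) (simp add: pt_ops pt_enc[OF yb yK] ij)
      also have "\<dots> = pt (M i j) n"
      proof (cases "n \<in> K")
        case True
        then have "pt (M i j) n = (\<Sum>k\<in>I. cnj (Y n k i) * Y n k j)" using Y ij by blast
        then show ?thesis using True by (simp add: y_def)
      qed (simp add: y_def pt_out)
      finally show "pt (M i j) n = pt (\<Oplus>\<^bsub>alg\<^esub>k\<in>I. star alg (enc (y k i)) \<otimes>\<^bsub>alg\<^esub> enc (y k j)) n" ..
    qed
  qed
qed

end

text \<open>A real number is coded by a set of naturals, and a complex sequence by one such set
  through pairing, with real parts at even and imaginary parts at odd positions. So bounded
  sequences inject into the reals and from there into the given type.\<close>

lemma bounded_sequences_embed: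
  assumes "inj (g :: real \<Rightarrow> 'u)"
  obtains e :: "(nat \<Rightarrow>\<^sub>C complex) \<Rightarrow> 'u" where "inj e"
proof -
  obtain h :: "nat set \<Rightarrow> real" where h: "bij h" using nat_sets_eqpoll_reals unfolding eqpoll_def by blast
  define k where "k = inv_into UNIV h"
  have k: "inj k" unfolding k_def using h by (simp add: bij_imp_bij_inv bij_is_inj)
  define c where "c f = {prod_encode (n, 2 * i) |n i. i \<in> k (Re (apply_bcontfun f n))}
      \<union> {prod_encode (n, 2 * i + 1) |n i. i \<in> k (Im (apply_bcontfun f n))}" for f :: "nat \<Rightarrow>\<^sub>C complex"
  have "inj c"
  proof (rule injI, rule bcontfun_eqI)
    fix f f' n assume eq: "c f = c f'"
    have re: "i \<in> k (Re (apply_bcontfun f n)) \<longleftrightarrow> prod_encode (n, 2 * i) \<in> c f" for f i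
      by (auto simp: c_def) presburger+
    have im: "i \<in> k (Im (apply_bcontfun f n)) \<longleftrightarrow> prod_encode (n, 2 * i + 1) \<in> c f" for f i
      by (auto simp: c_def) presburger+
    have "k (Re (apply_bcontfun f n)) = k (Re (apply_bcontfun f' n))" using re[of _ f] re[of _ f'] eq by blast
    moreover have "k (Im (apply_bcontfun f n)) = k (Im (apply_bcontfun f' n))" using im[of _ f] im[of _ f'] eq by blast
    ultimately show "apply_bcontfun f n = apply_bcontfun f' n" using k by (simp add: inj_eq complex_eq_iff)
  qed
  then have "inj (g \<circ> (h \<circ> c))" using assms h by (intro inj_compose) (auto simp: bij_is_inj)
  then show ?thesis using that by blast
qed

section \<open>Two by two symbols and a criterion for 2-subhomogeneity\<close>

lemma lessThan_two: "{..<2::nat} = {0, 1}"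
  by auto

lemma herm_form_blocks:
  fixes H :: "'i \<times> nat \<Rightarrow> 'i \<times> nat \<Rightarrow> complex"
  shows "herm_form (I \<times> {..<2}) H x = (\<Sum>i\<in>I. \<Sum>j\<in>I. \<Sum>p<2. \<Sum>q<2. cnj (x (i, p)) * H (i, p) (j, q) * x (j, q))"
proof -
  have "herm_form (I \<times> {..<2}) H x = (\<Sum>i\<in>I. \<Sum>p<2. \<Sum>j\<in>I. \<Sum>q<2. cnj (x (i, p)) * H (i, p) (j, q) * x (j, q))"
  proof -
    have cart: "(\<Sum>a\<in>I \<times> {..<2}. F a) = (\<Sum>i\<in>I. \<Sum>p<2::nat. F (i, p))" for F :: "'i \<times> nat \<Rightarrow> complex"
      by (simp add: sum.cartesian_product)
    show ?thesis unfolding herm_form_def cart ..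
  qed
  also have "\<dots> = (\<Sum>i\<in>I. \<Sum>j\<in>I. \<Sum>p<2. \<Sum>q<2. cnj (x (i, p)) * H (i, p) (j, q) * x (j, q))"
    by (intro sum.cong refl sum.swap)
  finally show ?thesis .
qed

definition congruence :: "(nat \<Rightarrow> nat \<Rightarrow> complex) \<Rightarrow> ('i \<times> nat \<Rightarrow> 'i \<times> nat \<Rightarrow> complex) \<Rightarrow> 'i \<times> nat \<Rightarrow> 'i \<times> nat \<Rightarrow> complex" where
  "congruence T H = (\<lambda>(i, p) (j, q). \<Sum>r<2. \<Sum>s<2. cnj (T r p) * H (i, r) (j, s) * T s q)"

lemma herm_form_congruence:
  "herm_form (I \<times> {..<2}) (congruence T H) x = herm_form (I \<times> {..<2}) H (\<lambda>(i, r). \<Sum>p<2. T r p * x (i, p))"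
  unfolding herm_form_blocks
  by (rule sum.cong[OF refl], rule sum.cong[OF refl]) (simp add: congruence_def lessThan_two algebra_simps)

text \<open>\<open>T\<close> is upper triangular with nonzero diagonal, hence invertible, and back
  substitution writes any vector as an image. So normalising the unit does not affect
  positivity.\<close>

lemma hpsd_congruence_iff:
  fixes T :: "nat \<Rightarrow> nat \<Rightarrow> complex"
  assumes T: "T 0 0 \<noteq> 0" "T 1 1 \<noteq> 0" "T 1 0 = 0"
    and H: "\<And>i p j q. H (j, q) (i, p) = cnj (H (i, p) (j, q))"
  shows "hpsd (I \<times> {..<2}) (congruence T H) \<longleftrightarrow> hpsd (I \<times> {..<2}) H"
proof
  assume h: "hpsd (I \<times> {..<2}) (congruence T H)"
  show "hpsd (I \<times> {..<2}) H"
  proof (rule hpsdI)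
    fix x y :: "'a \<times> nat"
    show "H y x = cnj (H x y)" using H[of "fst y" "snd y" "fst x" "snd x"] by simp
  next
    fix x :: "'a \<times> nat \<Rightarrow> complex"
    define y where "y = (\<lambda>(i, p). if p = (0::nat) then (x (i, 0) - T 0 1 * (x (i, 1) / T 1 1)) / T 0 0 else x (i, 1) / T 1 1)"
    have "(\<Sum>p<2. T r p * y (i, p)) = x (i, r)" if "r < 2" for i r
    proof -
      have "r = 0 \<or> r = 1" using that by auto
      then show ?thesis using T by (auto simp: y_def lessThan_two simp del: One_nat_def)
    qed
    then have "herm_form (I \<times> {..<2}) H (\<lambda>(i, r). \<Sum>p<2. T r p * y (i, p)) = herm_form (I \<times> {..<2}) H x"
      by (intro herm_form_cong) auto
    then show "0 \<le> Re (herm_form (I \<times> {..<2}) H x)"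
      using hpsd_pos[OF h, of y] by (simp add: herm_form_congruence)
  qed
next
  assume h: "hpsd (I \<times> {..<2}) H"
  show "hpsd (I \<times> {..<2}) (congruence T H)"
  proof (rule hpsdI)
    fix x y :: "'a \<times> nat"
    obtain i p j q where xy: "x = (i, p)" "y = (j, q)" by (cases x, cases y)
    have "cnj (congruence T H x y) = (\<Sum>r<2. \<Sum>s<2. cnj (T s q) * H (j, s) (i, r) * T r p)"
      unfolding congruence_def xy prod.case cnj_sum complex_cnj_mult H[of i _ j] complex_cnj_cnj
      by (intro sum.cong refl) (simp add: mult_ac)
    also have "\<dots> = congruence T H y x" unfolding congruence_def xy prod.case by (rule sum.swap)
    finally show "congruence T H y x = cnj (congruence T H x y)" by simp
  next
    show "0 \<le> Re (herm_form (I \<times> {..<2}) (congruence T H) x)" for x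
      unfolding herm_form_congruence by (rule hpsd_pos[OF h])
  qed
qed

lemma hpsd_kronecker:
  assumes H: "hpsd I H" and G: "hpsd J G" and fin: "finite I" "finite J"
  shows "hpsd (I \<times> J) (\<lambda>(i, p) (j, q). H i j * G p q)"
proof -
  obtain y where y: "\<forall>i\<in>I. \<forall>j\<in>I. H i j = (\<Sum>k\<in>I. cnj (y k i) * y k j)"
    using hpsd_square_gram[OF H fin(1)] by (elim exE) (rule that)
  obtain w where w: "\<forall>i\<in>J. \<forall>j\<in>J. G i j = (\<Sum>k\<in>J. cnj (w k i) * w k j)"
    using hpsd_square_gram[OF G fin(2)] by (elim exE) (rule that)
  have "hpsd (I \<times> J) (\<lambda>a b. \<Sum>k\<in>I \<times> J. cnj (y (fst k) (fst a) * w (snd k) (snd a)) * (y (fst k) (fst b) * w (snd k) (snd b)))"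
    by (rule hpsd_sum) (rule hpsd_rank1)
  also have "?this \<longleftrightarrow> ?thesis"
  proof (rule hpsd_cong)
    fix a b assume "a \<in> I \<times> J" "b \<in> I \<times> J"
    then obtain i p j q where ab: "a = (i, p)" "b = (j, q)" "i \<in> I" "j \<in> I" "p \<in> J" "q \<in> J" by auto
    have "H i j * G p q = (\<Sum>k\<in>I. cnj (y k i) * y k j) * (\<Sum>k\<in>J. cnj (w k p) * w k q)" using y w ab by simp
    also have "\<dots> = (\<Sum>k\<in>I \<times> J. cnj (y (fst k) i * w (snd k) p) * (y (fst k) j * w (snd k) q))"
      unfolding sum_product sum.cartesian_product by (intro sum.cong refl) (auto simp: mult_ac)
    finally show "(\<Sum>k\<in>I \<times> J. cnj (y (fst k) (fst a) * w (snd k) (snd a)) * (y (fst k) (fst b) * w (snd k) (snd b)))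
      = (\<lambda>(i, p) (j, q). H i j * G p q) a b" unfolding ab by simp
  qed
  finally show ?thesis .
qed

text \<open>\<open>sq_mat \<alpha> \<beta> \<gamma> z\<close> is the matrix with diagonal \<open>\<alpha>\<close> and upper corner \<open>\<beta> + z\<gamma>\<close>; for the coordinates of
  \<open>C\<^sub>\<square>\<close> it is positive for all \<open>z\<close> on the unit circle iff \<open>\<bar>\<beta>\<bar> + \<bar>\<gamma>\<bar> \<le> \<alpha>\<close>.\<close>

definition sq_mat :: "complex \<Rightarrow> complex \<Rightarrow> complex \<Rightarrow> complex \<Rightarrow> nat \<Rightarrow> nat \<Rightarrow> complex" where
  "sq_mat \<alpha> \<beta> \<gamma> z p q = (if p = q then \<alpha> else if p < q then \<beta> + z * \<gamma> else \<beta> + cnj z * \<gamma>)"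

definition cx :: "('e \<Rightarrow> real) \<Rightarrow> 'e \<times> 'e \<Rightarrow> complex" where
  "cx f w = Complex (f (fst w)) (f (snd w))"

definition sq_block :: "('e \<Rightarrow> real) \<Rightarrow> ('e \<Rightarrow> real) \<Rightarrow> ('e \<Rightarrow> real) \<Rightarrow> complex \<Rightarrow> 'e cmat \<Rightarrow> nat \<times> nat \<Rightarrow> nat \<times> nat \<Rightarrow> complex" where
  "sq_block \<alpha> \<beta> \<gamma> z Z = (\<lambda>(i, p) (j, q). sq_mat (cx \<alpha> (Z i j)) (cx \<beta> (Z i j)) (cx \<gamma> (Z i j)) z p q)"

lemma cx_herm:
  assumes "linear f" "Z \<in> her V s" shows "cx f (Z j i) = cnj (cx f (Z i j))"
  using herD(3,4)[OF assms(2), of i j] linear_neg[OF assms(1)] by (simp add: cx_def complex_eq_iff)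

lemma sq_block_herm:
  assumes "linear \<alpha>" "linear \<beta>" "linear \<gamma>" "Z \<in> her V s"
  shows "sq_block \<alpha> \<beta> \<gamma> z Z (j, q) (i, p) = cnj (sq_block \<alpha> \<beta> \<gamma> z Z (i, p) (j, q))"
  unfolding sq_block_def sq_mat_def prod.case
    cx_herm[OF assms(1,4), of j i] cx_herm[OF assms(2,4), of j i] cx_herm[OF assms(3,4), of j i]
  by simp

text \<open>Inverse of the upper triangular Cholesky factor of the matrix with diagonal
  \<open>A\<close> and upper corner \<open>g\<close>: congruence by it turns that matrix into the
  identity.\<close>

definition sq_norm :: "real \<Rightarrow> complex \<Rightarrow> nat \<Rightarrow> nat \<Rightarrow> complex" where
  "sq_norm A g p q = (let D = sqrt (A - (cmod g)\<^sup>2 / A) in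
     if p = 0 \<and> q = 0 then of_real (1 / sqrt A)
     else if p = 0 \<and> q = 1 then - g * of_real (1 / (A * D))
     else if p = 1 \<and> q = 1 then of_real (1 / D) else 0)"

lemma sq_norm_unit:
  assumes g: "cmod (of_real b + z * of_real c) < A" and pq: "p < 2" "q < 2" 
  shows "(\<Sum>r<2. \<Sum>s<2. cnj (sq_norm A (of_real b + z * of_real c) r p) * sq_mat (of_real A) (of_real b) (of_real c) z r s
      * sq_norm A (of_real b + z * of_real c) s q) = of_bool (p = q)"
proof -
  define g where "g = of_real b + z * of_real c"
  define D where "D = sqrt (A - (cmod g)\<^sup>2 / A)"
  have A: "0 < A" using g norm_ge_zero le_less_trans by blast
  have "(cmod g)\<^sup>2 < A\<^sup>2" using g by (intro power_strict_mono) (auto simp: g_def)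
  then have "0 < A - (cmod g)\<^sup>2 / A" using A by (simp add: field_simps power2_eq_square)
  then have D: "0 < D" "D * D = A - (cmod g)\<^sup>2 / A" by (simp_all add: D_def)
  have DD: "complex_of_real D * complex_of_real D = of_real A - cnj g * g / of_real A"
    unfolding of_real_mult[symmetric] D(2) using complex_norm_square[of g] by (simp add: mult.commute)
  have AA: "complex_of_real (sqrt A) * complex_of_real (sqrt A) = of_real A" unfolding of_real_mult[symmetric] using A by simp
  have n0: "complex_of_real A \<noteq> 0" "complex_of_real D \<noteq> 0" "complex_of_real (sqrt A) \<noteq> 0" using A D by auto
  have m: "sq_mat (of_real A) (of_real b) (of_real c) z 0 0 = of_real A" "sq_mat (of_real A) (of_real b) (of_real c) z 0 1 = g"
    "sq_mat (of_real A) (of_real b) (of_real c) z 1 0 = cnj g" "sq_mat (of_real A) (of_real b) (of_real c) z 1 1 = of_real A"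
    by (simp_all add: sq_mat_def g_def)
  have t: "sq_norm A g 0 0 = 1 / of_real (sqrt A)" "sq_norm A g 0 1 = - g / (of_real A * of_real D)"
    "sq_norm A g 1 0 = 0" "sq_norm A g 1 1 = 1 / of_real D"
    by (simp_all add: sq_norm_def D_def[symmetric])
  have 1: "of_real A / (complex_of_real (sqrt A) * complex_of_real (sqrt A)) = 1" unfolding AA using n0 by simp
  have 2: "(of_real A - cnj g * g / of_real A) / (complex_of_real D * complex_of_real D) = 1"
    unfolding DD[symmetric] using n0 by simp
  have "p = 0 \<or> p = 1" "q = 0 \<or> q = 1" using pq by auto
  then show ?thesis
    unfolding g_def[symmetric]
  proof (elim disjE)
    assume "p = 0" "q = 0"
    then have "(\<Sum>r<2. \<Sum>s<2. cnj (sq_norm A g r p) * sq_mat (of_real A) (of_real b) (of_real c) z r s * sq_norm A g s q)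
      = of_real A / (complex_of_real (sqrt A) * complex_of_real (sqrt A))"
      by (simp add: lessThan_two m t del: One_nat_def)
    then show "(\<Sum>r<2. \<Sum>s<2. cnj (sq_norm A g r p) * sq_mat (of_real A) (of_real b) (of_real c) z r s * sq_norm A g s q) = of_bool (p = q)"
      unfolding 1 using \<open>p = 0\<close> \<open>q = 0\<close> by simp
  next
    assume "p = 0" "q = 1"
    then show "(\<Sum>r<2. \<Sum>s<2. cnj (sq_norm A g r p) * sq_mat (of_real A) (of_real b) (of_real c) z r s * sq_norm A g s q) = of_bool (p = q)"
      using n0 by (simp add: lessThan_two m t del: One_nat_def)
  next
    assume "p = 1" "q = 0"
    then show "(\<Sum>r<2. \<Sum>s<2. cnj (sq_norm A g r p) * sq_mat (of_real A) (of_real b) (of_real c) z r s * sq_norm A g s q) = of_bool (p = q)"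
      using n0 by (simp add: lessThan_two m t del: One_nat_def)
  next
    assume "p = 1" "q = 1"
    then have "(\<Sum>r<2. \<Sum>s<2. cnj (sq_norm A g r p) * sq_mat (of_real A) (of_real b) (of_real c) z r s * sq_norm A g s q)
      = (of_real A - cnj g * g / of_real A) / (complex_of_real D * complex_of_real D)"
      using n0 by (simp add: lessThan_two m t del: One_nat_def) (simp add: field_simps)
    then show "(\<Sum>r<2. \<Sum>s<2. cnj (sq_norm A g r p) * sq_mat (of_real A) (of_real b) (of_real c) z r s * sq_norm A g s q) = of_bool (p = q)"
      unfolding 2 using \<open>p = 1\<close> \<open>q = 1\<close> by simp
  qed
qed

text \<open>The bound depends only on the gap between \<open>A\<close> and |g|, so the normalising
  factors stay bounded as z varies and define elements of the algebra.\<close>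

lemma sq_norm_bound:
  assumes g: "cmod g + \<delta> \<le> A" and d: "0 < \<delta>"
  shows "cmod (sq_norm A g p q) \<le> 1 / sqrt \<delta>"
proof -
  define D where "D = sqrt (A - (cmod g)\<^sup>2 / A)"
  have A: "0 < A" "\<delta> \<le> A" "cmod g \<le> A" using g d norm_ge_zero[of g] by linarith+
  have "(cmod g)\<^sup>2 \<le> cmod g * A" unfolding power2_eq_square using A by (intro mult_left_mono) auto
  then have "(cmod g)\<^sup>2 / A \<le> cmod g" using A by (simp add: field_simps)
  then have "\<delta> \<le> A - (cmod g)\<^sup>2 / A" using g by linarith
  then have D: "sqrt \<delta> \<le> D" by (simp add: D_def)
  have s: "0 < sqrt \<delta>" using d by simp
  have 1: "1 / sqrt A \<le> 1 / sqrt \<delta>" using A s by (intro divide_left_mono) auto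
  have D0: "0 < D" using D s by linarith
  have 2: "1 / D \<le> 1 / sqrt \<delta>" by (rule divide_left_mono[OF D]) (use D0 s in simp_all)
  have "cmod g * (1 / (A * D)) = (cmod g / A) * (1 / D)" by simp
  also have "\<dots> \<le> 1 * (1 / sqrt \<delta>)" by (rule mult_mono) (use A 2 D0 s in auto)
  finally have 3: "cmod g * (1 / (A * D)) \<le> 1 / sqrt \<delta>" by simp
  have n: "cmod (complex_of_real (1 / sqrt A)) = 1 / sqrt A" "cmod (complex_of_real (1 / D)) = 1 / D"
    "cmod (- g * complex_of_real (1 / (A * D))) = cmod g * (1 / (A * D))"
    using A D0 by (simp_all only: norm_of_real norm_mult norm_minus_cancel) simp_all
  show ?thesis
    unfolding sq_norm_def Let_def D_def[symmetric] using 1 2 3 n s by (simp only: split: if_split) simp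
qed

text \<open>If finitely many families of 2 by 2 symbols at roots of unity detect the minimal cone,
  their values form one map into 2 by 2 matrices over bounded sequences. The map is made unital by
  the congruence \<open>sq_norm\<close>, which is available because \<open>u\<close> gives strictly
  positive symbols with a uniform gap.\<close>

lemma subhomogeneous_of_blocks:
  fixes V C :: "'e::real_vector set" and g :: "real \<Rightarrow> 'u" and R :: nat
    and \<alpha> \<beta> \<gamma> :: "nat \<Rightarrow> 'e \<Rightarrow> real"
  assumes g: "inj g" and V: "subspace V"
    and lin: "\<And>k. k < R \<Longrightarrow> linear (\<alpha> k)" "\<And>k. k < R \<Longrightarrow> linear (\<beta> k)" "\<And>k. k < R \<Longrightarrow> linear (\<gamma> k)"
    and u: "\<And>k. k < R \<Longrightarrow> \<bar>\<beta> k u\<bar> + \<bar>\<gamma> k u\<bar> < \<alpha> k u"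
    and crit: "\<And>s Z. Z \<in> her V s \<Longrightarrow> Z \<in> min_cone C s \<longleftrightarrow> (\<forall>k<R. \<forall>N j. hpsd ({..<s} \<times> {..<2})
        (sq_block (\<alpha> k) (\<beta> k) (\<gamma> k) (cis (2 * pi * real j / real (N::nat))) Z))"
  shows "d_subhomogeneous TYPE('u) 2 (min_op_system V C u)"
proof -
  \<comment> \<open>A natural number codes the block and the root of unity exp(2 pi i j / N). For N
    = 0 division by zero yields the root 1, which does no harm.\<close>
  define comp where "comp n = fst (prod_decode n)" for n
  define ang where "ang n = (case prod_decode (snd (prod_decode n)) of (N, j) \<Rightarrow> cis (2 * pi * real j / real N))" for n
  have ang: "cmod (ang n) = 1" for n by (simp add: ang_def split_def)
  define K where "K = {n. comp n < R}"
  obtain e :: "(nat \<Rightarrow>\<^sub>C complex) \<Rightarrow> 'u" where e: "inj e" by (rule bounded_sequences_embed[OF g])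
  interpret L: linf e K by standard (rule e)
  define T where "T n = sq_norm (\<alpha> (comp n) u) (of_real (\<beta> (comp n) u) + ang n * of_real (\<gamma> (comp n) u))" for n
  define W where "W n v = sq_mat (of_real (\<alpha> (comp n) v)) (of_real (\<beta> (comp n) v)) (of_real (\<gamma> (comp n) v)) (ang n)" for n v
  define F where "F v p q n = (if n \<in> K then \<Sum>r<2. \<Sum>s<2. cnj (T n r p) * W n v r s * T n s q else 0)" for v p q n
  define \<Phi> where "\<Phi> v p q = L.enc (F v p q)" for v p q
  have gu: "cmod (of_real (\<beta> (comp n) u) + ang n * of_real (\<gamma> (comp n) u)) \<le> \<bar>\<beta> (comp n) u\<bar> + \<bar>\<gamma> (comp n) u\<bar>" for n
    using norm_triangle_ineq[of "complex_of_real (\<beta> (comp n) u)" "ang n * of_real (\<gamma> (comp n) u)"] by (simp add: norm_mult ang)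
  define b where "b k v = 4 * ((1 / sqrt (\<alpha> k u - \<bar>\<beta> k u\<bar> - \<bar>\<gamma> k u\<bar>))\<^sup>2 * (\<bar>\<alpha> k v\<bar> + \<bar>\<beta> k v\<bar> + \<bar>\<gamma> k v\<bar>))" for k v
  have b0: "0 \<le> b k v" for k v by (simp add: b_def)
  have Fb: "cmod (F v p q n) \<le> (\<Sum>k<R. b k v)" for v p q n
  proof (cases "n \<in> K")
    case True
    then have k: "comp n < R" by (simp add: K_def)
    let ?b = "1 / sqrt (\<alpha> (comp n) u - \<bar>\<beta> (comp n) u\<bar> - \<bar>\<gamma> (comp n) u\<bar>)" and ?m = "\<bar>\<alpha> (comp n) v\<bar> + \<bar>\<beta> (comp n) v\<bar> + \<bar>\<gamma> (comp n) v\<bar>"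
    have Tb: "cmod (T n r s) \<le> ?b" for r s
      unfolding T_def by (rule sq_norm_bound) (use gu[of n] u[OF k] in linarith)+
    have b1: "0 \<le> ?b" by (rule order.trans[OF norm_ge_zero Tb[of 0 0]])
    have t: "cmod (x + z * y) \<le> cmod x + cmod y" if "cmod z = 1" for x y z :: complex
      using norm_triangle_ineq[of x "z * y"] that by (simp add: norm_mult)
    have Wb: "cmod (W n v r s) \<le> ?m" for r s
      unfolding W_def sq_mat_def
      using t[OF ang[of n], of "of_real (\<beta> (comp n) v)" "of_real (\<gamma> (comp n) v)"]
        t[of "cnj (ang n)" "of_real (\<beta> (comp n) v)" "of_real (\<gamma> (comp n) v)"] ang[of n] by auto
    have one: "cmod (cnj (T n r p) * W n v r s * T n s q) \<le> ?b * ?m * ?b" for r s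
      unfolding norm_mult complex_mod_cnj
      by (rule mult_mono[OF mult_mono[OF Tb Wb b1 norm_ge_zero] Tb]) (rule mult_nonneg_nonneg[OF b1], simp, rule norm_ge_zero)
    have "cmod (F v p q n) \<le> (\<Sum>r<2::nat. \<Sum>s<2::nat. ?b * ?m * ?b)"
      using True one by (simp only: F_def if_True) (intro sum_norm_le one)
    also have "\<dots> = b (comp n) v" by (simp only: b_def sum_constant card_lessThan power2_eq_square) simp
    also have "\<dots> \<le> (\<Sum>k<R. b k v)" by (rule member_le_sum) (use k b0 in auto)
    finally show ?thesis .
  qed (simp add: F_def sum_nonneg b0)
  have Fbd: "bounded (range (F v p q))" for v p q by (rule L.bounded_rangeI[OF Fb])
  have FK: "n \<notin> K \<Longrightarrow> F v p q n = 0" for v p q n by (simp add: F_def)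
  have ptP: "L.pt (\<Phi> v p q) n = F v p q n" for v p q n unfolding \<Phi>_def by (rule L.pt_enc[OF Fbd FK])
  have Pc: "\<Phi> v p q \<in> L.carr" for v p q unfolding \<Phi>_def by (rule L.enc_carr[OF Fbd FK])
  have lk: "linear (\<alpha> (comp n))" "linear (\<beta> (comp n))" "linear (\<gamma> (comp n))" if "n \<in> K" for n
    using that lin by (auto simp: K_def)
  have Wadd: "W n (v + w) r s = W n v r s + W n w r s" if "n \<in> K" for n v w r s
    by (simp add: W_def sq_mat_def linear_add[OF lk(1)[OF that]] linear_add[OF lk(2)[OF that]] linear_add[OF lk(3)[OF that]] algebra_simps)
  have Wsc: "W n (t *\<^sub>R v) r s = of_real t * W n v r s" if "n \<in> K" for n v t r s
    by (simp add: W_def sq_mat_def linear_scale[OF lk(1)[OF that]] linear_scale[OF lk(2)[OF that]] linear_scale[OF lk(3)[OF that]] algebra_simps)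
  have Wh: "W n v s r = cnj (W n v r s)" for n v r s by (simp add: W_def sq_mat_def)
  have map: "unital_herm_map L.alg 2 V u \<Phi>"
    unfolding unital_herm_map_def
  proof (intro allI impI conjI ballI)
    fix p q :: nat and v w r assume pq: "p < 2" "q < 2"
    show "\<Phi> v p q \<in> carrier L.alg" unfolding L.alg_sel(1) by (rule Pc)
    show "\<Phi> v q p = star L.alg (\<Phi> v p q)"
    proof (rule L.carr_eqI[OF Pc L.closed_ops(6)])
      fix n
      have "(\<Sum>r<2. \<Sum>s<2. cnj (T n r q) * W n v r s * T n s p) = (\<Sum>s<2. \<Sum>r<2. cnj (T n r q) * W n v r s * T n s p)"
        by (rule sum.swap)
      also have "\<dots> = cnj (\<Sum>s<2. \<Sum>r<2. cnj (T n s p) * W n v s r * T n r q)"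
        unfolding cnj_sum complex_cnj_mult complex_cnj_cnj Wh[symmetric] by (simp only: mult_ac)
      finally show "L.pt (\<Phi> v q p) n = L.pt (star L.alg (\<Phi> v p q)) n" by (simp add: L.pt_ops ptP F_def)
    qed
    show "\<Phi> (v + w) p q = \<Phi> v p q \<oplus>\<^bsub>L.alg\<^esub> \<Phi> w p q"
      by (rule L.carr_eqI[OF Pc L.closed_ops(4)])
        (simp add: L.pt_ops ptP F_def Wadd distrib_left distrib_right sum.distrib)
    show "\<Phi> (r *\<^sub>R v) p q = complex_of_real r \<odot>\<^bsub>L.alg\<^esub> \<Phi> v p q"
      by (rule L.carr_eqI[OF Pc L.closed_ops(5)])
        (simp add: L.pt_ops ptP F_def Wsc sum_distrib_left mult_ac)
    have un: "F u p q n = of_bool (n \<in> K \<and> p = q)" for n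
    proof (cases "n \<in> K")
      case True
      then have "cmod (of_real (\<beta> (comp n) u) + ang n * of_real (\<gamma> (comp n) u)) < \<alpha> (comp n) u"
        using u[of "comp n"] gu[of n] by (simp add: K_def)
      from sq_norm_unit[OF this pq] show ?thesis using True by (simp add: F_def T_def W_def)
    qed (simp add: F_def)
    show "\<Phi> u p q = (if p = q then \<one>\<^bsub>L.alg\<^esub> else \<zero>\<^bsub>L.alg\<^esub>)"
    proof (cases "p = q")
      case True
      have "F u p q n = of_bool (n \<in> K)" for n using un[of n] True by simp
      then have "\<Phi> u p q = \<one>\<^bsub>L.alg\<^esub>"
        by (intro L.carr_eqI[OF Pc L.closed_ops(2)]) (simp only: L.pt_ops ptP)
      then show ?thesis using True by simp
    next
      case False
      have "\<Phi> u p q = \<zero>\<^bsub>L.alg\<^esub>"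
        by (rule L.carr_eqI[OF Pc L.closed_ops(3)]) (simp add: L.pt_ops ptP un False)
      then show ?thesis using False by simp
    qed
  qed
  have pos: "Z \<in> min_cone C s \<longleftrightarrow> mat_nonneg L.alg ({..<s} \<times> {..<2}) (ampliation L.alg \<Phi> Z)" if Z: "Z \<in> her V s" for s Z
  proof -
    have ac: "ampliation L.alg \<Phi> Z x y \<in> L.carr" for x y
      unfolding ampliation_def split_def by (rule L.closed_ops(4))
    have pa: "L.pt (ampliation L.alg \<Phi> Z x y) n = congruence (T n) (sq_block (\<alpha> (comp n)) (\<beta> (comp n)) (\<gamma> (comp n)) (ang n) Z) x y"
      if n: "n \<in> K" for n x y
    proof -
      obtain i p j q where xy: "x = (i, p)" "y = (j, q)" by (cases x, cases y)
      have c: "cx f w = of_real (f (fst w)) + \<i> * of_real (f (snd w))" for f and w :: "'e \<times> 'e"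
        by (simp add: cx_def complex_eq_iff)
      have w: "W n (fst (Z i j)) r s + \<i> * W n (snd (Z i j)) r s
        = sq_block (\<alpha> (comp n)) (\<beta> (comp n)) (\<gamma> (comp n)) (ang n) Z (i, r) (j, s)" for r s
        by (simp add: sq_block_def W_def sq_mat_def c algebra_simps)
      have "L.pt (ampliation L.alg \<Phi> Z x y) n = F (fst (Z i j)) p q n + \<i> * F (snd (Z i j)) p q n"
        unfolding xy ampliation_def prod.case by (simp add: L.pt_ops ptP)
      also have "\<dots> = (\<Sum>r<2. \<Sum>s<2. cnj (T n r p) * (W n (fst (Z i j)) r s + \<i> * W n (snd (Z i j)) r s) * T n s q)"
        using n by (simp add: F_def distrib_left distrib_right sum.distrib sum_distrib_left mult_ac)
      finally show ?thesis unfolding w xy congruence_def prod.case .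
    qed
    have T0: "T n 0 0 \<noteq> 0" "T n 1 1 \<noteq> 0" "T n 1 0 = 0" if n: "n \<in> K" for n
    proof -
      define A where "A = \<alpha> (comp n) u"
      define h where "h = of_real (\<beta> (comp n) u) + ang n * of_real (\<gamma> (comp n) u)"
      have hA: "cmod h < A" using n u[of "comp n"] gu[of n] by (simp add: K_def A_def h_def)
      have A: "0 < A" using hA norm_ge_zero le_less_trans by blast
      have "(cmod h)\<^sup>2 < A\<^sup>2" using hA by (intro power_strict_mono) auto
      then have "0 < A - (cmod h)\<^sup>2 / A" using A by (simp add: field_simps power2_eq_square)
      then have D: "sqrt (A - (cmod h)\<^sup>2 / A) \<noteq> 0" by simp
      show "T n 0 0 \<noteq> 0" "T n 1 1 \<noteq> 0" "T n 1 0 = 0"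
        unfolding T_def A_def[symmetric] h_def[symmetric] using A D by (simp_all add: sq_norm_def Let_def)
    qed
    have "mat_nonneg L.alg ({..<s} \<times> {..<2}) (ampliation L.alg \<Phi> Z) \<longleftrightarrow>
      (\<forall>n\<in>K. hpsd ({..<s} \<times> {..<2}) (\<lambda>x y. L.pt (ampliation L.alg \<Phi> Z x y) n))"
      by (rule L.mat_nonneg_iff) (simp_all add: ac)
    also have "\<dots> \<longleftrightarrow> (\<forall>n\<in>K. hpsd ({..<s} \<times> {..<2}) (sq_block (\<alpha> (comp n)) (\<beta> (comp n)) (\<gamma> (comp n)) (ang n) Z))"
    proof (rule ball_cong[OF refl])
      fix n assume n: "n \<in> K"
      have "hpsd ({..<s} \<times> {..<2}) (\<lambda>x y. L.pt (ampliation L.alg \<Phi> Z x y) n) \<longleftrightarrow>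
        hpsd ({..<s} \<times> {..<2}) (congruence (T n) (sq_block (\<alpha> (comp n)) (\<beta> (comp n)) (\<gamma> (comp n)) (ang n) Z))"
        by (rule hpsd_cong) (rule pa[OF n])
      also have "\<dots> \<longleftrightarrow> hpsd ({..<s} \<times> {..<2}) (sq_block (\<alpha> (comp n)) (\<beta> (comp n)) (\<gamma> (comp n)) (ang n) Z)"
        by (rule hpsd_congruence_iff[OF T0[OF n]]) (rule sq_block_herm[OF lk[OF n] Z])
      finally show "hpsd ({..<s} \<times> {..<2}) (\<lambda>x y. L.pt (ampliation L.alg \<Phi> Z x y) n) \<longleftrightarrow>
        hpsd ({..<s} \<times> {..<2}) (sq_block (\<alpha> (comp n)) (\<beta> (comp n)) (\<gamma> (comp n)) (ang n) Z)" .
    qed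
    also have "\<dots> \<longleftrightarrow> (\<forall>k<R. \<forall>N j. hpsd ({..<s} \<times> {..<2})
        (sq_block (\<alpha> k) (\<beta> k) (\<gamma> k) (cis (2 * pi * real j / real (N::nat))) Z))"
    proof (intro iffI allI impI ballI)
      fix k N j assume h: "\<forall>n\<in>K. hpsd ({..<s} \<times> {..<2}) (sq_block (\<alpha> (comp n)) (\<beta> (comp n)) (\<gamma> (comp n)) (ang n) Z)" and k: "k < R"
      let ?n = "prod_encode (k, prod_encode (N, j))"
      have "comp ?n = k" "ang ?n = cis (2 * pi * real j / real N)" by (simp_all add: comp_def ang_def)
      then show "hpsd ({..<s} \<times> {..<2}) (sq_block (\<alpha> k) (\<beta> k) (\<gamma> k) (cis (2 * pi * real j / real N)) Z)"
        using h[THEN bspec, of ?n] k by (simp add: K_def)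
    next
      fix n assume h: "\<forall>k<R. \<forall>N j. hpsd ({..<s} \<times> {..<2})
        (sq_block (\<alpha> k) (\<beta> k) (\<gamma> k) (cis (2 * pi * real j / real (N::nat))) Z)" and n: "n \<in> K"
      show "hpsd ({..<s} \<times> {..<2}) (sq_block (\<alpha> (comp n)) (\<beta> (comp n)) (\<gamma> (comp n)) (ang n) Z)"
        using h[THEN spec, of "comp n"] n unfolding ang_def split_def by (simp add: K_def)
    qed
    finally show ?thesis using crit[OF Z] by blast
  qed
  show ?thesis
    unfolding d_subhomogeneous_def min_op_system_def op_system.simps
    by (rule exI[of _ L.alg], rule exI[of _ \<Phi>]) (use L.alg_cstar map pos in blast)
qed

section \<open>Extreme rays and facets of polyhedral cones\<close>

lemma convex_cone_gen_cone: "convex_cone (gen_cone I x)"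
proof -
  have "0 \<in> gen_cone I x" using gen_coneI[of I "\<lambda>_. 0" x] by simp
  then show ?thesis
    unfolding convex_cone_iff using gen_cone_add gen_cone_scale by blast
qed

lemma convex_cone_hull_eq_gen_cone:
  assumes "finite S" shows "convex_cone hull S = gen_cone S (\<lambda>x. x)"
proof (rule hull_unique)
  show "S \<subseteq> gen_cone S (\<lambda>x. x)" using gen_cone_gen[OF assms, of _ 1 "\<lambda>x. x"] by auto
  show "convex_cone (gen_cone S (\<lambda>x. x))" by (rule convex_cone_gen_cone)
  fix T assume T: "S \<subseteq> T" "convex_cone T"
  show "gen_cone S (\<lambda>x. x) \<subseteq> T"
  proof
    fix v assume "v \<in> gen_cone S (\<lambda>x. x)"
    then obtain a where a: "v = (\<Sum>x\<in>S. a x *\<^sub>R x)" "\<forall>x\<in>S. 0 \<le> a x" by (auto simp: gen_cone_def)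
    have "(\<Sum>x\<in>F. a x *\<^sub>R x) \<in> T" if "finite F" "F \<subseteq> S" for F
      using that
    proof (induction F rule: finite_induct)
      case empty then show ?case using T(2) by (simp add: convex_cone_contains_0)
    next
      case (insert y F)
      then have "a y *\<^sub>R y \<in> T" using T a(2) by (auto simp: convex_cone_def conic_def)
      then show ?case using insert T(2) by (auto intro: convex_cone_add)
    qed
    then show "v \<in> T" using a assms by simp
  qed
qed

definition ray :: "'e::real_vector \<Rightarrow> 'e set" where
  "ray x = {t *\<^sub>R x |t. 0 \<le> t}"

text \<open>Extremality is phrased through decompositions of the generator, which suits computations
  with relations better than faces do; \<open>ext_rays_extreme_family\<close> provides the link. The
  last clause lists each ray once.\<close>

definition extreme_family :: "'e::real_vector set \<Rightarrow> 'i set \<Rightarrow> ('i \<Rightarrow> 'e) \<Rightarrow> bool" where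
  "extreme_family C I x \<longleftrightarrow> finite I \<and> C = gen_cone I x \<and>
     (\<forall>i\<in>I. x i \<noteq> 0 \<and> (\<forall>y\<in>C. \<forall>z\<in>C. x i = y + z \<longrightarrow> y \<in> ray (x i))) \<and>
     (\<forall>i\<in>I. \<forall>j\<in>I. x i \<in> ray (x j) \<longrightarrow> i = j)"

lemma pointed_sum_zero:
  assumes "finite I" "C = gen_cone I x" "C \<inter> uminus ` C = {0}" "\<forall>i\<in>I. 0 \<le> c i" "(\<Sum>i\<in>I. c i *\<^sub>R x i) = 0" "i \<in> I"
  shows "c i *\<^sub>R x i = 0"
proof -
  have "(\<Sum>j\<in>I - {i}. c j *\<^sub>R x j) \<in> C" unfolding assms(2) by (rule gen_cone_partial) (use assms in auto)
  moreover have "c i *\<^sub>R x i = - (\<Sum>j\<in>I - {i}. c j *\<^sub>R x j)"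
    using assms(1,5,6) by (simp add: sum.remove eq_neg_iff_add_eq_0)
  ultimately have "c i *\<^sub>R x i \<in> uminus ` C" by blast
  moreover have "c i *\<^sub>R x i \<in> C" unfolding assms(2) by (rule gen_cone_gen) (use assms in auto)
  ultimately show ?thesis using assms(3) by blast
qed

text \<open>A generating set of least cardinality works, since none of its members lies in the cone
  of the others.\<close>

lemma exists_extreme_family:
  fixes C :: "'e::real_vector set"
  assumes "finite S" "C = gen_cone S (\<lambda>x. x)" "C \<inter> uminus ` C = {0}"
  obtains G where "extreme_family C G (\<lambda>x. x)"
proof -
  define P where "P n = (\<exists>G. finite G \<and> card G = n \<and> C = gen_cone G (\<lambda>x. x))" for n
  have "P (card S)" using assms by (auto simp: P_def)
  then have "P (LEAST n. P n)" by (rule LeastI)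
  then obtain G where G: "finite G" "card G = (LEAST n. P n)" "C = gen_cone G (\<lambda>x. x)" unfolding P_def by blast
  have min: "C \<noteq> gen_cone Y (\<lambda>x. x)" if "Y \<subset> G" for Y
  proof
    assume "C = gen_cone Y (\<lambda>x. x)"
    then have "P (card Y)" using finite_subset[of Y G] that G(1) by (auto simp: P_def)
    then have "card G \<le> card Y" unfolding G(2) by (rule Least_le)
    then show False using psubset_card_mono[OF G(1) that] by simp
  qed
  have red: "x \<notin> gen_cone (G - {x}) (\<lambda>x. x)" if x: "x \<in> G" for x
  proof
    assume "x \<in> gen_cone (G - {x}) (\<lambda>x. x)"
    then obtain b where b: "x = (\<Sum>y\<in>G - {x}. b y *\<^sub>R y)" "\<forall>y\<in>G - {x}. 0 \<le> b y" by (auto simp: gen_cone_def)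
    have "gen_cone G (\<lambda>x. x) \<subseteq> gen_cone (G - {x}) (\<lambda>x. x)"
    proof
      fix v assume "v \<in> gen_cone G (\<lambda>x. x)"
      then obtain a where a: "v = (\<Sum>y\<in>G. a y *\<^sub>R y)" "\<forall>y\<in>G. 0 \<le> a y" by (auto simp: gen_cone_def)
      have "v = a x *\<^sub>R x + (\<Sum>y\<in>G - {x}. a y *\<^sub>R y)" unfolding a(1) using G(1) x by (simp add: sum.remove)
      also have "\<dots> = (\<Sum>y\<in>G - {x}. (a x * b y + a y) *\<^sub>R y)"
        by (subst b(1)) (simp add: scaleR_sum_right scaleR_add_left sum.distrib)
      finally show "v \<in> gen_cone (G - {x}) (\<lambda>x. x)"
        using gen_coneI[of "G - {x}" "\<lambda>y. a x * b y + a y" "\<lambda>x. x"] a(2) b(2) x by simp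
    qed
    moreover have "gen_cone (G - {x}) (\<lambda>x. x) \<subseteq> gen_cone G (\<lambda>x. x)"
      unfolding gen_cone_def[of "G - {x}"] using gen_cone_partial[OF G(1), of "G - {x}" _ "\<lambda>x. x"] by auto
    ultimately show False using min[of "G - {x}"] G(3) x by blast
  qed
  have "extreme_family C G (\<lambda>x. x)"
    unfolding extreme_family_def
  proof (intro conjI ballI impI)
    show "finite G" "C = gen_cone G (\<lambda>x. x)" by fact+
    fix x assume x: "x \<in> G"
    show x0: "x \<noteq> 0" using red[OF x] convex_cone_contains_0[OF convex_cone_gen_cone] by metis
    fix y z assume yz: "y \<in> C" "z \<in> C" "x = y + z"
    obtain a b where a: "y = (\<Sum>v\<in>G. a v *\<^sub>R v)" "\<forall>v\<in>G. 0 \<le> a v" and b: "z = (\<Sum>v\<in>G. b v *\<^sub>R v)" "\<forall>v\<in>G. 0 \<le> b v"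
      using yz(1,2) unfolding G(3) gen_cone_def by auto
    have sum: "(1 - (a x + b x)) *\<^sub>R x = (\<Sum>v\<in>G - {x}. (a v + b v) *\<^sub>R v)"
    proof -
      have "x = (\<Sum>v\<in>G. (a v + b v) *\<^sub>R v)" using yz(3) a(1) b(1) by (simp add: scaleR_add_left sum.distrib)
      then have "x = (a x + b x) *\<^sub>R x + (\<Sum>v\<in>G - {x}. (a v + b v) *\<^sub>R v)" using G(1) x by (simp add: sum.remove)
      then show ?thesis by (simp add: scaleR_diff_left algebra_simps)
    qed
    have nn: "\<forall>v\<in>G - {x}. 0 \<le> a v + b v" using a b by auto
    \<comment> \<open>The total coefficient of x in y + z: below 1, x would be redundant; above 1,
      -x would lie in \<open>C\<close>; equal to 1, the remaining nonnegative combination vanishes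
      and pointedness leaves y a multiple of x.\<close>
    consider "1 - (a x + b x) > 0" | "1 - (a x + b x) < 0" | "1 - (a x + b x) = 0" by linarith
    then show "y \<in> ray x"
    proof cases
      case 1
      let ?r = "1 - (a x + b x)"
      have "(1 / ?r) *\<^sub>R (?r *\<^sub>R x) \<in> gen_cone (G - {x}) (\<lambda>x. x)"
        unfolding sum by (intro gen_cone_scale gen_coneI) (use nn 1 in auto)
      then have "x \<in> gen_cone (G - {x}) (\<lambda>x. x)" using 1 by simp
      then show ?thesis using red[OF x] by blast
    next
      case 2
      let ?r = "a x + b x - 1"
      have "(\<Sum>v\<in>G - {x}. (a v + b v) *\<^sub>R v) \<in> C" unfolding G(3) by (rule gen_cone_partial) (use G nn in auto)
      then have "(1 / ?r) *\<^sub>R ((1 - (a x + b x)) *\<^sub>R x) \<in> C" unfolding sum[symmetric] G(3) by (rule gen_cone_scale) (use 2 in simp)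
      moreover have "(1 / ?r) *\<^sub>R ((1 - (a x + b x)) *\<^sub>R x) = - x"
      proof -
        have "(1 - (a x + b x)) *\<^sub>R x = - (?r *\<^sub>R x)" by (simp add: algebra_simps)
        then show ?thesis using 2 by simp
      qed
      ultimately have "- x \<in> C" by simp
      then have "x \<in> uminus ` C" by (metis add.inverse_inverse imageI)
      moreover have "x \<in> C" unfolding G(3) using gen_cone_gen[OF G(1) x, of 1 "\<lambda>x. x"] by simp
      ultimately have "x = 0" using assms(3) by blast
      then show ?thesis using x0 by blast
    next
      case 3
      then have "(\<Sum>v\<in>G - {x}. (a v + b v) *\<^sub>R v) = 0" using sum by simp
      then have z0: "(\<Sum>v\<in>G. (if v = x then 0 else a v + b v) *\<^sub>R v) = 0"
        using G(1) x by (simp add: sum.remove)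
      have "a v *\<^sub>R v = 0" if v: "v \<in> G - {x}" for v
      proof -
        have "(if v = x then 0 else a v + b v) *\<^sub>R v = 0"
          by (rule pointed_sum_zero[where c = "\<lambda>v. if v = x then 0 else a v + b v", OF G(1) G(3) assms(3) _ z0]) (use a b v in auto)
        then have "a v + b v = 0 \<or> v = 0" using v by simp
        moreover have "0 \<le> a v" "0 \<le> b v" using a b v by auto
        ultimately show ?thesis by auto
      qed
      then have "(\<Sum>v\<in>G - {x}. a v *\<^sub>R v) = 0" by (intro sum.neutral) auto
      then have "y = a x *\<^sub>R x" unfolding a(1) using G(1) x by (simp add: sum.remove)
      then show ?thesis using a(2) x unfolding ray_def by blast
    qed
  next
    fix x x' assume xx: "x \<in> G" "x' \<in> G" "x \<in> ray x'"
    show "x = x'"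
    proof (rule ccontr)
      assume ne: "x \<noteq> x'"
      obtain t where t: "x = t *\<^sub>R x'" "0 \<le> t" using xx(3) by (auto simp: ray_def)
      have "x \<in> gen_cone (G - {x}) (\<lambda>x. x)" unfolding t(1)
        by (rule gen_cone_gen) (use G xx ne t in auto)
      then show False using red[OF xx(1)] by blast
    qed
  qed
  then show ?thesis by (rule that)
qed

lemma ray_face_of_iff:
  fixes C :: "'e::euclidean_space set"
  assumes cone: "convex_cone C" and pt: "C \<inter> uminus ` C = {0}" and x: "x \<in> C" "x \<noteq> 0"
  shows "ray x face_of C \<longleftrightarrow> (\<forall>y\<in>C. \<forall>z\<in>C. x = y + z \<longrightarrow> y \<in> ray x)"
proof
  assume F: "ray x face_of C"
  show "\<forall>y\<in>C. \<forall>z\<in>C. x = y + z \<longrightarrow> y \<in> ray x"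
  proof (intro ballI impI)
    fix y z assume yz: "y \<in> C" "z \<in> C" "x = y + z"
    have r: "s *\<^sub>R x \<in> ray x" if "0 \<le> s" for s using that unfolding ray_def by blast
    have "(1/2) *\<^sub>R x \<in> ray x" "1 *\<^sub>R x \<in> ray x" by (rule r; simp)+
    then have "x \<in> ray x" by simp
    show "y \<in> ray x"
    proof (cases "y = z")
      case True
      then have "y = (1/2) *\<^sub>R x" using yz by (simp add: scaleR_2[symmetric])
      then show ?thesis using \<open>(1/2) *\<^sub>R x \<in> ray x\<close> by simp
    next
      case False
      have c: "2 *\<^sub>R y \<in> C" "2 *\<^sub>R z \<in> C" using cone yz by (auto simp: convex_cone_def conic_def)
      have "x = midpoint (2 *\<^sub>R y) (2 *\<^sub>R z)" by (simp add: midpoint_def yz(3) scaleR_add_right)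
      then have "x \<in> open_segment (2 *\<^sub>R y) (2 *\<^sub>R z)" using False by (simp add: midpoint_in_open_segment)
      then have "2 *\<^sub>R y \<in> ray x" using F c \<open>x \<in> ray x\<close> unfolding face_of_def by blast
      then obtain t where "2 *\<^sub>R y = t *\<^sub>R x" "0 \<le> t" by (auto simp: ray_def)
      then have "y = (t / 2) *\<^sub>R x" by (metis (no_types, lifting) divide_inverse_commute inverse_eq_divide scaleR_half_double scaleR_2 scaleR_scaleR)
      moreover have "0 \<le> t / 2" using \<open>0 \<le> t\<close> by simp
      ultimately show ?thesis unfolding ray_def by blast
    qed
  qed
next
  assume E: "\<forall>y\<in>C. \<forall>z\<in>C. x = y + z \<longrightarrow> y \<in> ray x"
  show "ray x face_of C"
    unfolding face_of_def
  proof (intro conjI ballI impI)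
    show sub: "ray x \<subseteq> C" using cone x by (auto simp: ray_def convex_cone_def conic_def)
    show "convex (ray x)"
    proof (rule convexI)
      fix v w and s t :: real assume "v \<in> ray x" "w \<in> ray x" "0 \<le> s" "0 \<le> t"
      then obtain a b where "v = a *\<^sub>R x" "0 \<le> a" "w = b *\<^sub>R x" "0 \<le> b" unfolding ray_def by blast
      then have "s *\<^sub>R v + t *\<^sub>R w = (s * a + t * b) *\<^sub>R x" "0 \<le> s * a + t * b"
        using \<open>0 \<le> s\<close> \<open>0 \<le> t\<close> by (simp_all add: scaleR_add_left)
      then show "s *\<^sub>R v + t *\<^sub>R w \<in> ray x" unfolding ray_def by blast
    qed
    have key: "a \<in> ray x" if ab: "a \<in> C" "b \<in> C" "v \<in> ray x" "v = (1 - r) *\<^sub>R a + r *\<^sub>R b" "0 < r" "r < 1" for a b v r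
    proof -
      obtain s where s: "v = s *\<^sub>R x" "0 \<le> s" using ab(3) by (auto simp: ray_def)
      have C1: "t *\<^sub>R w \<in> C" if "w \<in> C" "0 \<le> t" for t w using cone that by (auto simp: convex_cone_def conic_def)
      show ?thesis
      proof (cases "s = 0")
        case True
        then have "(1 - r) *\<^sub>R a = - (r *\<^sub>R b)" using s ab(4) by (simp add: eq_neg_iff_add_eq_0)
        moreover have "(1 - r) *\<^sub>R a \<in> C" "r *\<^sub>R b \<in> C" using C1 ab by simp_all
        ultimately have "(1 - r) *\<^sub>R a \<in> C \<inter> uminus ` C" by blast
        then have "a = 0" using pt ab(6) by auto
        then show ?thesis unfolding ray_def by (auto intro: exI[of _ 0])
      next
        case False
        then have s0: "0 < s" using s by simp
        have "x = (1 / s) *\<^sub>R v" using s s0 by simp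
        then have "x = ((1 - r) / s) *\<^sub>R a + (r / s) *\<^sub>R b" unfolding ab(4) by (simp add: scaleR_add_right)
        moreover have "((1 - r) / s) *\<^sub>R a \<in> C" "(r / s) *\<^sub>R b \<in> C" using C1 ab s0 by auto
        ultimately have "((1 - r) / s) *\<^sub>R a \<in> ray x" using E by blast
        then obtain t where t: "((1 - r) / s) *\<^sub>R a = t *\<^sub>R x" "0 \<le> t" by (auto simp: ray_def)
        have "(s / (1 - r)) *\<^sub>R (((1 - r) / s) *\<^sub>R a) = a" using s0 ab(6) by simp
        then have "a = (s / (1 - r) * t) *\<^sub>R x" unfolding t(1) by simp
        moreover have "0 \<le> s / (1 - r) * t" using s0 ab(6) t(2) by simp
        ultimately show ?thesis unfolding ray_def by blast
      qed
    qed
    fix a b v assume ab: "a \<in> C" "b \<in> C" "v \<in> ray x" "v \<in> open_segment a b"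
    then obtain r where r: "0 < r" "r < 1" "v = (1 - r) *\<^sub>R a + r *\<^sub>R b" by (auto simp: in_segment)
    show "a \<in> ray x" by (rule key[OF ab(1,2,3) r(3,1,2)])
    have "v = (1 - (1 - r)) *\<^sub>R b + (1 - r) *\<^sub>R a" using r(3) by simp
    then show "b \<in> ray x" by (rule key[OF ab(2,1,3)]) (use r in auto)
  qed
qed

text \<open>For surjectivity, expand a generator v of an extreme ray: some x_i occurs with positive
  coefficient, and extremality of v forces x_i onto the same ray.\<close>

lemma ext_rays_extreme_family:
  fixes C :: "'e::euclidean_space set"
  assumes fam: "extreme_family C I x" and pt: "C \<inter> uminus ` C = {0}"
  shows "bij_betw (\<lambda>i. ray (x i)) I (ext_rays C)"
proof -
  have fin: "finite I" and C: "C = gen_cone I x" and x0: "\<And>i. i \<in> I \<Longrightarrow> x i \<noteq> 0"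
    and ex: "\<And>i. i \<in> I \<Longrightarrow> \<forall>y\<in>C. \<forall>z\<in>C. x i = y + z \<longrightarrow> y \<in> ray (x i)"
    and inj: "\<And>i j. i \<in> I \<Longrightarrow> j \<in> I \<Longrightarrow> x i \<in> ray (x j) \<Longrightarrow> i = j"
    using fam unfolding extreme_family_def by blast+
  have cone: "convex_cone C" unfolding C by (rule convex_cone_gen_cone)
  have xC: "x i \<in> C" if "i \<in> I" for i unfolding C using gen_cone_gen[OF fin that, of 1 x] by simp
  have self: "v \<in> ray v" for v :: 'e unfolding ray_def by (force intro: exI[of _ 1])
  show ?thesis
    unfolding bij_betw_def
  proof
    show "inj_on (\<lambda>i. ray (x i)) I"
    proof (rule inj_onI)
      fix i j assume "i \<in> I" "j \<in> I" "ray (x i) = ray (x j)"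
      then show "i = j" using self[of "x i"] inj by metis
    qed
    show "(\<lambda>i. ray (x i)) ` I = ext_rays C"
    proof
      show "(\<lambda>i. ray (x i)) ` I \<subseteq> ext_rays C"
      proof
        fix R assume "R \<in> (\<lambda>i. ray (x i)) ` I"
        then obtain i where i: "i \<in> I" "R = ray (x i)" by blast
        have "ray (x i) face_of C" using ray_face_of_iff[OF cone pt xC x0] ex i by blast
        then show "R \<in> ext_rays C" unfolding ext_rays_def i(2) using x0[OF i(1)] unfolding ray_def by blast
      qed
      show "ext_rays C \<subseteq> (\<lambda>i. ray (x i)) ` I"
      proof
        fix R assume "R \<in> ext_rays C"
        then obtain v where v: "R face_of C" "v \<noteq> 0" "R = ray v" unfolding ext_rays_def ray_def by blast
        have vC: "v \<in> C" using face_of_imp_subset[OF v(1)] self[of v] v(3) by blast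
        have E: "\<forall>y\<in>C. \<forall>z\<in>C. v = y + z \<longrightarrow> y \<in> ray v" using ray_face_of_iff[OF cone pt vC v(2)] v by blast
        obtain a where a: "v = (\<Sum>i\<in>I. a i *\<^sub>R x i)" "\<forall>i\<in>I. 0 \<le> a i" using vC unfolding C gen_cone_def by blast
        obtain i where i: "i \<in> I" "a i \<noteq> 0"
        proof -
          have "\<exists>i\<in>I. a i \<noteq> 0"
          proof (rule ccontr)
            assume "\<not> (\<exists>i\<in>I. a i \<noteq> 0)"
            then have "v = 0" unfolding a(1) by (intro sum.neutral) auto
            then show False using v(2) by blast
          qed
          then show ?thesis using that by blast
        qed
        have ai: "0 < a i" using a(2) i by (simp add: less_le)
        have "v = a i *\<^sub>R x i + (\<Sum>j\<in>I - {i}. a j *\<^sub>R x j)" unfolding a(1) using fin i by (simp add: sum.remove)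
        moreover have "a i *\<^sub>R x i \<in> C" unfolding C by (rule gen_cone_gen) (use fin i ai in auto)
        moreover have "(\<Sum>j\<in>I - {i}. a j *\<^sub>R x j) \<in> C" unfolding C by (rule gen_cone_partial) (use fin a in auto)
        ultimately have "a i *\<^sub>R x i \<in> ray v" using E by blast
        then obtain t where t: "a i *\<^sub>R x i = t *\<^sub>R v" "0 \<le> t" by (auto simp: ray_def)
        have t0: "0 < t" using t ai x0[OF i(1)] by (cases "t = 0") auto
        have "(1 / t) *\<^sub>R (a i *\<^sub>R x i) = v" unfolding t(1) using t0 by simp
        then have v2: "v = (a i / t) *\<^sub>R x i" by simp
        have "ray v = ray (x i)"
        proof
          show "ray v \<subseteq> ray (x i)"
          proof
            fix w assume "w \<in> ray v"
            then obtain s where s: "w = s *\<^sub>R v" "0 \<le> s" by (auto simp: ray_def)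
            have "w = (s * (a i / t)) *\<^sub>R x i" unfolding s(1) v2 by simp
            moreover have "0 \<le> s * (a i / t)" using s t0 ai by simp
            ultimately show "w \<in> ray (x i)" unfolding ray_def by blast
          qed
          show "ray (x i) \<subseteq> ray v"
          proof
            fix w assume "w \<in> ray (x i)"
            then obtain s where s: "w = s *\<^sub>R x i" "0 \<le> s" by (auto simp: ray_def)
            have "(s * t / a i) *\<^sub>R v = w" unfolding v2 s(1) using t0 ai by simp
            moreover have "0 \<le> s * t / a i" using s t0 ai by simp
            ultimately show "w \<in> ray v" unfolding ray_def by blast
          qed
        qed
        then show "R \<in> (\<lambda>i. ray (x i)) ` I" using v(3) i by blast
      qed
    qed
  qed
qed

lemma interior_absorbs:
  fixes V C :: "'e::euclidean_space set"
  assumes V: "subspace V" and u: "u \<in> (top_of_set V) interior_of C" and v: "v \<in> V"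
  shows "\<exists>s>0. u + s *\<^sub>R v \<in> C"
proof -
  obtain T where T: "u \<in> T" "openin (top_of_set V) T" "T \<subseteq> C"
    using u by (auto simp: interior_of_def)
  then obtain r where r: "r > 0" "ball u r \<inter> V \<subseteq> T" and uV: "u \<in> V"
    unfolding openin_contains_ball by blast
  define s where "s = r / (2 * (norm v + 1))"
  have n: "norm v + 1 > 0" using norm_ge_zero[of v] by linarith
  have s: "s > 0" using r n by (simp add: s_def del: distrib_left_numeral)
  have "norm (s *\<^sub>R v) = r * (norm v / (2 * (norm v + 1)))"
    using s by (simp only: norm_scaleR abs_of_pos) (simp only: s_def times_divide_eq_left times_divide_eq_right)
  also have "\<dots> < r * 1" using r n by (intro mult_strict_left_mono) (auto simp: divide_less_eq)
  finally have "norm (s *\<^sub>R v) < r" by simp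
  then have "u + s *\<^sub>R v \<in> T" using r(2) uV v V by (auto simp: dist_norm subspace_add subspace_scale)
  then show ?thesis using s T(3) by blast
qed

text \<open>An irredundant half-space description of a polyhedron consists of facet inequalities.
  Interior points make the affine hull all of \<open>V\<close>, so these inequalities describe
  \<open>C\<close> inside \<open>V\<close>.\<close>

lemma facet_functionals:
  fixes V C :: "'e::euclidean_space set"
  assumes V: "subspace V" and C: "proper_polyhedral_cone V C"
  obtains H where "C = {v \<in> V. \<forall>h\<in>H. 0 \<le> h \<bullet> v}" "\<And>h. h \<in> H \<Longrightarrow> (C \<inter> {v. h \<bullet> v = 0}) facet_of C"
proof -
  obtain S where S: "finite S" "C = convex_cone hull S" and CV: "C \<subseteq> V"
    and int: "(top_of_set V) interior_of C \<noteq> {}" using C unfolding proper_polyhedral_cone_def by blast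
  have poly: "polyhedron C" unfolding S(2) by (rule polyhedron_convex_cone_hull[OF S(1)])
  have cone: "convex_cone C" unfolding S(2) by (rule convex_cone_convex_cone_hull)
  have C0: "0 \<in> C" using cone by (rule convex_cone_contains_0)
  have Csc: "t *\<^sub>R w \<in> C" if "w \<in> C" "0 \<le> t" for t w using cone that by (auto simp: convex_cone_def conic_def)
  have aff: "affine hull C = V"
  proof
    show "affine hull C \<subseteq> V" by (rule hull_minimal[OF CV]) (rule subspace_imp_affine[OF V])
    obtain w where w: "w \<in> (top_of_set V) interior_of C" using int by blast
    then have wC: "w \<in> C" by (rule subsetD[OF interior_of_subset])
    show "V \<subseteq> affine hull C"
    proof
      fix v assume v: "v \<in> V"
      obtain s where s: "s > 0" "w + s *\<^sub>R v \<in> C" using interior_absorbs[OF V w v] by blast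
      have "(1 / s) *\<^sub>R ((w + s *\<^sub>R v) - w) \<in> span C" by (intro span_scale span_diff span_base s(2) wC)
      then have "v \<in> span C" using s(1) by simp
      then show "v \<in> affine hull C" using affine_hull_span_0[of C] C0 hull_inc by metis
    qed
  qed
  obtain F where F: "finite F" "C = affine hull C \<inter> \<Inter>F" "\<forall>h\<in>F. \<exists>a b. a \<noteq> 0 \<and> h = {x. a \<bullet> x \<le> b}"
    "\<forall>F'. F' \<subset> F \<longrightarrow> C \<subset> affine hull C \<inter> \<Inter>F'" using poly unfolding polyhedron_Int_affine_minimal by blast
  from F(3) obtain a b where ab: "\<And>h. h \<in> F \<Longrightarrow> a h \<noteq> 0 \<and> h = {x. a h \<bullet> x \<le> b h}" by metis
  have facet: "(C \<inter> {x. a h \<bullet> x = b h}) facet_of C" if "h \<in> F" for h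
    using facet_of_polyhedron_explicit[OF F(1,2) ab] F(4) that by blast
  \<comment> \<open>A point v of the facet satisfies a.v = b; doubling it inside the cone gives 2b
    \<le> b, while the origin gives 0 \<le> b.\<close>
  have b0: "b h = 0" if h: "h \<in> F" for h
  proof -
    obtain v where v: "v \<in> C" "a h \<bullet> v = b h" using facet[OF h] unfolding facet_of_def by blast
    have le: "a h \<bullet> w \<le> b h" if "w \<in> C" for w
    proof -
      have "w \<in> h" using F(2) that h by blast
      then show ?thesis using ab[OF h] by blast
    qed
    have "2 *\<^sub>R v \<in> C" using Csc v by simp
    then have "2 * b h \<le> b h" using le[of "2 *\<^sub>R v"] v(2) by simp
    moreover have "0 \<le> b h" using le[OF C0] by simp
    ultimately show ?thesis by simp
  qed
  show ?thesis
  proof (rule that[of "(\<lambda>h. - a h) ` F"])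
    show "C = {v \<in> V. \<forall>h\<in>(\<lambda>h. - a h) ` F. 0 \<le> h \<bullet> v}"
    proof
      show "C \<subseteq> {v \<in> V. \<forall>h\<in>(\<lambda>h. - a h) ` F. 0 \<le> h \<bullet> v}"
      proof
        fix v assume v: "v \<in> C"
        have "a h \<bullet> v \<le> 0" if h: "h \<in> F" for h
        proof -
          have "v \<in> h" using F(2) v h by blast
          then show ?thesis using ab[OF h] b0[OF h] by (metis mem_Collect_eq)
        qed
        then show "v \<in> {v \<in> V. \<forall>h\<in>(\<lambda>h. - a h) ` F. 0 \<le> h \<bullet> v}" using v CV by auto
      qed
      show "{v \<in> V. \<forall>h\<in>(\<lambda>h. - a h) ` F. 0 \<le> h \<bullet> v} \<subseteq> C"
      proof
        fix v assume v: "v \<in> {v \<in> V. \<forall>h\<in>(\<lambda>h. - a h) ` F. 0 \<le> h \<bullet> v}"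
        have "v \<in> h" if h: "h \<in> F" for h
        proof -
          have "a h \<bullet> v \<le> b h" using v h b0[OF h] by auto
          then show ?thesis using ab[OF h] by blast
        qed
        then have "v \<in> V \<inter> \<Inter>F" using v by blast
        then show "v \<in> C" using F(2) aff by blast
      qed
    qed
    fix h assume "h \<in> (\<lambda>h. - a h) ` F"
    then obtain h' where h': "h' \<in> F" "h = - a h'" by blast
    have "{v. h \<bullet> v = 0} = {x. a h' \<bullet> x = b h'}" using b0[OF h'(1)] h'(2) by auto
    then show "(C \<inter> {v. h \<bullet> v = 0}) facet_of C" using facet[OF h'(1)] by simp
  qed
qed

section \<open>Presentations by orthant rays and squares\<close>

text \<open>Indices of a generating family of \<open>\<real>\<^sub>+\<^sup>a \<oplus> C\<^sub>\<square>\<^sup>m\<close>: the \<open>a\<close> rays of the orthant and, for each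
  \<open>l < m\<close>, the four rays of a square cone in cyclic order.\<close>

definition sq_index :: "nat \<Rightarrow> nat \<Rightarrow> (nat + nat \<times> nat) set" where
  "sq_index a m = {..<a} <+> ({..<m} \<times> {..<4})"

definition sq_rel :: "nat \<Rightarrow> nat \<Rightarrow> (nat + nat \<times> nat \<Rightarrow> real) \<Rightarrow> bool" where
  "sq_rel a m c \<longleftrightarrow> (\<forall>j<a. c (Inl j) = 0) \<and>
     (\<forall>l<m. c (Inr (l, 1)) = - c (Inr (l, 0)) \<and> c (Inr (l, 2)) = c (Inr (l, 0)) \<and> c (Inr (l, 3)) = - c (Inr (l, 0)))"

text \<open>Generators with a prescribed space of relations. As this data determines the cone up to
  linear isomorphism, it replaces the concrete direct sum throughout: \<open>cone_iso\<close> is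
  used only to pass to and from this form.\<close>

definition sq_presentation :: "'e::real_vector set \<Rightarrow> 'e set \<Rightarrow> nat \<Rightarrow> nat \<Rightarrow> (nat + nat \<times> nat \<Rightarrow> 'e) \<Rightarrow> bool" where
  "sq_presentation V C a m y \<longleftrightarrow> C = gen_cone (sq_index a m) y \<and> V = span (y ` sq_index a m) \<and>
     (\<forall>c. (\<Sum>i\<in>sq_index a m. c i *\<^sub>R y i) = 0 \<longleftrightarrow> sq_rel a m c)"

lemma lessThan_four: "{..<4::nat} = {0, 1, 2, 3}"
  by auto

lemma finite_sq_index [simp]: "finite (sq_index a m)"
  by (simp add: sq_index_def)

lemma sum_sq_index:
  fixes F :: "nat + nat \<times> nat \<Rightarrow> 'b::comm_monoid_add"
  shows "(\<Sum>i\<in>sq_index a m. F i) = (\<Sum>j<a. F (Inl j)) +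
    (\<Sum>l<m. F (Inr (l, 0)) + F (Inr (l, 1)) + F (Inr (l, 2)) + F (Inr (l, 3)))"
proof -
  have "(\<Sum>i\<in>sq_index a m. F i) = (\<Sum>j<a. F (Inl j)) + (\<Sum>l\<in>{..<m} \<times> {..<4}. F (Inr l))"
    unfolding sq_index_def by (subst sum.Plus) auto
  also have "(\<Sum>l\<in>{..<m} \<times> {..<4}. F (Inr l)) = (\<Sum>l<m. \<Sum>k<4. F (Inr (l, k)))"
    by (simp add: sum.cartesian_product)
  finally show ?thesis by (simp add: lessThan_four add.assoc)
qed

text \<open>The coordinates of an element are dual to the vectors \<open>p\<^sub>j\<close>, \<open>(q\<^sub>0 + q\<^sub>2)/2\<close>, \<open>(q\<^sub>0 - q\<^sub>2)/2\<close> and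
  \<open>(q\<^sub>1 - q\<^sub>3)/2\<close>, where \<open>q\<^sub>0 + q\<^sub>2 = q\<^sub>1 + q\<^sub>3\<close>.\<close>

lemma sq_presentation_coordinates:
  fixes y :: "nat + nat \<times> nat \<Rightarrow> 'e::real_vector"
  assumes P: "sq_presentation V C a m y"
  obtains t \<alpha> \<beta> \<gamma> :: "nat \<Rightarrow> 'e \<Rightarrow> real" where
    "\<And>j. linear (t j)" "\<And>l. linear (\<alpha> l)" "\<And>l. linear (\<beta> l)" "\<And>l. linear (\<gamma> l)"
    "\<And>j i. i \<in> sq_index a m \<Longrightarrow> t j (y i) = of_bool (i = Inl j)"
    "\<And>l i. i \<in> sq_index a m \<Longrightarrow> \<alpha> l (y i) = of_bool (\<exists>k. i = Inr (l, k))"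
    "\<And>l i. i \<in> sq_index a m \<Longrightarrow> \<beta> l (y i) = of_bool (i = Inr (l, 0)) - of_bool (i = Inr (l, 2))"
    "\<And>l i. i \<in> sq_index a m \<Longrightarrow> \<gamma> l (y i) = of_bool (i = Inr (l, 1)) - of_bool (i = Inr (l, 3))"
    "\<And>v. v \<in> V \<Longrightarrow> v = (\<Sum>j<a. t j v *\<^sub>R y (Inl j)) + (\<Sum>l<m.
        (\<alpha> l v / 2) *\<^sub>R (y (Inr (l, 0)) + y (Inr (l, 2))) + (\<beta> l v / 2) *\<^sub>R (y (Inr (l, 0)) - y (Inr (l, 2)))
        + (\<gamma> l v / 2) *\<^sub>R (y (Inr (l, 1)) - y (Inr (l, 3))))"
    "\<And>l. l < m \<Longrightarrow> y (Inr (l, 1)) + y (Inr (l, 3)) = y (Inr (l, 0)) + y (Inr (l, 2))"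
proof -
  let ?J = "sq_index a m"
  have rel: "sq_rel a m c" if "(\<Sum>i\<in>?J. c i *\<^sub>R y i) = 0" for c using P that by (simp add: sq_presentation_def)
  have ext: "\<exists>h. linear h \<and> (\<forall>i\<in>?J. h (y i) = f i)" if f: "\<And>c. sq_rel a m c \<Longrightarrow> (\<Sum>i\<in>?J. c i * f i) = 0" for f :: "_ \<Rightarrow> real"
  proof -
    have k: "(\<Sum>i\<in>?J. c i *\<^sub>R f i) = 0" if "(\<Sum>i\<in>?J. c i *\<^sub>R y i) = 0" for c
      using f[OF rel[OF that]] by simp
    obtain h where "linear h" "\<And>i. i \<in> ?J \<Longrightarrow> h (y i) = f i"
      by (rule linear_extension_family[OF finite_sq_index[of a m] k]) (assumption, rule that, assumption, blast)
    then show ?thesis by blast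
  qed
  have "\<exists>t :: nat \<Rightarrow> 'e \<Rightarrow> real. \<forall>j. linear (t j) \<and> (\<forall>i\<in>?J. t j (y i) = of_bool (i = Inl j))"
    by (rule choice, rule allI, rule ext) (auto simp: sum_sq_index sq_rel_def intro!: sum.neutral)
  then obtain t :: "nat \<Rightarrow> 'e \<Rightarrow> real" where t: "\<forall>j. linear (t j) \<and> (\<forall>i\<in>?J. t j (y i) = of_bool (i = Inl j))"
    by (elim exE) (rule that)
  have "\<exists>\<alpha> :: nat \<Rightarrow> 'e \<Rightarrow> real. \<forall>l. linear (\<alpha> l) \<and> (\<forall>i\<in>?J. \<alpha> l (y i) = of_bool (\<exists>k. i = Inr (l, k)))"
    by (rule choice, rule allI, rule ext) (auto simp: sum_sq_index sq_rel_def intro!: sum.neutral)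
  then obtain \<alpha> :: "nat \<Rightarrow> 'e \<Rightarrow> real" where \<alpha>: "\<forall>l. linear (\<alpha> l) \<and> (\<forall>i\<in>?J. \<alpha> l (y i) = of_bool (\<exists>k. i = Inr (l, k)))"
    by (elim exE) (rule that)
  have "\<exists>\<beta> :: nat \<Rightarrow> 'e \<Rightarrow> real. \<forall>l. linear (\<beta> l) \<and> (\<forall>i\<in>?J. \<beta> l (y i) = of_bool (i = Inr (l, 0)) - of_bool (i = Inr (l, 2)))"
    by (rule choice, rule allI, rule ext) (auto simp: sum_sq_index sq_rel_def intro!: sum.neutral)
  then obtain \<beta> :: "nat \<Rightarrow> 'e \<Rightarrow> real" where \<beta>: "\<forall>l. linear (\<beta> l) \<and> (\<forall>i\<in>?J. \<beta> l (y i) = of_bool (i = Inr (l, 0)) - of_bool (i = Inr (l, 2)))"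
    by (elim exE) (rule that)
  have "\<exists>\<gamma> :: nat \<Rightarrow> 'e \<Rightarrow> real. \<forall>l. linear (\<gamma> l) \<and> (\<forall>i\<in>?J. \<gamma> l (y i) = of_bool (i = Inr (l, 1)) - of_bool (i = Inr (l, 3)))"
    by (rule choice, rule allI, rule ext) (auto simp: sum_sq_index sq_rel_def intro!: sum.neutral)
  then obtain \<gamma> :: "nat \<Rightarrow> 'e \<Rightarrow> real" where \<gamma>: "\<forall>l. linear (\<gamma> l) \<and> (\<forall>i\<in>?J. \<gamma> l (y i) = of_bool (i = Inr (l, 1)) - of_bool (i = Inr (l, 3)))"
    by (elim exE) (rule that)
  have sq: "y (Inr (l, 1)) + y (Inr (l, 3)) = y (Inr (l, 0)) + y (Inr (l, 2))" if l: "l < m" for l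
  proof -
    define c :: "nat + nat \<times> nat \<Rightarrow> real" where
      "c i = of_bool (i = Inr (l, 0)) - of_bool (i = Inr (l, 1)) + of_bool (i = Inr (l, 2)) - of_bool (i = Inr (l, 3))" for i
    have "sq_rel a m c" by (simp add: sq_rel_def c_def)
    then have "(\<Sum>i\<in>?J. c i *\<^sub>R y i) = 0" using P by (simp add: sq_presentation_def)
    moreover have "(\<Sum>i\<in>?J. c i *\<^sub>R y i) = y (Inr (l, 0)) - y (Inr (l, 1)) + y (Inr (l, 2)) - y (Inr (l, 3))"
    proof -
      have "c (Inr (l', 0)) *\<^sub>R y (Inr (l', 0)) + c (Inr (l', 1)) *\<^sub>R y (Inr (l', 1)) + c (Inr (l', 2)) *\<^sub>R y (Inr (l', 2)) + c (Inr (l', 3)) *\<^sub>R y (Inr (l', 3))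
        = (if l' = l then y (Inr (l, 0)) - y (Inr (l, 1)) + y (Inr (l, 2)) - y (Inr (l, 3)) else 0)" for l'
        by (simp add: c_def)
      moreover have "c (Inl j) = 0" for j by (simp add: c_def)
      ultimately show ?thesis unfolding sum_sq_index using l by simp
    qed
    ultimately have "y (Inr (l, 0)) - y (Inr (l, 1)) + y (Inr (l, 2)) - y (Inr (l, 3)) = 0" using l by simp
    then show ?thesis by (simp add: algebra_simps)
  qed
  define S where "S v = (\<Sum>j<a. t j v *\<^sub>R y (Inl j)) + (\<Sum>l<m.
        (\<alpha> l v / 2) *\<^sub>R (y (Inr (l, 0)) + y (Inr (l, 2))) + (\<beta> l v / 2) *\<^sub>R (y (Inr (l, 0)) - y (Inr (l, 2)))
        + (\<gamma> l v / 2) *\<^sub>R (y (Inr (l, 1)) - y (Inr (l, 3))))" for v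
  have "linear S"
  proof (rule linearI)
    fix v w r
    show "S (v + w) = S v + S w"
      unfolding S_def using t \<alpha> \<beta> \<gamma>
      by (simp add: linear_add scaleR_add_left sum.distrib add_divide_distrib add_ac)
    show "S (r *\<^sub>R v) = r *\<^sub>R S v"
      unfolding S_def using t \<alpha> \<beta> \<gamma>
      by (simp add: linear_scale scaleR_sum_right scaleR_add_right)
  qed
  have Sy: "S (y i) = y i" if i: "i \<in> ?J" for i
  proof (cases i)
    case (Inl j)
    then have j: "j < a" using i by (auto simp: sq_index_def)
    have "t j' (y i) *\<^sub>R y (Inl j') = (if j' = j then y (Inl j) else 0)" for j' using t i Inl by simp
    moreover have "\<alpha> l (y i) = 0" "\<beta> l (y i) = 0" "\<gamma> l (y i) = 0" for l using \<alpha> \<beta> \<gamma> i Inl by simp_all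
    ultimately have "S (y i) = (\<Sum>j'<a. if j' = j then y (Inl j) else 0)" unfolding S_def by simp
    then show ?thesis using j Inl by simp
  next
    case (Inr lk)
    then obtain l k where lk: "i = Inr (l, k)" by (cases lk) simp
    then have l: "l < m" "k < 4" using i by (auto simp: sq_index_def)
    define w where "w = (1 / 2) *\<^sub>R (y (Inr (l, 0)) + y (Inr (l, 2))) + (((if k = 0 then 1 else 0) - (if k = 2 then 1 else 0)) / 2) *\<^sub>R (y (Inr (l, 0)) - y (Inr (l, 2)))
        + (((if k = 1 then 1 else 0) - (if k = 3 then 1 else 0)) / 2) *\<^sub>R (y (Inr (l, 1)) - y (Inr (l, 3)))"
    have "(\<alpha> l' (y i) / 2) *\<^sub>R (y (Inr (l', 0)) + y (Inr (l', 2))) + (\<beta> l' (y i) / 2) *\<^sub>R (y (Inr (l', 0)) - y (Inr (l', 2)))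
        + (\<gamma> l' (y i) / 2) *\<^sub>R (y (Inr (l', 1)) - y (Inr (l', 3))) = (if l' = l then w else 0)" for l'
    proof -
      have "\<alpha> l' (y i) = (if l' = l then 1 else 0)" "\<beta> l' (y i) = (if l' = l then (if k = 0 then 1 else 0) - (if k = 2 then 1 else 0) else 0)"
        "\<gamma> l' (y i) = (if l' = l then (if k = 1 then 1 else 0) - (if k = 3 then 1 else 0) else 0)"
        using \<alpha> \<beta> \<gamma> i lk by auto
      then show ?thesis by (simp add: w_def)
    qed
    moreover have "t j (y i) = 0" for j using t i lk by simp
    ultimately have "S (y i) = (\<Sum>l'<m. if l' = l then w else 0)" unfolding S_def by simp
    then have Sw: "S (y i) = w" using l by simp
    have half: "(1 / 2) *\<^sub>R v + (1 / 2) *\<^sub>R v = v" for v :: 'e by (simp add: scaleR_left_distrib[symmetric])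
    have e: "(1 / 2) *\<^sub>R y (Inr (l, 0)) + (1 / 2) *\<^sub>R y (Inr (l, 2)) = (1 / 2) *\<^sub>R y (Inr (l, 1)) + (1 / 2) *\<^sub>R y (Inr (l, 3))"
      using arg_cong[OF sq[OF l(1)], of "\<lambda>v. (1 / 2) *\<^sub>R v"] by (simp add: scaleR_add_right)
    have "k = 0 \<or> k = 1 \<or> k = 2 \<or> k = 3" using l(2) by auto
    then have "w = y (Inr (l, k))"
    proof (elim disjE)
      assume "k = 0" then show ?thesis using half[of "y (Inr (l, 0))"] by (simp add: w_def scaleR_add_right scaleR_diff_right)
    next
      assume "k = 1" then show ?thesis using half[of "y (Inr (l, 1))"] e by (simp add: w_def scaleR_add_right scaleR_diff_right)
    next
      assume "k = 2" then show ?thesis using half[of "y (Inr (l, 2))"] by (simp add: w_def scaleR_add_right scaleR_diff_right)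
    next
      assume "k = 3" then show ?thesis using half[of "y (Inr (l, 3))"] e by (simp add: w_def scaleR_add_right scaleR_diff_right)
    qed
    then show ?thesis using Sw lk by simp
  qed
  have "v = S v" if "v \<in> V" for v
  proof -
    have "v \<in> span (y ` ?J)" using P that by (simp add: sq_presentation_def)
    then have "S v = id v" by (rule linear_eq_on[OF \<open>linear S\<close> linear_id]) (use Sy in auto)
    then show ?thesis by simp
  qed
  then have coord: "v \<in> V \<Longrightarrow> v = (\<Sum>j<a. t j v *\<^sub>R y (Inl j)) + (\<Sum>l<m.
        (\<alpha> l v / 2) *\<^sub>R (y (Inr (l, 0)) + y (Inr (l, 2))) + (\<beta> l v / 2) *\<^sub>R (y (Inr (l, 0)) - y (Inr (l, 2)))
        + (\<gamma> l v / 2) *\<^sub>R (y (Inr (l, 1)) - y (Inr (l, 3))))" for v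
    unfolding S_def .
  show ?thesis
  proof (rule that[of t \<alpha> \<beta> \<gamma>])
    show "linear (t j)" "linear (\<alpha> j)" "linear (\<beta> j)" "linear (\<gamma> j)" for j using t \<alpha> \<beta> \<gamma> by blast+
    fix i l assume i: "i \<in> ?J"
    show "t l (y i) = of_bool (i = Inl l)" "\<alpha> l (y i) = of_bool (\<exists>k. i = Inr (l, k))"
      "\<beta> l (y i) = of_bool (i = Inr (l, 0)) - of_bool (i = Inr (l, 2))"
      "\<gamma> l (y i) = of_bool (i = Inr (l, 1)) - of_bool (i = Inr (l, 3))"
      using t \<alpha> \<beta> \<gamma> i by blast+
  next
    fix v assume "v \<in> V"
    then show "v = (\<Sum>j<a. t j v *\<^sub>R y (Inl j)) + (\<Sum>l<m.
        (\<alpha> l v / 2) *\<^sub>R (y (Inr (l, 0)) + y (Inr (l, 2))) + (\<beta> l v / 2) *\<^sub>R (y (Inr (l, 0)) - y (Inr (l, 2)))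
        + (\<gamma> l v / 2) *\<^sub>R (y (Inr (l, 1)) - y (Inr (l, 3))))" by (rule coord)
  next
    fix l assume "l < m"
    then show "y (Inr (l, 1)) + y (Inr (l, 3)) = y (Inr (l, 0)) + y (Inr (l, 2))" by (rule sq)
  qed
qed

lemma min_cone_sumI:
  assumes "finite J" "\<And>i. i \<in> J \<Longrightarrow> psd s (H i)" "\<And>i. i \<in> J \<Longrightarrow> y i \<in> C"
  shows "(\<lambda>a b. \<Sum>i\<in>J. pure_tensor (H i) (y i) a b) \<in> min_cone C s"
proof -
  obtain f where f: "bij_betw f {..<card J} J" using ex_bij_betw_nat_finite[OF assms(1)] by (auto simp: atLeast0LessThan)
  have fJ: "f k \<in> J" if "k < card J" for k using f that by (auto simp: bij_betw_def)
  show ?thesis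
    unfolding min_cone_def mem_Collect_eq
  proof (rule exI[of _ "card J"], rule exI[of _ "\<lambda>_. 1"], rule exI[of _ "\<lambda>k. H (f k)"], rule exI[of _ "\<lambda>k. y (f k)"], rule conjI)
    show "\<forall>k<card J. (0::real) \<le> 1 \<and> psd s (H (f k)) \<and> y (f k) \<in> C" using assms fJ by simp
    show "(\<lambda>a b. \<Sum>i\<in>J. pure_tensor (H i) (y i) a b) = (\<lambda>a b. \<Sum>k<card J. 1 *\<^sub>R pure_tensor (H (f k)) (y (f k)) a b)"
      by (intro ext, subst sum.reindex_bij_betw[OF f, symmetric]) simp
  qed
qed

lemma extreme_familyD:
  assumes "extreme_family C I x"
  shows "finite I" "C = gen_cone I x" "\<And>i. i \<in> I \<Longrightarrow> x i \<noteq> 0"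
    "\<And>i y z. i \<in> I \<Longrightarrow> y \<in> C \<Longrightarrow> z \<in> C \<Longrightarrow> x i = y + z \<Longrightarrow> y \<in> ray (x i)"
    "\<And>i j. i \<in> I \<Longrightarrow> j \<in> I \<Longrightarrow> x i \<in> ray (x j) \<Longrightarrow> i = j"
  using assms unfolding extreme_family_def by blast+

text \<open>No positive coefficient contradicts pointedness. A single one would write that generator
  as a positive combination of others, and extremality would put one of those on the same
  ray.\<close>

lemma relation_two_positive:
  fixes c :: "'i \<Rightarrow> real"
  assumes fam: "extreme_family C I x" and pt: "C \<inter> uminus ` C = {0}" and K: "K \<subseteq> I" "K \<noteq> {}"
    and c: "\<forall>j\<in>K. c j \<noteq> 0" and rel: "(\<Sum>j\<in>K. c j *\<^sub>R x j) = 0"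
  shows "\<exists>p\<in>K. \<exists>p'\<in>K. p \<noteq> p' \<and> 0 < c p \<and> 0 < c p'"
proof -
  have finI: "finite I" and C: "C = gen_cone I x" and x0: "\<And>i. i \<in> I \<Longrightarrow> x i \<noteq> 0" using extreme_familyD[OF fam] by blast+
  have finK: "finite K" using K finI finite_subset by blast
  have "\<exists>p\<in>K. 0 < c p"
  proof (rule ccontr)
    assume no: "\<not> (\<exists>p\<in>K. 0 < c p)"
    obtain j where j: "j \<in> K" using K by blast
    define b where "b i = (if i \<in> K then - c i else 0)" for i
    have "(\<Sum>i\<in>I. b i *\<^sub>R x i) = (\<Sum>i\<in>K. b i *\<^sub>R x i)"
      by (rule sum.mono_neutral_right[OF finI K(1)]) (simp add: b_def)
    also have "\<dots> = - (\<Sum>i\<in>K. c i *\<^sub>R x i)" by (simp add: b_def sum_negf)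
    finally have z: "(\<Sum>i\<in>I. b i *\<^sub>R x i) = 0" using rel by simp
    have nn: "\<forall>i\<in>I. 0 \<le> b i" using no by (auto simp: b_def not_less)
    have "b j *\<^sub>R x j = 0" by (rule pointed_sum_zero[OF finI C pt nn z]) (use j K in blast)
    then show False using j c x0[of j] K by (auto simp: b_def)
  qed
  then obtain p where p: "p \<in> K" "0 < c p" by blast
  show ?thesis
  proof (rule ccontr)
    assume no: "\<not> ?thesis"
    have neg: "c j < 0" if "j \<in> K - {p}" for j
    proof -
      have "\<not> 0 < c j" using no p that by blast
      then show ?thesis using c that by force
    qed
    have pI: "p \<in> I" using p K by blast
    have e: "c p *\<^sub>R x p = - (\<Sum>j\<in>K - {p}. c j *\<^sub>R x j)"
      using rel finK p by (simp add: sum.remove eq_neg_iff_add_eq_0)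
    have "K - {p} \<noteq> {}"
    proof
      assume "K - {p} = {}"
      then have "c p *\<^sub>R x p = 0" using e by (metis sum_clauses(1) sum_negf)
      then show False using p x0[OF pI] by simp
    qed
    then obtain q where q: "q \<in> K - {p}" by blast
    then have qI: "q \<in> I" using K by blast
    define b where "b j = - c j / c p" for j
    have b: "0 < b j" if "j \<in> K - {p}" for j using divide_neg_pos[OF neg[OF that] p(2)] by (simp add: b_def)
    have "x p = (1 / c p) *\<^sub>R (c p *\<^sub>R x p)" using p by simp
    also have "\<dots> = (\<Sum>j\<in>K - {p}. b j *\<^sub>R x j)" unfolding e b_def by (simp add: scaleR_sum_right sum_negf)
    also have "\<dots> = b q *\<^sub>R x q + (\<Sum>j\<in>K - {p} - {q}. b j *\<^sub>R x j)" using finK q by (simp add: sum.remove)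
    finally have s: "x p = b q *\<^sub>R x q + (\<Sum>j\<in>K - {p} - {q}. b j *\<^sub>R x j)" .
    have 1: "b q *\<^sub>R x q \<in> C" unfolding C by (rule gen_cone_gen[OF finI qI less_imp_le[OF b[OF q]]])
    have 2: "(\<Sum>j\<in>K - {p} - {q}. b j *\<^sub>R x j) \<in> C" unfolding C
      by (rule gen_cone_partial[OF finI]) (use K b in \<open>auto intro: less_imp_le\<close>)
    have "b q *\<^sub>R x q \<in> ray (x p)" by (rule extreme_familyD(4)[OF fam pI 1 2 s])
    then obtain t where t: "b q *\<^sub>R x q = t *\<^sub>R x p" "0 \<le> t" by (auto simp: ray_def)
    have "x q = (1 / b q) *\<^sub>R (b q *\<^sub>R x q)" using b[OF q] by simp
    then have "x q = (t / b q) *\<^sub>R x p" unfolding t(1) by simp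
    moreover have "0 \<le> t / b q" using t(2) b[OF q] by simp
    ultimately have "x q \<in> ray (x p)" unfolding ray_def by blast
    then have "q = p" by (rule extreme_familyD(5)[OF fam qI pI])
    then show False using q by blast
  qed
qed

lemma relation_two_negative:
  fixes c :: "'i \<Rightarrow> real"
  assumes "extreme_family C I x" "C \<inter> uminus ` C = {0}" "K \<subseteq> I" "K \<noteq> {}"
    "\<forall>j\<in>K. c j \<noteq> 0" "(\<Sum>j\<in>K. c j *\<^sub>R x j) = 0"
  shows "\<exists>q\<in>K. \<exists>q'\<in>K. q \<noteq> q' \<and> c q < 0 \<and> c q' < 0"
proof -
  have "(\<Sum>j\<in>K. (- c j) *\<^sub>R x j) = 0" using assms(6) by (simp add: sum_negf)
  from relation_two_positive[OF assms(1-4) _ this] assms(5) show ?thesis by simp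
qed

lemma enumerate_four:
  assumes "p \<noteq> p'" "q \<noteq> q'" "p \<noteq> q" "p \<noteq> q'" "p' \<noteq> q" "p' \<noteq> q'" "K = {p, p', q, q'}"
  shows "\<exists>\<sigma>::nat \<Rightarrow> 'i. bij_betw \<sigma> {..<4} K \<and> \<sigma> 0 = p \<and> \<sigma> 1 = q \<and> \<sigma> 2 = p' \<and> \<sigma> 3 = q'"
proof -
  define \<sigma> where "\<sigma> k = (if k = (0::nat) then p else if k = 1 then q else if k = 2 then p' else q')" for k
  have "inj_on \<sigma> {..<4}" unfolding lessThan_four using assms by (auto simp: inj_on_def \<sigma>_def)
  moreover have "\<sigma> ` {..<4} = K" unfolding lessThan_four using assms(7) by (auto simp: \<sigma>_def)
  ultimately have "bij_betw \<sigma> {..<4} K" by (simp add: bij_betw_def)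
  then show ?thesis by (intro exI[of _ \<sigma>]) (simp add: \<sigma>_def)
qed

lemma sum_four: "(\<Sum>k<4. F k) = F 0 + F 1 + F 2 + (F (3::nat) :: 'a::comm_monoid_add)"
  by (simp add: lessThan_four add_ac)

lemma gen_cone_rescale:
  fixes W :: "'j \<Rightarrow> real"
  assumes bij: "bij_betw \<phi> J I" and W: "\<And>i. i \<in> J \<Longrightarrow> 0 < W i"
  shows "gen_cone J (\<lambda>i. W i *\<^sub>R x (\<phi> i)) = gen_cone I x"
proof
  let ?\<psi> = "inv_into J \<phi>"
  have \<psi>: "?\<psi> (\<phi> i) = i" if "i \<in> J" for i using bij that by (simp add: bij_betw_def)
  have \<psi>J: "?\<psi> i \<in> J" "\<phi> (?\<psi> i) = i" if "i \<in> I" for i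
    using bij that by (auto simp: bij_betw_def inv_into_into f_inv_into_f)
  have re: "(\<Sum>i\<in>I. F i) = (\<Sum>i\<in>J. F (\<phi> i))" for F :: "_ \<Rightarrow> 'b" by (rule sum.reindex_bij_betw[OF bij, symmetric])
  show "gen_cone J (\<lambda>i. W i *\<^sub>R x (\<phi> i)) \<subseteq> gen_cone I x"
  proof
    fix v assume "v \<in> gen_cone J (\<lambda>i. W i *\<^sub>R x (\<phi> i))"
    then obtain a where a: "v = (\<Sum>i\<in>J. a i *\<^sub>R (W i *\<^sub>R x (\<phi> i)))" "\<forall>i\<in>J. 0 \<le> a i" by (auto simp: gen_cone_def)
    have "v = (\<Sum>i\<in>I. (a (?\<psi> i) * W (?\<psi> i)) *\<^sub>R x i)" unfolding re a(1) by (intro sum.cong refl) (simp add: \<psi>)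
    moreover have "0 \<le> a (?\<psi> i) * W (?\<psi> i)" if "i \<in> I" for i using a(2) W[of "?\<psi> i"] \<psi>J[OF that] by simp
    ultimately show "v \<in> gen_cone I x" using gen_coneI[of I "\<lambda>i. a (?\<psi> i) * W (?\<psi> i)" x] by simp
  qed
  show "gen_cone I x \<subseteq> gen_cone J (\<lambda>i. W i *\<^sub>R x (\<phi> i))"
  proof
    fix v assume "v \<in> gen_cone I x"
    then obtain a where a: "v = (\<Sum>i\<in>I. a i *\<^sub>R x i)" "\<forall>i\<in>I. 0 \<le> a i" by (auto simp: gen_cone_def)
    have "v = (\<Sum>i\<in>J. (a (\<phi> i) / W i) *\<^sub>R (W i *\<^sub>R x (\<phi> i)))" unfolding re a(1)
    proof (rule sum.cong[OF refl])
      fix i assume "i \<in> J"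
      then show "a (\<phi> i) *\<^sub>R x (\<phi> i) = (a (\<phi> i) / W i) *\<^sub>R (W i *\<^sub>R x (\<phi> i))" using W[of i] by simp
    qed
    moreover have "0 \<le> a (\<phi> i) / W i" if "i \<in> J" for i
    proof -
      have "\<phi> i \<in> I" using bij that by (auto simp: bij_betw_def)
      then show ?thesis using a(2) W[OF that] by simp
    qed
    ultimately show "v \<in> gen_cone J (\<lambda>i. W i *\<^sub>R x (\<phi> i))"
      using gen_coneI[of J "\<lambda>i. a (\<phi> i) / W i" "\<lambda>i. W i *\<^sub>R x (\<phi> i)"] by simp
  qed
qed

lemma span_image_sum:
  assumes "finite I" shows "span (y ` I) = {\<Sum>i\<in>I. c i *\<^sub>R y i |c. True}"
proof
  show "span (y ` I) \<subseteq> {\<Sum>i\<in>I. c i *\<^sub>R y i |c. True}"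
  proof (rule span_minimal)
    show "y ` I \<subseteq> {\<Sum>i\<in>I. c i *\<^sub>R y i |c. True}"
    proof
      fix v assume "v \<in> y ` I"
      then obtain j where j: "j \<in> I" "v = y j" by blast
      have "(\<Sum>i\<in>I. (if i = j then 1 else 0) *\<^sub>R y i) = (\<Sum>i\<in>I. if i = j then y i else 0)"
        by (intro sum.cong refl) simp
      also have "\<dots> = v" using assms j by simp
      finally have "v = (\<Sum>i\<in>I. (if i = j then 1 else 0) *\<^sub>R y i)" ..
      then show "v \<in> {\<Sum>i\<in>I. c i *\<^sub>R y i |c. True}" by auto
    qed
    show "subspace {\<Sum>i\<in>I. c i *\<^sub>R y i |c. True}"
    proof (rule subspaceI)
      have "0 = (\<Sum>i\<in>I. 0 *\<^sub>R y i)" by simp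
      then show "0 \<in> {\<Sum>i\<in>I. c i *\<^sub>R y i |c. True}" by fast
      fix v w r assume "v \<in> {\<Sum>i\<in>I. c i *\<^sub>R y i |c. True}"
      then obtain b where b: "v = (\<Sum>i\<in>I. b i *\<^sub>R y i)" by blast
      have "r *\<^sub>R v = (\<Sum>i\<in>I. (r * b i) *\<^sub>R y i)" unfolding b by (simp add: scaleR_sum_right)
      then show "r *\<^sub>R v \<in> {\<Sum>i\<in>I. c i *\<^sub>R y i |c. True}" by auto
      assume "w \<in> {\<Sum>i\<in>I. c i *\<^sub>R y i |c. True}"
      then obtain d where d: "w = (\<Sum>i\<in>I. d i *\<^sub>R y i)" by blast
      have "v + w = (\<Sum>i\<in>I. (b i + d i) *\<^sub>R y i)" unfolding b d by (simp add: scaleR_add_left sum.distrib)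
      then show "v + w \<in> {\<Sum>i\<in>I. c i *\<^sub>R y i |c. True}" by auto
    qed
  qed
  show "{\<Sum>i\<in>I. c i *\<^sub>R y i |c. True} \<subseteq> span (y ` I)"
  proof
    fix v assume "v \<in> {\<Sum>i\<in>I. c i *\<^sub>R y i |c. True}"
    then obtain c where v: "v = (\<Sum>i\<in>I. c i *\<^sub>R y i)" by blast
    show "v \<in> span (y ` I)" unfolding v by (intro span_sum span_scale span_base imageI)
  qed
qed

lemma proper_cone_span:
  fixes V C :: "'e::euclidean_space set"
  assumes V: "subspace V" and u: "u \<in> (top_of_set V) interior_of C" and C: "C = gen_cone I x" "finite I" and CV: "C \<subseteq> V"
  shows "V = span (x ` I)"
proof
  have CS: "C \<subseteq> span (x ` I)" unfolding C(1) gen_cone_def span_image_sum[OF C(2)] by blast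
  show "V \<subseteq> span (x ` I)"
  proof
    fix v assume v: "v \<in> V"
    obtain s where s: "s > 0" "u + s *\<^sub>R v \<in> C" using interior_absorbs[OF V u v] by blast
    have uC: "u \<in> C" using u by (rule subsetD[OF interior_of_subset])
    have "(1 / s) *\<^sub>R ((u + s *\<^sub>R v) - u) \<in> span (x ` I)"
      by (intro span_scale span_diff subsetD[OF CS] s(2) uC)
    then show "v \<in> span (x ` I)" using s(1) by simp
  qed
  have "x i \<in> C" if "i \<in> I" for i unfolding C(1) using gen_cone_gen[OF C(2) that, of 1 x] by simp
  then have "x ` I \<subseteq> V" using CV by blast
  then show "span (x ` I) \<subseteq> V" by (rule span_minimal[OF _ V])
qed

text \<open>A cone with four extreme rays in \<open>\<real>\<^sup>3\<close> has a single relation between its generators, which can be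
  normalised to \<open>q\<^sub>0 + q\<^sub>2 = q\<^sub>1 + q\<^sub>3\<close>.\<close>

lemma four_ray_cone:
  fixes C :: "(real ^ 3) set"
  assumes C: "proper_polyhedral_cone UNIV C" and card: "card (ext_rays C) = 4"
  obtains q :: "nat \<Rightarrow> real ^ 3" where "C = gen_cone {..<4} q" "UNIV = span (q ` {..<4})"
    "\<And>c. (\<Sum>k<4. c k *\<^sub>R q k) = 0 \<longleftrightarrow> c 1 = - c 0 \<and> c 2 = c 0 \<and> c 3 = - c 0"
proof -
  obtain S where S: "finite S" "C = convex_cone hull S" and pt: "C \<inter> uminus ` C = {0}"
    and int: "(top_of_set UNIV) interior_of C \<noteq> {}" using C unfolding proper_polyhedral_cone_def by blast
  obtain u where u: "u \<in> (top_of_set UNIV) interior_of C" using int by blast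
  obtain I where fam: "extreme_family C I (\<lambda>x. x)"
    by (rule exists_extreme_family[OF S(1) _ pt]) (use S convex_cone_hull_eq_gen_cone[OF S(1)] in simp, rule that)
  have finI: "finite I" and Ce: "C = gen_cone I (\<lambda>x. x)" using extreme_familyD[OF fam] by blast+
  have cI: "card I = 4" using bij_betw_same_card[OF ext_rays_extreme_family[OF fam pt]] card by simp
  have pat: "\<exists>p p' q q'. I = {p, p', q, q'} \<and> p \<noteq> p' \<and> q \<noteq> q' \<and> 0 < c p \<and> 0 < c p' \<and> c q < 0 \<and> c q' < 0"
    if c: "(\<Sum>i\<in>I. c i *\<^sub>R i) = 0" "\<exists>i\<in>I. c i \<noteq> 0" for c :: "real ^ 3 \<Rightarrow> real"
  proof -
    define K where "K = {i \<in> I. c i \<noteq> 0}"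
    have K: "K \<subseteq> I" "K \<noteq> {}" "\<forall>j\<in>K. c j \<noteq> 0" using c(2) by (auto simp: K_def)
    have r: "(\<Sum>j\<in>K. c j *\<^sub>R j) = 0"
    proof -
      have "(\<Sum>i\<in>I. c i *\<^sub>R i) = (\<Sum>j\<in>K. c j *\<^sub>R j)" by (rule sum.mono_neutral_right[OF finI K(1)]) (simp add: K_def)
      then show ?thesis using c(1) by simp
    qed
    obtain p p' where p: "p \<in> K" "p' \<in> K" "p \<noteq> p'" "0 < c p" "0 < c p'"
      using relation_two_positive[OF fam pt K r] by blast
    obtain q q' where q: "q \<in> K" "q' \<in> K" "q \<noteq> q'" "c q < 0" "c q' < 0"
      using relation_two_negative[OF fam pt K r] by blast
    have ne: "p \<noteq> q" "p \<noteq> q'" "p' \<noteq> q" "p' \<noteq> q'" using p q by auto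
    have "card {p, p', q, q'} = 4" using ne p(3) q(3) by simp
    moreover have "{p, p', q, q'} \<subseteq> I" using p q K by blast
    ultimately have "I = {p, p', q, q'}" using card_subset_eq[OF finI, of "{p, p', q, q'}"] cI by simp
    then show ?thesis using p q by blast
  qed
  \<comment> \<open>Four vectors in a three-dimensional space.\<close>
  have "dependent I"
  proof (rule ccontr)
    assume "\<not> dependent I"
    then have "card I \<le> DIM(real ^ 3)" by (rule independent_card_le)
    then show False using cI by simp
  qed
  then obtain c0 where c0: "\<exists>v\<in>I. c0 v \<noteq> 0" "(\<Sum>v\<in>I. c0 v *\<^sub>R v) = 0" unfolding dependent_finite[OF finI] by blast
  obtain p p' q q' where I: "I = {p, p', q, q'}" "p \<noteq> p'" "q \<noteq> q'" "0 < c0 p" "0 < c0 p'" "c0 q < 0" "c0 q' < 0"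
    using pat[OF c0(2,1)] by (elim exE conjE) (rule that)
  have ne: "p \<noteq> q" "p \<noteq> q'" "p' \<noteq> q" "p' \<noteq> q'" using I by auto
  obtain \<sigma> :: "nat \<Rightarrow> real ^ 3" where \<sigma>: "bij_betw \<sigma> {..<4} I" "\<sigma> 0 = p" "\<sigma> 1 = q" "\<sigma> 2 = p'" "\<sigma> 3 = q'"
    using enumerate_four[OF I(2,3) ne I(1)] by (elim exE conjE) (rule that)
  have all0: "c0 i \<noteq> 0" if "i \<in> I" for i using that I by auto
  \<comment> \<open>Subtract the multiple of the fixed relation that cancels the coefficient at
    \<open>p\<close>. A nonzero difference would have all four coefficients nonzero by
    \<open>pat\<close>.\<close>
  have proportional: "\<exists>r. \<forall>i\<in>I. c i = r * c0 i" if c: "(\<Sum>i\<in>I. c i *\<^sub>R i) = 0" for c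
  proof -
    define r where "r = c p / c0 p"
    have "(\<Sum>i\<in>I. (c i - r * c0 i) *\<^sub>R i) = (\<Sum>i\<in>I. c i *\<^sub>R i) - r *\<^sub>R (\<Sum>i\<in>I. c0 i *\<^sub>R i)"
      by (simp add: scaleR_diff_left sum_subtractf scaleR_sum_right)
    then have z: "(\<Sum>i\<in>I. (c i - r * c0 i) *\<^sub>R i) = 0" using c c0(2) by simp
    have "\<not> (\<exists>i\<in>I. c i - r * c0 i \<noteq> 0)"
    proof
      assume "\<exists>i\<in>I. c i - r * c0 i \<noteq> 0"
      from pat[OF z this] obtain a a' b b' where ab: "I = {a, a', b, b'}" "0 < c a - r * c0 a" "0 < c a' - r * c0 a'" "c b - r * c0 b < 0" "c b' - r * c0 b' < 0"
        by (elim exE conjE) (rule that)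
      have "c p - r * c0 p = 0" using I by (simp add: r_def)
      moreover have "p \<in> {a, a', b, b'}" using ab(1) I(1) by blast
      ultimately show False using ab by auto
    qed
    then show ?thesis by (intro exI[of _ r]) auto
  qed
  define y where "y k = \<bar>c0 (\<sigma> k)\<bar> *\<^sub>R \<sigma> k" for k
  have \<sigma>I: "\<sigma> k \<in> I" if "k < 4" for k using \<sigma>(1) that by (auto simp: bij_betw_def)
  have W: "0 < \<bar>c0 (\<sigma> k)\<bar>" if "k \<in> {..<4}" for k using all0[OF \<sigma>I] that by simp
  have Cy: "C = gen_cone {..<4} y" unfolding Ce y_def using gen_cone_rescale[OF \<sigma>(1) W, of "\<lambda>x. x"] by fast
  have sy: "UNIV = span (y ` {..<4})" by (rule proper_cone_span[OF subspace_UNIV u Cy]) simp_all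
  have yk: "y 0 = c0 p *\<^sub>R p" "y 1 = - (c0 q *\<^sub>R q)" "y 2 = c0 p' *\<^sub>R p'" "y 3 = - (c0 q' *\<^sub>R q')"
    unfolding y_def \<sigma> using I by simp_all
  have sumI: "(\<Sum>i\<in>I. F i) = F p + F q + F p' + F q'" for F :: "real ^ 3 \<Rightarrow> real ^ 3"
    using sum.reindex_bij_betw[OF \<sigma>(1), of F] by (simp only: sum_four \<sigma>)
  have rel: "(\<Sum>k<4. c k *\<^sub>R y k) = 0 \<longleftrightarrow> c 1 = - c 0 \<and> c 2 = c 0 \<and> c 3 = - c 0" for c :: "nat \<Rightarrow> real"
  proof
    assume z: "(\<Sum>k<4. c k *\<^sub>R y k) = 0"
    define b where "b i = (if i = p then c 0 * c0 p else if i = q then - c 1 * c0 q else if i = p' then c 2 * c0 p' else - c 3 * c0 q')" for i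
    have bv: "b p = c 0 * c0 p" "b q = - c 1 * c0 q" "b p' = c 2 * c0 p'" "b q' = - c 3 * c0 q'"
      using I ne by (simp_all add: b_def del: One_nat_def)
    have "(\<Sum>i\<in>I. b i *\<^sub>R i) = 0" using z unfolding sumI sum_four yk bv by simp
    from proportional[OF this] obtain r where r: "\<forall>i\<in>I. b i = r * c0 i" by blast
    then have "b p = r * c0 p" "b q = r * c0 q" "b p' = r * c0 p'" "b q' = r * c0 q'" unfolding I(1) by blast+
    then have b: "c 0 = r" "- c 1 * c0 q = r * c0 q" "c 2 = r" "- c 3 * c0 q' = r * c0 q'" unfolding bv using I by (simp_all del: One_nat_def)
    have "- c 1 = r" "- c 3 = r" using mult_right_cancel[of "c0 q" "- c 1" r] mult_right_cancel[of "c0 q'" "- c 3" r] b(2,4) I by simp_all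
    then show "c 1 = - c 0 \<and> c 2 = c 0 \<and> c 3 = - c 0" using b(1,3) by linarith
  next
    assume "c 1 = - c 0 \<and> c 2 = c 0 \<and> c 3 = - c 0"
    then have c: "c 1 = - c 0" "c 2 = c 0" "c 3 = - c 0" by simp_all
    have "(\<Sum>k<4. c k *\<^sub>R y k) = c 0 *\<^sub>R (\<Sum>i\<in>I. c0 i *\<^sub>R i)"
      unfolding sumI sum_four yk c by (simp add: scaleR_add_right)
    then show "(\<Sum>k<4. c k *\<^sub>R y k) = 0" using c0(2) by simp
  qed
  show ?thesis by (rule that[OF Cy sy rel])
qed

section \<open>From facets omitting two rays to square summands\<close>

text \<open>The facet condition decomposes the relations along proportionality classes, and
  \<open>no_five\<close> limits a class that carries a relation to four generators: two coefficients
  of each sign always occur, and a fifth generator would make three of one sign. Generators with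
  coefficient 0 in every relation become the orthant.\<close>

lemma exists_sq_presentation:
  fixes V C :: "'e::euclidean_space set"
  assumes V: "subspace V" and fam: "extreme_family C I x" and pt: "C \<inter> uminus ` C = {0}"
    and u: "u \<in> (top_of_set V) interior_of C"
    and CH: "C = {v \<in> V. \<forall>h\<in>H. 0 \<le> h \<bullet> v}" and two: "\<And>h. h \<in> H \<Longrightarrow> card {i \<in> I. h \<bullet> x i \<noteq> 0} \<le> 2"
    and no_five: "\<And>K c p p' q q' q''. \<lbrakk>K \<subseteq> I; \<forall>j\<in>K. c j \<noteq> 0; (\<Sum>j\<in>K. c j *\<^sub>R x j) = 0;
        \<And>b. (\<Sum>i\<in>I. b i *\<^sub>R x i) = 0 \<Longrightarrow> \<exists>r. \<forall>j\<in>K. b j = r * c j;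
        p \<in> K; p' \<in> K; q \<in> K; q' \<in> K; q'' \<in> K; p \<noteq> p'; q \<noteq> q'; q \<noteq> q''; q' \<noteq> q'';
        0 < c p; 0 < c p'; c q < 0; c q' < 0; c q'' < 0\<rbrakk> \<Longrightarrow> False"
  shows "\<exists>a m y. sq_presentation V C a m y"
proof -
  have finI: "finite I" and C: "C = gen_cone I x" using extreme_familyD[OF fam] by blast+
  have CV: "C \<subseteq> V" using CH by blast
  have xC: "x i \<in> C" if "i \<in> I" for i unfolding C using gen_cone_gen[OF finI that, of 1 x] by simp
  define \<Lambda> where "\<Lambda> c \<longleftrightarrow> (\<Sum>i\<in>I. c i *\<^sub>R x i) = 0" for c
  \<comment> \<open>The factor \<open>r\<close> must be the same for all relations and nonzero; the
    latter makes the notion symmetric.\<close>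
  define E where "E i j \<longleftrightarrow> (\<exists>r. r \<noteq> 0 \<and> (\<forall>c. \<Lambda> c \<longrightarrow> c j = r * c i))" for i j
  have Er: "E i i" for i unfolding E_def by (rule exI[of _ 1]) simp
  have Es: "E j i" if E: "E i j" for i j
  proof -
    obtain r where r: "r \<noteq> 0" "\<forall>c. \<Lambda> c \<longrightarrow> c j = r * c i" using E unfolding E_def by blast
    have "\<forall>c. \<Lambda> c \<longrightarrow> c i = (1 / r) * c j"
    proof (intro allI impI)
      fix c assume "\<Lambda> c"
      then have "c j = r * c i" using r(2) by blast
      then show "c i = (1 / r) * c j" using r(1) by simp
    qed
    then show ?thesis unfolding E_def using r(1) by (intro exI[of _ "1 / r"]) simp
  qed
  have Et: "E i k" if E: "E i j" "E j k" for i j k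
  proof -
    obtain r where r: "r \<noteq> 0" "\<forall>c. \<Lambda> c \<longrightarrow> c j = r * c i" using E(1) unfolding E_def by blast
    obtain s where s: "s \<noteq> 0" "\<forall>c. \<Lambda> c \<longrightarrow> c k = s * c j" using E(2) unfolding E_def by blast
    have "\<forall>c. \<Lambda> c \<longrightarrow> c k = (s * r) * c i"
    proof (intro allI impI)
      fix c assume "\<Lambda> c"
      then have "c j = r * c i" "c k = s * c j" using r(2) s(2) by blast+
      then show "c k = (s * r) * c i" by simp
    qed
    then show ?thesis unfolding E_def using r(1) s(1) by (intro exI[of _ "s * r"]) simp
  qed
  \<comment> \<open>Evaluating \<open>h\<close> on a relation leaves at most two terms, whose sum is
    0. This is the place where the bound on omitted rays enters.\<close>
  have hE: "E i j" if h: "h \<in> H" and ij: "i \<in> I" "j \<in> I" "h \<bullet> x i \<noteq> 0" "h \<bullet> x j \<noteq> 0" for h i j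
  proof (cases "i = j")
    case True then show ?thesis using Er by simp
  next
    case False
    let ?S = "{i \<in> I. h \<bullet> x i \<noteq> 0}"
    have fS: "finite ?S" using finI by simp
    have sub: "{i, j} \<subseteq> ?S" using ij by blast
    have "card {i, j} = 2" using False by simp
    then have S: "?S = {i, j}" using card_subset_eq[OF fS sub] two[OF h] card_mono[OF fS sub] by simp
    have "c j = - (h \<bullet> x i / (h \<bullet> x j)) * c i" if c: "\<Lambda> c" for c
    proof -
      have "0 = h \<bullet> (\<Sum>i\<in>I. c i *\<^sub>R x i)" using c by (simp add: \<Lambda>_def)
      also have "\<dots> = (\<Sum>i\<in>I. c i * (h \<bullet> x i))" by (simp add: inner_sum_right)
      also have "\<dots> = (\<Sum>i\<in>?S. c i * (h \<bullet> x i))" by (rule sum.mono_neutral_right[OF finI]) auto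
      also have "\<dots> = c i * (h \<bullet> x i) + c j * (h \<bullet> x j)" unfolding S using False by simp
      finally have "c j * (h \<bullet> x j) = - (c i * (h \<bullet> x i))" by linarith
      then show ?thesis using ij(4) by (simp add: field_simps)
    qed
    moreover have "- (h \<bullet> x i / (h \<bullet> x j)) \<noteq> 0" using ij by simp
    ultimately show ?thesis unfolding E_def by blast
  qed
  define cls where "cls i = {j \<in> I. E i j}" for i
  \<comment> \<open>The generators on which a facet functional is nonzero lie in one class, so it
    sees either the whole relation or nothing of its restriction to \<open>cls i\<close>. All facet
    functionals thus vanish on the restricted sum, which lies in \<open>C\<close> and
    -\<open>C\<close> and is 0.\<close>
  have closed: "(\<Sum>j\<in>cls i. c j *\<^sub>R x j) = 0" if c: "\<Lambda> c" for i c
  proof -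
    let ?v = "\<Sum>j\<in>cls i. c j *\<^sub>R x j"
    have vV: "?v \<in> V" by (rule subspace_sum[OF V]) (use xC CV in \<open>auto simp: cls_def intro!: subspace_scale[OF V]\<close>)
    have h0: "h \<bullet> ?v = 0" if h: "h \<in> H" for h
    proof (cases "\<exists>j\<in>cls i. h \<bullet> x j \<noteq> 0")
      case True
      then obtain j where j: "j \<in> I" "E i j" "h \<bullet> x j \<noteq> 0" by (auto simp: cls_def)
      have "h \<bullet> x k = 0" if k: "k \<in> I - cls i" for k
      proof (rule ccontr)
        assume "h \<bullet> x k \<noteq> 0"
        then have "E j k" using hE[OF h j(1) _ j(3)] k by blast
        then have "E i k" using Et j(2) by blast
        then show False using k by (simp add: cls_def)
      qed
      then have "(\<Sum>j\<in>I. c j * (h \<bullet> x j)) = (\<Sum>j\<in>cls i. c j * (h \<bullet> x j))"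
        by (intro sum.mono_neutral_right[OF finI]) (auto simp: cls_def)
      moreover have "h \<bullet> (\<Sum>i\<in>I. c i *\<^sub>R x i) = 0" using c by (simp add: \<Lambda>_def)
      ultimately show ?thesis by (simp add: inner_sum_right)
    next
      case False then show ?thesis by (simp add: inner_sum_right)
    qed
    have "?v \<in> C" unfolding CH using vV h0 by simp
    moreover have "- ?v \<in> C" unfolding CH using subspace_neg[OF V vV] h0 by simp
    then have "?v \<in> uminus ` C" by (metis add.inverse_inverse imageI)
    ultimately show ?thesis using pt by blast
  qed
  define Nf where "Nf = {i \<in> I. \<exists>c. \<Lambda> c \<and> c i \<noteq> 0}"
  \<comment> \<open>Alternating signs along sigma match the cyclic order of the rays of a square:
    opposite corners carry the same sign.\<close>
  have square: "\<exists>\<sigma> c. \<Lambda> c \<and> bij_betw \<sigma> {..<4::nat} (cls i) \<and> 0 < c (\<sigma> 0) \<and> c (\<sigma> 1) < 0 \<and> 0 < c (\<sigma> 2) \<and> c (\<sigma> 3) < 0"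
    if i: "i \<in> Nf" for i
  proof -
    obtain c where c: "\<Lambda> c" "c i \<noteq> 0" and iI: "i \<in> I" using i unfolding Nf_def by blast
    have K: "cls i \<subseteq> I" "cls i \<noteq> {}" using Er iI by (auto simp: cls_def)
    have nz: "\<forall>j\<in>cls i. c j \<noteq> 0" using c by (auto simp: cls_def E_def)
    have pr: "\<exists>r. \<forall>j\<in>cls i. b j = r * c j" if b: "(\<Sum>i\<in>I. b i *\<^sub>R x i) = 0" for b
    proof (rule exI[of _ "b i / c i"], rule ballI)
      fix j assume "j \<in> cls i"
      then obtain r where r: "\<forall>c. \<Lambda> c \<longrightarrow> c j = r * c i" by (auto simp: cls_def E_def)
      have "b j = r * b i" "c j = r * c i" using r b c(1) by (auto simp: \<Lambda>_def)
      then show "b j = b i / c i * c j" using c(2) by simp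
    qed
    obtain p p' where p: "p \<in> cls i" "p' \<in> cls i" "p \<noteq> p'" "0 < c p" "0 < c p'"
      using relation_two_positive[OF fam pt K nz closed[OF c(1)]] by blast
    obtain q q' where q: "q \<in> cls i" "q' \<in> cls i" "q \<noteq> q'" "c q < 0" "c q' < 0"
      using relation_two_negative[OF fam pt K nz closed[OF c(1)]] by blast
    have ne: "p \<noteq> q" "p \<noteq> q'" "p' \<noteq> q" "p' \<noteq> q'" using p q by auto
    have "j \<in> {p, p', q, q'}" if j: "j \<in> cls i" for j
    proof (rule ccontr)
      assume nj: "j \<notin> {p, p', q, q'}"
      show False
      proof (cases "0 < c j")
        case True
        have z: "(\<Sum>j\<in>cls i. (- c j) *\<^sub>R x j) = 0" using closed[OF c(1), of i] by (simp add: sum_negf)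
        have nz': "\<forall>j\<in>cls i. - c j \<noteq> 0" using nz by simp
        have pr': "\<exists>r. \<forall>j\<in>cls i. b j = r * - c j" if b: "(\<Sum>i\<in>I. b i *\<^sub>R x i) = 0" for b
        proof -
          obtain r where "\<forall>j\<in>cls i. b j = r * c j" using pr[OF b] by blast
          then have "\<forall>j\<in>cls i. b j = (- r) * - c j" by simp
          then show ?thesis by blast
        qed
        show False
          by (rule no_five[OF K(1) nz' z pr' q(1,2) p(1,2) j q(3) p(3)]) (use nj p q True in auto)
      next
        case False
        then have cj: "c j < 0" using nz j by force
        show False
          by (rule no_five[OF K(1) nz closed[OF c(1)] pr p(1,2) q(1,2) j p(3) q(3)]) (use nj p q cj in auto)
      qed
    qed
    then have "cls i = {p, p', q, q'}" using p q by blast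
    from enumerate_four[OF p(3) q(3) ne this] obtain \<sigma> where "bij_betw \<sigma> {..<4::nat} (cls i)" "\<sigma> 0 = p" "\<sigma> 1 = q" "\<sigma> 2 = p'" "\<sigma> 3 = q'"
      by (elim exE conjE) (rule that)
    then show ?thesis using p q c(1) by (intro exI[of _ \<sigma>] exI[of _ c]) simp
  qed
  have clsE: "cls j = cls i" if "j \<in> cls i" for i j
    using that Es Et unfolding cls_def by blast
  define Ks where "Ks = cls ` Nf"
  have finK: "finite Ks" using finI by (simp add: Ks_def Nf_def)
  have "\<forall>K\<in>Ks. \<exists>d. \<Lambda> (snd d) \<and> bij_betw (fst d) {..<4::nat} K \<and> 0 < snd d (fst d 0) \<and> snd d (fst d 1) < 0 \<and> 0 < snd d (fst d 2) \<and> snd d (fst d 3) < 0"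
  proof
    fix K assume "K \<in> Ks"
    then obtain i where i: "i \<in> Nf" "K = cls i" unfolding Ks_def by blast
    from square[OF i(1)] obtain \<sigma> c where "\<Lambda> c" "bij_betw \<sigma> {..<4::nat} (cls i)" "0 < c (\<sigma> 0)" "c (\<sigma> 1) < 0" "0 < c (\<sigma> 2)" "c (\<sigma> 3) < 0"
      by (elim exE conjE) (rule that)
    then show "\<exists>d. \<Lambda> (snd d) \<and> bij_betw (fst d) {..<4::nat} K \<and> 0 < snd d (fst d 0) \<and> snd d (fst d 1) < 0 \<and> 0 < snd d (fst d 2) \<and> snd d (fst d 3) < 0"
      unfolding i(2) by (intro exI[of _ "(\<sigma>, c)"]) simp
  qed
  from bchoice[OF this] obtain D where D: "\<forall>K\<in>Ks. \<Lambda> (snd (D K)) \<and> bij_betw (fst (D K)) {..<4::nat} K \<and> 0 < snd (D K) (fst (D K) 0) \<and>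
    snd (D K) (fst (D K) 1) < 0 \<and> 0 < snd (D K) (fst (D K) 2) \<and> snd (D K) (fst (D K) 3) < 0" by (elim exE) (rule that)
  define m where "m = card Ks"
  define a where "a = card (I - Nf)"
  obtain e where e: "bij_betw e {..<m} Ks" using ex_bij_betw_nat_finite[OF finK] unfolding m_def atLeast0LessThan by blast
  obtain f where f: "bij_betw f {..<a} (I - Nf)" using ex_bij_betw_nat_finite[of "I - Nf"] finI unfolding a_def atLeast0LessThan by blast
  define \<sigma> where "\<sigma> l = fst (D (e l))" for l
  define cc where "cc l = snd (D (e l))" for l
  have eK: "e l \<in> Ks" if "l < m" for l using e that by (auto simp: bij_betw_def)
  have De: "\<Lambda> (cc l)" "bij_betw (\<sigma> l) {..<4} (e l)" "0 < cc l (\<sigma> l 0)" "cc l (\<sigma> l 1) < 0" "0 < cc l (\<sigma> l 2)" "cc l (\<sigma> l 3) < 0"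
    if "l < m" for l using bspec[OF D eK[OF that]] by (simp_all only: \<sigma>_def cc_def simp_thms)
  have eI: "e l \<subseteq> Nf" if l: "l < m" for l
  proof
    fix j assume j: "j \<in> e l"
    obtain i where i: "i \<in> Nf" "e l = cls i" using eK[OF l] unfolding Ks_def by blast
    have jI: "j \<in> I" and Eij: "E i j" using j i(2) by (auto simp: cls_def)
    obtain c where c: "\<Lambda> c" "c i \<noteq> 0" using i(1) unfolding Nf_def by blast
    then have "c j \<noteq> 0" using Eij by (auto simp: E_def)
    then show "j \<in> Nf" using jI c(1) unfolding Nf_def by blast
  qed
  have disj: "l = l'" if ll: "l < m" "l' < m" and j: "j \<in> e l" "j \<in> e l'" for l l' j
  proof -
    have "cls j = e l" if "l < m" "j \<in> e l" for l
    proof -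
      obtain i where i: "e l = cls i" using eK[OF \<open>l < m\<close>] unfolding Ks_def by blast
      show ?thesis using clsE[of j i] that(2) unfolding i by simp
    qed
    then have "e l = e l'" using ll j by metis
    then show ?thesis using e ll by (auto simp: bij_betw_def inj_on_def)
  qed
  have cover: "\<exists>l<m. j \<in> e l" if j: "j \<in> Nf" for j
  proof -
    have "cls j \<in> Ks" using j unfolding Ks_def by blast
    then obtain l where "l < m" "e l = cls j" using e unfolding bij_betw_def by (metis imageE lessThan_iff)
    moreover have "j \<in> cls j" using j Er by (simp add: cls_def Nf_def)
    ultimately show ?thesis by blast
  qed
  let ?J = "sq_index a m"
  define \<phi> where "\<phi> i = (case i of Inl j \<Rightarrow> f j | Inr lk \<Rightarrow> \<sigma> (fst lk) (snd lk))" for i :: "nat + nat \<times> nat"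
  \<comment> \<open>Rescaling each generator by the absolute value of its coefficient normalises the
    relation of a class to q_0 - q_1 + q_2 - q_3 = 0.\<close>
  define W where "W i = (case i of Inl j \<Rightarrow> 1 | Inr lk \<Rightarrow> \<bar>cc (fst lk) (\<sigma> (fst lk) (snd lk))\<bar>)" for i :: "nat + nat \<times> nat"
  have \<phi>s: "\<phi> (Inl j) = f j" "\<phi> (Inr (l, k)) = \<sigma> l k" for j l k by (simp_all add: \<phi>_def)
  have Ws: "W (Inl j) = 1" "W (Inr (l, k)) = \<bar>cc l (\<sigma> l k)\<bar>" for j l k by (simp_all add: W_def)
  have \<sigma>e: "\<sigma> l k \<in> e l" if "l < m" "k < 4" for l k using De(2)[OF that(1)] that(2) by (auto simp: bij_betw_def)
  have fF: "f j \<in> I - Nf" if "j < a" for j using f that by (auto simp: bij_betw_def)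
  have Jcases: "(\<exists>j<a. i = Inl j) \<or> (\<exists>l<m. \<exists>k<4. i = Inr (l, k))" if "i \<in> ?J" for i
    using that unfolding sq_index_def by auto
  have bij: "bij_betw \<phi> ?J I"
    unfolding bij_betw_def
  proof
    show "inj_on \<phi> ?J"
    proof (rule inj_onI)
      fix i i' assume ii: "i \<in> ?J" "i' \<in> ?J" "\<phi> i = \<phi> i'"
      consider (ll) j j' where "j < a" "j' < a" "i = Inl j" "i' = Inl j'"
        | (lr) j l k where "j < a" "l < m" "k < 4" "i = Inl j" "i' = Inr (l, k)"
        | (rl) j l k where "j < a" "l < m" "k < 4" "i' = Inl j" "i = Inr (l, k)"
        | (rr) l k l' k' where "l < m" "k < 4" "l' < m" "k' < 4" "i = Inr (l, k)" "i' = Inr (l', k')"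
        using Jcases[OF ii(1)] Jcases[OF ii(2)] by blast
      then show "i = i'"
      proof cases
        case ll
        then have "f j = f j'" using ii(3) by (simp add: \<phi>s)
        then show ?thesis using f ll by (auto simp: bij_betw_def inj_on_def)
      next
        case lr
        then have "f j = \<sigma> l k" using ii(3) by (simp add: \<phi>s)
        then show ?thesis using fF[OF lr(1)] \<sigma>e[OF lr(2,3)] eI[OF lr(2)] by auto
      next
        case rl
        then have "f j = \<sigma> l k" using ii(3) by (simp add: \<phi>s)
        then show ?thesis using fF[OF rl(1)] \<sigma>e[OF rl(2,3)] eI[OF rl(2)] by auto
      next
        case rr
        then have s: "\<sigma> l k = \<sigma> l' k'" using ii(3) by (simp add: \<phi>s)
        then have "l = l'" using disj[OF rr(1,3)] \<sigma>e[OF rr(1,2)] \<sigma>e[OF rr(3,4)] by simp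
        moreover have "k = k'" using De(2)[OF rr(1)] s rr \<open>l = l'\<close> by (auto simp: bij_betw_def inj_on_def)
        ultimately show ?thesis using rr by simp
      qed
    qed
    show "\<phi> ` ?J = I"
    proof
      show "\<phi> ` ?J \<subseteq> I"
      proof
        fix v assume "v \<in> \<phi> ` ?J"
        then obtain i where i: "i \<in> ?J" "v = \<phi> i" by blast
        from Jcases[OF i(1)] show "v \<in> I"
        proof (elim disjE exE conjE)
          fix j assume "j < a" "i = Inl j" then show ?thesis using fF i(2) by (simp add: \<phi>s)
        next
          fix l k assume "l < m" "k < 4" "i = Inr (l, k)"
          then show ?thesis using \<sigma>e[of l k] eI[of l] i(2) by (auto simp: \<phi>s Nf_def)
        qed
      qed
      show "I \<subseteq> \<phi> ` ?J"
      proof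
        fix v assume v: "v \<in> I"
        show "v \<in> \<phi> ` ?J"
        proof (cases "v \<in> Nf")
          case True
          then obtain l where l: "l < m" "v \<in> e l" using cover by blast
          then obtain k where k: "k < 4" "v = \<sigma> l k" using De(2)[OF l(1)] unfolding bij_betw_def by (metis imageE lessThan_iff)
          have "Inr (l, k) \<in> ?J" using l k by (auto simp: sq_index_def)
          then show ?thesis using k(2) \<phi>s(2)[of l k] by (metis imageI)
        next
          case False
          then have "v \<in> f ` {..<a}" using f v by (simp add: bij_betw_def)
          then obtain j where j: "j < a" "v = f j" by auto
          have "Inl j \<in> ?J" using j by (auto simp: sq_index_def)
          then show ?thesis using j(2) \<phi>s(1)[of j] by (metis imageI)
        qed
      qed
    qed
  qed
  have cc0: "cc l (\<sigma> l k) \<noteq> 0" if "l < m" "k < 4" for l k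
  proof -
    have "k = 0 \<or> k = 1 \<or> k = 2 \<or> k = 3" using that(2) by auto
    then show ?thesis using De(3-6)[OF that(1)] by auto
  qed
  have Wp: "0 < W i" if "i \<in> ?J" for i
    using Jcases[OF that] cc0 by (auto simp: Ws)
  define y where "y i = W i *\<^sub>R x (\<phi> i)" for i
  have Cy: "C = gen_cone ?J y" unfolding C y_def by (rule gen_cone_rescale[OF bij Wp, symmetric])
  have Vy: "V = span (y ` ?J)" by (rule proper_cone_span[OF V u Cy _ CV]) simp
  have ysq: "y (Inr (l, 0)) - y (Inr (l, 1)) + y (Inr (l, 2)) - y (Inr (l, 3)) = 0" if l: "l < m" for l
  proof -
    obtain i where i: "e l = cls i" using eK[OF l] unfolding Ks_def by blast
    have "0 = (\<Sum>j\<in>e l. cc l j *\<^sub>R x j)" unfolding i by (rule closed[OF De(1)[OF l], symmetric])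
    also have "\<dots> = (\<Sum>k<4. cc l (\<sigma> l k) *\<^sub>R x (\<sigma> l k))" by (rule sum.reindex_bij_betw[OF De(2)[OF l], symmetric])
    also have "\<dots> = y (Inr (l, 0)) - y (Inr (l, 1)) + y (Inr (l, 2)) - y (Inr (l, 3))"
      unfolding sum_four y_def \<phi>s Ws using De(3-6)[OF l] by simp
    finally show ?thesis ..
  qed
  have rel: "(\<Sum>i\<in>?J. c i *\<^sub>R y i) = 0 \<longleftrightarrow> sq_rel a m c" for c
  proof
    assume z: "(\<Sum>i\<in>?J. c i *\<^sub>R y i) = 0"
    define b where "b v = c (inv_into ?J \<phi> v) * W (inv_into ?J \<phi> v)" for v
    have b\<phi>: "b (\<phi> i) = c i * W i" if "i \<in> ?J" for i using bij that by (simp add: b_def bij_betw_def)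
    have "(\<Sum>v\<in>I. b v *\<^sub>R x v) = (\<Sum>i\<in>?J. b (\<phi> i) *\<^sub>R x (\<phi> i))" by (rule sum.reindex_bij_betw[OF bij, symmetric])
    also have "\<dots> = (\<Sum>i\<in>?J. c i *\<^sub>R y i)" by (rule sum.cong[OF refl]) (simp add: b\<phi> y_def)
    finally have b: "\<Lambda> b" using z by (simp add: \<Lambda>_def)
    show "sq_rel a m c"
      unfolding sq_rel_def
    proof (rule conjI; intro allI impI)
      fix j assume j: "j < a"
      have jJ: "Inl j \<in> ?J" using j by (auto simp: sq_index_def)
      have "b (f j) = 0" using fF[OF j] b unfolding Nf_def by blast
      then show "c (Inl j) = 0" using b\<phi>[OF jJ] by (simp add: \<phi>s Ws)
    next
      fix l assume l: "l < m"
      obtain i where i: "i \<in> Nf" "e l = cls i" using eK[OF l] unfolding Ks_def by blast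
      have ci: "cc l i \<noteq> 0"
      proof -
        have "E i (\<sigma> l 0)" using \<sigma>e[OF l, of 0] i(2) by (simp add: cls_def)
        then obtain r where "\<forall>c. \<Lambda> c \<longrightarrow> c (\<sigma> l 0) = r * c i" unfolding E_def by blast
        then have "cc l (\<sigma> l 0) = r * cc l i" using De(1)[OF l] by blast
        then show ?thesis using De(3)[OF l] by auto
      qed
      define r where "r = b i / cc l i"
      have pr: "b (\<sigma> l k) = r * cc l (\<sigma> l k)" if k: "k < 4" for k
      proof -
        have "E i (\<sigma> l k)" using \<sigma>e[OF l k] i(2) by (simp add: cls_def)
        then obtain s where s: "\<forall>c. \<Lambda> c \<longrightarrow> c (\<sigma> l k) = s * c i" unfolding E_def by blast
        have "b (\<sigma> l k) = s * b i" "cc l (\<sigma> l k) = s * cc l i" using s b De(1)[OF l] by blast+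
        then show ?thesis using ci by (simp add: r_def)
      qed
      have lk: "c (Inr (l, k)) * \<bar>cc l (\<sigma> l k)\<bar> = r * cc l (\<sigma> l k)" if k: "k < 4" for k
      proof -
        have "Inr (l, k) \<in> ?J" using l k by (auto simp: sq_index_def)
        from b\<phi>[OF this] show ?thesis using pr[OF k] by (simp add: \<phi>s Ws)
      qed
      have P: "c (Inr (l, k)) = r" if "k < 4" "0 < cc l (\<sigma> l k)" for k
        using lk[OF that(1)] that(2) by simp
      have N: "c (Inr (l, k)) = - r" if "k < 4" "cc l (\<sigma> l k) < 0" for k
      proof -
        have "(c (Inr (l, k)) + r) * cc l (\<sigma> l k) = 0" using lk[OF that(1)] that(2) by (simp add: algebra_simps)
        then show ?thesis using that(2) by (simp add: eq_neg_iff_add_eq_0)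
      qed
      show "c (Inr (l, 1)) = - c (Inr (l, 0)) \<and> c (Inr (l, 2)) = c (Inr (l, 0)) \<and> c (Inr (l, 3)) = - c (Inr (l, 0))"
        using P[OF _ De(3)[OF l]] N[OF _ De(4)[OF l]] P[OF _ De(5)[OF l]] N[OF _ De(6)[OF l]] by simp
    qed
  next
    assume s: "sq_rel a m c"
    show "(\<Sum>i\<in>?J. c i *\<^sub>R y i) = 0"
      unfolding sum_sq_index
    proof -
      have 1: "(\<Sum>j<a. c (Inl j) *\<^sub>R y (Inl j)) = 0" by (rule sum.neutral) (use s in \<open>simp add: sq_rel_def\<close>)
      have "c (Inr (l, 0)) *\<^sub>R y (Inr (l, 0)) + c (Inr (l, 1)) *\<^sub>R y (Inr (l, 1)) + c (Inr (l, 2)) *\<^sub>R y (Inr (l, 2)) + c (Inr (l, 3)) *\<^sub>R y (Inr (l, 3)) = 0"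
        if l: "l < m" for l
      proof -
        have c: "c (Inr (l, 1)) = - c (Inr (l, 0))" "c (Inr (l, 2)) = c (Inr (l, 0))" "c (Inr (l, 3)) = - c (Inr (l, 0))"
          using s l unfolding sq_rel_def by blast+
        have "c (Inr (l, 0)) *\<^sub>R (y (Inr (l, 0)) - y (Inr (l, 1)) + y (Inr (l, 2)) - y (Inr (l, 3))) = 0" using ysq[OF l] by simp
        then show ?thesis unfolding c by (simp only: scaleR_add_right scaleR_diff_right scaleR_minus_left add_uminus_conv_diff)
      qed
      then show "(\<Sum>j<a. c (Inl j) *\<^sub>R y (Inl j)) + (\<Sum>l<m. c (Inr (l, 0)) *\<^sub>R y (Inr (l, 0)) + c (Inr (l, 1)) *\<^sub>R y (Inr (l, 1)) + c (Inr (l, 2)) *\<^sub>R y (Inr (l, 2)) + c (Inr (l, 3)) *\<^sub>R y (Inr (l, 3))) = 0"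
        using 1 by simp
    qed
  qed
  have "sq_presentation V C a m y" unfolding sq_presentation_def using Cy Vy rel by blast
  then show ?thesis by blast
qed

section \<open>Isomorphisms, extreme rays and dimension of presented cones\<close>

lemma sq_presentationD:
  assumes "sq_presentation V C a m y"
  shows "C = gen_cone (sq_index a m) y" "V = span (y ` sq_index a m)"
    "\<And>c. (\<Sum>i\<in>sq_index a m. c i *\<^sub>R y i) = 0 \<longleftrightarrow> sq_rel a m c"
  using assms unfolding sq_presentation_def by blast+

lemma linear_image_gen_cone:
  assumes "linear F" "\<And>i. i \<in> J \<Longrightarrow> F (y i) = g i"
  shows "F ` gen_cone J y = gen_cone J g"
proof -
  have F: "F (\<Sum>i\<in>J. c i *\<^sub>R y i) = (\<Sum>i\<in>J. c i *\<^sub>R g i)" for c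
    unfolding linear_sum[OF assms(1)] by (intro sum.cong refl) (simp add: linear_scale[OF assms(1)] assms(2))
  show ?thesis unfolding gen_cone_def using F by (auto simp: image_iff) metis+
qed

text \<open>Equal relations let the correspondence of generators extend linearly in both directions,
  and the two extensions are inverse on the spans.\<close>

lemma sq_presentation_iso:
  assumes P: "sq_presentation V C a m y" and Q: "sq_presentation W D a m g"
  shows "cone_iso V C W D"
proof -
  let ?J = "sq_index a m"
  have r1: "(\<Sum>i\<in>?J. c i *\<^sub>R g i) = 0" if "(\<Sum>i\<in>?J. c i *\<^sub>R y i) = 0" for c
    using that sq_presentationD(3)[OF P] sq_presentationD(3)[OF Q] by blast
  have r2: "(\<Sum>i\<in>?J. c i *\<^sub>R y i) = 0" if "(\<Sum>i\<in>?J. c i *\<^sub>R g i) = 0" for c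
    using that sq_presentationD(3)[OF P] sq_presentationD(3)[OF Q] by blast
  obtain F where F: "linear F" "\<And>i. i \<in> ?J \<Longrightarrow> F (y i) = g i"
    by (rule linear_extension_family[OF finite_sq_index r1]) (assumption, rule that, assumption, blast)
  obtain F' where F': "linear F'" "\<And>i. i \<in> ?J \<Longrightarrow> F' (g i) = y i"
    by (rule linear_extension_family[OF finite_sq_index r2]) (assumption, rule that, assumption, blast)
  have im: "F ` V = W"
  proof -
    have "F ` V = span (F ` (y ` ?J))" unfolding sq_presentationD(2)[OF P] by (rule linear_span_image[OF F(1), symmetric])
    also have "F ` (y ` ?J) = g ` ?J" using F(2) by (auto simp: image_iff)
    finally show ?thesis using sq_presentationD(2)[OF Q] by simp
  qed
  have inv: "F' (F v) = v" if "v \<in> V" for v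
  proof -
    have "v \<in> span (y ` ?J)" using that sq_presentationD(2)[OF P] by simp
    then have "(F' \<circ> F) v = id v"
      by (rule linear_eq_on[OF linear_compose[OF F(1) F'(1)] linear_id]) (use F F' in auto)
    then show ?thesis by simp
  qed
  have "inj_on F V" by (rule inj_on_inverseI[of V F' F]) (rule inv)
  then have "bij_betw F V W" using im by (simp add: bij_betw_def)
  moreover have "F ` C = D" unfolding sq_presentationD(1)[OF P] sq_presentationD(1)[OF Q] by (rule linear_image_gen_cone[OF F])
  ultimately show ?thesis unfolding cone_iso_def using F(1) by blast
qed

lemma cone_iso_sq_presentation:
  assumes V: "subspace V" and CV: "C \<subseteq> V" and iso: "cone_iso V C W D" and Q: "sq_presentation W D a m g"
  obtains y where "sq_presentation V C a m y"
proof -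
  let ?J = "sq_index a m"
  obtain F where F: "linear F" "bij_betw F V W" "F ` C = D" using iso unfolding cone_iso_def by blast
  have inj: "inj_on F V" and im: "F ` V = W" using F(2) by (simp_all add: bij_betw_def)
  define y where "y i = inv_into V F (g i)" for i
  have gW: "g i \<in> W" if "i \<in> ?J" for i unfolding sq_presentationD(2)[OF Q] using that by (intro span_base) simp
  have Fy: "F (y i) = g i" "y i \<in> V" if "i \<in> ?J" for i
    using gW[OF that] im by (auto simp: y_def f_inv_into_f inv_into_into)
  have ys: "y ` ?J \<subseteq> V" using Fy by blast
  have sub: "span (y ` ?J) \<subseteq> V" by (rule span_minimal[OF ys V])
  have "F ` span (y ` ?J) = span (F ` (y ` ?J))" by (rule linear_span_image[OF F(1), symmetric])
  also have "F ` (y ` ?J) = g ` ?J" using Fy(1) by (auto simp: image_iff)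
  finally have "F ` span (y ` ?J) = F ` V" using sq_presentationD(2)[OF Q] im by simp
  then have Vs: "V = span (y ` ?J)" using inj_on_image_eq_iff[OF inj sub order_refl] by simp
  have gs: "gen_cone ?J y \<subseteq> V" unfolding gen_cone_def Vs span_image_sum[OF finite_sq_index] by blast
  have "F ` gen_cone ?J y = gen_cone ?J g" by (rule linear_image_gen_cone[OF F(1)]) (rule Fy(1))
  then have "F ` gen_cone ?J y = F ` C" unfolding F(3) using sq_presentationD(1)[OF Q] by simp
  then have Cs: "C = gen_cone ?J y" using inj_on_image_eq_iff[OF inj gs CV] by simp
  have "(\<Sum>i\<in>?J. c i *\<^sub>R y i) = 0 \<longleftrightarrow> sq_rel a m c" for c
  proof -
    let ?v = "\<Sum>i\<in>?J. c i *\<^sub>R y i"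
    have vV: "?v \<in> V" using Vs unfolding span_image_sum[OF finite_sq_index] by blast
    have "F ?v = (\<Sum>i\<in>?J. c i *\<^sub>R g i)"
      unfolding linear_sum[OF F(1)] by (intro sum.cong refl) (simp add: linear_scale[OF F(1)] Fy)
    moreover have "?v = 0 \<longleftrightarrow> F ?v = 0"
      using inj_onD[OF inj _ vV subspace_0[OF V]] linear_0[OF F(1)] by auto
    ultimately show ?thesis using sq_presentationD(3)[OF Q] by simp
  qed
  then have "sq_presentation V C a m y" unfolding sq_presentation_def using Cs Vs by blast
  then show ?thesis by (rule that)
qed

text \<open>In a square the coefficients alternate in sign, so a nonzero relation has at least two
  negative ones. This single fact yields nonvanishing, distinctness and extremality of the
  generators in \<open>sq_presentation_extreme\<close>.\<close>

lemma sq_rel_one_exception: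
  assumes s: "sq_rel a m c" and i: "i \<in> sq_index a m" and nn: "\<And>k. k \<in> sq_index a m \<Longrightarrow> k \<noteq> i \<Longrightarrow> 0 \<le> c k"
    and k: "k \<in> sq_index a m"
  shows "c k = 0"
proof -
  consider j where "k = Inl j" "j < a" | l p where "k = Inr (l, p)" "l < m" "p < 4" using k unfolding sq_index_def by auto
  then show ?thesis
  proof cases
    case 1 then show ?thesis using s by (simp add: sq_rel_def)
  next
    case (2 l p)
    have c: "c (Inr (l, 1)) = - c (Inr (l, 0))" "c (Inr (l, 2)) = c (Inr (l, 0))" "c (Inr (l, 3)) = - c (Inr (l, 0))"
      using s 2(2) unfolding sq_rel_def by blast+
    have n: "0 \<le> c (Inr (l, p))" if "p < 4" "Inr (l, p) \<noteq> i" for p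
      by (rule nn) (use that 2(2) in \<open>auto simp: sq_index_def\<close>)
    have "c (Inr (l, 0)) = 0"
    proof (cases "i = Inr (l, 0) \<or> i = Inr (l, 2)")
      case True
      have "0 \<le> c (Inr (l, 1))" by (rule n) (use True in auto)
      moreover have "0 \<le> c (Inr (l, 0)) \<or> 0 \<le> c (Inr (l, 2))" using n[of 0] n[of 2] by fastforce
      ultimately show ?thesis using c by linarith
    next
      case False
      have "0 \<le> c (Inr (l, 0))" by (rule n) (use False in auto)
      moreover have "0 \<le> c (Inr (l, 1)) \<or> 0 \<le> c (Inr (l, 3))" using n[of 1] n[of 3] by fastforce
      ultimately show ?thesis using c by linarith
    qed
    moreover have "p = 0 \<or> p = 1 \<or> p = 2 \<or> p = 3" using 2(3) by auto
    ultimately show ?thesis using c 2(1) by auto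
  qed
qed

lemma sum_single_coefficient:
  "finite J \<Longrightarrow> i \<in> J \<Longrightarrow> (\<Sum>k\<in>J. (t * of_bool (k = i)) *\<^sub>R y k) = t *\<^sub>R y i" for y :: "'i \<Rightarrow> 'e::real_vector"
proof -
  assume "finite J" "i \<in> J"
  have "(\<Sum>k\<in>J. (t * of_bool (k = i)) *\<^sub>R y k) = (\<Sum>k\<in>J. if k = i then t *\<^sub>R y k else 0)" by (intro sum.cong refl) simp
  then show ?thesis using \<open>finite J\<close> \<open>i \<in> J\<close> by simp
qed

lemma sq_presentation_extreme:
  assumes P: "sq_presentation V C a m y"
  shows "extreme_family C (sq_index a m) y"
proof -
  let ?J = "sq_index a m"
  have C: "C = gen_cone ?J y" by (rule sq_presentationD(1)[OF P])
  have one: "(\<Sum>k\<in>?J. (t * of_bool (k = i)) *\<^sub>R y k) = t *\<^sub>R y i" if "i \<in> ?J" for i t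
    by (rule sum_single_coefficient[OF finite_sq_index that])
  have zero: "c k = 0" if z: "(\<Sum>k\<in>?J. c k *\<^sub>R y k) = 0" and i: "i \<in> ?J" and nn: "\<And>k. k \<in> ?J \<Longrightarrow> k \<noteq> i \<Longrightarrow> 0 \<le> c k" and k: "k \<in> ?J" for c i k
    by (rule sq_rel_one_exception[OF _ i nn k]) (use z sq_presentationD(3)[OF P] in blast)+
  have y0: "y i \<noteq> 0" if i: "i \<in> ?J" for i
  proof
    assume "y i = 0"
    then have "(\<Sum>k\<in>?J. ((-1) * of_bool (k = i)) *\<^sub>R y k) = 0" unfolding one[OF i] by simp
    from zero[OF this i _ i] show False by simp
  qed
  have dis: "i = j" if ij: "i \<in> ?J" "j \<in> ?J" "y i \<in> ray (y j)" for i j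
  proof (rule ccontr)
    assume ne: "i \<noteq> j"
    obtain t where t: "y i = t *\<^sub>R y j" "0 \<le> t" using ij(3) by (auto simp: ray_def)
    have "(\<Sum>k\<in>?J. (t * of_bool (k = j) + (-1) * of_bool (k = i)) *\<^sub>R y k) = t *\<^sub>R y j + (-1) *\<^sub>R y i"
      unfolding scaleR_add_left sum.distrib one[OF ij(1)] one[OF ij(2)] ..
    then have z: "(\<Sum>k\<in>?J. (t * of_bool (k = j) + (-1) * of_bool (k = i)) *\<^sub>R y k) = 0" using t(1) by simp
    have "t * of_bool (i = j) + (-1) * of_bool (i = i) = 0" by (rule zero[OF z ij(1) _ ij(1)]) (use t(2) in simp)
    then show False using ne by simp
  qed
  have ext: "v \<in> ray (y i)" if i: "i \<in> ?J" and vw: "v \<in> C" "w \<in> C" "y i = v + w" for i v w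
  proof -
    obtain b where b: "v = (\<Sum>k\<in>?J. b k *\<^sub>R y k)" "\<forall>k\<in>?J. 0 \<le> b k" using vw(1) unfolding C gen_cone_def by blast
    obtain d where d: "w = (\<Sum>k\<in>?J. d k *\<^sub>R y k)" "\<forall>k\<in>?J. 0 \<le> d k" using vw(2) unfolding C gen_cone_def by blast
    have "(\<Sum>k\<in>?J. (b k + d k + (-1) * of_bool (k = i)) *\<^sub>R y k) = v + w + (-1) *\<^sub>R y i"
      unfolding scaleR_add_left sum.distrib one[OF i] b(1) d(1) ..
    then have z: "(\<Sum>k\<in>?J. (b k + d k + (-1) * of_bool (k = i)) *\<^sub>R y k) = 0" using vw(3) by simp
    have bk: "b k = 0" if k: "k \<in> ?J" "k \<noteq> i" for k
    proof -
      have "b k + d k + (-1) * of_bool (k = i) = 0" by (rule zero[OF z i _ k(1)]) (use b(2) d(2) in simp)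
      then show ?thesis using b(2) d(2) k by (simp add: add_nonneg_eq_0_iff)
    qed
    have "v = (\<Sum>k\<in>?J. (b i * of_bool (k = i)) *\<^sub>R y k)" unfolding b(1) by (rule sum.cong[OF refl]) (use bk in auto)
    then have "v = b i *\<^sub>R y i" unfolding one[OF i] .
    then show ?thesis using b(2) i unfolding ray_def by blast
  qed
  show ?thesis unfolding extreme_family_def using C y0 dis ext finite_sq_index by auto
qed

lemma card_sq_index: "card (sq_index a m) = a + 4 * m"
  unfolding sq_index_def by (subst card_Plus) (simp_all add: card_cartesian_product)

text \<open>Dropping the fourth ray of every square leaves a basis: the only relation of a square
  involves all four rays and expresses the fourth by the others.\<close>

lemma sq_presentation_dim:
  fixes V :: "'e::euclidean_space set"
  assumes P: "sq_presentation V C a m y"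
  shows "dim V = a + 3 * m"
proof -
  let ?J = "sq_index a m"
  define B where "B = {..<a} <+> ({..<m} \<times> {..<3::nat})"
  have BJ: "B \<subseteq> ?J" and finB: "finite B" by (auto simp: B_def sq_index_def)
  have J: "i \<in> B \<or> (\<exists>l<m. i = Inr (l, 3))" if i: "i \<in> ?J" for i
  proof -
    consider j where "i = Inl j" "j < a" | l p where "i = Inr (l, p)" "l < m" "p < 4" using i unfolding sq_index_def by auto
    then show ?thesis
    proof cases
      case (2 l p)
      then have "p < 3 \<or> p = 3" by auto
      then show ?thesis using 2 by (auto simp: B_def)
    qed (auto simp: B_def)
  qed
  have zero: "c i = 0" if z: "(\<Sum>i\<in>B. c i *\<^sub>R y i) = 0" and i: "i \<in> B" for c i
  proof -
    define b where "b i = (if i \<in> B then c i else 0)" for i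
    have "(\<Sum>i\<in>?J. b i *\<^sub>R y i) = (\<Sum>i\<in>B. b i *\<^sub>R y i)" by (rule sum.mono_neutral_right[OF finite_sq_index BJ]) (simp add: b_def)
    also have "\<dots> = 0" using z by (simp add: b_def)
    finally have s: "sq_rel a m b" using sq_presentationD(3)[OF P] by blast
    consider j where "i = Inl j" "j < a" | l p where "i = Inr (l, p)" "l < m" "p < 3" using i unfolding B_def by auto
    then have "b i = 0"
    proof cases
      case 1 then show ?thesis using s by (simp add: sq_rel_def)
    next
      case (2 l p)
      have "b (Inr (l, 3)) = 0" by (auto simp: b_def B_def)
      moreover have "b (Inr (l, 1)) = - b (Inr (l, 0))" "b (Inr (l, 2)) = b (Inr (l, 0))" "b (Inr (l, 3)) = - b (Inr (l, 0))"
        using s 2(2) unfolding sq_rel_def by blast+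
      moreover have "p = 0 \<or> p = 1 \<or> p = 2" using 2(3) by auto
      ultimately show ?thesis using 2(1) by auto
    qed
    then show ?thesis using i by (simp add: b_def)
  qed
  have inj: "inj_on y B"
  proof (rule inj_onI, rule ccontr)
    fix i j assume ij: "i \<in> B" "j \<in> B" "y i = y j" "i \<noteq> j"
    have "(\<Sum>k\<in>B. (1 * of_bool (k = i) + (-1) * of_bool (k = j)) *\<^sub>R y k) = 1 *\<^sub>R y i + (-1) *\<^sub>R y j"
      unfolding scaleR_add_left sum.distrib sum_single_coefficient[OF finB ij(1)] sum_single_coefficient[OF finB ij(2)] ..
    then have "(\<Sum>k\<in>B. (1 * of_bool (k = i) + (-1) * of_bool (k = j)) *\<^sub>R y k) = 0" using ij(3) by simp
    from zero[OF this ij(1)] show False using ij(4) by simp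
  qed
  have ind: "independent (y ` B)"
  proof
    assume "dependent (y ` B)"
    then obtain c where c: "\<exists>v\<in>y ` B. c v \<noteq> 0" "(\<Sum>v\<in>y ` B. c v *\<^sub>R v) = 0"
      using dependent_finite[of "y ` B"] finB by blast
    have "(\<Sum>i\<in>B. c (y i) *\<^sub>R y i) = 0" using c(2) by (simp add: sum.reindex[OF inj])
    then show False using zero c(1) by fast
  qed
  have sp: "y ` ?J \<subseteq> span (y ` B)"
  proof
    fix v assume "v \<in> y ` ?J"
    then obtain i where i: "i \<in> ?J" "v = y i" by blast
    from J[OF i(1)] show "v \<in> span (y ` B)"
    proof
      assume "i \<in> B" then show ?thesis using i(2) by (simp add: span_base)
    next
      assume "\<exists>l<m. i = Inr (l, 3)"
      then obtain l where l: "l < m" "i = Inr (l, 3)" by blast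
      have "y (Inr (l, 1)) + y (Inr (l, 3)) = y (Inr (l, 0)) + y (Inr (l, 2))"
        by (rule sq_presentation_coordinates[OF P]) (use l in blast)
      then have "v = y (Inr (l, 0)) + y (Inr (l, 2)) - y (Inr (l, 1))" using l(2) i(2) by (simp add: algebra_simps)
      moreover have "y (Inr (l, k)) \<in> span (y ` B)" if "k < 3" for k
        by (rule span_base) (use that l in \<open>auto simp: B_def\<close>)
      ultimately show ?thesis by (simp add: span_add span_diff)
    qed
  qed
  have "V = span (y ` B)"
  proof
    show "V \<subseteq> span (y ` B)" unfolding sq_presentationD(2)[OF P] by (rule span_minimal[OF sp subspace_span])
    show "span (y ` B) \<subseteq> V" unfolding sq_presentationD(2)[OF P] by (rule span_mono) (use BJ in blast)
  qed
  then have "dim V = card (y ` B)" using dim_span_eq_card_independent[OF ind] by simp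
  also have "\<dots> = card B" by (rule card_image[OF inj])
  also have "\<dots> = a + 3 * m" unfolding B_def by (subst card_Plus) (simp_all add: card_cartesian_product)
  finally show ?thesis .
qed

lemma lookup_scaleR_fin: "Poly_Mapping.lookup (r *\<^sub>R f) i = r *\<^sub>R Poly_Mapping.lookup f i"
  for f :: "nat \<Rightarrow>\<^sub>0 'b::real_vector"
proof -
  have "finite {i. r *\<^sub>R Poly_Mapping.lookup f i \<noteq> 0}"
    by (rule finite_subset[OF _ finite_lookup[of f]]) auto
  then show ?thesis unfolding scaleR_poly_mapping_def by (simp add: Abs_poly_mapping_inverse)
qed

text \<open>Brings the concrete direct sum into the form of a presentation. A relation can be read
  off separately in each coordinate, where it is a scalar equation or a relation of a single
  square.\<close>

lemma fin_power_presentation: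
  fixes q :: "nat \<Rightarrow> 'b::real_vector"
  assumes D: "D = gen_cone {..<4} q" and sp: "UNIV = span (q ` {..<4})"
    and rel: "\<And>c. (\<Sum>k<4. c k *\<^sub>R q k) = 0 \<longleftrightarrow> c 1 = - c 0 \<and> c 2 = c 0 \<and> c 3 = - c 0"
  shows "sq_presentation (fin_power a (UNIV :: real set) \<times> fin_power m UNIV) (fin_power a {0..} \<times> fin_power m D) a m
    (\<lambda>i. case i of Inl j \<Rightarrow> (Poly_Mapping.single j 1, 0) | Inr lk \<Rightarrow> (0, Poly_Mapping.single (fst lk) (q (snd lk))))"
proof -
  let ?J = "sq_index a m" and ?L = "Poly_Mapping.lookup"
  let ?g = "\<lambda>i. case i of Inl j \<Rightarrow> (Poly_Mapping.single j (1::real), 0) | Inr lk \<Rightarrow> (0, Poly_Mapping.single (fst lk) (q (snd lk)))"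
  define S where "S c = (\<Sum>i\<in>?J. c i *\<^sub>R ?g i)" for c
  have Se: "S c = (\<Sum>j<a. (c (Inl j) *\<^sub>R Poly_Mapping.single j 1, 0)) + (\<Sum>l<m. (0, Poly_Mapping.single l (\<Sum>k<4. c (Inr (l, k)) *\<^sub>R q k)))" for c
  proof -
    have s: "r *\<^sub>R Poly_Mapping.single l v = Poly_Mapping.single l (r *\<^sub>R v)" for r and l :: nat and v :: 'b
      by (rule poly_mapping_eqI) (simp add: lookup_single when_def lookup_scaleR_fin)
    show ?thesis unfolding S_def sum_sq_index sum_four by (simp add: s single_add)
  qed
  have L1: "?L (fst (S c)) j = (if j < a then c (Inl j) else 0)" for c j
  proof -
    have "?L (fst (S c)) j = (\<Sum>i<a. if i = j then c (Inl j) else 0)"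
      unfolding Se by (auto simp: fst_sum lookup_sum lookup_single when_def lookup_scaleR_fin mult_delta_right)
    then show ?thesis by simp
  qed
  have L2: "?L (snd (S c)) l = (if l < m then \<Sum>k<4. c (Inr (l, k)) *\<^sub>R q k else 0)" for c l
  proof -
    have "?L (snd (S c)) l = (\<Sum>i<m. if i = l then \<Sum>k<4. c (Inr (l, k)) *\<^sub>R q k else 0)"
      unfolding Se by (auto simp: snd_sum lookup_sum lookup_single when_def lookup_scaleR_fin intro!: sum.cong)
    then show ?thesis by simp
  qed
  have Seq: "S c = w" if "\<And>j. ?L (fst w) j = (if j < a then c (Inl j) else 0)"
    "\<And>l. ?L (snd w) l = (if l < m then \<Sum>k<4. c (Inr (l, k)) *\<^sub>R q k else 0)" for c w
  proof (rule prod_eqI)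
    show "fst (S c) = fst w" by (rule poly_mapping_eqI) (simp add: L1 that(1))
    show "snd (S c) = snd w" by (rule poly_mapping_eqI) (simp only: L2 that(2))
  qed
  have 1: "fin_power a {0..} \<times> fin_power m D = gen_cone ?J ?g"
  proof
    show "fin_power a {0..} \<times> fin_power m D \<subseteq> gen_cone ?J ?g"
    proof
      fix w assume w: "w \<in> fin_power a {0::real..} \<times> fin_power m D"
      have w1: "0 \<le> ?L (fst w) j" if "j < a" for j using w that by (auto simp: fin_power_def)
      have w10: "?L (fst w) j = 0" if "\<not> j < a" for j using w that by (auto simp: fin_power_def)
      have w20: "?L (snd w) l = 0" if "\<not> l < m" for l using w that by (auto simp: fin_power_def)
      have "\<forall>l\<in>{..<m}. \<exists>b. ?L (snd w) l = (\<Sum>k<4. b k *\<^sub>R q k) \<and> (\<forall>k<4. 0 \<le> b k)"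
      proof
        fix l assume "l \<in> {..<m}"
        then have "?L (snd w) l \<in> gen_cone {..<4} q" using w D by (auto simp: fin_power_def)
        then show "\<exists>b. ?L (snd w) l = (\<Sum>k<4. b k *\<^sub>R q k) \<and> (\<forall>k<4. 0 \<le> b k)" unfolding gen_cone_def by auto
      qed
      from bchoice[OF this] obtain b where b: "\<forall>l\<in>{..<m}. ?L (snd w) l = (\<Sum>k<4. b l k *\<^sub>R q k) \<and> (\<forall>k<4. 0 \<le> b l k)"
        by (elim exE) (rule that)
      define c where "c i = (case i of Inl j \<Rightarrow> ?L (fst w) j | Inr lk \<Rightarrow> b (fst lk) (snd lk))" for i
      have "S c = w" by (rule Seq) (use w10 w20 b in \<open>auto simp: c_def\<close>)
      moreover have "0 \<le> c i" if "i \<in> ?J" for i using that w1 b by (auto simp: c_def sq_index_def)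
      then have "S c \<in> gen_cone ?J ?g" unfolding S_def by (rule gen_coneI)
      ultimately show "w \<in> gen_cone ?J ?g" by simp
    qed
    show "gen_cone ?J ?g \<subseteq> fin_power a {0..} \<times> fin_power m D"
    proof
      fix w assume "w \<in> gen_cone ?J ?g"
      then obtain c where c: "w = S c" "\<forall>i\<in>?J. 0 \<le> c i" unfolding gen_cone_def S_def by blast
      have 1: "0 \<le> c (Inl j)" if "j < a" for j using c(2) that by (auto simp: sq_index_def)
      have "0 \<le> c (Inr (l, k))" if "l < m" "k \<in> {..<4}" for l k using c(2) that by (auto simp: sq_index_def)
      then have 2: "(\<Sum>k<4. c (Inr (l, k)) *\<^sub>R q k) \<in> D" if "l < m" for l
        unfolding D using that by (intro gen_coneI) blast
      have "fst w \<in> fin_power a {0..}" unfolding fin_power_def c(1) using 1 by (simp add: L1)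
      moreover have "snd w \<in> fin_power m D" unfolding fin_power_def c(1) using 2 by (simp add: L2)
      ultimately show "w \<in> fin_power a {0..} \<times> fin_power m D" by (simp add: mem_Times_iff)
    qed
  qed
  have 2: "fin_power a (UNIV :: real set) \<times> fin_power m UNIV = span (?g ` ?J)"
    unfolding span_image_sum[OF finite_sq_index]
  proof
    show "fin_power a (UNIV :: real set) \<times> fin_power m UNIV \<subseteq> {\<Sum>i\<in>?J. c i *\<^sub>R ?g i |c. True}"
    proof
      fix w assume w: "w \<in> fin_power a (UNIV :: real set) \<times> fin_power m (UNIV :: 'b set)"
      have w10: "?L (fst w) j = 0" if "\<not> j < a" for j using w that by (auto simp: fin_power_def)
      have w20: "?L (snd w) l = 0" if "\<not> l < m" for l using w that by (auto simp: fin_power_def)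
      have "\<forall>l. \<exists>b. ?L (snd w) l = (\<Sum>k<4. b k *\<^sub>R q k)"
      proof
        fix l
        have "?L (snd w) l \<in> span (q ` {..<4})" using sp by blast
        then show "\<exists>b. ?L (snd w) l = (\<Sum>k<4. b k *\<^sub>R q k)" unfolding span_image_sum[OF finite_lessThan] by blast
      qed
      from choice[OF this] obtain b where b: "\<forall>l. ?L (snd w) l = (\<Sum>k<4. b l k *\<^sub>R q k)" by (elim exE) (rule that)
      define c where "c i = (case i of Inl j \<Rightarrow> ?L (fst w) j | Inr lk \<Rightarrow> b (fst lk) (snd lk))" for i
      have "S c = w" by (rule Seq) (use w10 w20 b in \<open>auto simp: c_def\<close>)
      then show "w \<in> {\<Sum>i\<in>?J. c i *\<^sub>R ?g i |c. True}" unfolding S_def by blast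
    qed
    show "{\<Sum>i\<in>?J. c i *\<^sub>R ?g i |c. True} \<subseteq> fin_power a (UNIV :: real set) \<times> fin_power m UNIV"
    proof
      fix w assume "w \<in> {\<Sum>i\<in>?J. c i *\<^sub>R ?g i |c. True}"
      then obtain c where c: "w = S c" unfolding S_def by blast
      show "w \<in> fin_power a (UNIV :: real set) \<times> fin_power m UNIV"
        unfolding c fin_power_def mem_Times_iff by (simp add: L1 L2)
    qed
  qed
  have 3: "(\<Sum>i\<in>?J. c i *\<^sub>R ?g i) = 0 \<longleftrightarrow> sq_rel a m c" for c
  proof -
    have "S c = 0 \<longleftrightarrow> (\<forall>j<a. c (Inl j) = 0) \<and> (\<forall>l<m. (\<Sum>k<4. c (Inr (l, k)) *\<^sub>R q k) = 0)"
    proof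
      assume z: "S c = 0"
      have "c (Inl j) = 0" if "j < a" for j using L1[of c j] that z by simp
      moreover have "(\<Sum>k<4. c (Inr (l, k)) *\<^sub>R q k) = 0" if "l < m" for l using L2[of c l] that z by simp
      ultimately show "(\<forall>j<a. c (Inl j) = 0) \<and> (\<forall>l<m. (\<Sum>k<4. c (Inr (l, k)) *\<^sub>R q k) = 0)" by blast
    next
      assume z: "(\<forall>j<a. c (Inl j) = 0) \<and> (\<forall>l<m. (\<Sum>k<4. c (Inr (l, k)) *\<^sub>R q k) = 0)"
      show "S c = 0" by (rule Seq) (use z in auto)
    qed
    also have "\<dots> \<longleftrightarrow> sq_rel a m c" unfolding sq_rel_def rel ..
    finally show ?thesis unfolding S_def .
  qed
  show ?thesis unfolding sq_presentation_def using 1 2 3 by blast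
qed

section \<open>Sums of squares and an orthant are 2-subhomogeneous\<close>

lemma sq_mat_hpsd:
  assumes "\<bar>b\<bar> + \<bar>c\<bar> \<le> a" "cmod z = 1"
  shows "hpsd {..<2} (sq_mat (of_real a) (of_real b) (of_real c) z)"
proof (rule hpsdI)
  show "sq_mat (of_real a) (of_real b) (of_real c) z j i = cnj (sq_mat (of_real a) (of_real b) (of_real c) z i j)" for i j
    by (simp add: sq_mat_def)
  fix x :: "nat \<Rightarrow> complex"
  define g where "g = of_real b + z * of_real c"
  have g: "cmod g \<le> a"
    unfolding g_def using norm_triangle_ineq[of "complex_of_real b" "z * of_real c"] assms by (simp add: norm_mult)
  have m: "sq_mat (of_real a) (of_real b) (of_real c) z 0 0 = of_real a" "sq_mat (of_real a) (of_real b) (of_real c) z 0 1 = g"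
    "sq_mat (of_real a) (of_real b) (of_real c) z 1 0 = cnj g" "sq_mat (of_real a) (of_real b) (of_real c) z 1 1 = of_real a"
    by (simp_all add: sq_mat_def g_def)
  have "herm_form {..<2} (sq_mat (of_real a) (of_real b) (of_real c) z) x
    = of_real a * (cnj (x 0) * x 0) + of_real a * (cnj (x 1) * x 1) + (cnj (x 0) * g * x 1 + cnj (cnj (x 0) * g * x 1))"
    by (simp add: herm_form_def lessThan_two m algebra_simps del: One_nat_def)
  then have "Re (herm_form {..<2} (sq_mat (of_real a) (of_real b) (of_real c) z) x)
    = a * (cmod (x 0))\<^sup>2 + a * (cmod (x 1))\<^sup>2 + 2 * Re (cnj (x 0) * g * x 1)"
    unfolding cmod_power2 by (simp add: power2_eq_square algebra_simps del: One_nat_def)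
  moreover have "\<bar>Re (cnj (x 0) * g * x 1)\<bar> \<le> cmod (x 0) * a * cmod (x 1)"
  proof -
    have "\<bar>Re (cnj (x 0) * g * x 1)\<bar> \<le> cmod (cnj (x 0) * g * x 1)" by (rule abs_Re_le_cmod)
    also have "\<dots> = cmod g * (cmod (x 0) * cmod (x 1))" by (simp add: norm_mult)
    also have "\<dots> \<le> a * (cmod (x 0) * cmod (x 1))" by (rule mult_right_mono[OF g]) simp
    finally show ?thesis by (simp add: mult_ac)
  qed
  moreover have "0 \<le> a * (cmod (x 0) - cmod (x 1))\<^sup>2" using order.trans[OF norm_ge_zero g] by simp
  ultimately show "0 \<le> Re (herm_form {..<2} (sq_mat (of_real a) (of_real b) (of_real c) z) x)"
    by (simp add: power2_diff algebra_simps del: One_nat_def)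
qed

lemma cx_zero: "linear f \<Longrightarrow> cx f 0 = 0"
  by (simp add: cx_def linear_0 complex_eq_iff)

lemma cx_sum_pure_tensor:
  assumes "linear f"
  shows "cx f (\<Sum>k<(N::nat). r k *\<^sub>R pure_tensor (H k) (c k) i j) = (\<Sum>k<N. of_real (r k) * (H k i j * of_real (f (c k))))"
  by (simp add: cx_def complex_eq_iff fst_sum snd_sum linear_sum[OF assms] linear_scale[OF assms] pure_tensor_def mult_ac)

lemma sq_block_form:
  assumes lin: "linear \<alpha>" "linear \<beta>" "linear \<gamma>" and Z: "Z \<in> her V s"
  shows "Re (herm_form ({..<s} \<times> {..<2}) (sq_block \<alpha> \<beta> \<gamma> z Z) (\<lambda>(i, p). if p = 0 then v i else w i))
    = Re (sesq s (\<lambda>i j. cx \<alpha> (Z i j)) v v) + Re (sesq s (\<lambda>i j. cx \<alpha> (Z i j)) w w)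
      + 2 * Re (sesq s (\<lambda>i j. cx \<beta> (Z i j)) v w) + 2 * Re (z * sesq s (\<lambda>i j. cx \<gamma> (Z i j)) v w)"
proof -
  let ?A = "\<lambda>i j. cx \<alpha> (Z i j)" and ?B = "\<lambda>i j. cx \<beta> (Z i j)" and ?G = "\<lambda>i j. cx \<gamma> (Z i j)"
  have one: "(\<Sum>p<2. \<Sum>q<2. cnj ((\<lambda>(i, p). if p = 0 then v i else w i) (i, p)) * sq_block \<alpha> \<beta> \<gamma> z Z (i, p) (j, q) * (\<lambda>(i, p). if p = 0 then v i else w i) (j, q))
    = cnj (v i) * ?A i j * v j + cnj (w i) * ?A i j * w j + cnj (v i) * ?B i j * w j + cnj (w i) * ?B i j * v j
      + z * (cnj (v i) * ?G i j * w j) + cnj (z * w i) * ?G i j * v j" for i j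
    by (simp add: lessThan_two sq_block_def sq_mat_def algebra_simps)
  have "herm_form ({..<s} \<times> {..<2}) (sq_block \<alpha> \<beta> \<gamma> z Z) (\<lambda>(i, p). if p = 0 then v i else w i)
    = sesq s ?A v v + sesq s ?A w w + sesq s ?B v w + sesq s ?B w v + z * sesq s ?G v w + sesq s ?G (\<lambda>i. z * w i) v"
    unfolding herm_form_blocks one sesq_def sum.distrib sum_distrib_left ..
  moreover have "Re (sesq s ?B w v) = Re (sesq s ?B v w)" by (rule Re_sesq_swap) (rule cx_herm[OF lin(2) Z])
  moreover have "Re (sesq s ?G (\<lambda>i. z * w i) v) = Re (sesq s ?G v (\<lambda>i. z * w i))" by (rule Re_sesq_swap) (rule cx_herm[OF lin(3) Z])
  moreover have "sesq s ?G v (\<lambda>i. z * w i) = z * sesq s ?G v w" by (simp add: sesq_def sum_distrib_left mult_ac)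
  ultimately show ?thesis by simp
qed

text \<open>Explains why a split of \<alpha> is what is needed: the parts x0 and x1 become the
  weights (x0 + b)/2, (x0 - b)/2 and (x1 + c)/2, (x1 - c)/2 on the two pairs of opposite corners,
  nonnegative when |b| \<le> x0 and |c| \<le> x1.\<close>

lemma square_vector_split:
  fixes q0 :: "'e::real_vector"
  assumes q: "q1 + q3 = q0 + q2" and x: "x0 + x1 = al"
  shows "((x0 + b) / 2) *\<^sub>R q0 + ((x1 + c) / 2) *\<^sub>R q1 + ((x0 - b) / 2) *\<^sub>R q2 + ((x1 - c) / 2) *\<^sub>R q3
    = (al / 2) *\<^sub>R (q0 + q2) + (b / 2) *\<^sub>R (q0 - q2) + (c / 2) *\<^sub>R (q1 - q3)"
proof -
  have "((x0 + b) / 2) *\<^sub>R q0 + ((x1 + c) / 2) *\<^sub>R q1 + ((x0 - b) / 2) *\<^sub>R q2 + ((x1 - c) / 2) *\<^sub>R q3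
    = (x0 / 2) *\<^sub>R (q0 + q2) + (x1 / 2) *\<^sub>R (q1 + q3) + (b / 2) *\<^sub>R (q0 - q2) + (c / 2) *\<^sub>R (q1 - q3)"
    by (simp add: add_divide_distrib diff_divide_distrib scaleR_add_left scaleR_diff_left scaleR_add_right scaleR_diff_right)
  also have "(x0 / 2) *\<^sub>R (q0 + q2) + (x1 / 2) *\<^sub>R (q1 + q3) = (al / 2) *\<^sub>R (q0 + q2)"
    unfolding q x[symmetric] add_divide_distrib scaleR_add_left ..
  finally show ?thesis .
qed

text \<open>Elements of the minimal cone give positive blocks because a tensor of positive matrices
  is positive. Conversely \<open>square_split\<close> turns positive blocks into positive matrix
  coefficients for the four rays of each square.\<close>

lemma sq_presentation_subhomogeneous:
  fixes V C :: "'e::euclidean_space set" and g :: "real \<Rightarrow> 'u"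
  assumes g: "inj g" and P: "sq_presentation V C a m y" and u: "u \<in> (top_of_set V) interior_of C"
  shows "d_subhomogeneous TYPE('u) 2 (min_op_system V C u)"
proof -
  let ?J = "sq_index a m"
  have C: "C = gen_cone ?J y" and V: "V = span (y ` ?J)" using P by (simp_all add: sq_presentation_def)
  have sub: "subspace V" unfolding V by (rule subspace_span)
  have yC: "y i \<in> C" if "i \<in> ?J" for i unfolding C using gen_cone_gen[OF finite_sq_index that, of 1 y] by simp
  have yV: "y i \<in> V" if "i \<in> ?J" for i unfolding V using that by (intro span_base) simp
  have J: "Inl j \<in> ?J \<longleftrightarrow> j < a" "Inr (l, k) \<in> ?J \<longleftrightarrow> l < m \<and> k < 4" for j l k
    unfolding sq_index_def by auto
  obtain t \<alpha> \<beta> \<gamma> :: "nat \<Rightarrow> 'e \<Rightarrow> real" where lin: "\<And>j. linear (t j)" "\<And>l. linear (\<alpha> l)" "\<And>l. linear (\<beta> l)" "\<And>l. linear (\<gamma> l)"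
    and ty: "\<And>j i. i \<in> ?J \<Longrightarrow> t j (y i) = of_bool (i = Inl j)"
    and ay: "\<And>l i. i \<in> ?J \<Longrightarrow> \<alpha> l (y i) = of_bool (\<exists>k. i = Inr (l, k))"
    and bey: "\<And>l i. i \<in> ?J \<Longrightarrow> \<beta> l (y i) = of_bool (i = Inr (l, 0)) - of_bool (i = Inr (l, 2))"
    and cy: "\<And>l i. i \<in> ?J \<Longrightarrow> \<gamma> l (y i) = of_bool (i = Inr (l, 1)) - of_bool (i = Inr (l, 3))"
    and coord: "\<And>v. v \<in> V \<Longrightarrow> v = (\<Sum>j<a. t j v *\<^sub>R y (Inl j)) + (\<Sum>l<m.
        (\<alpha> l v / 2) *\<^sub>R (y (Inr (l, 0)) + y (Inr (l, 2))) + (\<beta> l v / 2) *\<^sub>R (y (Inr (l, 0)) - y (Inr (l, 2)))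
        + (\<gamma> l v / 2) *\<^sub>R (y (Inr (l, 1)) - y (Inr (l, 3))))"
    and sq: "\<And>l. l < m \<Longrightarrow> y (Inr (l, 1)) + y (Inr (l, 3)) = y (Inr (l, 0)) + y (Inr (l, 2))"
    by (rule sq_presentation_coordinates[OF P]) (rule that)
  have nn: "0 \<le> f v" if f: "linear f" "\<forall>i\<in>?J. 0 \<le> f (y i)" and v: "v \<in> C" for f :: "'e \<Rightarrow> real" and v
  proof -
    obtain c where c: "v = (\<Sum>i\<in>?J. c i *\<^sub>R y i)" "\<forall>i\<in>?J. 0 \<le> c i" using v unfolding C gen_cone_def by blast
    have "f v = (\<Sum>i\<in>?J. c i * f (y i))" unfolding c(1) linear_sum[OF f(1)] by (simp add: linear_scale[OF f(1)])
    also have "\<dots> \<ge> 0" by (rule sum_nonneg) (use c(2) f(2) in simp)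
    finally show ?thesis .
  qed
  have ps: "0 < f u" if f: "linear f" "\<forall>i\<in>?J. 0 \<le> f (y i)" and i: "i \<in> ?J" "0 < f (y i)" for f :: "'e \<Rightarrow> real" and i
  proof -
    obtain r where r: "r > 0" "u + r *\<^sub>R (- y i) \<in> C"
      using interior_absorbs[OF sub u, of "- y i"] yV[OF i(1)] subspace_neg[OF sub] by blast
    have "0 \<le> f (u + r *\<^sub>R (- y i))" by (rule nn[OF f r(2)])
    then have "r * f (y i) \<le> f u" by (simp add: linear_add[OF f(1)] linear_scale[OF f(1)] linear_neg[OF f(1)] linear_diff[OF f(1)])
    moreover have "0 < r * f (y i)" using r(1) i(2) by simp
    ultimately show ?thesis by linarith
  qed
  \<comment> \<open>For signs e and d these are the four facet functionals of a square; their
    positivity on \<open>C\<close> is |\<beta>| + |\<gamma>| \<le> \<alpha>, and strict positivity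
    at the interior point \<open>u\<close> is the strict inequality.\<close>
  define lc where "lc e d l v = \<alpha> l v + e * \<beta> l v + d * \<gamma> l v" for e d :: real and l v
  have lcl: "linear (lc e d l)" for e d l
  proof -
    have "linear (\<lambda>v. r * f v)" if "linear f" for r and f :: "'e \<Rightarrow> real"
      by (rule linearI) (simp_all add: linear_add[OF that] linear_scale[OF that] algebra_simps)
    then show ?thesis unfolding lc_def by (simp add: lin(2,3,4) module_hom_add)
  qed
  have lcy: "0 \<le> lc e d l (y i)" if ed: "e = 1 \<or> e = -1" "d = 1 \<or> d = -1" and i: "i \<in> ?J" for e d l i
    unfolding lc_def ay[OF i] bey[OF i] cy[OF i] using ed by auto
  have tC: "0 \<le> t j v" if "v \<in> C" for j v by (rule nn[OF lin(1) _ that]) (simp add: ty)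
  have tu: "0 < t j u" if j: "j < a" for j
    by (rule ps[OF lin(1), where i = "Inl j"]) (use j in \<open>simp_all add: ty J\<close>)
  have sC: "\<bar>\<beta> l v\<bar> + \<bar>\<gamma> l v\<bar> \<le> \<alpha> l v" if v: "v \<in> C" for l v
  proof -
    have "0 \<le> lc e d l v" if "e = 1 \<or> e = -1" "d = 1 \<or> d = -1" for e d
      by (rule nn[OF lcl _ v]) (use lcy[OF that] in blast)
    from this[of 1 1] this[of 1 "-1"] this[of "-1" 1] this[of "-1" "-1"] show ?thesis unfolding lc_def by auto
  qed
  have su: "\<bar>\<beta> l u\<bar> + \<bar>\<gamma> l u\<bar> < \<alpha> l u" if l: "l < m" for l
  proof -
    have "0 < lc e d l u" if ed: "e = 1 \<or> e = -1" "d = 1 \<or> d = -1" for e d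
    proof -
      have i: "Inr (l, if e = 1 then 0 else 2) \<in> ?J" using l by (simp add: J)
      have "0 < lc e d l (y (Inr (l, if e = 1 then 0 else 2)))"
        unfolding lc_def ay[OF i] bey[OF i] cy[OF i] using ed by auto
      then show ?thesis using ps[OF lcl _ i] lcy[OF ed] by blast
    qed
    from this[of 1 1] this[of 1 "-1"] this[of "-1" 1] this[of "-1" "-1"] show ?thesis unfolding lc_def by auto
  qed
  \<comment> \<open>An orthant coordinate is treated as a degenerate square with \<beta> = \<gamma>
    = 0, whose symbol is a multiple of the 2 by 2 identity; so all coordinates share one
    criterion.\<close>
  define A where "A k = (if k < a then t k else \<alpha> (k - a))" for k
  define B where "B k = (if k < a then (\<lambda>_. 0) else \<beta> (k - a))" for k
  define G where "G k = (if k < a then (\<lambda>_. 0) else \<gamma> (k - a))" for k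
  have zl: "linear (\<lambda>_::'e. 0::real)" by (rule linear_zero)
  have ABG: "linear (A k)" "linear (B k)" "linear (G k)" for k using lin zl by (simp_all add: A_def B_def G_def)
  have dom: "\<bar>B k v\<bar> + \<bar>G k v\<bar> \<le> A k v" if "v \<in> C" for k v
    using tC[OF that] sC[OF that] by (simp add: A_def B_def G_def)
  show ?thesis
  proof (rule subhomogeneous_of_blocks[OF g sub, of "a + m" A B G])
    show "linear (A k)" "linear (B k)" "linear (G k)" for k by (rule ABG)+
    show "\<bar>B k u\<bar> + \<bar>G k u\<bar> < A k u" if "k < a + m" for k
      using tu[of k] su[of "k - a"] that by (auto simp: A_def B_def G_def)
    fix s Z assume Z: "Z \<in> her V s"
    show "Z \<in> min_cone C s \<longleftrightarrow> (\<forall>k<a + m. \<forall>N j. hpsd ({..<s} \<times> {..<2})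
        (sq_block (A k) (B k) (G k) (cis (2 * pi * real j / real (N::nat))) Z))"
    proof
      assume "Z \<in> min_cone C s"
      then obtain n r H c where H: "\<forall>k<(n::nat). 0 \<le> r k \<and> psd s (H k) \<and> c k \<in> C"
        and Ze: "Z = (\<lambda>i j. \<Sum>k<n. r k *\<^sub>R pure_tensor (H k) (c k) i j)"
        unfolding min_cone_def mem_Collect_eq by (elim exE conjE) (rule that)
      show "\<forall>k<a + m. \<forall>N j. hpsd ({..<s} \<times> {..<2}) (sq_block (A k) (B k) (G k) (cis (2 * pi * real j / real (N::nat))) Z)"
      proof (intro allI impI)
        fix k N j assume "k < a + m"
        let ?z = "cis (2 * pi * real j / real N)"
        let ?S = "\<lambda>n. sq_mat (of_real (A k (c n))) (of_real (B k (c n))) (of_real (G k (c n))) ?z"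
        have "hpsd ({..<s} \<times> {..<2}) (\<lambda>x y. \<Sum>k<n. of_real (r k) * (case x of (i, p) \<Rightarrow> case y of (j, q) \<Rightarrow> H k i j * ?S k p q))"
        proof (rule hpsd_sum)
          fix k' assume "k' \<in> {..<n}"
          then have k': "0 \<le> r k'" "psd s (H k')" "c k' \<in> C" using H by auto
          have "hpsd {..<s} (H k')" using k'(2) psd_iff_hpsd by blast
          moreover have "hpsd {..<2} (?S k')" by (rule sq_mat_hpsd[OF dom[OF k'(3)]]) simp
          ultimately have "hpsd ({..<s} \<times> {..<2}) (\<lambda>(i, p) (j, q). H k' i j * ?S k' p q)" by (rule hpsd_kronecker) simp_all
          from hpsd_scale[OF this k'(1)]
          show "hpsd ({..<s} \<times> {..<2}) (\<lambda>x y. of_real (r k') * (case x of (i, p) \<Rightarrow> case y of (j, q) \<Rightarrow> H k' i j * ?S k' p q))"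
            by (simp only: split_def)
        qed
        also have "?this \<longleftrightarrow> hpsd ({..<s} \<times> {..<2}) (sq_block (A k) (B k) (G k) ?z Z)"
        proof (rule hpsd_cong)
          fix x y :: "nat \<times> nat"
          show "(\<Sum>k<n. of_real (r k) * (case x of (i, p) \<Rightarrow> case y of (j, q) \<Rightarrow> H k i j * ?S k p q)) = sq_block (A k) (B k) (G k) ?z Z x y"
            unfolding sq_block_def split_def Ze cx_sum_pure_tensor[OF ABG(1)] cx_sum_pure_tensor[OF ABG(2)] cx_sum_pure_tensor[OF ABG(3)] sq_mat_def
            by (simp add: sum_distrib_left sum.distrib[symmetric] algebra_simps)
        qed
        finally show "hpsd ({..<s} \<times> {..<2}) (sq_block (A k) (B k) (G k) ?z Z)" .
      qed
    next
      assume h: "\<forall>k<a + m. \<forall>N j. hpsd ({..<s} \<times> {..<2}) (sq_block (A k) (B k) (G k) (cis (2 * pi * real j / real (N::nat))) Z)"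
      have form: "0 \<le> Re (sesq s (\<lambda>i j. cx (A k) (Z i j)) v v) + Re (sesq s (\<lambda>i j. cx (A k) (Z i j)) w w)
          + 2 * Re (sesq s (\<lambda>i j. cx (B k) (Z i j)) v w) + 2 * Re (cis (2 * pi * real j / real N) * sesq s (\<lambda>i j. cx (G k) (Z i j)) v w)"
        if k: "k < a + m" for k N j v w
        unfolding sq_block_form[OF ABG Z, symmetric] by (rule hpsd_pos) (use h k in blast)
      have Z0: "Z i j = 0" if "s \<le> i \<or> s \<le> j" for i j by (rule herD(5)[OF Z that])
      have tp: "psd s (\<lambda>i j. cx (t k) (Z i j))" if k: "k < a" for k
        unfolding psd_iff_hpsd
      proof (rule conjI, rule hpsdI)
        show "cx (t k) (Z j i) = cnj (cx (t k) (Z i j))" for i j by (rule cx_herm[OF lin(1) Z])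
        show "\<forall>i j. s \<le> i \<or> s \<le> j \<longrightarrow> cx (t k) (Z i j) = 0" using Z0 cx_zero[OF lin(1)] by simp
        fix x :: "nat \<Rightarrow> complex"
        have "A k = t k" using k by (simp add: A_def)
        moreover have "sesq s H (\<lambda>_. 0) y = 0" "sesq s H y (\<lambda>_. 0) = 0" for H y by (simp_all add: sesq_def)
        ultimately have "0 \<le> Re (sesq s (\<lambda>i j. cx (t k) (Z i j)) x x)" using form[of k x "\<lambda>_. 0" 0 0] k by simp
        then show "0 \<le> Re (herm_form {..<s} (\<lambda>i j. cx (t k) (Z i j)) x)" unfolding sesq_diag .
      qed
      have "\<forall>l\<in>{..<m}. \<exists>d. hpsd {..<s} (\<lambda>i j. fst d i j + cx (\<beta> l) (Z i j)) \<and> hpsd {..<s} (\<lambda>i j. fst d i j - cx (\<beta> l) (Z i j)) \<and>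
        hpsd {..<s} (\<lambda>i j. snd d i j + cx (\<gamma> l) (Z i j)) \<and> hpsd {..<s} (\<lambda>i j. snd d i j - cx (\<gamma> l) (Z i j)) \<and>
        (\<forall>i<s. \<forall>j<s. fst d i j + snd d i j = cx (\<alpha> l) (Z i j))"
      proof
        fix l assume "l \<in> {..<m}"
        then have l: "a + l < a + m" by simp
        have e: "A (a + l) = \<alpha> l" "B (a + l) = \<beta> l" "G (a + l) = \<gamma> l" by (simp_all add: A_def B_def G_def)
        have "\<exists>a0 a1. hpsd {..<s} (\<lambda>i j. a0 i j + cx (\<beta> l) (Z i j)) \<and> hpsd {..<s} (\<lambda>i j. a0 i j - cx (\<beta> l) (Z i j)) \<and>
          hpsd {..<s} (\<lambda>i j. a1 i j + cx (\<gamma> l) (Z i j)) \<and> hpsd {..<s} (\<lambda>i j. a1 i j - cx (\<gamma> l) (Z i j)) \<and>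
          (\<forall>i<s. \<forall>j<s. a0 i j + a1 i j = cx (\<alpha> l) (Z i j))"
          by (rule square_split) (rule cx_herm[OF lin(2) Z] cx_herm[OF lin(3) Z] cx_herm[OF lin(4) Z] form[OF l, unfolded e])+
        then show "\<exists>d. hpsd {..<s} (\<lambda>i j. fst d i j + cx (\<beta> l) (Z i j)) \<and> hpsd {..<s} (\<lambda>i j. fst d i j - cx (\<beta> l) (Z i j)) \<and>
          hpsd {..<s} (\<lambda>i j. snd d i j + cx (\<gamma> l) (Z i j)) \<and> hpsd {..<s} (\<lambda>i j. snd d i j - cx (\<gamma> l) (Z i j)) \<and>
          (\<forall>i<s. \<forall>j<s. fst d i j + snd d i j = cx (\<alpha> l) (Z i j))"
          by (elim exE) (rule exI[of _ "(x, y)" for x y], simp only: fst_conv snd_conv)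
      qed
      from bchoice[OF this] obtain d where d: "\<forall>l\<in>{..<m}. hpsd {..<s} (\<lambda>i j. fst (d l) i j + cx (\<beta> l) (Z i j)) \<and> hpsd {..<s} (\<lambda>i j. fst (d l) i j - cx (\<beta> l) (Z i j)) \<and>
        hpsd {..<s} (\<lambda>i j. snd (d l) i j + cx (\<gamma> l) (Z i j)) \<and> hpsd {..<s} (\<lambda>i j. snd (d l) i j - cx (\<gamma> l) (Z i j)) \<and>
        (\<forall>i<s. \<forall>j<s. fst (d l) i j + snd (d l) i j = cx (\<alpha> l) (Z i j))" by (elim exE) (rule that)
      \<comment> \<open>The coefficient matrices of the four rays in cyclic order, still without the
        factor 1/2. The pair for \<open>b\<close> uses the first part of the split and the pair for
        \<open>c\<close> the second.\<close>
      define E where "E l k i j = (if k = (0::nat) then fst (d l) i j + cx (\<beta> l) (Z i j) else if k = 1 then snd (d l) i j + cx (\<gamma> l) (Z i j)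
        else if k = 2 then fst (d l) i j - cx (\<beta> l) (Z i j) else snd (d l) i j - cx (\<gamma> l) (Z i j))" for l k i j
      define F where "F l k i j = (if i < s \<and> j < s then of_real (1 / 2) * E l k i j else 0)" for l k i j
      have Fp: "psd s (F l k)" if l: "l < m" for l k
      proof -
        have dl: "hpsd {..<s} (\<lambda>i j. fst (d l) i j + cx (\<beta> l) (Z i j))" "hpsd {..<s} (\<lambda>i j. fst (d l) i j - cx (\<beta> l) (Z i j))"
          "hpsd {..<s} (\<lambda>i j. snd (d l) i j + cx (\<gamma> l) (Z i j))" "hpsd {..<s} (\<lambda>i j. snd (d l) i j - cx (\<gamma> l) (Z i j))"
          using bspec[OF d, of l] l by simp_all
        have "hpsd {..<s} (\<lambda>i j. E l k i j)"
          unfolding E_def using dl by (cases "k = 0"; cases "k = 1"; cases "k = 2") simp_all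
        from hpsd_scale[OF this, of "1 / 2"] have "hpsd {..<s} (\<lambda>i j. of_real (1 / 2) * E l k i j)" by simp
        also have "?this \<longleftrightarrow> hpsd {..<s} (F l k)" by (rule hpsd_cong) (simp add: F_def)
        finally show ?thesis unfolding psd_iff_hpsd by (simp add: F_def)
      qed
      define H where "H x = (case x of Inl k \<Rightarrow> (\<lambda>i j. cx (t k) (Z i j)) | Inr lk \<Rightarrow> F (fst lk) (snd lk))" for x
      have "(\<lambda>i j. \<Sum>x\<in>?J. pure_tensor (H x) (y x) i j) \<in> min_cone C s"
      proof (rule min_cone_sumI[OF finite_sq_index _ yC])
        fix x assume x: "x \<in> ?J"
        show "psd s (H x)"
        proof (cases x)
          case (Inl k) then show ?thesis using x tp J by (simp add: H_def)
        next
          case (Inr lk) then show ?thesis using x Fp J(2)[of "fst lk" "snd lk"] by (simp add: H_def)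
        qed
      qed
      also have "(\<lambda>i j. \<Sum>x\<in>?J. pure_tensor (H x) (y x) i j) = Z"
      proof (intro ext)
        fix i j
        show "(\<Sum>x\<in>?J. pure_tensor (H x) (y x) i j) = Z i j"
        proof (cases "i < s \<and> j < s")
          case False
          have "pure_tensor (H x) (y x) i j = 0" for x
            using False Z0[of i j] cx_zero[OF lin(1)] by (auto simp: H_def F_def pure_tensor_def zero_prod_def not_less split: sum.split)
          then show ?thesis using False Z0[of i j] by (auto simp: not_less)
        next
          case True
          have dl: "fst (d l) i j + snd (d l) i j = cx (\<alpha> l) (Z i j)" if "l < m" for l using bspec[OF d, of l] that True by simp
          have re: "Re (fst (d l) i j) + Re (snd (d l) i j) = \<alpha> l (fst (Z i j))"
            and im: "Im (fst (d l) i j) + Im (snd (d l) i j) = \<alpha> l (snd (Z i j))" if "l < m" for l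
            using arg_cong[OF dl[OF that], of Re] arg_cong[OF dl[OF that], of Im] by (simp_all add: cx_def)
          have "fst (\<Sum>x\<in>?J. pure_tensor (H x) (y x) i j) = (\<Sum>k<a. t k (fst (Z i j)) *\<^sub>R y (Inl k))
            + (\<Sum>l<m. ((Re (fst (d l) i j) + \<beta> l (fst (Z i j))) / 2) *\<^sub>R y (Inr (l, 0)) + ((Re (snd (d l) i j) + \<gamma> l (fst (Z i j))) / 2) *\<^sub>R y (Inr (l, 1))
              + ((Re (fst (d l) i j) - \<beta> l (fst (Z i j))) / 2) *\<^sub>R y (Inr (l, 2)) + ((Re (snd (d l) i j) - \<gamma> l (fst (Z i j))) / 2) *\<^sub>R y (Inr (l, 3)))"
            unfolding fst_sum sum_sq_index using True by (simp add: H_def F_def E_def pure_tensor_def cx_def fst_sum)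
          also have "\<dots> = fst (Z i j)"
          proof -
            have e: "((Re (fst (d l) i j) + \<beta> l (fst (Z i j))) / 2) *\<^sub>R y (Inr (l, 0)) + ((Re (snd (d l) i j) + \<gamma> l (fst (Z i j))) / 2) *\<^sub>R y (Inr (l, 1))
              + ((Re (fst (d l) i j) - \<beta> l (fst (Z i j))) / 2) *\<^sub>R y (Inr (l, 2)) + ((Re (snd (d l) i j) - \<gamma> l (fst (Z i j))) / 2) *\<^sub>R y (Inr (l, 3))
              = (\<alpha> l (fst (Z i j)) / 2) *\<^sub>R (y (Inr (l, 0)) + y (Inr (l, 2))) + (\<beta> l (fst (Z i j)) / 2) *\<^sub>R (y (Inr (l, 0)) - y (Inr (l, 2)))
                + (\<gamma> l (fst (Z i j)) / 2) *\<^sub>R (y (Inr (l, 1)) - y (Inr (l, 3)))" if "l \<in> {..<m}" for l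
              by (rule square_vector_split) (use sq[of l] re[of l] that in simp_all)
            show ?thesis by (rule trans[OF _ coord[OF herD(1)[OF Z], symmetric]], rule arg_cong2[where f = "(+)"], rule refl, rule sum.cong[OF refl], rule e)
          qed
          finally have 1: "fst (\<Sum>x\<in>?J. pure_tensor (H x) (y x) i j) = fst (Z i j)" .
          have "snd (\<Sum>x\<in>?J. pure_tensor (H x) (y x) i j) = (\<Sum>k<a. t k (snd (Z i j)) *\<^sub>R y (Inl k))
            + (\<Sum>l<m. ((Im (fst (d l) i j) + \<beta> l (snd (Z i j))) / 2) *\<^sub>R y (Inr (l, 0)) + ((Im (snd (d l) i j) + \<gamma> l (snd (Z i j))) / 2) *\<^sub>R y (Inr (l, 1))
              + ((Im (fst (d l) i j) - \<beta> l (snd (Z i j))) / 2) *\<^sub>R y (Inr (l, 2)) + ((Im (snd (d l) i j) - \<gamma> l (snd (Z i j))) / 2) *\<^sub>R y (Inr (l, 3)))"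
            unfolding snd_sum sum_sq_index using True by (simp add: H_def F_def E_def pure_tensor_def cx_def snd_sum)
          also have "\<dots> = snd (Z i j)"
          proof -
            have e: "((Im (fst (d l) i j) + \<beta> l (snd (Z i j))) / 2) *\<^sub>R y (Inr (l, 0)) + ((Im (snd (d l) i j) + \<gamma> l (snd (Z i j))) / 2) *\<^sub>R y (Inr (l, 1))
              + ((Im (fst (d l) i j) - \<beta> l (snd (Z i j))) / 2) *\<^sub>R y (Inr (l, 2)) + ((Im (snd (d l) i j) - \<gamma> l (snd (Z i j))) / 2) *\<^sub>R y (Inr (l, 3))
              = (\<alpha> l (snd (Z i j)) / 2) *\<^sub>R (y (Inr (l, 0)) + y (Inr (l, 2))) + (\<beta> l (snd (Z i j)) / 2) *\<^sub>R (y (Inr (l, 0)) - y (Inr (l, 2)))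
                + (\<gamma> l (snd (Z i j)) / 2) *\<^sub>R (y (Inr (l, 1)) - y (Inr (l, 3)))" if "l \<in> {..<m}" for l
              by (rule square_vector_split) (use sq[of l] im[of l] that in simp_all)
            show ?thesis by (rule trans[OF _ coord[OF herD(2)[OF Z], symmetric]], rule arg_cong2[where f = "(+)"], rule refl, rule sum.cong[OF refl], rule e)
          qed
          finally have 2: "snd (\<Sum>x\<in>?J. pure_tensor (H x) (y x) i j) = snd (Z i j)" .
          from 1 2 show ?thesis by (rule prod_eqI)
        qed
      qed
      finally show "Z \<in> min_cone C s" .
    qed
  qed
qed

section \<open>Subhomogeneity forces a decomposition into squares\<close>

lemma subhomogeneous_sq_presentation:
  fixes V C :: "'e::euclidean_space set"
  assumes V: "subspace V" and P: "proper_polyhedral_cone V C" and u: "u \<in> (top_of_set V) interior_of C"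
    and two: "\<forall>F. F facet_of C \<longrightarrow> card {R \<in> ext_rays C. \<not> R \<subseteq> F} \<le> 2"
    and sub: "subhomogeneous TYPE('u) (min_op_system V C u)"
  shows "\<exists>a m y. sq_presentation V C a m y"
proof -
  obtain d where d: "1 \<le> d" "d_subhomogeneous TYPE('u) d (min_op_system V C u)"
    using sub unfolding subhomogeneous_def by blast
  obtain S where S: "finite S" "C = convex_cone hull S" and pt: "C \<inter> uminus ` C = {0}" and CV: "C \<subseteq> V"
    using P unfolding proper_polyhedral_cone_def by blast
  obtain I where fam: "extreme_family C I (\<lambda>x. x)"
    by (rule exists_extreme_family[OF S(1) _ pt]) (use S convex_cone_hull_eq_gen_cone[OF S(1)] in simp, rule that)
  have finI: "finite I" and C: "C = gen_cone I (\<lambda>x. x)" using extreme_familyD[OF fam] by blast+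
  have IC: "i \<in> C" if "i \<in> I" for i unfolding C using gen_cone_gen[OF finI that, of 1 "\<lambda>x. x"] by simp
  have bij: "bij_betw ray I (ext_rays C)" using ext_rays_extreme_family[OF fam pt] by simp
  have uC: "u \<in> C" using u by (rule subsetD[OF interior_of_subset])
  obtain H where H: "C = {v \<in> V. \<forall>h\<in>H. 0 \<le> h \<bullet> v}" "\<And>h. h \<in> H \<Longrightarrow> (C \<inter> {v. h \<bullet> v = 0}) facet_of C"
    by (rule facet_functionals[OF V P]) (rule that)
  \<comment> \<open>A generator at which \<open>h\<close> is nonzero spans an extreme ray outside
    the facet cut out by \<open>h\<close>, and different generators span different rays.\<close>
  have two': "card {i \<in> I. h \<bullet> i \<noteq> 0} \<le> 2" if h: "h \<in> H" for h
  proof -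
    let ?F = "C \<inter> {v. h \<bullet> v = 0}"
    have "card {i \<in> I. h \<bullet> i \<noteq> 0} \<le> card {R \<in> ext_rays C. \<not> R \<subseteq> ?F}"
    proof (rule card_inj_on_le[of ray])
      show "inj_on ray {i \<in> I. h \<bullet> i \<noteq> 0}" using bij by (auto simp: bij_betw_def intro: inj_on_subset)
      show "ray ` {i \<in> I. h \<bullet> i \<noteq> 0} \<subseteq> {R \<in> ext_rays C. \<not> R \<subseteq> ?F}"
      proof
        fix R assume "R \<in> ray ` {i \<in> I. h \<bullet> i \<noteq> 0}"
        then obtain i where i: "i \<in> I" "h \<bullet> i \<noteq> 0" "R = ray i" by blast
        have "R \<in> ext_rays C" using bij i by (auto simp: bij_betw_def)
        moreover have "1 *\<^sub>R i \<in> ray i" unfolding ray_def by (intro CollectI exI[of _ 1]) simp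
        then have "\<not> R \<subseteq> ?F" using i by auto
        ultimately show "R \<in> {R \<in> ext_rays C. \<not> R \<subseteq> ?F}" by blast
      qed
      have "finite (ext_rays C)" using bij_betw_finite[OF bij] finI by blast
      then show "finite {R \<in> ext_rays C. \<not> R \<subseteq> ?F}" by simp
    qed
    also have "\<dots> \<le> 2" using two H(2)[OF h] by blast
    finally show ?thesis .
  qed
  have absorb: "\<exists>k>0. k *\<^sub>R u - v \<in> C" if v: "v \<in> V" for v
  proof -
    obtain s where s: "s > 0" "u + s *\<^sub>R (- v) \<in> C" using interior_absorbs[OF V u subspace_neg[OF V v]] by blast
    have "(1 / s) *\<^sub>R (u + s *\<^sub>R (- v)) \<in> C" using s unfolding C by (intro gen_cone_scale) simp_all
    moreover have "(1 / s) *\<^sub>R (u + s *\<^sub>R (- v)) = (1 / s) *\<^sub>R u - v" using s(1) by (simp add: scaleR_diff_right)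
    ultimately show ?thesis using s(1) by (intro exI[of _ "1 / s"]) simp
  qed
  show ?thesis
  proof (rule exists_sq_presentation[OF V fam pt u H(1) two'])
    fix K :: "'e set" and c p p' q q' q''
    assume K: "K \<subseteq> I" and nz: "\<forall>j\<in>K. c j \<noteq> 0" and z: "(\<Sum>j\<in>K. c j *\<^sub>R j) = 0"
      and pr: "\<And>b. (\<Sum>i\<in>I. b i *\<^sub>R i) = 0 \<Longrightarrow> \<exists>r. \<forall>j\<in>K. b j = r * c j"
      and mem: "p \<in> K" "p' \<in> K" "q \<in> K" "q' \<in> K" "q'' \<in> K" and ne: "p \<noteq> p'" "q \<noteq> q'" "q \<noteq> q''" "q' \<noteq> q''"
      and sg: "0 < c p" "0 < c p'" "c q < 0" "c q' < 0" "c q'' < 0"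
    \<comment> \<open>The two sides of the relation, with the absolute values of the coefficients as
      positive weights.\<close>
    define I1 where "I1 = {j \<in> K. 0 < c j}"
    define I2 where "I2 = {j \<in> K. c j < 0}"
    define jj where "jj k = (if k = (0::nat) then q else if k = 1 then q' else q'')" for k
    have finK: "finite K" using K finI finite_subset by blast
    have KI: "K = I1 \<union> I2" "I1 \<inter> I2 = {}" using nz by (auto simp: I1_def I2_def)
    have fin: "finite I1" "finite I2" using finK by (simp_all add: I1_def I2_def)
    have "(\<Sum>j\<in>I1. c j *\<^sub>R j) + (\<Sum>j\<in>I2. c j *\<^sub>R j) = 0"
      using z unfolding KI(1) by (simp add: sum.union_disjoint[OF fin KI(2)])
    moreover have "(\<Sum>j\<in>I1. c j *\<^sub>R j) = (\<Sum>j\<in>I1. \<bar>c j\<bar> *\<^sub>R j)" by (rule sum.cong[OF refl]) (simp add: I1_def)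
    moreover have "(\<Sum>j\<in>I2. \<bar>c j\<bar> *\<^sub>R j) = - (\<Sum>j\<in>I2. c j *\<^sub>R j)"
      unfolding sum_negf[symmetric] by (rule sum.cong[OF refl]) (simp add: I2_def)
    ultimately have rel: "(\<Sum>j\<in>I1. \<bar>c j\<bar> *\<^sub>R j) = (\<Sum>j\<in>I2. \<bar>c j\<bar> *\<^sub>R j)" by (simp add: add_eq_0_iff2)
    have "\<not> d_subhomogeneous TYPE('u) d (min_op_system V C u)"
    proof (rule not_d_subhomogeneous[OF V finI _ C _ absorb, of I1 I2 "\<lambda>j. \<bar>c j\<bar>" p p' jj])
      show "i \<in> V" if "i \<in> I" for i using IC[OF that] CV by blast
      show "u \<in> V" using uC CV by blast
      show "I1 \<subseteq> I" "I2 \<subseteq> I" using K by (auto simp: I1_def I2_def)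
      show "I1 \<inter> I2 = {}" by (rule KI(2))
      show "0 < \<bar>c i\<bar>" if "i \<in> I1 \<union> I2" for i using that nz KI(1) by auto
      show "(\<Sum>j\<in>I1. \<bar>c j\<bar> *\<^sub>R j) = (\<Sum>j\<in>I2. \<bar>c j\<bar> *\<^sub>R j)" by (rule rel)
      show "\<exists>r. (\<forall>i\<in>I1. b i = r * \<bar>c i\<bar>) \<and> (\<forall>i\<in>I2. b i = - r * \<bar>c i\<bar>)" if b: "(\<Sum>i\<in>I. b i *\<^sub>R i) = 0" for b
      proof -
        obtain r where r: "\<forall>j\<in>K. b j = r * c j" using pr[OF b] by blast
        have "\<forall>i\<in>I1. b i = r * \<bar>c i\<bar>" using r by (simp add: I1_def)
        moreover have "\<forall>i\<in>I2. b i = - r * \<bar>c i\<bar>" using r by (simp add: I2_def)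
        ultimately show ?thesis by blast
      qed
      show "p \<in> I1" "p' \<in> I1" "p \<noteq> p'" using mem sg ne by (simp_all add: I1_def)
      show "jj 0 \<in> I2" "jj 1 \<in> I2" "jj 2 \<in> I2" "jj 0 \<noteq> jj 1" "jj 0 \<noteq> jj 2" "jj 1 \<noteq> jj 2"
        using mem sg ne by (simp_all add: I2_def jj_def)
      show "1 \<le> d" by (rule d(1))
    qed
    then show False using d(2) by blast
  qed
qed

theorem theorem4p8:
  fixes V C :: "'e::euclidean_space set" and u :: 'e and n :: nat
    and C_sq :: "(real ^ 3) set"
    and universe_embedding :: "real \<Rightarrow> 'u"
  assumes "inj universe_embedding"
    and "proper_polyhedral_cone (UNIV :: (real ^ 3) set) C_sq" and "card (ext_rays C_sq) = 4"
    and "subspace V" and "dim V = n"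
    and "proper_polyhedral_cone V C"
    and "u \<in> (top_of_set V) interior_of C"
    and "\<forall>F. F facet_of C \<longrightarrow> card {R \<in> ext_rays C. \<not> R \<subseteq> F} \<le> 2"
  shows "(subhomogeneous TYPE('u) (min_op_system V C u) \<longleftrightarrow>
           (\<exists>a m. cone_iso V C (fin_power a (UNIV :: real set) \<times> fin_power m (UNIV :: (real ^ 3) set))
                              (fin_power a {0..} \<times> fin_power m C_sq))) \<and>
         (\<forall>a m. cone_iso V C (fin_power a (UNIV :: real set) \<times> fin_power m (UNIV :: (real ^ 3) set))
                              (fin_power a {0..} \<times> fin_power m C_sq) \<longrightarrow>
           d_subhomogeneous TYPE('u) 2 (min_op_system V C u) \<and>
           card (ext_rays C) = n + m \<and>
           n + m \<le> n + n div 3)"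
proof -
  obtain q :: "nat \<Rightarrow> real ^ 3" where q: "C_sq = gen_cone {..<4} q" "UNIV = span (q ` {..<4})"
    "\<And>c. (\<Sum>k<4. c k *\<^sub>R q k) = 0 \<longleftrightarrow> c 1 = - c 0 \<and> c 2 = c 0 \<and> c 3 = - c 0"
    by (rule four_ray_cone[OF assms(2,3)]) (rule that)
  note target = fin_power_presentation[OF q]
  have CV: "C \<subseteq> V" and pt: "C \<inter> uminus ` C = {0}" using assms(6) unfolding proper_polyhedral_cone_def by blast+
  have iso: "d_subhomogeneous TYPE('u) 2 (min_op_system V C u) \<and> card (ext_rays C) = n + m \<and> n + m \<le> n + n div 3"
    if I: "cone_iso V C (fin_power a (UNIV :: real set) \<times> fin_power m (UNIV :: (real ^ 3) set))
      (fin_power a {0..} \<times> fin_power m C_sq)" for a m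
  proof -
    obtain y where y: "sq_presentation V C a m y"
      by (rule cone_iso_sq_presentation[OF assms(4) CV I target]) (rule that)
    \<comment> \<open>With a + 4m extreme rays this gives the count n + m, and 3m \<le> n gives the
      upper bound.\<close>
    have n: "n = a + 3 * m" using sq_presentation_dim[OF y] assms(5) by simp
    have "card (ext_rays C) = a + 4 * m"
      using bij_betw_same_card[OF ext_rays_extreme_family[OF sq_presentation_extreme[OF y] pt]] card_sq_index[of a m] by simp
    then show ?thesis using sq_presentation_subhomogeneous[OF assms(1) y assms(7)] n by simp
  qed
  have "subhomogeneous TYPE('u) (min_op_system V C u)"
    if "\<exists>a m. cone_iso V C (fin_power a (UNIV :: real set) \<times> fin_power m (UNIV :: (real ^ 3) set))
      (fin_power a {0..} \<times> fin_power m C_sq)"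
  proof -
    from that have "d_subhomogeneous TYPE('u) 2 (min_op_system V C u)" using iso by blast
    then show ?thesis unfolding subhomogeneous_def by (intro exI[of _ 2]) simp
  qed
  moreover have "\<exists>a m. cone_iso V C (fin_power a (UNIV :: real set) \<times> fin_power m (UNIV :: (real ^ 3) set))
      (fin_power a {0..} \<times> fin_power m C_sq)" if S: "subhomogeneous TYPE('u) (min_op_system V C u)"
  proof -
    obtain a m y where "sq_presentation V C a m y"
      using subhomogeneous_sq_presentation[OF assms(4,6,7,8) S] by (elim exE) (rule that)
    from sq_presentation_iso[OF this target] show ?thesis by blast
  qed
  ultimately show ?thesis using iso by blast
qed

end
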